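(* Let $\varepsilon>0$, let $\Phi_1,\Phi_2$ be quasi-Young functions of order $r_0\in(0,1]$, let $\omega,v\in\mathscr P_E(\mathbf R^{2d})$ with $v$ submultiplicative be such that $\omega$ is $v$-moderate, and let $\phi\in M^{r_0}_{(v)}(\mathbf R^d)$ have a dual window in $M^{r_0}_{(v)}(\mathbf R^d)$ with respect to $\varepsilon\mathbf Z^{2d}$. Then the analysis operator $C^\varepsilon_\phi f=\{V_\phi f(j,\iota)\}_{j,\iota\in\varepsilon\mathbf Z^d}$ is continuous from $M^{\Phi_1,\Phi_2}_{(\omega)}(\mathbf R^d)$ into $\ell^{\Phi_1,\Phi_2}_{(\omega)}(\varepsilon\mathbf Z^{2d})$, and $$\|C^\varepsilon_\phi f\|_{\ell^{\Phi_1,\Phi_2}_{(\omega)}}\lesssim\|f\|_{M^{\Phi_1,\Phi_2}_{(\omega)}},\qquad f\in M^{\Phi_1,\Phi_2}_{(\omega)}(\mathbf R^d).$$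
   Context: Weights: a weight on $\mathbf R^n$ is a positive $\omega\in L^\infty_{loc}$ with $1/\omega\in L^\infty_{loc}$. It is $v$-moderate, for a positive weight $v$, if $\omega(x+y)\lesssim\omega(x)v(y)$; $\mathscr P_E(\mathbf R^n)$ is the set of weights that are $v$-moderate for some $v$. A weight $v$ is submultiplicative if it is even and $v(x+y)\lesssim v(x)v(y)$. $A\lesssim B$ means $A\le cB$ with a constant $c>0$ (independent of $f$). Young functions: a Young function is a convex $\Phi_0:[0,\infty)\to[0,\infty]$ with $\Phi_0(0)=0$, $\lim_{t\to\infty}\Phi_0(t)=\infty$; a quasi-Young function of order $r_0\in(0,1]$ is $\Phi(t)=\Phi_0(t^{r_0})$ with $\Phi_0$ Young. Orlicz quasi-norms: for a measure $\mu$, $\|f\|_{L^\Phi(\mu)}=\inf\{\lambda>0:\int\Phi(|f|/\lambda)\,d\mu\le1\}$, and $\|F\|_{L^{\Phi_1,\Phi_2}_{(\omega)}(\mu\otimes\mu)}=\big\|\,\xi\mapsto\|F(\cdot,\xi)\omega(\cdot,\xi)\|_{L^{\Phi_1}(\mu)}\big\|_{L^{\Phi_2}(\mu)}$. $L^{\Phi_1,\Phi_2}_{(\omega)}(\mathbf R^{2d})$ uses Lebesgue measure on $\mathbf R^d$; $\ell^{\Phi_1,\Phi_2}_{(\omega)}(\varepsilon\mathbf Z^{2d})$ uses counting measure on $\varepsilon\mathbf Z^d$ (so the weight is $\omega$ evaluated at the lattice points). Pilipović space: $\mathcal H'_\flat(\mathbf R^d)$ is the space of formal Hermite series $\sum_\alpha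 c(\alpha)h_\alpha$ with $|c(\alpha)|\lesssim r^{|\alpha|}\alpha!^{1/2}$ for every $r>0$ ($h_\alpha$ the $L^2$-normalized Hermite functions), dual via the $L^2$-form to the space $\mathcal H_\flat(\mathbf R^d)$ of Hermite series with $|c(\alpha)|\lesssim r^{|\alpha|}\alpha!^{-1/2}$ for some $r>0$. Modulation spaces: with $\phi_0(x)=\pi^{-d/4}e^{-|x|^2/2}$, $M^{\Phi_1,\Phi_2}_{(\omega)}(\mathbf R^d)=\{f\in\mathcal H'_\flat(\mathbf R^d):\|f\|_{M^{\Phi_1,\Phi_2}_{(\omega)}}:=\|V_{\phi_0}f\|_{L^{\Phi_1,\Phi_2}_{(\omega)}}<\infty\}$, and $M^{p}_{(v)}$ is defined in the same way with $L^{p}_{(v)}(\mathbf R^{2d})$. Here $V_\phi f(x,\xi)=\mathscr F(f\,\overline{\phi(\cdot-x)})(\xi)=(2\pi)^{-d/2}(f,e^{i\langle\cdot,\xi\rangle}\phi(\cdot-x))$, where $\mathscr Fg(\xi)=(2\pi)^{-d/2}\int g(y)e^{-i\langle y,\xi\rangle}dy$ and the pairing is the extension of the $L^2$ form (for $f\in M^\infty_{(\omega)}$ and $\phi\in M^1_{(v)}$ it is the duality between $M^\infty_{(\omega)}$ and $M^1_{(1/\omega)}$). Dual window: $\psi$ is a dual window of $\phi$ with respect to $\varepsilon\mathbf Z^{2d}$ if $\{e^{i\langle\cdot,\iota\rangle}\phi(\cdot-j)\}_{j,\iota\in\varepsilon\mathbf Z^d}$ and $\{e^{i\langle\cdot,\iota\rangle}\psi(\cdot-j)\}_{j,\iota\in\varepsilon\mathbf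 Z^d}$ are dual frames for $L^2(\mathbf R^d)$, normalized so that $f=\sum_{j,\iota}V_\phi f(j,\iota)e^{i\langle\cdot,\iota\rangle}\psi(\cdot-j)$ for $f\in L^2(\mathbf R^d)$. *)

theory Defs
  imports "HOL-Analysis.Analysis"
begin

section \<open>Weights\<close>

definition locally_ess_bounded :: "('a::euclidean_space \<Rightarrow> real) \<Rightarrow> bool" where
  "locally_ess_bounded f \<longleftrightarrow> f \<in> borel_measurable lebesgue \<and>
     (\<forall>K. compact K \<longrightarrow> (\<exists>C. AE x in lebesgue. x \<in> K \<longrightarrow> \<bar>f x\<bar> \<le> C))"

definition weight :: "('a::euclidean_space \<Rightarrow> real) \<Rightarrow> bool" where
  "weight \<omega> \<longleftrightarrow> (\<forall>x. 0 < \<omega> x) \<and> locally_ess_bounded \<omega> \<and> locally_ess_bounded (\<lambda>x. 1 / \<omega> x)"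

definition moderate :: "('a::euclidean_space \<Rightarrow> real) \<Rightarrow> ('a \<Rightarrow> real) \<Rightarrow> bool" where
  "moderate v \<omega> \<longleftrightarrow> (\<exists>C>0. \<forall>x y. \<omega> (x + y) \<le> C * \<omega> x * v y)"

definition moderate_weights :: "('a::euclidean_space \<Rightarrow> real) set" where
  "moderate_weights = {\<omega>. weight \<omega> \<and> (\<exists>v. weight v \<and> moderate v \<omega>)}"

definition submultiplicative :: "('a::euclidean_space \<Rightarrow> real) \<Rightarrow> bool" where
  "submultiplicative v \<longleftrightarrow> weight v \<and> (\<forall>x. v (- x) = v x) \<and>
     (\<exists>C>0. \<forall>x y. v (x + y) \<le> C * v x * v y)"

section \<open>Quasi-Young functions and Orlicz quasi-norms\<close>

text \<open>Functions from the half-line to the extended half-line are modelled as functions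
  of type \<^typ>\<open>real \<Rightarrow> ennreal\<close> of which only the values at nonnegative arguments matter.\<close>

definition young :: "(real \<Rightarrow> ennreal) \<Rightarrow> bool" where
  "young \<Phi> \<longleftrightarrow> \<Phi> 0 = 0 \<and> (\<Phi> \<longlongrightarrow> top) at_top \<and>
     (\<forall>s\<ge>0. \<forall>t\<ge>0. \<forall>\<theta>\<in>{0..1}.
        \<Phi> (\<theta> * s + (1 - \<theta>) * t) \<le> ennreal \<theta> * \<Phi> s + ennreal (1 - \<theta>) * \<Phi> t)"

definition quasi_young :: "real \<Rightarrow> (real \<Rightarrow> ennreal) \<Rightarrow> bool" where
  "quasi_young r\<^sub>0 \<Phi> \<longleftrightarrow> 0 < r\<^sub>0 \<and> r\<^sub>0 \<le> 1 \<and> (\<exists>\<Phi>\<^sub>0. young \<Phi>\<^sub>0 \<and> (\<forall>t\<ge>0. \<Phi> t = \<Phi>\<^sub>0 (t powr r\<^sub>0)))"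

text \<open>Extension by the limit at infinity; needed because the inner quasi-norm of a mixed
  quasi-norm may be infinite.\<close>

definition at_ennreal :: "(real \<Rightarrow> ennreal) \<Rightarrow> ennreal \<Rightarrow> ennreal" where
  "at_ennreal \<Phi> t = (if t = top then top else \<Phi> (enn2real t))"

definition orlicz_norm :: "'a measure \<Rightarrow> (real \<Rightarrow> ennreal) \<Rightarrow> ('a \<Rightarrow> ennreal) \<Rightarrow> ennreal" where
  "orlicz_norm \<mu> \<Phi> f =
     Inf {ennreal c |c. 0 < c \<and> (\<integral>\<^sup>+ x. at_ennreal \<Phi> (f x / ennreal c) \<partial>\<mu>) \<le> 1}"

definition mixed_orlicz_norm ::
  "'a measure \<Rightarrow> (real \<Rightarrow> ennreal) \<Rightarrow> (real \<Rightarrow> ennreal) \<Rightarrow> ('a \<times> 'a \<Rightarrow> real) \<Rightarrow> ('a \<times> 'a \<Rightarrow> complex) \<Rightarrow> ennreal"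
  where
  "mixed_orlicz_norm \<mu> \<Phi>\<^sub>1 \<Phi>\<^sub>2 \<omega> F =
     orlicz_norm \<mu> \<Phi>\<^sub>2 (\<lambda>\<xi>. orlicz_norm \<mu> \<Phi>\<^sub>1 (\<lambda>x. ennreal (cmod (F (x, \<xi>)) * \<omega> (x, \<xi>))))"

definition lattice :: "real \<Rightarrow> (real ^ 'n) set" where
  "lattice \<epsilon> = {x. \<forall>i. \<exists>k::int. x $ i = \<epsilon> * of_int k}"

definition ell_norm ::
  "real \<Rightarrow> (real \<Rightarrow> ennreal) \<Rightarrow> (real \<Rightarrow> ennreal) \<Rightarrow> ((real ^ 'n) \<times> (real ^ 'n) \<Rightarrow> real)
    \<Rightarrow> ((real ^ 'n) \<times> (real ^ 'n) \<Rightarrow> complex) \<Rightarrow> ennreal" where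
  "ell_norm \<epsilon> = mixed_orlicz_norm (count_space (lattice \<epsilon>))"

text \<open>A sequence on the lattice is a function extended by \<^term>\<open>undefined\<close> off the lattice.\<close>

definition ell_space ::
  "real \<Rightarrow> (real \<Rightarrow> ennreal) \<Rightarrow> (real \<Rightarrow> ennreal) \<Rightarrow> ((real ^ 'n) \<times> (real ^ 'n) \<Rightarrow> real)
    \<Rightarrow> ((real ^ 'n) \<times> (real ^ 'n) \<Rightarrow> complex) set" where
  "ell_space \<epsilon> \<Phi>\<^sub>1 \<Phi>\<^sub>2 \<omega> =
     {a \<in> extensional (lattice \<epsilon> \<times> lattice \<epsilon>). ell_norm \<epsilon> \<Phi>\<^sub>1 \<Phi>\<^sub>2 \<omega> a < top}"

section \<open>Square-integrable functions and Hermite series\<close>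

definition L2 :: "(real ^ 'n \<Rightarrow> complex) set" where
  "L2 = {f \<in> borel_measurable lebesgue. integrable lebesgue (\<lambda>x. (cmod (f x))\<^sup>2)}"

definition L2_norm_sq :: "(real ^ 'n \<Rightarrow> complex) \<Rightarrow> real" where
  "L2_norm_sq f = integral\<^sup>L lebesgue (\<lambda>x. (cmod (f x))\<^sup>2)"

definition L2_form :: "(real ^ 'n \<Rightarrow> complex) \<Rightarrow> (real ^ 'n \<Rightarrow> complex) \<Rightarrow> complex" where
  "L2_form f g = integral\<^sup>L lebesgue (\<lambda>x. f x * cnj (g x))"

definition hermite1 :: "nat \<Rightarrow> real \<Rightarrow> real" where
  "hermite1 n t = pi powr (- 1 / 4) * (- 1) ^ n / sqrt (2 ^ n * fact n)
     * exp (t\<^sup>2 / 2) * (deriv ^^ n) (\<lambda>s. exp (- s\<^sup>2)) t"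

definition hermite :: "('n \<Rightarrow> nat) \<Rightarrow> real ^ 'n \<Rightarrow> complex" where
  "hermite \<alpha> x = of_real (\<Prod>i\<in>UNIV. hermite1 (\<alpha> i) (x $ i))"

text \<open>A formal Hermite series is identified with its family of coefficients.\<close>

type_synonym 'n series = "('n \<Rightarrow> nat) \<Rightarrow> complex"

definition mi_length :: "('n::finite \<Rightarrow> nat) \<Rightarrow> nat" where
  "mi_length \<alpha> = (\<Sum>i\<in>UNIV. \<alpha> i)"

definition mi_fact :: "('n::finite \<Rightarrow> nat) \<Rightarrow> real" where
  "mi_fact \<alpha> = (\<Prod>i\<in>UNIV. fact (\<alpha> i))"

definition H_flat :: "('n::finite) series set" where
  "H_flat = {c. \<exists>r>0. \<exists>C. \<forall>\<alpha>. cmod (c \<alpha>) \<le> C * r ^ mi_length \<alpha> * mi_fact \<alpha> powr (- 1 / 2)}"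

definition H_flat_dual :: "('n::finite) series set" where
  "H_flat_dual = {c. \<forall>r>0. \<exists>C. \<forall>\<alpha>. cmod (c \<alpha>) \<le> C * r ^ mi_length \<alpha> * mi_fact \<alpha> powr (1 / 2)}"

definition hermite_series :: "(real ^ 'n \<Rightarrow> complex) \<Rightarrow> 'n series" where
  "hermite_series f = (\<lambda>\<alpha>. L2_form f (hermite \<alpha>))"

text \<open>The \<^const>\<open>L2_form\<close> in terms of Hermite coefficients; the sum is absolutely convergent on
  \<^term>\<open>H_flat_dual \<times> H_flat\<close>.\<close>

definition flat_form :: "('n::finite) series \<Rightarrow> 'n series \<Rightarrow> complex" where
  "flat_form f g = (\<Sum>\<^sub>\<infinity>\<alpha>. f \<alpha> * cnj (g \<alpha>))"

section \<open>Modulation spaces\<close>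

definition tf_shift :: "real ^ 'n \<Rightarrow> real ^ 'n \<Rightarrow> (real ^ 'n \<Rightarrow> complex) \<Rightarrow> real ^ 'n \<Rightarrow> complex" where
  "tf_shift x \<xi> \<phi> y = cis (y \<bullet> \<xi>) * \<phi> (y - x)"

definition gaussian :: "real ^ 'n \<Rightarrow> complex" where
  "gaussian x = of_real (pi powr (- real CARD('n) / 4) * exp (- (norm x)\<^sup>2 / 2))"

definition stft_const :: "'n::finite itself \<Rightarrow> complex" where
  "stft_const _ = of_real ((2 * pi) powr (- real CARD('n) / 2))"

text \<open>The short-time Fourier transform of a formal Hermite series with the Gaussian window;
  the time-frequency shifts of the Gaussian belong to \<^const>\<open>H_flat\<close>.\<close>

definition gauss_stft :: "('n::finite) series \<Rightarrow> (real ^ 'n) \<times> (real ^ 'n) \<Rightarrow> complex" where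
  "gauss_stft f = (\<lambda>(x, \<xi>).
     stft_const TYPE('n) * flat_form f (hermite_series (tf_shift x \<xi> gaussian)))"

definition mod_norm ::
  "(real \<Rightarrow> ennreal) \<Rightarrow> (real \<Rightarrow> ennreal) \<Rightarrow> ((real ^ 'n) \<times> (real ^ 'n) \<Rightarrow> real) \<Rightarrow> 'n series \<Rightarrow> ennreal"
  where
  "mod_norm \<Phi>\<^sub>1 \<Phi>\<^sub>2 \<omega> f = mixed_orlicz_norm lebesgue \<Phi>\<^sub>1 \<Phi>\<^sub>2 \<omega> (gauss_stft f)"

definition mod_space ::
  "(real \<Rightarrow> ennreal) \<Rightarrow> (real \<Rightarrow> ennreal) \<Rightarrow> ((real ^ 'n) \<times> (real ^ 'n) \<Rightarrow> real) \<Rightarrow> 'n series set" where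
  "mod_space \<Phi>\<^sub>1 \<Phi>\<^sub>2 \<omega> = {f \<in> H_flat_dual. mod_norm \<Phi>\<^sub>1 \<Phi>\<^sub>2 \<omega> f < top}"

definition Lp_norm :: "real \<Rightarrow> ('a::euclidean_space \<Rightarrow> real) \<Rightarrow> ('a \<Rightarrow> complex) \<Rightarrow> ennreal" where
  "Lp_norm p \<omega> F =
     (let I = (\<integral>\<^sup>+ X. ennreal ((cmod (F X) * \<omega> X) powr p) \<partial>lebesgue)
      in if I = top then top else ennreal (enn2real I powr (1 / p)))"

definition Mp_norm :: "real \<Rightarrow> ((real ^ 'n) \<times> (real ^ 'n) \<Rightarrow> real) \<Rightarrow> 'n series \<Rightarrow> ennreal" where
  "Mp_norm p \<omega> f = Lp_norm p \<omega> (gauss_stft f)"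

definition Mp_space :: "real \<Rightarrow> ((real ^ 'n) \<times> (real ^ 'n) \<Rightarrow> real) \<Rightarrow> 'n series set" where
  "Mp_space p \<omega> = {f \<in> H_flat_dual. Mp_norm p \<omega> f < top}"

text \<open>For \<open>p \<le> 1\<close> and submultiplicative \<open>v\<close> (hence bounded from below) every element of
  \<^term>\<open>Mp_space p v\<close> is the Hermite series of an \<^const>\<open>L2\<close> function. The windows generating frames
  of \<^const>\<open>L2\<close> are taken to be these functions.\<close>

definition window_space ::
  "real \<Rightarrow> ((real ^ 'n) \<times> (real ^ 'n) \<Rightarrow> real) \<Rightarrow> (real ^ 'n \<Rightarrow> complex) set" where
  "window_space p v = {\<phi> \<in> L2. hermite_series \<phi> \<in> Mp_space p v}"

section \<open>Short-time Fourier transform with general window\<close>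

text \<open>The duality between \<open>M\<^sup>\<infinity>\<close> with weight \<open>\<omega>\<close> and \<open>M\<^sup>1\<close> with weight \<open>1 / \<omega>\<close>: the extension
  of \<^const>\<open>flat_form\<close>, by continuity in the second argument, from \<^const>\<open>H_flat\<close> to \<open>M\<^sup>1\<close>.\<close>

definition M1_approx :: "((real ^ 'n) \<times> (real ^ 'n) \<Rightarrow> real) \<Rightarrow> 'n series \<Rightarrow> 'n series filter" where
  "M1_approx w g =
     (INF e\<in>{0<..}. principal {h \<in> H_flat. Mp_norm 1 w (\<lambda>\<alpha>. h \<alpha> - g \<alpha>) < ennreal e})"

definition dual_form ::
  "((real ^ 'n) \<times> (real ^ 'n) \<Rightarrow> real) \<Rightarrow> 'n series \<Rightarrow> 'n series \<Rightarrow> complex" where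
  "dual_form \<omega> f g = Lim (M1_approx (\<lambda>X. 1 / \<omega> X) g) (flat_form f)"

definition stft ::
  "((real ^ 'n) \<times> (real ^ 'n) \<Rightarrow> real) \<Rightarrow> (real ^ 'n \<Rightarrow> complex) \<Rightarrow> 'n series
    \<Rightarrow> (real ^ 'n) \<times> (real ^ 'n) \<Rightarrow> complex" where
  "stft \<omega> \<phi> f = (\<lambda>(x, \<xi>).
     stft_const TYPE('n) * dual_form \<omega> f (hermite_series (tf_shift x \<xi> \<phi>)))"

definition analysis_op ::
  "real \<Rightarrow> ((real ^ 'n) \<times> (real ^ 'n) \<Rightarrow> real) \<Rightarrow> (real ^ 'n \<Rightarrow> complex) \<Rightarrow> 'n series
    \<Rightarrow> (real ^ 'n) \<times> (real ^ 'n) \<Rightarrow> complex" where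
  "analysis_op \<epsilon> \<omega> \<phi> f = restrict (stft \<omega> \<phi> f) (lattice \<epsilon> \<times> lattice \<epsilon>)"

section \<open>Gabor frames and dual windows\<close>

definition L2_frame :: "'k set \<Rightarrow> ('k \<Rightarrow> real ^ 'n \<Rightarrow> complex) \<Rightarrow> bool" where
  "L2_frame K e \<longleftrightarrow> (\<forall>k\<in>K. e k \<in> L2) \<and>
     (\<exists>A>0. \<exists>B>0. \<forall>f\<in>L2.
        ennreal (A * L2_norm_sq f) \<le> (\<integral>\<^sup>+ k. ennreal ((cmod (L2_form f (e k)))\<^sup>2) \<partial>count_space K) \<and>
        (\<integral>\<^sup>+ k. ennreal ((cmod (L2_form f (e k)))\<^sup>2) \<partial>count_space K) \<le> ennreal (B * L2_norm_sq f))"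

definition gabor_system ::
  "(real ^ 'n \<Rightarrow> complex) \<Rightarrow> (real ^ 'n) \<times> (real ^ 'n) \<Rightarrow> real ^ 'n \<Rightarrow> complex" where
  "gabor_system \<phi> = (\<lambda>(j, \<iota>). tf_shift j \<iota> \<phi>)"

text \<open>The factor \<^const>\<open>stft_const\<close> makes the coefficients in the expansion the values of the
  short-time Fourier transform; the series converges unconditionally in \<^const>\<open>L2\<close>.\<close>

definition dual_window ::
  "real \<Rightarrow> (real ^ 'n \<Rightarrow> complex) \<Rightarrow> (real ^ 'n \<Rightarrow> complex) \<Rightarrow> bool" where
  "dual_window \<epsilon> \<phi> \<psi> \<longleftrightarrow>
     L2_frame (lattice \<epsilon> \<times> lattice \<epsilon>) (gabor_system \<phi>) \<and>
     L2_frame (lattice \<epsilon> \<times> lattice \<epsilon>) (gabor_system \<psi>) \<and>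
     (\<forall>f\<in>L2. ((\<lambda>J. L2_norm_sq (\<lambda>y. f y - (\<Sum>k\<in>J.
          stft_const TYPE('n) * L2_form f (gabor_system \<phi> k) * gabor_system \<psi> k y))) \<longlongrightarrow> 0)
        (finite_subsets_at_top (lattice \<epsilon> \<times> lattice \<epsilon>)))"

section \<open>Continuity with respect to quasi-norms\<close>

definition qn_continuous ::
  "('i \<Rightarrow> complex) set \<Rightarrow> (('i \<Rightarrow> complex) \<Rightarrow> ennreal) \<Rightarrow> (('k \<Rightarrow> complex) \<Rightarrow> ennreal)
    \<Rightarrow> (('i \<Rightarrow> complex) \<Rightarrow> ('k \<Rightarrow> complex)) \<Rightarrow> bool" where
  "qn_continuous S N N' T \<longleftrightarrow>
     (\<forall>f\<in>S. \<forall>e>0. \<exists>\<delta>>0. \<forall>g\<in>S.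
        N (\<lambda>i. g i - f i) < ennreal \<delta> \<longrightarrow> N' (\<lambda>k. T g k - T f k) < ennreal e)"

end

(*
  The expansion of f in Hermite functions turns the Gaussian short-time Fourier transform V f into an
  entire function times a Gaussian (Bargmann transform). Hence |V f|^r is, up to
  constants, dominated by its averages over unit balls for 0 < r <= 1, and the integral of
  |V f| |V g(. - X)| by the r-th root of the integral of its r-th power. The reproducing formula gives
  |V_phi f(X)| <= c int |V f(Y)| |V phi(Y - X)| dY, so that |V_phi f|^r is bounded by the convolution type
  integral of |V f|^r against |V phi|^r, with v-moderateness distributing the weights. Raising to the power
  r turns the quasi-Young functions into Young functions, and the kernel (|V phi| v)^r is integrable and
  dominated by its own local averages. Jensen's inequality then bounds the mixed norm of this integral on
  the lattice by the mixed norm of (|V f| omega)^r on phase space.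
*)

theory Submission
  imports Defs "HOL-Complex_Analysis.Complex_Analysis" "HOL-Probability.Probability" "HOL-Real_Asymp.Real_Asymp"
begin

subsection \<open>Young functions and Orlicz norms\<close>

text \<open>For f outside L2 the values of V_phi f are limits along the filter
  \<open>M1_approx\<close>, so two facts precede every estimate: that filter is nontrivial, which is
  density of \<open>H_flat\<close> in a weighted M^1 and is shown by synthesising truncations of a
  transform, and the pairing is continuous along it, which asks for |V f| \<omega> to be bounded.
  For r < 1 the triangle inequality and Young's convolution inequality fail, and analyticity
  replaces them. The constants are uniform in the point X because the class of entire functions
  times Gaussians is closed under translations of phase space and under products. The weights are
  merely Lebesgue measurable, and their restrictions to a fixed frequency may fail to be measurable;
  hence the Borel majorants of \<omega>, v and 1 / \<omega>, comparable with them up to constants.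
  The Young functions may be infinite and may fail to be left continuous, which explains the strict
  inequalities, the passage through finite lower values, and the work with admissible constants in
  place of attained minima.\<close>

text \<open>A convex function that vanishes at 0 lies below its chords through the origin. Every
  later use of convexity, Jensen's inequality included, passes through this ratio bound.\<close>

lemma young_ratio:
  assumes "young \<Psi>" "0 \<le> s" "s \<le> t" "0 < t"
  shows "\<Psi> s \<le> ennreal (s / t) * \<Psi> t"
proof -
  have "\<forall>s\<ge>0. \<forall>t\<ge>0. \<forall>\<theta>\<in>{0..1}.
        \<Psi> (\<theta> * s + (1 - \<theta>) * t) \<le> ennreal \<theta> * \<Psi> s + ennreal (1 - \<theta>) * \<Psi> t"
    using assms(1) by (simp add: young_def)
  then have "\<Psi> (s / t * t + (1 - s / t) * 0) \<le> ennreal (s / t) * \<Psi> t + ennreal (1 - s / t) * \<Psi> 0"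
    using assms(2-) by (meson atLeastAtMost_iff divide_le_eq_1_pos divide_nonneg_pos less_imp_le order_refl)
  then show ?thesis using assms by (simp add: young_def)
qed

lemma young_mono:
  assumes "young \<Psi>" "0 \<le> s" "s \<le> t"
  shows "\<Psi> s \<le> \<Psi> t"
proof (cases "t = 0")
  case False
  then have "\<Psi> s \<le> ennreal (s / t) * \<Psi> t" using young_ratio assms by auto
  also have "\<dots> \<le> 1 * \<Psi> t"
    using assms False by (intro mult_right_mono) (auto simp: divide_simps)
  finally show ?thesis by simp
qed (use assms in auto)

lemma young_zero: "young \<Psi> \<Longrightarrow> \<Psi> 0 = 0"
  by (simp add: young_def)

lemma at_ennreal_mono:
  assumes "young \<Psi>" "x \<le> y"
  shows "at_ennreal \<Psi> x \<le> at_ennreal \<Psi> y"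
  using assms(2) unfolding at_ennreal_def
  by (auto simp: top_unique less_top intro!: enn2real_mono young_mono[OF assms(1)])

lemma at_ennreal_ennreal: "0 \<le> t \<Longrightarrow> at_ennreal \<Psi> (ennreal t) = \<Psi> t"
  by (simp add: at_ennreal_def)

lemma at_ennreal_top [simp]: "at_ennreal \<Psi> top = top"
  by (simp add: at_ennreal_def)

text \<open>Superlevel sets of a monotone function are upward closed, so each is empty, the whole
  line, or a ray with or without its end point.\<close>

lemma borel_measurable_mono_ennreal:
  fixes f :: "real \<Rightarrow> ennreal"
  assumes "mono f"
  shows "f \<in> borel_measurable borel"
proof (rule borel_measurableI_ge)
  fix y
  define S where "S = {t. y \<le> f t}"
  have up: "t \<in> S" if "s \<in> S" "s \<le> t" for s t
    using that assms unfolding S_def by (auto dest: monoD intro: order.trans)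
  consider "S = {}" | "\<not> bdd_below S" | "S \<noteq> {}" "bdd_below S" by auto
  then have "S \<in> sets borel"
  proof cases
    case 2
    then have "S = UNIV" using up unfolding bdd_below_def by (metis UNIV_eq_I linear)
    then show ?thesis by simp
  next
    case 3
    have "{Inf S<..} \<subseteq> S" using 3 up cInf_less_iff[of S] by (meson greaterThan_iff less_imp_le subsetI)
    moreover have "S \<subseteq> {Inf S..}" using 3 by (auto intro: cInf_lower)
    ultimately have "S = {Inf S<..} \<or> S = {Inf S..}"
      by (cases "Inf S \<in> S") (auto simp: order.order_iff_strict)
    then show ?thesis by (metis atLeast_borel greaterThan_borel)
  qed simp
  then show "{t \<in> space borel. y \<le> f t} \<in> sets borel" by (simp add: S_def)
qed

lemma young_measurable:
  assumes "young \<Psi>"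
  shows "at_ennreal \<Psi> \<in> borel_measurable borel"
proof -
  \<comment> \<open>\<open>young\<close> says nothing about negative arguments. Truncation at 0
    gives a monotone function that agrees with \<open>\<Psi>\<close> on all values of
    \<open>enn2real\<close>.\<close>
  have "mono (\<lambda>t. \<Psi> (max 0 t))"
    using young_mono[OF assms] by (intro monoI) auto
  then have [measurable]: "(\<lambda>t. \<Psi> (max 0 t)) \<in> borel_measurable borel"
    by (rule borel_measurable_mono_ennreal)
  have "at_ennreal \<Psi> = (\<lambda>x. if x = top then top else (\<lambda>t. \<Psi> (max 0 t)) (enn2real x))"
    by (auto simp: at_ennreal_def fun_eq_iff)
  also have "\<dots> \<in> borel_measurable borel" by measurable
  finally show ?thesis .
qed

text \<open>The factor \<open>1 / 2\<close> allows to replace supporting lines by the chord through the origin: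
  \<open>\<Psi> s \<ge> (\<Psi> t / t) (s - t)\<close>, which needs no care where \<open>\<Psi>\<close> is infinite.\<close>

lemma young_jensen:
  assumes y: "young \<Psi>" and [measurable]: "k \<in> borel_measurable M" "h \<in> borel_measurable M"
    and k: "(\<integral>\<^sup>+x. k x \<partial>M) \<le> 1"
  shows "at_ennreal \<Psi> ((\<integral>\<^sup>+x. k x * h x \<partial>M) / 2)
    \<le> (\<integral>\<^sup>+x. k x * at_ennreal \<Psi> (h x) \<partial>M)" (is "_ \<le> ?R")
proof -
  note [measurable] = young_measurable[OF y]
  have A: "\<Psi> t \<le> ?R" if t: "0 < t" "ennreal (2 * t) \<le> (\<integral>\<^sup>+x. k x * h x \<partial>M)" for t
  \<comment> \<open>\<open>\<Psi> t\<close> may be infinite; a finite z below it can be cancelled at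
    the end.\<close>
  proof (rule dense_le)
    fix z assume z: "z < \<Psi> t"
    then obtain y' where y': "z = ennreal y'" "0 \<le> y'"
      by (cases z) auto
    \<comment> \<open>The line of slope z / t through (t, 0) lies below \<Psi>: up to t it is
      nonpositive, and beyond t the ratio bound gives z \<le> (t / u) \<Psi> u. Multiplying by t and
      moving z t to the right avoids subtraction in \<open>ennreal\<close>.\<close>
    have pw: "z * u \<le> ennreal t * at_ennreal \<Psi> u + z * ennreal t" for u
    proof (cases u)
      case (real s)
      show ?thesis
      proof (cases "s \<le> t")
        case True
        then have "z * u \<le> z * ennreal t" unfolding real by (intro mult_left_mono) (auto intro: ennreal_leI)
        then show ?thesis by (simp add: add_increasing)
      next
        case False
        then have s: "0 < s" "t \<le> s" using t by auto
        have "z \<le> ennreal (t / s) * \<Psi> s"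
          using young_ratio[OF y _ s(2) s(1)] t z by (meson less_imp_le order.trans)
        then have "z * u \<le> (ennreal (t / s) * \<Psi> s) * ennreal s" unfolding real by (rule mult_right_mono) auto
        also have "\<dots> = (ennreal (t / s) * ennreal s) * \<Psi> s" by (simp add: ac_simps)
        also have "ennreal (t / s) * ennreal s = ennreal t"
          using s t by (simp flip: ennreal_mult)
        also have "\<Psi> s = at_ennreal \<Psi> u" using real by (simp add: at_ennreal_ennreal)
        finally show ?thesis by (simp add: add_increasing2)
      qed
    next
      case top
      then show ?thesis using t by (simp add: ennreal_mult_top)
    qed
    have "z * ennreal (2 * t) \<le> z * (\<integral>\<^sup>+x. k x * h x \<partial>M)" by (intro mult_left_mono t) auto
    also have "\<dots> = (\<integral>\<^sup>+x. k x * (z * h x) \<partial>M)"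
      by (subst nn_integral_cmult[symmetric]) (auto simp: ac_simps)
    also have "\<dots> \<le> (\<integral>\<^sup>+x. k x * (ennreal t * at_ennreal \<Psi> (h x) + z * ennreal t) \<partial>M)"
      by (intro nn_integral_mono mult_left_mono pw) auto
    also have "\<dots> = (\<integral>\<^sup>+x. ennreal t * (k x * at_ennreal \<Psi> (h x)) + (z * ennreal t) * k x \<partial>M)"
      by (intro nn_integral_cong) (auto simp: algebra_simps)
    also have "\<dots> = ennreal t * ?R + (z * ennreal t) * (\<integral>\<^sup>+x. k x \<partial>M)"
      by (subst nn_integral_add) (auto simp: nn_integral_cmult)
    also have "\<dots> \<le> ennreal t * ?R + (z * ennreal t) * 1"
      by (intro add_mono mult_left_mono k) auto
    finally have *: "z * ennreal (2 * t) \<le> ennreal t * ?R + z * ennreal t" by simp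
    show "z \<le> ?R"
    proof (cases ?R)
      case (real \<rho>)
      have "ennreal (y' * (2 * t)) \<le> ennreal (t * \<rho> + y' * t)"
        using * t y' real by (simp add: ennreal_mult ennreal_plus)
      then have "y' * (2 * t) \<le> t * \<rho> + y' * t" using t y' real by (subst (asm) ennreal_le_iff) auto
      then have "t * y' \<le> t * \<rho>" by (simp add: algebra_simps)
      then have "y' \<le> \<rho>" using t by auto
      then show ?thesis unfolding real y' by (rule ennreal_leI)
    qed auto
  qed
  show ?thesis
  proof (cases "\<integral>\<^sup>+x. k x * h x \<partial>M")
    case (real T)
    show ?thesis
    proof (cases "T = 0")
      case True
      then show ?thesis using real y by (simp add: at_ennreal_def young_zero)
    next
      case False
      then have "\<Psi> (T / 2) \<le> ?R" using A[of "T / 2"] real by simp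
      moreover have "ennreal T / 2 = ennreal (T / 2)" using real by (simp add: ennreal_divide_numeral)
      ultimately show ?thesis using real by (simp add: at_ennreal_ennreal)
    qed
  next
    case top
    \<comment> \<open>If the mean is infinite, \<open>A\<close> applies to every t > 0, and the
      right-hand side bounds all values of \<Psi>, which tend to infinity.\<close>
    have "(\<Psi> \<longlongrightarrow> top) at_top" using y by (simp add: young_def)
    moreover have "\<forall>\<^sub>F t in at_top. \<Psi> t \<le> ?R"
      using eventually_gt_at_top[of 0] by eventually_elim (use A top in auto)
    ultimately have "top \<le> ?R" by (rule tendsto_upperbound) auto
    then show ?thesis by (simp add: top_unique)
  qed
qed

section \<open>Powers of extended reals and the passage from order r to Young functions\<close>

definition epow :: "real \<Rightarrow> ennreal \<Rightarrow> ennreal" where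
  "epow r x = (if x = top then top else ennreal (enn2real x powr r))"

lemma epow_top [simp]: "epow r top = top"
  by (simp add: epow_def)

lemma epow_ennreal: "0 \<le> t \<Longrightarrow> epow r (ennreal t) = ennreal (t powr r)"
  by (simp add: epow_def)

lemma epow_mono: "0 < r \<Longrightarrow> x \<le> y \<Longrightarrow> epow r x \<le> epow r y"
  by (cases x; cases y) (auto simp: epow_ennreal top_unique intro!: ennreal_leI powr_mono2)

lemma epow_inverse: "0 < r \<Longrightarrow> epow (1 / r) (epow r x) = x"
  by (cases x) (auto simp: epow_ennreal powr_powr)

lemma epow_le_iff: "0 < r \<Longrightarrow> epow r x \<le> epow r y \<longleftrightarrow> x \<le> y"
  by (metis epow_inverse epow_mono zero_less_divide_1_iff)

lemma epow_mult_ennreal: "0 < r \<Longrightarrow> 0 < c \<Longrightarrow> epow r (ennreal c * x) = ennreal (c powr r) * epow r x"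
  by (cases x) (auto simp: epow_ennreal powr_mult ennreal_mult_top simp flip: ennreal_mult)

lemma epow_divide: "0 < r \<Longrightarrow> 0 < c \<Longrightarrow> epow r (x / ennreal c) = epow r x / ennreal (c powr r)"
  by (cases x) (auto simp: epow_ennreal powr_divide divide_ennreal ennreal_top_divide)

lemma at_ennreal_epow:
  assumes "\<And>t. 0 \<le> t \<Longrightarrow> \<Phi> t = \<Psi> (t powr r)"
  shows "at_ennreal \<Phi> x = at_ennreal \<Psi> (epow r x)"
  by (cases x) (auto simp: epow_ennreal at_ennreal_ennreal assms)

text \<open>\<Phi> (f / c) = \<Psi> (f^r / c^r), so c is admissible on the left exactly if c^r is
  admissible on the right. This turns a quasi-norm of order r into a norm of the r-th power with a
  Young function.\<close>

lemma epow_orlicz_norm: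
  assumes r: "0 < r" and \<Phi>: "\<And>t. 0 \<le> t \<Longrightarrow> \<Phi> t = \<Psi> (t powr r)"
  shows "epow r (orlicz_norm \<mu> \<Phi> f) = orlicz_norm \<mu> \<Psi> (\<lambda>x. epow r (f x))"
proof -
  have eq: "(\<integral>\<^sup>+ x. at_ennreal \<Phi> (f x / ennreal c) \<partial>\<mu>)
     = (\<integral>\<^sup>+ x. at_ennreal \<Psi> (epow r (f x) / ennreal (c powr r)) \<partial>\<mu>)" if "0 < c" for c
    using that r by (simp add: at_ennreal_epow[where \<Phi> = \<Phi> and \<Psi> = \<Psi> and r = r, OF \<Phi>] epow_divide)
  have inv: "c = epow r (epow (1 / r) c)" for c
    using epow_inverse[of "1 / r" c] r by simp
  show ?thesis
  proof (rule antisym)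
    show "epow r (orlicz_norm \<mu> \<Phi> f) \<le> orlicz_norm \<mu> \<Psi> (\<lambda>x. epow r (f x))"
      unfolding orlicz_norm_def
    proof (rule Inf_greatest)
      fix y assume "y \<in> {ennreal c |c. 0 < c \<and> (\<integral>\<^sup>+ x. at_ennreal \<Psi> (epow r (f x) / ennreal c)
        \<partial>\<mu>) \<le> 1}"
      then obtain c where c: "y = ennreal c" "0 < c" "(\<integral>\<^sup>+ x. at_ennreal \<Psi> (epow r (f x) / ennreal c) \<partial>\<mu>)
        \<le> 1" by auto
      define d where "d = c powr (1 / r)"
      have d: "0 < d" "c = d powr r" using c r by (auto simp: d_def powr_powr)
      have "Inf {ennreal c |c. 0 < c \<and> (\<integral>\<^sup>+ x. at_ennreal \<Phi> (f x / ennreal c) \<partial>\<mu>) \<le> 1} \<le> ennreal d"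
        using c d eq by (intro Inf_lower) auto
      then have "epow r (Inf {ennreal c |c. 0 < c \<and> (\<integral>\<^sup>+ x. at_ennreal \<Phi> (f x / ennreal c) \<partial>\<mu>)
        \<le> 1}) \<le> epow r (ennreal d)"
        by (rule epow_mono[OF r])
      also have "epow r (ennreal d) = y" using d c by (simp add: epow_ennreal)
      finally show "epow r (Inf {ennreal c |c. 0 < c \<and> (\<integral>\<^sup>+ x. at_ennreal \<Phi> (f x / ennreal c) \<partial>\<mu>)
        \<le> 1}) \<le> y" .
    qed
    have "epow (1 / r) (orlicz_norm \<mu> \<Psi> (\<lambda>x. epow r (f x))) \<le> orlicz_norm \<mu> \<Phi> f"
      unfolding orlicz_norm_def
    proof (rule Inf_greatest)
      fix y assume "y \<in> {ennreal c |c. 0 < c \<and> (\<integral>\<^sup>+ x. at_ennreal \<Phi> (f x / ennreal c) \<partial>\<mu>) \<le> 1}"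
      then obtain c where c: "y = ennreal c" "0 < c" "(\<integral>\<^sup>+ x. at_ennreal \<Phi> (f x / ennreal c) \<partial>\<mu>) \<le> 1" by auto
      have "Inf {ennreal c |c. 0 < c \<and> (\<integral>\<^sup>+ x. at_ennreal \<Psi> (epow r (f x) / ennreal c) \<partial>\<mu>) \<le> 1}
        \<le> ennreal (c powr r)"
        using c eq by (intro Inf_lower) auto
      also have "\<dots> = epow r y" using c by (simp add: epow_ennreal)
      finally have "epow (1 / r) (Inf {ennreal c |c. 0 < c \<and> (\<integral>\<^sup>+ x. at_ennreal \<Psi> (epow r (f x) / ennreal c)
        \<partial>\<mu>) \<le> 1})
        \<le> epow (1 / r) (epow r y)"
        using r by (intro epow_mono) auto
      then show "epow (1 / r) (Inf {ennreal c |c. 0 < c \<and> (\<integral>\<^sup>+ x. at_ennreal \<Psi> (epow r (f x) / ennreal c)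
        \<partial>\<mu>) \<le> 1}) \<le> y"
        by (simp only: epow_inverse[OF r])
    qed
    then have "epow r (epow (1 / r) (orlicz_norm \<mu> \<Psi> (\<lambda>x. epow r (f x)))) \<le> epow r (orlicz_norm \<mu> \<Phi> f)"
      by (rule epow_mono[OF r])
    then show "orlicz_norm \<mu> \<Psi> (\<lambda>x. epow r (f x)) \<le> epow r (orlicz_norm \<mu> \<Phi> f)"
      by (simp only: inv[symmetric])
  qed
qed

lemma orlicz_norm_mono:
  assumes "young \<Psi>" "\<And>x. x \<in> space \<mu> \<Longrightarrow> f x \<le> g x"
  shows "orlicz_norm \<mu> \<Psi> f \<le> orlicz_norm \<mu> \<Psi> g"
  unfolding orlicz_norm_def
proof (intro Inf_superset_mono Collect_mono impI, elim exE conjE, intro exI conjI)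
  fix c assume "(\<integral>\<^sup>+ x. at_ennreal \<Psi> (g x / ennreal c) \<partial>\<mu>) \<le> 1"
  moreover have "(\<integral>\<^sup>+ x. at_ennreal \<Psi> (f x / ennreal c) \<partial>\<mu>)
    \<le> (\<integral>\<^sup>+ x. at_ennreal \<Psi> (g x / ennreal c) \<partial>\<mu>)"
    by (intro nn_integral_mono at_ennreal_mono assms divide_right_mono_ennreal)
  ultimately show "(\<integral>\<^sup>+ x. at_ennreal \<Psi> (f x / ennreal c) \<partial>\<mu>) \<le> 1" by simp
qed

lemma orlicz_norm_le:
  assumes "0 < c" "(\<integral>\<^sup>+ x. at_ennreal \<Psi> (f x / ennreal c) \<partial>\<mu>) \<le> 1"
  shows "orlicz_norm \<mu> \<Psi> f \<le> ennreal c"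
  unfolding orlicz_norm_def using assms by (auto intro!: Inf_lower)

lemma ennreal_divide_antimono: "0 < b \<Longrightarrow> b \<le> c \<Longrightarrow> x / ennreal c \<le> x / ennreal b"
  by (auto simp: divide_ennreal_def inverse_ennreal intro!: mult_left_mono ennreal_leI le_imp_inverse_le)

text \<open>The strict inequality matters: a Young function that is 0 on [0, 1) and infinite from 1
  on shows that the infimum in \<open>orlicz_norm\<close> can fail to be attained.\<close>

lemma orlicz_norm_lt:
  assumes "young \<Psi>" "orlicz_norm \<mu> \<Psi> f < ennreal c"
  shows "(\<integral>\<^sup>+ x. at_ennreal \<Psi> (f x / ennreal c) \<partial>\<mu>) \<le> 1"
proof -
  obtain b where b: "0 < b" "(\<integral>\<^sup>+ x. at_ennreal \<Psi> (f x / ennreal b) \<partial>\<mu>) \<le> 1" "ennreal b < ennreal c"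
    using assms(2) unfolding orlicz_norm_def Inf_less_iff by auto
  have "(\<integral>\<^sup>+ x. at_ennreal \<Psi> (f x / ennreal c) \<partial>\<mu>)
    \<le> (\<integral>\<^sup>+ x. at_ennreal \<Psi> (f x / ennreal b) \<partial>\<mu>)"
    using b by (intro nn_integral_mono at_ennreal_mono assms ennreal_divide_antimono) (auto simp: ennreal_less_iff)
  with b show ?thesis by simp
qed

lemma orlicz_norm_cmult_le:
  assumes "0 < c"
  shows "orlicz_norm \<mu> \<Psi> (\<lambda>x. ennreal c * f x) \<le> ennreal c * orlicz_norm \<mu> \<Psi> f"
proof -
  have "ennreal (1 / c) * orlicz_norm \<mu> \<Psi> (\<lambda>x. ennreal c * f x) \<le> orlicz_norm \<mu> \<Psi> f"
    unfolding orlicz_norm_def[of _ _ f]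
  proof (rule Inf_greatest, clarify)
    fix d :: real assume d: "0 < d" "(\<integral>\<^sup>+ x. at_ennreal \<Psi> (f x / ennreal d) \<partial>\<mu>) \<le> 1"
    have "ennreal c * x / ennreal (c * d) = x / ennreal d" for x
      using d assms by (cases x) (auto simp: divide_ennreal ennreal_mult_top ennreal_top_divide simp flip: ennreal_mult)
    then have "orlicz_norm \<mu> \<Psi> (\<lambda>x. ennreal c * f x) \<le> ennreal (c * d)"
      using d assms by (intro orlicz_norm_le) auto
    then have "ennreal (1 / c) * orlicz_norm \<mu> \<Psi> (\<lambda>x. ennreal c * f x) \<le> ennreal (1 / c) * ennreal (c * d)"
      by (rule mult_left_mono) auto
    also have "\<dots> = ennreal d" using assms d by (simp flip: ennreal_mult)
    finally show "ennreal (1 / c) * orlicz_norm \<mu> \<Psi> (\<lambda>x. ennreal c * f x) \<le> ennreal d" .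
  qed
  then have "ennreal c * (ennreal (1 / c) * orlicz_norm \<mu> \<Psi> (\<lambda>x. ennreal c * f x)) \<le> ennreal c * orlicz_norm \<mu> \<Psi> f"
    by (rule mult_left_mono) auto
  then show ?thesis using assms by (simp flip: mult.assoc ennreal_mult)
qed

text \<open>Constants larger than an admissible one are admissible, so the rational ones suffice. A
  countable infimum preserves measurability in a parameter, which the next lemma exploits.\<close>

lemma orlicz_norm_eq_INF_rat:
  assumes "young \<Psi>"
  shows "orlicz_norm \<mu> \<Psi> f = (INF q\<in>\<rat> \<inter> {0<..}.
     if (\<integral>\<^sup>+ x. at_ennreal \<Psi> (f x / ennreal q) \<partial>\<mu>) \<le> 1 then ennreal q else top)"
proof (rule antisym)
  show "orlicz_norm \<mu> \<Psi> f \<le> (INF q\<in>\<rat> \<inter> {0<..}.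
     if (\<integral>\<^sup>+ x. at_ennreal \<Psi> (f x / ennreal q) \<partial>\<mu>) \<le> 1 then ennreal q else top)"
    by (rule INF_greatest) (auto intro: orlicz_norm_le)
  show "(INF q\<in>\<rat> \<inter> {0<..}. if (\<integral>\<^sup>+ x. at_ennreal \<Psi> (f x / ennreal q) \<partial>\<mu>)
    \<le> 1 then ennreal q else top)
    \<le> orlicz_norm \<mu> \<Psi> f" (is "?I \<le> _")
  proof (rule dense_ge)
    fix y assume y: "orlicz_norm \<mu> \<Psi> f < y"
    then obtain b where b: "0 < b" "(\<integral>\<^sup>+ x. at_ennreal \<Psi> (f x / ennreal b) \<partial>\<mu>) \<le> 1" "ennreal b < y"
      unfolding orlicz_norm_def Inf_less_iff by auto
    obtain e where e: "ennreal b < e" "e < y" using b(3) dense by blast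
    then obtain e' where e': "e = ennreal e'" "0 \<le> e'"
      by (cases e) auto
    obtain q where q: "q \<in> \<rat>" "b < q" "q < e'"
      using Rats_dense_in_real[of b e'] e e' b by (auto simp: ennreal_less_iff)
    have "orlicz_norm \<mu> \<Psi> f < ennreal q"
      using orlicz_norm_le[OF b(1,2)] q b by (auto simp: ennreal_less_iff intro: le_less_trans)
    then have "?I \<le> ennreal q"
      using q b orlicz_norm_lt[OF assms] by (intro INF_lower2[of q]) auto
    also have "\<dots> \<le> y" using q e e' by (metis ennreal_leI less_imp_le order.trans)
    finally show "?I \<le> y" .
  qed
qed

lemma orlicz_norm_section_measurable:
  assumes y: "young \<Psi>" and "sigma_finite_measure \<mu>"
    and [measurable]: "(\<lambda>(\<xi>, x). g x \<xi>) \<in> borel_measurable (N \<Otimes>\<^sub>M \<mu>)"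
  shows "(\<lambda>\<xi>. orlicz_norm \<mu> \<Psi> (\<lambda>x. g x \<xi>)) \<in> borel_measurable N"
proof -
  interpret sigma_finite_measure \<mu> by fact
  note [measurable] = young_measurable[OF y]
  have "countable (\<rat> \<inter> {0<..} :: real set)" using countable_rat by (rule countable_subset[rotated]) auto
  moreover have "(\<lambda>\<xi>. if (\<integral>\<^sup>+ x. at_ennreal \<Psi> (g x \<xi> / ennreal q) \<partial>\<mu>)
    \<le> 1 then ennreal q else top)
    \<in> borel_measurable N" for q
    by measurable
  ultimately show ?thesis unfolding orlicz_norm_eq_INF_rat[OF y]
    by (intro borel_measurable_INF) auto
qed

text \<open>Testing against every admissible c is enough; the factor a is divided out first, so that
  the bare infimum stands on the right.\<close>

lemma le_cmult_orlicz_norm: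
  assumes "0 < a"
    and le: "\<And>c. 0 < c \<Longrightarrow> (\<integral>\<^sup>+ x. at_ennreal \<Psi> (f x / ennreal c) \<partial>\<mu>) \<le> 1
      \<Longrightarrow> X \<le> ennreal (a * c)"
  shows "X \<le> ennreal a * orlicz_norm \<mu> \<Psi> f"
proof -
  have "ennreal (1 / a) * X \<le> orlicz_norm \<mu> \<Psi> f"
    unfolding orlicz_norm_def
  proof (rule Inf_greatest, clarify)
    fix c :: real assume c: "0 < c" "(\<integral>\<^sup>+ x. at_ennreal \<Psi> (f x / ennreal c) \<partial>\<mu>) \<le> 1"
    have "ennreal (1 / a) * X \<le> ennreal (1 / a) * ennreal (a * c)"
      by (intro mult_left_mono le c) auto
    also have "\<dots> = ennreal c" using assms c by (simp flip: ennreal_mult)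
    finally show "ennreal (1 / a) * X \<le> ennreal c" .
  qed
  then have "ennreal a * (ennreal (1 / a) * X) \<le> ennreal a * orlicz_norm \<mu> \<Psi> f"
    by (rule mult_left_mono) auto
  then show ?thesis using assms by (simp flip: mult.assoc ennreal_mult)
qed

section \<open>Translation invariance and kernels acting on mixed norms\<close>

lemma nn_integral_lborel_shift:
  fixes f :: "'b::euclidean_space \<Rightarrow> ennreal"
  assumes [measurable]: "f \<in> borel_measurable borel"
  shows "(\<integral>\<^sup>+x. f (x + a) \<partial>lborel) = (\<integral>\<^sup>+x. f x \<partial>lborel)"
proof -
  have "(\<integral>\<^sup>+x. f x \<partial>lborel) = (\<integral>\<^sup>+x. f x \<partial>distr lborel borel ((+) a))"
    by (simp add: lborel_distr_plus)
  also have "\<dots> = (\<integral>\<^sup>+x. f (a + x) \<partial>lborel)" by (rule nn_integral_distr) auto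
  finally show ?thesis by (simp add: add.commute)
qed

lemma nn_integral_lborel_pair:
  fixes f :: "'b::euclidean_space \<times> 'b \<Rightarrow> ennreal"
  assumes "f \<in> borel_measurable borel"
  shows "(\<integral>\<^sup>+Y. f Y \<partial>lborel)
    = (\<integral>\<^sup>+\<xi>. \<integral>\<^sup>+x. f (x, \<xi>) \<partial>lborel \<partial>lborel)"
proof -
  have "f \<in> borel_measurable (lborel \<Otimes>\<^sub>M lborel)" using assms by (simp add: lborel_prod)
  from lborel_pair.nn_integral_snd[OF this] show ?thesis by (simp add: lborel_prod)
qed

text \<open>After the substitution u = x - j + w a point u is counted once for each j with u - x + j
  in B, hence at most N times.\<close>

lemma sum_translates_le:
  fixes K :: "'b::euclidean_space \<Rightarrow> ennreal"
  assumes [measurable]: "K \<in> borel_measurable borel" "B \<in> sets borel" and J: "countable J"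
    and count: "\<And>u. (\<integral>\<^sup>+j. indicator B (u + j) \<partial>count_space J) \<le> N"
  shows "(\<integral>\<^sup>+j. (\<integral>\<^sup>+w. indicator B w * K (x - j + w) \<partial>lborel) \<partial>count_space J)
    \<le> N * (\<integral>\<^sup>+u. K u \<partial>lborel)"
proof -
  have "(\<integral>\<^sup>+w. indicator B w * K (x - j + w) \<partial>lborel)
    = (\<integral>\<^sup>+u. indicator B (u - x + j) * K u \<partial>lborel)" for j
    using nn_integral_lborel_shift[of "\<lambda>u. indicator B (u - x + j) * K u" "x - j"]
    by (simp add: algebra_simps)
  then have "(\<integral>\<^sup>+j. (\<integral>\<^sup>+w. indicator B w * K (x - j + w) \<partial>lborel) \<partial>count_space J)
     = (\<integral>\<^sup>+j. (\<integral>\<^sup>+u. indicator B (u - x + j) * K u \<partial>lborel) \<partial>count_space J)" by simp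
  also have "\<dots> = (\<integral>\<^sup>+u. (\<integral>\<^sup>+j. indicator B (u - x + j) * K u \<partial>count_space J) \<partial>lborel)"
    by (rule nn_integral_count_space_nn_integral[symmetric, OF J]) measurable
  also have "\<dots> = (\<integral>\<^sup>+u. (\<integral>\<^sup>+j. indicator B (u - x + j) \<partial>count_space J) * K u \<partial>lborel)"
    by (simp add: nn_integral_multc)
  also have "\<dots> \<le> (\<integral>\<^sup>+u. N * K u \<partial>lborel)" by (intro nn_integral_mono mult_right_mono count) auto
  also have "\<dots> = N * (\<integral>\<^sup>+u. K u \<partial>lborel)" by (simp add: nn_integral_cmult)
  finally show ?thesis .
qed

text \<open>The continuous counterpart of the preceding count: the measure of B takes the place of
  N.\<close>

lemma integral_translates_eq:
  fixes K :: "'b::euclidean_space \<Rightarrow> ennreal"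
  assumes [measurable]: "K \<in> borel_measurable borel" "B \<in> sets borel"
  shows "(\<integral>\<^sup>+x. (\<integral>\<^sup>+w. indicator B w * K (x + w) \<partial>lborel) \<partial>lborel)
    = emeasure lborel B * (\<integral>\<^sup>+u. K u \<partial>lborel)"
proof -
  have "(\<integral>\<^sup>+x. (\<integral>\<^sup>+w. indicator B w * K (x + w) \<partial>lborel) \<partial>lborel)
     = (\<integral>\<^sup>+w. (\<integral>\<^sup>+x. indicator B w * K (x + w) \<partial>lborel) \<partial>lborel)"
    by (rule lborel_pair.Fubini') measurable
  also have "\<dots> = (\<integral>\<^sup>+w. indicator B w * (\<integral>\<^sup>+u. K u \<partial>lborel) \<partial>lborel)"
    by (simp add: nn_integral_cmult nn_integral_lborel_shift)
  finally show ?thesis by (simp add: nn_integral_multc)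
qed

text \<open>A kernel that is dominated by its own averages over translates of \<open>B\<close> acts from the mixed
  norm on the space to the mixed norm on a uniformly discrete set. The inner quasi-norm of the
  argument enters as a density \<open>l\<close>, so that a single application of Jensen's inequality in both
  variables replaces Minkowski's inequality.\<close>

lemma orlicz_kernel_inner:
  fixes \<kappa> g :: "'b::euclidean_space \<times> 'b \<Rightarrow> ennreal" and l k2 :: "'b \<Rightarrow> ennreal"
  assumes y: "young \<Psi>" and [measurable]: "g \<in> borel_measurable borel" "\<kappa> \<in> borel_measurable borel"
      "l \<in> borel_measurable borel" "k2 \<in> borel_measurable borel"
    and J: "countable J"
    and k1: "\<And>\<eta>. (\<integral>\<^sup>+x. \<kappa> (x, \<eta>) \<partial>lborel) \<le> k2 \<eta>"
    and kJ: "\<And>x \<eta>. (\<integral>\<^sup>+j. \<kappa> (x - j, \<eta>) \<partial>count_space J) \<le> k2 \<eta>"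
    and l: "\<And>\<xi>. 0 < l \<xi>" "\<And>\<xi>. l \<xi> < top"
    and ml: "AE \<xi> in lborel. (\<integral>\<^sup>+x. at_ennreal \<Psi> (g (x, \<xi>) / l \<xi>) \<partial>lborel) \<le> 1"
  shows "orlicz_norm (count_space J) \<Psi> (\<lambda>j. \<integral>\<^sup>+Y. g Y * \<kappa> (Y - (j, i)) \<partial>lborel)
     \<le> 2 * (\<integral>\<^sup>+\<xi>. k2 (\<xi> - i) * l \<xi> \<partial>lborel)" (is "?N \<le> 2 * ?L")
proof (rule dense_ge)
  note [measurable] = young_measurable[OF y]
  fix z assume z: "2 * ?L < z"
  show "?N \<le> z"
  proof (cases z)
    case (real c)
    \<comment> \<open>Half of c is reserved for the factor 2 that \<open>young_jensen\<close>
      loses.\<close>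
    define L where "L = c / 2"
    have L: "0 < L" "?L \<le> ennreal L"
    proof -
      have "0 < z" using z by (metis not_gr_zero not_less_zero)
      then show "0 < L" using real by (simp add: L_def)
      have "2 * ?L \<le> 2 * ennreal L" using z real unfolding L_def
        by (simp add: ennreal_mult[symmetric, of 2, simplified] less_imp_le)
      then have "2 * ?L / 2 \<le> 2 * ennreal L / 2" by (rule divide_right_mono_ennreal)
      moreover have "2 * x / 2 = x" for x :: ennreal
        using L_def by (cases x) (auto simp: ennreal_mult_top ennreal_top_divide ennreal_divide_numeral
          ennreal_mult[symmetric, of 2, simplified])
      ultimately show "?L \<le> ennreal L" by simp
    qed
    \<comment> \<open>The density l is moved from the argument into the kernel: k h is still g
      \<kappa> / L, while k has mass at most 1 in Y, and the integral of \<Psi> (h) over each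
      frequency is at most 1 by the hypothesis on l.\<close>
    define k where "k j Y = \<kappa> (Y - (j, i)) * l (snd Y) / ennreal L" for j Y
    define h where "h Y = g Y / l (snd Y)" for Y
    have snd: "(\<lambda>Y :: 'b \<times> 'b. m (snd Y)) \<in> borel_measurable borel"
      if "m \<in> borel_measurable borel" for m :: "'b \<Rightarrow> ennreal"
      by (rule measurable_compose[OF _ that]) (intro borel_measurable_continuous_onI continuous_on_snd continuous_on_id)
    have [measurable]: "(\<lambda>Y :: 'b \<times> 'b. l (snd Y)) \<in> borel_measurable borel"
      "(\<lambda>Y :: 'b \<times> 'b. k2 (snd Y - i)) \<in> borel_measurable borel"
      using snd[of l] snd[of "\<lambda>\<eta>. k2 (\<eta> - i)"] by auto
    have [measurable]: "k j \<in> borel_measurable borel" "h \<in> borel_measurable borel" for j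
      unfolding k_def h_def by measurable
    have kh: "k j Y * h Y = g Y * \<kappa> (Y - (j, i)) / ennreal L" for j Y
    proof -
      have "l (snd Y) \<noteq> 0" "l (snd Y) \<noteq> top" using l[of "snd Y"] by auto
      then have "l (snd Y) * inverse (l (snd Y)) = 1"
        by (cases "l (snd Y)") (auto simp: inverse_ennreal simp flip: ennreal_mult)
      moreover have "k j Y * h Y = (l (snd Y) * inverse (l (snd Y))) * (g Y * \<kappa> (Y - (j, i)) / ennreal L)"
        unfolding k_def h_def divide_ennreal_def by (simp only: ac_simps)
      ultimately show ?thesis by simp
    qed
    have kpt: "(\<integral>\<^sup>+Y. k j Y * h Y \<partial>lborel)
      = (\<integral>\<^sup>+Y. g Y * \<kappa> (Y - (j, i)) \<partial>lborel) / ennreal L" for j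
      unfolding kh by (subst nn_integral_divide) auto
    have k1': "(\<integral>\<^sup>+Y. k j Y \<partial>lborel) \<le> 1" for j
    proof -
      have "(\<integral>\<^sup>+Y. k j Y \<partial>lborel)
        = (\<integral>\<^sup>+\<xi>. \<integral>\<^sup>+x. \<kappa> (x - j, \<xi> - i) * l \<xi> / ennreal L \<partial>lborel \<partial>lborel)"
        by (subst nn_integral_lborel_pair) (auto simp: k_def)
      also have "\<dots> = (\<integral>\<^sup>+\<xi>. (\<integral>\<^sup>+x. \<kappa> (x - j, \<xi> - i) \<partial>lborel) * l \<xi>
        \<partial>lborel) / ennreal L"
        by (simp add: nn_integral_divide nn_integral_multc)
      also have "\<dots> \<le> ?L / ennreal L"
        using nn_integral_lborel_shift[of "\<lambda>x. \<kappa> (x, \<eta>)" "- j" for \<eta>] k1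
        by (intro divide_right_mono_ennreal nn_integral_mono mult_right_mono) auto
      also have "\<dots> \<le> ennreal L / ennreal L" by (intro divide_right_mono_ennreal L)
      finally show ?thesis using L by (simp add: divide_ennreal)
    qed
    have "(\<integral>\<^sup>+j. at_ennreal \<Psi> ((\<integral>\<^sup>+Y. g Y * \<kappa> (Y - (j, i)) \<partial>lborel) / ennreal c)
      \<partial>count_space J)
       \<le> (\<integral>\<^sup>+j. (\<integral>\<^sup>+Y. k j Y * at_ennreal \<Psi> (h Y) \<partial>lborel) \<partial>count_space J)"
    proof (intro nn_integral_mono)
      fix j
      have "x / ennreal c = x / ennreal L / 2" for x
        using L real by (cases x) (auto simp: L_def divide_ennreal ennreal_divide_numeral ennreal_top_divide)
      then have "(\<integral>\<^sup>+Y. g Y * \<kappa> (Y - (j, i)) \<partial>lborel) / ennreal c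
        = (\<integral>\<^sup>+Y. k j Y * h Y \<partial>lborel) / 2"
        by (simp add: kpt)
      then show "at_ennreal \<Psi> ((\<integral>\<^sup>+Y. g Y * \<kappa> (Y - (j, i)) \<partial>lborel) / ennreal c)
        \<le> (\<integral>\<^sup>+Y. k j Y * at_ennreal \<Psi> (h Y) \<partial>lborel)"
        using young_jensen[OF y, of "k j" lborel h] k1' by simp
    qed
    also have "\<dots> = (\<integral>\<^sup>+Y. (\<integral>\<^sup>+j. k j Y * at_ennreal \<Psi> (h Y) \<partial>count_space J) \<partial>lborel)"
      by (rule nn_integral_count_space_nn_integral[symmetric, OF J]) measurable
    also have "\<dots> = (\<integral>\<^sup>+Y. (\<integral>\<^sup>+j. \<kappa> (Y - (j, i)) \<partial>count_space J) * (l (snd Y) / ennreal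
      L * at_ennreal \<Psi> (h Y)) \<partial>lborel)"
      by (simp add: k_def nn_integral_multc divide_ennreal_def mult.assoc)
    also have "\<dots> \<le> (\<integral>\<^sup>+Y. k2 (snd Y - i) * (l (snd Y) / ennreal L * at_ennreal \<Psi> (h Y)) \<partial>lborel)"
    proof (intro nn_integral_mono mult_right_mono)
      fix Y :: "'b \<times> 'b"
      show "(\<integral>\<^sup>+j. \<kappa> (Y - (j, i)) \<partial>count_space J) \<le> k2 (snd Y - i)"
        using kJ[of "fst Y" "snd Y - i"] by (cases Y) simp
    qed auto
    also have "\<dots> = (\<integral>\<^sup>+\<xi>. \<integral>\<^sup>+x. k2 (\<xi> - i) * (l \<xi> / ennreal L * at_ennreal \<Psi> (g (x,
      \<xi>) / l \<xi>)) \<partial>lborel \<partial>lborel)"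
      by (subst nn_integral_lborel_pair) (auto simp: h_def)
    also have "\<dots> = (\<integral>\<^sup>+\<xi>. k2 (\<xi> - i) * (l \<xi> / ennreal L) * (\<integral>\<^sup>+x. at_ennreal \<Psi> (g (x,
      \<xi>) / l \<xi>) \<partial>lborel) \<partial>lborel)"
      by (subst nn_integral_cmult[symmetric]) (auto simp: mult.assoc)
    also have "\<dots> \<le> (\<integral>\<^sup>+\<xi>. k2 (\<xi> - i) * (l \<xi> / ennreal L) * 1 \<partial>lborel)"
      by (rule nn_integral_mono_AE, rule eventually_mono[OF ml], rule mult_left_mono) auto
    also have "\<dots> = ?L / ennreal L"
      by (simp add: divide_ennreal_def nn_integral_multc flip: mult.assoc)
    also have "\<dots> \<le> ennreal L / ennreal L" by (intro divide_right_mono_ennreal L)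
    also have "\<dots> = 1" using L by (simp add: divide_ennreal)
    finally have "?N \<le> ennreal c" using L by (intro orlicz_norm_le) (auto simp: L_def)
    then show ?thesis using real by simp
  qed auto
qed

text \<open>The constant: each of the two applications of Jensen's inequality costs a factor 2; D
  comes from the local domination, one N from integrating or summing over the first variable, the
  other N from the second variable, and I is the mass of the kernel.\<close>

lemma orlicz_kernel_bound:
  fixes \<kappa> g :: "'b::euclidean_space \<times> 'b \<Rightarrow> ennreal"
  assumes y1: "young \<Psi>\<^sub>1" and y2: "young \<Psi>\<^sub>2"
    and [measurable]: "g \<in> borel_measurable borel" "\<kappa> \<in> borel_measurable borel" "B \<in> sets borel"
    and B: "emeasure lborel B \<le> ennreal N" and J: "countable J\<^sub>1" "countable J\<^sub>2"
    and c1: "\<And>u. (\<integral>\<^sup>+j. indicator B (u + j) \<partial>count_space J\<^sub>1) \<le> ennreal N"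
    and c2: "\<And>u. (\<integral>\<^sup>+j. indicator B (u + j) \<partial>count_space J\<^sub>2) \<le> ennreal N"
    and loc: "\<And>x \<eta>. \<kappa> (x, \<eta>) \<le> ennreal D *
        (\<integral>\<^sup>+w2. indicator B w2 * (\<integral>\<^sup>+w1. indicator B w1 * \<kappa> (x + w1, \<eta> + w2) \<partial>lborel)
          \<partial>lborel)"
    and I: "(\<integral>\<^sup>+Y. \<kappa> Y \<partial>lborel) \<le> ennreal I"
    and pos: "0 < D" "0 < N" "0 < I"
  shows "orlicz_norm (count_space J\<^sub>2) \<Psi>\<^sub>2 (\<lambda>i. orlicz_norm (count_space J\<^sub>1) \<Psi>\<^sub>1
      (\<lambda>j. \<integral>\<^sup>+Y. g Y * \<kappa> (Y - (j, i)) \<partial>lborel))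
    \<le> ennreal (4 * D * N * N * I) * orlicz_norm lborel \<Psi>\<^sub>2 (\<lambda>\<xi>. orlicz_norm lborel \<Psi>\<^sub>1 (\<lambda>x. g
      (x, \<xi>)))"
proof -
  note [measurable] = young_measurable[OF y1] young_measurable[OF y2]
  define K where "K \<eta> = (\<integral>\<^sup>+x. \<kappa> (x, \<eta>) \<partial>lborel)" for \<eta>
  \<comment> \<open>\<open>k2 \<eta>\<close> majorises both the integral and the sum over J1 of
    \<kappa> in its first variable. The remaining average over B in the second variable allows the
    same counting argument once more, for the sum over J2.\<close>
  define k2 where "k2 \<eta> = ennreal (D * N) * (\<integral>\<^sup>+w. indicator B w * K (\<eta> + w) \<partial>lborel)" for \<eta>
  define n where "n \<xi> = orlicz_norm lborel \<Psi>\<^sub>1 (\<lambda>x. g (x, \<xi>))" for \<xi>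
  have [measurable]: "K \<in> borel_measurable borel" unfolding K_def by measurable
  have [measurable]: "k2 \<in> borel_measurable borel" unfolding k2_def by measurable
  have "n \<in> borel_measurable lborel" unfolding n_def
    by (rule orlicz_norm_section_measurable[OF y1 lborel.sigma_finite_measure_axioms]) measurable
  then have [measurable]: "n \<in> borel_measurable borel" by simp
  have Kint: "(\<integral>\<^sup>+\<eta>. K \<eta> \<partial>lborel) \<le> ennreal I"
    using I unfolding K_def by (subst (asm) nn_integral_lborel_pair) auto
  define Q where "Q = D * N * N * I"
  have Q: "0 < Q" using pos by (simp add: Q_def)
  have k1: "(\<integral>\<^sup>+x. \<kappa> (x, \<eta>) \<partial>lborel) \<le> k2 \<eta>" for \<eta>
  proof -
    have "(\<integral>\<^sup>+x. \<kappa> (x, \<eta>) \<partial>lborel) \<le> (\<integral>\<^sup>+x. ennreal D *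
        (\<integral>\<^sup>+w2. indicator B w2 * (\<integral>\<^sup>+w1. indicator B w1 * \<kappa> (x + w1, \<eta> + w2) \<partial>lborel)
          \<partial>lborel) \<partial>lborel)"
      by (intro nn_integral_mono loc)
    also have "\<dots> = ennreal D * (\<integral>\<^sup>+x.
        (\<integral>\<^sup>+w2. indicator B w2 * (\<integral>\<^sup>+w1. indicator B w1 * \<kappa> (x + w1, \<eta> + w2) \<partial>lborel)
          \<partial>lborel) \<partial>lborel)"
      by (intro nn_integral_cmult) measurable
    also have "(\<integral>\<^sup>+x. (\<integral>\<^sup>+w2. indicator B w2 * (\<integral>\<^sup>+w1. indicator B w1 * \<kappa> (x + w1,
      \<eta> + w2) \<partial>lborel) \<partial>lborel) \<partial>lborel)
       = (\<integral>\<^sup>+w2. (\<integral>\<^sup>+x. indicator B w2 * (\<integral>\<^sup>+w1. indicator B w1 * \<kappa> (x + w1, \<eta> +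
         w2) \<partial>lborel) \<partial>lborel) \<partial>lborel)"
      by (rule lborel_pair.Fubini') measurable
    also have "\<dots> = (\<integral>\<^sup>+w2. indicator B w2 * (emeasure lborel B * K (\<eta> + w2)) \<partial>lborel)"
      by (simp add: nn_integral_cmult K_def integral_translates_eq[where K = "\<lambda>x. \<kappa> (x, _)"])
    also have "\<dots> \<le> (\<integral>\<^sup>+w2. ennreal N * (indicator B w2 * K (\<eta> + w2)) \<partial>lborel)"
    proof (intro nn_integral_mono)
      fix w2 show "indicator B w2 * (emeasure lborel B * K (\<eta> + w2)) \<le> ennreal N * (indicator B w2 * K (\<eta> + w2))"
        using mult_right_mono[OF B, of "indicator B w2 * K (\<eta> + w2)"] by (simp add: ac_simps)
    qed
    also have "\<dots> = ennreal N * (\<integral>\<^sup>+w2. indicator B w2 * K (\<eta> + w2) \<partial>lborel)"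
      by (intro nn_integral_cmult) measurable
    finally show ?thesis unfolding k2_def using pos
      by (simp add: ennreal_mult mult.assoc mult_left_mono)
  qed
  have kJ: "(\<integral>\<^sup>+j. \<kappa> (x - j, \<eta>) \<partial>count_space J\<^sub>1) \<le> k2 \<eta>" for x \<eta>
  proof -
    have "(\<integral>\<^sup>+j. \<kappa> (x - j, \<eta>) \<partial>count_space J\<^sub>1) \<le> (\<integral>\<^sup>+j. ennreal D *
        (\<integral>\<^sup>+w2. indicator B w2 * (\<integral>\<^sup>+w1. indicator B w1 * \<kappa> (x - j + w1, \<eta> + w2)
          \<partial>lborel) \<partial>lborel) \<partial>count_space J\<^sub>1)"
      by (intro nn_integral_mono loc)
    also have "\<dots> = ennreal D * (\<integral>\<^sup>+j.
        (\<integral>\<^sup>+w2. indicator B w2 * (\<integral>\<^sup>+w1. indicator B w1 * \<kappa> (x - j + w1, \<eta> + w2)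
          \<partial>lborel) \<partial>lborel) \<partial>count_space J\<^sub>1)"
      by (intro nn_integral_cmult) auto
    also have "(\<integral>\<^sup>+j. (\<integral>\<^sup>+w2. indicator B w2 * (\<integral>\<^sup>+w1. indicator B w1 * \<kappa> (x - j +
      w1, \<eta> + w2) \<partial>lborel) \<partial>lborel) \<partial>count_space J\<^sub>1)
       = (\<integral>\<^sup>+w2. (\<integral>\<^sup>+j. indicator B w2 * (\<integral>\<^sup>+w1. indicator B w1 * \<kappa> (x - j + w1,
         \<eta> + w2) \<partial>lborel) \<partial>count_space J\<^sub>1) \<partial>lborel)"
      by (rule nn_integral_count_space_nn_integral[symmetric, OF J(1)]) measurable
    also have "\<dots> = (\<integral>\<^sup>+w2. indicator B w2 * (\<integral>\<^sup>+j. (\<integral>\<^sup>+w1. indicator B w1 * \<kappa>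
      (x - j + w1, \<eta> + w2) \<partial>lborel) \<partial>count_space J\<^sub>1) \<partial>lborel)"
      by (simp add: nn_integral_cmult)
    also have "\<dots> \<le> (\<integral>\<^sup>+w2. indicator B w2 * (ennreal N * K (\<eta> + w2)) \<partial>lborel)"
      unfolding K_def by (intro nn_integral_mono mult_left_mono sum_translates_le J c1) auto
    also have "\<dots> = (\<integral>\<^sup>+w2. ennreal N * (indicator B w2 * K (\<eta> + w2)) \<partial>lborel)"
      by (simp add: ac_simps)
    also have "\<dots> = ennreal N * (\<integral>\<^sup>+w2. indicator B w2 * K (\<eta> + w2) \<partial>lborel)"
      by (intro nn_integral_cmult) measurable
    finally show ?thesis unfolding k2_def using pos
      by (simp add: ennreal_mult mult.assoc mult_left_mono)
  qed
  have Q1: "(\<integral>\<^sup>+\<xi>. k2 (\<xi> - i) \<partial>lborel) \<le> ennreal Q" for i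
  proof -
    have "(\<integral>\<^sup>+\<xi>. k2 (\<xi> - i) \<partial>lborel) = (\<integral>\<^sup>+\<xi>. k2 \<xi> \<partial>lborel)"
      using nn_integral_lborel_shift[of k2 "- i"] by simp
    also have "\<dots> = ennreal (D * N) * (emeasure lborel B * (\<integral>\<^sup>+\<eta>. K \<eta> \<partial>lborel))"
      unfolding k2_def by (subst nn_integral_cmult) (auto simp: integral_translates_eq)
    also have "\<dots> \<le> ennreal (D * N) * (ennreal N * ennreal I)"
      by (intro mult_left_mono mult_mono B Kint) auto
    also have "\<dots> = ennreal Q" using pos by (simp add: Q_def ac_simps flip: ennreal_mult)
    finally show ?thesis .
  qed
  have Q2: "(\<integral>\<^sup>+i. k2 (\<xi> - i) \<partial>count_space J\<^sub>2) \<le> ennreal Q" for \<xi>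
  proof -
    have "(\<integral>\<^sup>+i. k2 (\<xi> - i) \<partial>count_space J\<^sub>2)
      = ennreal (D * N) * (\<integral>\<^sup>+i. (\<integral>\<^sup>+w. indicator B w * K (\<xi> - i + w) \<partial>lborel)
        \<partial>count_space J\<^sub>2)"
      unfolding k2_def by (intro nn_integral_cmult) auto
    also have "\<dots> \<le> ennreal (D * N) * (ennreal N * ennreal I)"
      by (intro mult_left_mono order.trans[OF sum_translates_le[OF _ _ J(2) c2]] Kint) auto
    also have "\<dots> = ennreal Q" using pos by (simp add: Q_def ac_simps flip: ennreal_mult)
    finally show ?thesis .
  qed
  define S where "S i = orlicz_norm (count_space J\<^sub>1) \<Psi>\<^sub>1 (\<lambda>j. \<integral>\<^sup>+Y. g Y * \<kappa> (Y - (j, i))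
    \<partial>lborel)" for i
  have S: "S i \<le> 2 * (\<integral>\<^sup>+\<xi>. k2 (\<xi> - i) * n \<xi> \<partial>lborel)" if fin: "AE \<xi> in lborel. n \<xi> < top" for i
  proof (rule ennreal_le_epsilon)
    fix e :: real assume e: "0 < e"
    define d where "d = e / (2 * Q)"
    have d: "0 < d" using e Q by (simp add: d_def)
    \<comment> \<open>The inner norm n can vanish or be infinite, whereas the density must be
      positive and finite. Adding d costs at most e / 2 by \<open>Q1\<close>; the value 1 is taken
      only where n is infinite, a null set here.\<close>
    define l where "l \<xi> = (if n \<xi> = top then 1 else n \<xi> + ennreal d)" for \<xi>
    have lpos: "0 < l \<xi>" "l \<xi> < top" for \<xi>
      using d by (auto simp: l_def less_top add_pos_nonneg zero_less_iff_neq_zero)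
    have ml: "(\<integral>\<^sup>+x. at_ennreal \<Psi>\<^sub>1 (g (x, \<xi>) / l \<xi>) \<partial>lborel) \<le> 1" if nf: "n \<xi> < top" for \<xi>
    proof -
      obtain c where c: "0 \<le> c" "n \<xi> = ennreal c" using nf by (cases "n \<xi>") auto
      have lc: "l \<xi> = ennreal (c + d)" using c d nf by (simp add: l_def ennreal_plus)
      have "n \<xi> < l \<xi>" unfolding lc using c d by (simp add: ennreal_less_iff)
      then show ?thesis using orlicz_norm_lt[OF y1] unfolding n_def lc by blast
    qed
    have [measurable]: "l \<in> borel_measurable borel" unfolding l_def by measurable
    have "S i \<le> 2 * (\<integral>\<^sup>+\<xi>. k2 (\<xi> - i) * l \<xi> \<partial>lborel)"
      unfolding S_def
      by (rule orlicz_kernel_inner[OF y1 _ _ _ _ J(1) k1 kJ lpos]) (use fin ml in auto)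
    also have "(\<integral>\<^sup>+\<xi>. k2 (\<xi> - i) * l \<xi> \<partial>lborel)
      = (\<integral>\<^sup>+\<xi>. k2 (\<xi> - i) * n \<xi> + k2 (\<xi> - i) * ennreal d \<partial>lborel)"
      using fin by (intro nn_integral_cong_AE) (auto simp: l_def distrib_left less_top)
    also have "\<dots> = (\<integral>\<^sup>+\<xi>. k2 (\<xi> - i) * n \<xi> \<partial>lborel) + (\<integral>\<^sup>+\<xi>. k2 (\<xi> - i)
      \<partial>lborel) * ennreal d"
      by (subst nn_integral_add) (auto simp: nn_integral_multc)
    also have "\<dots> \<le> (\<integral>\<^sup>+\<xi>. k2 (\<xi> - i) * n \<xi> \<partial>lborel) + ennreal Q * ennreal d"
      by (intro add_left_mono mult_right_mono Q1) auto
    also have "ennreal Q * ennreal d = ennreal (e / 2)"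
      using Q e by (simp add: d_def flip: ennreal_mult)
    finally have "S i \<le> 2 * ((\<integral>\<^sup>+\<xi>. k2 (\<xi> - i) * n \<xi> \<partial>lborel) + ennreal (e / 2))"
      by (simp add: mult_left_mono)
    also have "2 * ennreal (e / 2) = ennreal e"
      using ennreal_mult[of 2 "e / 2"] e by simp
    then have "2 * ((\<integral>\<^sup>+\<xi>. k2 (\<xi> - i) * n \<xi> \<partial>lborel) + ennreal (e / 2))
      = 2 * (\<integral>\<^sup>+\<xi>. k2 (\<xi> - i) * n \<xi> \<partial>lborel) + ennreal e" by (simp add: distrib_left)
    finally show "S i \<le> 2 * (\<integral>\<^sup>+\<xi>. k2 (\<xi> - i) * n \<xi> \<partial>lborel) + ennreal e" .
  qed
  have "orlicz_norm (count_space J\<^sub>2) \<Psi>\<^sub>2 S \<le> ennreal (4 * Q) * orlicz_norm lborel \<Psi>\<^sub>2 n"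
  proof (rule le_cmult_orlicz_norm)
    show "0 < 4 * Q" using Q by simp
    fix c :: real assume c: "0 < c" "(\<integral>\<^sup>+ x. at_ennreal \<Psi>\<^sub>2 (n x / ennreal c) \<partial>lborel) \<le> 1"
    \<comment> \<open>Admissibility of c forces \<Psi>2 (n / c), and with it n, to be finite almost
      everywhere, which is the premise of \<open>S\<close>.\<close>
    have "AE x in lborel. at_ennreal \<Psi>\<^sub>2 (n x / ennreal c) \<noteq> top"
    proof (rule nn_integral_noteq_infinite[unfolded infinity_ennreal_def])
      show "(\<lambda>x. at_ennreal \<Psi>\<^sub>2 (n x / ennreal c)) \<in> borel_measurable lborel" by measurable
      show "(\<integral>\<^sup>+ x. at_ennreal \<Psi>\<^sub>2 (n x / ennreal c) \<partial>lborel) \<noteq> top"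
        using c(2) ennreal_one_less_top by (metis not_le)
    qed
    then have fin: "AE \<xi> in lborel. n \<xi> < top"
    proof eventually_elim
      case (elim \<xi>)
      then show ?case by (cases "n \<xi>") (auto simp: ennreal_top_divide)
    qed
    have "(\<integral>\<^sup>+i. at_ennreal \<Psi>\<^sub>2 (S i / ennreal (4 * Q * c)) \<partial>count_space J\<^sub>2)
       \<le> (\<integral>\<^sup>+i. (\<integral>\<^sup>+\<xi>. k2 (\<xi> - i) / ennreal Q * at_ennreal \<Psi>\<^sub>2 (n \<xi> / ennreal c)
         \<partial>lborel) \<partial>count_space J\<^sub>2)"
    proof (intro nn_integral_mono)
      fix i
      have "S i / ennreal (4 * Q * c) \<le> 2 * (\<integral>\<^sup>+\<xi>. k2 (\<xi> - i) * n \<xi> \<partial>lborel) / ennreal (4 * Q * c)"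
        by (intro divide_right_mono_ennreal S fin)
      also have "\<dots> = (\<integral>\<^sup>+\<xi>. k2 (\<xi> - i) * n \<xi> \<partial>lborel) / ennreal (Q * c) / 2"
      proof -
        have "2 * x / ennreal (4 * Q * c) = x / ennreal (Q * c) / 2" for x
          using Q c by (cases x) (auto simp: divide_ennreal ennreal_divide_numeral ennreal_top_divide ennreal_mult_top
              ennreal_mult[symmetric, of 2, simplified])
        then show ?thesis .
      qed
      also have "(\<integral>\<^sup>+\<xi>. k2 (\<xi> - i) * n \<xi> \<partial>lborel) / ennreal (Q * c)
        = (\<integral>\<^sup>+\<xi>. (k2 (\<xi> - i) / ennreal Q) * (n \<xi> / ennreal c) \<partial>lborel)"
      proof -
        have "(k2 (\<xi> - i) / ennreal Q) * (n \<xi> / ennreal c) = k2 (\<xi> - i) * n \<xi> / ennreal (Q * c)" for \<xi>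
        proof -
          have "inverse (ennreal (Q * c)) = inverse (ennreal Q) * inverse (ennreal c)"
            using Q c by (simp add: inverse_ennreal flip: ennreal_mult)
          then show ?thesis by (simp only: divide_ennreal_def ac_simps)
        qed
        then show ?thesis by (simp add: nn_integral_divide)
      qed
      finally have "at_ennreal \<Psi>\<^sub>2 (S i / ennreal (4 * Q * c))
         \<le> at_ennreal \<Psi>\<^sub>2 ((\<integral>\<^sup>+\<xi>. (k2 (\<xi> - i) / ennreal Q) * (n \<xi> / ennreal c) \<partial>lborel) / 2)"
        by (rule at_ennreal_mono[OF y2])
      also have "\<dots> \<le> (\<integral>\<^sup>+\<xi>. k2 (\<xi> - i) / ennreal Q * at_ennreal \<Psi>\<^sub>2 (n \<xi> / ennreal c)
        \<partial>lborel)"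
      proof (rule young_jensen[OF y2])
        have "(\<integral>\<^sup>+\<xi>. k2 (\<xi> - i) / ennreal Q \<partial>lborel)
          = (\<integral>\<^sup>+\<xi>. k2 (\<xi> - i) \<partial>lborel) / ennreal Q"
          by (simp add: nn_integral_divide)
        also have "\<dots> \<le> ennreal Q / ennreal Q" by (intro divide_right_mono_ennreal Q1)
        finally show "(\<integral>\<^sup>+\<xi>. k2 (\<xi> - i) / ennreal Q \<partial>lborel) \<le> 1" using Q by (simp add: divide_ennreal)
      qed auto
      finally show "at_ennreal \<Psi>\<^sub>2 (S i / ennreal (4 * Q * c))
         \<le> (\<integral>\<^sup>+\<xi>. k2 (\<xi> - i) / ennreal Q * at_ennreal \<Psi>\<^sub>2 (n \<xi> / ennreal c) \<partial>lborel)" .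
    qed
    also have "\<dots> = (\<integral>\<^sup>+\<xi>. (\<integral>\<^sup>+i. k2 (\<xi> - i) / ennreal Q * at_ennreal \<Psi>\<^sub>2 (n \<xi> /
      ennreal c) \<partial>count_space J\<^sub>2) \<partial>lborel)"
      by (rule nn_integral_count_space_nn_integral[symmetric, OF J(2)]) measurable
    also have "\<dots> = (\<integral>\<^sup>+\<xi>. (\<integral>\<^sup>+i. k2 (\<xi> - i) \<partial>count_space J\<^sub>2) / ennreal Q *
      at_ennreal \<Psi>\<^sub>2 (n \<xi> / ennreal c) \<partial>lborel)"
      by (simp add: nn_integral_multc nn_integral_divide)
    also have "\<dots> \<le> (\<integral>\<^sup>+\<xi>. ennreal Q / ennreal Q * at_ennreal \<Psi>\<^sub>2 (n \<xi> / ennreal c) \<partial>lborel)"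
      by (intro nn_integral_mono mult_right_mono divide_right_mono_ennreal Q2) auto
    also have "\<dots> \<le> 1" using c(2) Q by (simp add: divide_ennreal)
    finally show "orlicz_norm (count_space J\<^sub>2) \<Psi>\<^sub>2 S \<le> ennreal (4 * Q * c)"
      using Q c by (intro orlicz_norm_le) auto
  qed
  then show ?thesis unfolding S_def n_def Q_def by (simp add: mult.assoc)
qed

subsection \<open>Separately holomorphic functions on phase space\<close>

text \<open>Phase space carries the complex structure with coordinates \<open>x\<^sub>i - \<i> \<xi>\<^sub>i\<close>, for which
  Gaussian short-time Fourier transforms are entire up to a Gaussian factor.\<close>

definition zc :: "(real ^ 'n) \<times> (real ^ 'n) \<Rightarrow> 'n \<Rightarrow> complex" where
  "zc X i = Complex (fst X $ i) (- snd X $ i)"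

definition emb :: "'n \<Rightarrow> complex \<Rightarrow> (real ^ 'n) \<times> (real ^ 'n)" where
  "emb i s = (axis i (Re s), axis i (- Im s))"

text \<open>The i-th complex coordinate is multiplied by \<open>cis t\<close>, the others are kept;
  the additive form expresses this through \<open>emb\<close>.\<close>

definition rot :: "'n \<Rightarrow> real \<Rightarrow> (real ^ 'n) \<times> (real ^ 'n) \<Rightarrow> (real ^ 'n) \<times> (real ^ 'n)" where
  "rot i t X = X + emb i ((cis t - 1) * zc X i)"

text \<open>Holomorphy is asked in one coordinate at a time, as the circle averages use it; joint
  continuity supplies the measurability and the integrability on polydiscs for Fubini's
  theorem.\<close>

definition sep_entire :: "((real ^ 'n) \<times> (real ^ 'n) \<Rightarrow> complex) \<Rightarrow> bool" where
  "sep_entire A \<longleftrightarrow> continuous_on UNIV A \<and> (\<forall>i X. (\<lambda>s. A (X + emb i s)) holomorphic_on UNIV)"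

definition polydisc :: "real \<Rightarrow> ((real ^ 'n) \<times> (real ^ 'n)) set" where
  "polydisc R = {X. \<forall>i. cmod (zc X i) \<le> R}"

lemma zc_add [simp]: "zc (X + Y) i = zc X i + zc Y i"
  by (simp add: zc_def complex_eq_iff)

lemma zc_0 [simp]: "zc 0 i = 0"
  by (simp add: zc_def complex_eq_iff)

lemma zc_emb: "zc (emb i s) j = (if j = i then s else 0)"
  by (auto simp: zc_def emb_def axis_def complex_eq_iff)

lemma zc_eqI: "(\<And>i. zc X i = zc Y i) \<Longrightarrow> X = Y"
  by (auto simp: zc_def prod_eq_iff vec_eq_iff complex_eq_iff)

lemma zc_rot: "zc (rot i t X) j = (if j = i then cis t * zc X i else zc X j)"
  by (auto simp: rot_def zc_emb algebra_simps)

lemma continuous_on_zc [continuous_intros]: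
  assumes "continuous_on S f" shows "continuous_on S (\<lambda>x. zc (f x) i)"
proof -
  have "zc X i = complex_of_real (fst X $ i) - \<i> * complex_of_real (snd X $ i)" for X
    by (simp add: zc_def complex_eq_iff)
  then show ?thesis by (simp only:) (intro continuous_intros assms)
qed

lemma sep_entireD:
  assumes "sep_entire A"
  shows "continuous_on UNIV A" and "(\<lambda>s. A (X + emb i s)) holomorphic_on UNIV"
proof -
  have *: "continuous_on UNIV A \<and> (\<forall>i X. (\<lambda>s. A (X + emb i s)) holomorphic_on UNIV)"
    using assms unfolding sep_entire_def .
  show "continuous_on UNIV A" by (rule conjunct1[OF *])
  show "(\<lambda>s. A (X + emb i s)) holomorphic_on UNIV" by (rule conjunct2[OF *, rule_format])
qed

lemma continuous_on_emb [continuous_intros]: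
  assumes "continuous_on S f" shows "continuous_on S (\<lambda>x. emb i (f x))"
proof -
  have "axis i (r::real) = r *\<^sub>R axis i 1" for r by (simp add: vec_eq_iff axis_def)
  then have "emb i s = (Re s *\<^sub>R axis i 1, (- Im s) *\<^sub>R axis i 1)" for s :: complex
    unfolding emb_def by metis
  then show ?thesis by (simp only:) (intro continuous_intros assms)
qed

lemma cmod_zc_le: "cmod (zc X i) \<le> norm X"
proof -
  have "cmod (zc X i) \<le> sqrt ((norm (fst X))\<^sup>2 + (norm (snd X))\<^sup>2)"
    unfolding zc_def cmod_def using component_le_norm_cart[of "fst X" i] component_le_norm_cart[of "snd X" i]
    by (auto intro!: real_sqrt_le_mono add_mono simp: abs_le_square_iff[symmetric])
  then show ?thesis by (simp add: norm_prod_def)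
qed

lemma norm_sq_zc: "(norm X)\<^sup>2 = (\<Sum>i\<in>UNIV. (cmod (zc X i))\<^sup>2)"
proof -
  have "(norm X)\<^sup>2 = (norm (fst X))\<^sup>2 + (norm (snd X))\<^sup>2" by (cases X) (simp add: norm_Pair)
  also have "\<dots> = (\<Sum>i\<in>UNIV. (fst X $ i)\<^sup>2) + (\<Sum>i\<in>UNIV. (snd X $ i)\<^sup>2)"
    by (simp add: norm_vec_def L2_set_def sum_nonneg)
  also have "\<dots> = (\<Sum>i\<in>UNIV. (cmod (zc X i))\<^sup>2)" by (simp add: zc_def cmod_def sum.distrib)
  finally show ?thesis .
qed

lemma ball_subset_polydisc: "ball 0 R \<subseteq> polydisc R"
  by (auto simp: polydisc_def intro: order.trans[OF cmod_zc_le] less_imp_le)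

lemma compact_polydisc: "compact (polydisc R :: ((real ^ 'n) \<times> (real ^ 'n)) set)"
proof -
  have "closed (polydisc R :: ((real ^ 'n) \<times> (real ^ 'n)) set)"
    unfolding polydisc_def
    by (intro closed_Collect_all closed_Collect_le continuous_intros)
  moreover have "bounded (polydisc R :: ((real ^ 'n) \<times> (real ^ 'n)) set)"
  proof (rule boundedI)
    fix X :: "(real ^ 'n) \<times> (real ^ 'n)" assume X: "X \<in> polydisc R"
    have "(norm X)\<^sup>2 \<le> (\<Sum>i\<in>(UNIV :: 'n set). R\<^sup>2)"
      unfolding norm_sq_zc using X by (intro sum_mono power_mono) (auto simp: polydisc_def)
    then have "(norm X)\<^sup>2 \<le> real CARD('n) * R\<^sup>2" by simp
    then show "norm X \<le> sqrt (real CARD('n) * R\<^sup>2)" by (rule real_le_rsqrt)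
  qed
  ultimately show ?thesis by (simp add: compact_eq_bounded_closed)
qed

lemma polydisc_borel [measurable]: "polydisc R \<in> sets borel"
  by (intro borel_closed compact_imp_closed compact_polydisc)

lemma rot_polydisc [simp]: "rot i t X \<in> polydisc R \<longleftrightarrow> X \<in> polydisc R"
  unfolding polydisc_def mem_Collect_eq by (intro all_cong1) (auto simp: zc_rot norm_mult)

lemma continuous_rot: "continuous_on UNIV (rot i t)"
  unfolding rot_def by (intro continuous_intros)

lemma rot_measurable [measurable]: "rot i t \<in> borel_measurable borel"
  by (rule borel_measurable_continuous_onI[OF continuous_rot])

text \<open>A plane rotation is a product of three shears, which preserve Lebesgue measure by translation
  invariance in one group of variables.\<close>

lemma nn_integral_shear_fst:
  fixes f :: "'b::euclidean_space \<times> 'b \<Rightarrow> ennreal"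
  assumes f: "f \<in> borel_measurable borel" and c: "continuous_on UNIV c"
  shows "(\<integral>\<^sup>+X. f (fst X + c (snd X), snd X) \<partial>lborel) = (\<integral>\<^sup>+X. f X \<partial>lborel)"
proof -
  have "(\<lambda>X. f (fst X + c (snd X), snd X)) \<in> borel_measurable borel"
    by (rule measurable_compose[OF borel_measurable_continuous_onI f])
       (intro continuous_intros continuous_on_compose2[OF c], auto)
  then have "(\<integral>\<^sup>+X. f (fst X + c (snd X), snd X) \<partial>lborel)
     = (\<integral>\<^sup>+\<xi>. \<integral>\<^sup>+x. f (x + c \<xi>, \<xi>) \<partial>lborel \<partial>lborel)"
    by (simp add: nn_integral_lborel_pair)
  also have "\<dots> = (\<integral>\<^sup>+\<xi>. \<integral>\<^sup>+x. f (x, \<xi>) \<partial>lborel \<partial>lborel)"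
  proof (rule nn_integral_cong)
    fix \<xi>
    have "(\<lambda>x. f (x, \<xi>)) \<in> borel_measurable borel"
      by (rule measurable_compose[OF borel_measurable_continuous_onI f]) (intro continuous_intros)
    then show "(\<integral>\<^sup>+x. f (x + c \<xi>, \<xi>) \<partial>lborel) = (\<integral>\<^sup>+x. f (x, \<xi>) \<partial>lborel)"
      using nn_integral_lborel_shift[of "\<lambda>x. f (x, \<xi>)" "c \<xi>"] by simp
  qed
  finally show ?thesis by (simp add: nn_integral_lborel_pair[OF f])
qed

lemma nn_integral_lborel_swap:
  fixes f :: "'b::euclidean_space \<times> 'b \<Rightarrow> ennreal"
  assumes f: "f \<in> borel_measurable borel"
  shows "(\<integral>\<^sup>+X. f (snd X, fst X) \<partial>lborel) = (\<integral>\<^sup>+X. f X \<partial>lborel)"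
proof -
  have f': "f \<in> borel_measurable (lborel \<Otimes>\<^sub>M lborel)" using f by (simp add: lborel_prod)
  have "(\<lambda>X. f (snd X, fst X)) \<in> borel_measurable borel"
    by (rule measurable_compose[OF borel_measurable_continuous_onI f]) (intro continuous_intros)
  then have "(\<integral>\<^sup>+X. f (snd X, fst X) \<partial>lborel)
    = (\<integral>\<^sup>+\<xi>. \<integral>\<^sup>+x. f (\<xi>, x) \<partial>lborel \<partial>lborel)"
    by (simp add: nn_integral_lborel_pair)
  also have "\<dots> = (\<integral>\<^sup>+x. \<integral>\<^sup>+\<xi>. f (\<xi>, x) \<partial>lborel \<partial>lborel)"
    by (rule lborel_pair.Fubini[OF f', symmetric])
  also have "\<dots> = (\<integral>\<^sup>+X. f X \<partial>lborel)" by (simp add: nn_integral_lborel_pair[OF f])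
  finally show ?thesis .
qed

lemma nn_integral_shear_snd:
  fixes f :: "'b::euclidean_space \<times> 'b \<Rightarrow> ennreal"
  assumes f: "f \<in> borel_measurable borel" and c: "continuous_on UNIV c"
  shows "(\<integral>\<^sup>+X. f (fst X, snd X + c (fst X)) \<partial>lborel) = (\<integral>\<^sup>+X. f X \<partial>lborel)"
proof -
  define g where "g X = f (snd X, fst X)" for X
  have g: "g \<in> borel_measurable borel" unfolding g_def
    by (rule measurable_compose[OF borel_measurable_continuous_onI f]) (intro continuous_intros)
  have g': "(\<lambda>X. g (fst X + c (snd X), snd X)) \<in> borel_measurable borel"
    by (rule measurable_compose[OF borel_measurable_continuous_onI g])
       (intro continuous_intros continuous_on_compose2[OF c], auto)
  have "(\<integral>\<^sup>+X. f (fst X, snd X + c (fst X)) \<partial>lborel) = (\<integral>\<^sup>+X. g (fst X + c (snd X), snd X) \<partial>lborel)"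
    using nn_integral_lborel_swap[OF g'] by (simp add: g_def)
  also have "\<dots> = (\<integral>\<^sup>+X. f X \<partial>lborel)"
    using nn_integral_shear_fst[OF g c] nn_integral_lborel_swap[OF f] by (simp add: g_def)
  finally show ?thesis .
qed

text \<open>The number a is tan (t / 2). Shears by a, - sin t and a compose to the rotation. The
  factorisation degenerates where sin t = 0, which is a null set of angles.\<close>

lemma rot_shears:
  fixes X :: "(real ^ 'n) \<times> (real ^ 'n)" and i :: "'n :: finite"
  assumes "sin t \<noteq> 0"
  defines "a \<equiv> (1 - cos t) / sin t"
  defines "P \<equiv> \<lambda>X :: (real ^ 'n) \<times> (real ^ 'n). (fst X + axis i (a * snd X $ i), snd X)"
  defines "Q \<equiv> \<lambda>X :: (real ^ 'n) \<times> (real ^ 'n). (fst X, snd X + axis i (- sin t * fst X $ i))"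
  shows "rot i t X = P (Q (P X))"
proof -
  obtain x \<xi> where X: "X = (x, \<xi>)" by (metis surj_pair)
  have as: "a * sin t = 1 - cos t" using assms by (simp add: a_def)
  have "a * (1 + cos t) = (1 - cos t) * (1 + cos t) / sin t" by (simp add: a_def)
  also have "(1 - cos t) * (1 + cos t) = sin t * sin t"
    using sin_cos_squared_add3[of t] by (simp add: algebra_simps)
  finally have a2: "a * (1 + cos t) = sin t" using assms by simp
  define u w where "u = x $ i" and "w = \<xi> $ i"
  define w' where "w' = w - sin t * (u + a * w)"
  have 1: "w' = cos t * w - sin t * u"
  proof -
    have "w' = w - sin t * u - (a * sin t) * w" by (simp add: w'_def algebra_simps)
    then show ?thesis unfolding as by (simp add: algebra_simps)
  qed
  have 2: "u + a * w + a * w' = cos t * u + sin t * w"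
  proof -
    have "u + a * w + a * w' = u * (1 - a * sin t) + w * (a * (1 + cos t))"
      unfolding 1 by (simp add: algebra_simps)
    then show ?thesis unfolding as a2 by (simp add: algebra_simps)
  qed
  have fst: "fst (P (Q (P X))) $ j = fst (rot i t X) $ j" for j
    using 2 by (auto simp: X P_def Q_def rot_def emb_def axis_def zc_def u_def w_def w'_def algebra_simps)
  have snd: "snd (P (Q (P X))) $ j = snd (rot i t X) $ j" for j
    using 1 by (auto simp: X P_def Q_def rot_def emb_def axis_def zc_def u_def w_def w'_def algebra_simps)
  show ?thesis using fst snd by (simp add: prod_eq_iff vec_eq_iff)
qed

lemma lborel_distr_rot:
  fixes i :: "'n :: finite"
  assumes t: "sin t \<noteq> 0"
  shows "distr lborel borel (rot i t) = lborel"
proof (rule measure_eqI)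
  fix S :: "((real ^ 'n) \<times> (real ^ 'n)) set" assume "S \<in> sets (distr lborel borel (rot i t))"
  then have [measurable]: "S \<in> sets borel" by simp
  define a where "a = (1 - cos t) / sin t"
  define P where "P X = (fst X + axis i (a * snd X $ i), snd X)" for X :: "(real ^ 'n) \<times> (real ^ 'n)"
  define Q where "Q X = (fst X, snd X + axis i (- sin t * fst X $ i))" for X :: "(real ^ 'n) \<times> (real ^ 'n)"
  have ax: "continuous_on UNIV (\<lambda>x :: real ^ 'n. axis i (r * x $ i))" for r :: real
  proof -
    have "axis i (r * x $ i) = (r * x $ i) *\<^sub>R (axis i 1 :: real ^ 'n)" for x :: "real ^ 'n"
      by (simp add: vec_eq_iff axis_def)
    then show ?thesis by (simp only:) (intro continuous_intros)
  qed
  have rot: "rot i t X = P (Q (P X))" for X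
    unfolding P_def Q_def a_def by (rule rot_shears[OF t])
  have [measurable]: "P \<in> borel_measurable borel"
    unfolding P_def
    by (intro borel_measurable_continuous_onI continuous_intros continuous_on_compose2[OF ax continuous_on_snd[OF continuous_on_id]]) auto
  have [measurable]: "Q \<in> borel_measurable borel"
    unfolding Q_def
    by (intro borel_measurable_continuous_onI continuous_intros continuous_on_compose2[OF ax continuous_on_fst[OF continuous_on_id]]) auto
  have P: "(\<integral>\<^sup>+X. f (P X) \<partial>lborel) = (\<integral>\<^sup>+X. f X \<partial>lborel)" if "f \<in> borel_measurable borel" for f
    using nn_integral_shear_fst[OF that ax] by (simp add: P_def)
  have Q: "(\<integral>\<^sup>+X. f (Q X) \<partial>lborel) = (\<integral>\<^sup>+X. f X \<partial>lborel)" if "f \<in> borel_measurable borel" for f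
    unfolding Q_def by (rule nn_integral_shear_snd[OF that ax])
  have "emeasure (distr lborel borel (rot i t)) S = (\<integral>\<^sup>+X. indicator S X \<partial>distr lborel borel (rot i t))"
    by simp
  also have "\<dots> = (\<integral>\<^sup>+X. indicator S (P (Q (P X))) \<partial>lborel)"
    by (subst nn_integral_distr) (auto simp: rot)
  also have "\<dots> = (\<integral>\<^sup>+X. indicator S (P (Q X)) \<partial>lborel)" by (rule P) measurable
  also have "\<dots> = (\<integral>\<^sup>+X. indicator S (P X) \<partial>lborel)" by (rule Q) measurable
  also have "\<dots> = (\<integral>\<^sup>+X. indicator S X \<partial>lborel)" by (rule P) measurable
  finally show "emeasure (distr lborel borel (rot i t)) S = emeasure lborel S" by simp
qed simp

lemma integral_rot:
  fixes f :: "(real ^ 'n) \<times> (real ^ 'n) \<Rightarrow> complex"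
  assumes "sin t \<noteq> 0" "f \<in> borel_measurable borel"
  shows "(\<integral>X. f (rot i t X) \<partial>lborel) = (\<integral>X. f X \<partial>lborel)"
proof -
  have "(\<integral>X. f X \<partial>lborel) = (\<integral>X. f X \<partial>distr lborel borel (rot i t))"
    using assms by (simp add: lborel_distr_rot)
  also have "\<dots> = (\<integral>X. f (rot i t X) \<partial>lborel)"
    using assms by (intro integral_distr) auto
  finally show ?thesis by simp
qed

text \<open>Cauchy's integral formula on the unit circle for s \<mapsto> f (s w); using this
  function in place of f on the circle of radius |w| includes w = 0.\<close>

lemma integral_circle_mean:
  fixes f :: "complex \<Rightarrow> complex"
  assumes "f holomorphic_on UNIV"
  shows "(\<integral>t. indicator {0..2 * pi} t *\<^sub>R f (cis t * w) \<partial>lborel) = 2 * pi * f 0"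
proof -
  define g where "g s = f (s * w)" for s
  have g: "g holomorphic_on UNIV"
  proof -
    have "f \<circ> (\<lambda>s. s * w) holomorphic_on UNIV"
      by (intro holomorphic_on_compose holomorphic_on_subset[OF assms] holomorphic_intros) auto
    then show ?thesis by (simp add: o_def g_def[abs_def])
  qed
  have "((\<lambda>u. g u / (u - 0)) has_contour_integral (2 * of_real pi * \<i> * g 0)) (circlepath 0 1)"
    by (rule Cauchy_integral_circlepath_simple) (auto intro: holomorphic_on_subset[OF g])
  then have "((\<lambda>t. g (cis t) / cis t * \<i> * cis t) has_integral (2 * of_real pi * \<i> * g 0)) {0..2 * pi}"
    unfolding circlepath_def by (subst (asm) has_contour_integral_part_circlepath_iff) auto
  then have "((\<lambda>t. (- \<i>) * (g (cis t) / cis t * \<i> * cis t)) has_integral ((- \<i>) * (2 * of_real pi * \<i> * g 0))) {0..2 * pi}"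
    by (rule has_integral_mult_right)
  moreover have "(- \<i>) * (x / cis t * \<i> * cis t) = x" for x t
  proof -
    have "x / cis t * \<i> * cis t = \<i> * x" using cis_neq_zero[of t] by (simp add: field_simps)
    then show ?thesis by (simp only:) (simp flip: mult.assoc)
  qed
  moreover have "(- \<i>) * (2 * of_real pi * \<i> * g 0) = of_real (2 * pi) * g 0"
    by (simp add: algebra_simps)
  ultimately have *: "((\<lambda>t. g (cis t)) has_integral (2 * pi * g 0)) {0..2 * pi}" by (simp only:)
  have "continuous_on {0..2 * pi} (\<lambda>t. g (cis t))"
    by (intro continuous_on_compose2[OF holomorphic_on_imp_continuous_on[OF g]] continuous_intros) auto
  then have "set_integrable lborel {0..2 * pi} (\<lambda>t. g (cis t))"
    unfolding set_integrable_def by (intro borel_integrable_compact) auto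
  then have "(LINT t:{0..2 * pi}|lborel. g (cis t)) = integral {0..2 * pi} (\<lambda>t. g (cis t))"
    by (rule set_borel_integral_eq_integral)
  then show ?thesis using integral_unique[OF *] by (simp add: set_lebesgue_integral_def g_def)
qed

text \<open>The integral over the polydisc is unchanged by rotating the i-th coordinate, for almost
  every angle. Averaging over the angles inside the integral replaces A by its value where that
  coordinate is 0.\<close>

lemma mean_value_coordinate:
  fixes A :: "(real ^ 'n) \<times> (real ^ 'n) \<Rightarrow> complex"
  assumes A: "sep_entire A"
  shows "(\<integral>X. indicator (polydisc R) X *\<^sub>R A X \<partial>lborel)
    = (\<integral>X. indicator (polydisc R) X *\<^sub>R A (X + emb i (- zc X i)) \<partial>lborel)"
proof -
  have c: "continuous_on UNIV A" using A by (simp add: sep_entire_def)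
  then have [measurable]: "A \<in> borel_measurable borel" by (rule borel_measurable_continuous_onI)
  let ?K = "polydisc R :: ((real ^ 'n) \<times> (real ^ 'n)) set" and ?T = "{0..2 * pi} :: real set"
  let ?J = "\<integral>X. indicator ?K X *\<^sub>R A X \<partial>lborel"
  have null: "AE t::real in lborel. sin t \<noteq> 0"
  proof -
    have eq: "{t. sin t = 0} = range (\<lambda>k::int. of_int k * pi)" by (auto simp: sin_zero_iff_int2)
    have "{t::real. sin t = 0} \<in> null_sets lborel"
      unfolding eq by (rule countable_imp_null_set_lborel[OF countable_image[OF countableI_type]])
    from AE_not_in[OF this] show ?thesis unfolding mem_Collect_eq .
  qed
  have inv: "(\<integral>X. indicator ?K X *\<^sub>R A (rot i t X) \<partial>lborel) = ?J" if "sin t \<noteq> 0" for t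
    using integral_rot[OF that, of "\<lambda>X. indicator ?K X *\<^sub>R A X" i] by (simp add: indicator_def)
  have int: "integrable (lborel \<Otimes>\<^sub>M lborel) (\<lambda>(X, t). indicator ?K X *\<^sub>R indicator ?T t *\<^sub>R A (rot i t X))"
  proof -
    have "continuous_on (?K \<times> ?T) (\<lambda>p. A (rot i (snd p) (fst p)))"
      unfolding rot_def by (intro continuous_on_compose2[OF c] continuous_intros) auto
    then have "integrable lborel (\<lambda>p. indicator (?K \<times> ?T) p *\<^sub>R A (rot i (snd p) (fst p)))"
      by (intro borel_integrable_compact compact_Times compact_polydisc) auto
    moreover have "indicator (?K \<times> ?T) p *\<^sub>R A (rot i (snd p) (fst p))
      = (case p of (X, t) \<Rightarrow> indicator ?K X *\<^sub>R indicator ?T t *\<^sub>R A (rot i t X))" for p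
      by (auto simp: indicator_def split: prod.split)
    ultimately show ?thesis by (simp add: lborel_prod)
  qed
  have "2 * pi * ?J = (\<integral>t. indicator ?T t *\<^sub>R ?J \<partial>lborel)"
    by (simp add: scaleR_conv_of_real)
  also have "\<dots> = (\<integral>t. (\<integral>X. indicator ?K X *\<^sub>R indicator ?T t *\<^sub>R A (rot i t X) \<partial>lborel)
    \<partial>lborel)"
  proof (rule integral_cong_AE)
    show "(\<lambda>t. \<integral>X. indicator ?K X *\<^sub>R indicator ?T t *\<^sub>R A (rot i t X) \<partial>lborel) \<in> borel_measurable lborel"
      using lborel_pair.integrable_snd[OF int] by auto
    show "AE t in lborel. indicator ?T t *\<^sub>R ?J
      = (\<integral>X. indicator ?K X *\<^sub>R indicator ?T t *\<^sub>R A (rot i t X) \<partial>lborel)"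
      using null
    proof eventually_elim
      case (elim t)
      then show ?case using inv[OF elim] by (cases "t \<in> ?T") auto
    qed
  qed simp
  also have "\<dots> = (\<integral>X. (\<integral>t. indicator ?K X *\<^sub>R indicator ?T t *\<^sub>R A (rot i t X) \<partial>lborel)
    \<partial>lborel)"
    by (rule lborel_pair.Fubini_integral[OF int])
  also have "\<dots> = (\<integral>X. 2 * pi * (indicator ?K X *\<^sub>R A (X + emb i (- zc X i))) \<partial>lborel)"
  proof (rule Bochner_Integration.integral_cong[OF refl])
    fix X :: "(real ^ 'n) \<times> (real ^ 'n)"
    define Y where "Y = X + emb i (- zc X i)"
    have "rot i t X = Y + emb i (cis t * zc X i)" for t
      by (rule zc_eqI) (simp add: zc_rot zc_emb Y_def)
    moreover from integral_circle_mean[OF sep_entireD(2)[OF A], of Y i "zc X i"]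
    have "(\<integral>t. indicator ?T t *\<^sub>R A (Y + emb i (cis t * zc X i)) \<partial>lborel) = 2 * pi * A (Y + emb i 0)" .
    moreover have "Y + emb i 0 = Y" by (rule zc_eqI) (simp add: zc_emb)
    ultimately show "(\<integral>t. indicator ?K X *\<^sub>R indicator ?T t *\<^sub>R A (rot i t X) \<partial>lborel)
      = 2 * pi * (indicator ?K X *\<^sub>R A (X + emb i (- zc X i)))"
      by (cases "X \<in> ?K") (simp_all add: Y_def[symmetric])
  qed
  also have "\<dots> = 2 * pi * (\<integral>X. indicator ?K X *\<^sub>R A (X + emb i (- zc X i)) \<partial>lborel)"
    by (rule Bochner_Integration.integral_mult_right_zero)
  finally show ?thesis by simp
qed

lemma mean_value_polydisc:
  fixes A :: "(real ^ 'n) \<times> (real ^ 'n) \<Rightarrow> complex"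
  assumes A: "sep_entire A"
  shows "(\<integral>X. indicator (polydisc R) X *\<^sub>R A X \<partial>lborel)
    = measure lborel (polydisc R :: ((real ^ 'n) \<times> (real ^ 'n)) set) *\<^sub>R A 0"
proof -
  \<comment> \<open>\<open>Z S\<close> sets the coordinates in S to 0. They are removed one at a
    time, and A composed with \<open>Z S\<close> stays separately entire, until the integrand is the
    constant \<open>A 0\<close>.\<close>
  define Z where "Z S X = X + (\<Sum>i\<in>S. emb i (- zc X i))" for S and X :: "(real ^ 'n) \<times> (real ^ 'n)"
  have zc_sum: "zc (\<Sum>i\<in>S. h i) j = (\<Sum>i\<in>S. zc (h i) j)" if "finite S" for S and h :: "'n \<Rightarrow> (real ^ 'n) \<times>
    (real ^ 'n)" and j
    using that by (induction S) auto
  have zcZ: "zc (Z S X) j = (if j \<in> S then 0 else zc X j)" for S X j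
    by (simp add: Z_def zc_sum zc_emb)
  have Zins: "Z S (X + emb i (- zc X i)) = Z (insert i S) X" for S i X
    by (rule zc_eqI) (auto simp: zcZ zc_emb)
  have ent: "sep_entire (\<lambda>X. A (Z S X))" for S
    unfolding sep_entire_def
  proof (intro conjI allI)
    show "continuous_on UNIV (\<lambda>X. A (Z S X))"
      unfolding Z_def
      by (rule continuous_on_compose2[OF sep_entireD(1)[OF A]]) (intro continuous_intros, auto)
    fix i X
    show "(\<lambda>s. A (Z S (X + emb i s))) holomorphic_on UNIV"
    proof (cases "i \<in> S")
      case True
      then have "Z S (X + emb i s) = Z S X" for s by (intro zc_eqI) (auto simp: zcZ zc_emb)
      then show ?thesis by simp
    next
      case False
      then have "Z S (X + emb i s) = Z S X + emb i s" for s by (intro zc_eqI) (auto simp: zcZ zc_emb)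
      then show ?thesis using sep_entireD(2)[OF A] by simp
    qed
  qed
  have "finite S \<Longrightarrow> (\<integral>X. indicator (polydisc R) X *\<^sub>R A X \<partial>lborel)
    = (\<integral>X. indicator (polydisc R) X *\<^sub>R A (Z S X) \<partial>lborel)" for S
  proof (induction S rule: finite_induct)
    case empty
    then show ?case by (simp add: Z_def)
  next
    case (insert i S)
    then show ?case using mean_value_coordinate[OF ent[of S], of R i] by (simp add: Zins)
  qed
  from this[of UNIV] have "(\<integral>X. indicator (polydisc R) X *\<^sub>R A X \<partial>lborel)
    = (\<integral>X. indicator (polydisc R) X *\<^sub>R A (Z UNIV X) \<partial>lborel)" by simp
  moreover have "Z UNIV X = 0" for X by (rule zc_eqI) (simp add: zcZ)
  moreover have "emeasure lborel (polydisc R :: ((real ^ 'n) \<times> (real ^ 'n)) set) < \<infinity>"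
    by (rule emeasure_bounded_finite[OF compact_imp_bounded[OF compact_polydisc]])
  ultimately show ?thesis by simp
qed

subsection \<open>Local estimates with small exponents\<close>

lemma sep_entire_mult:
  assumes "sep_entire A" "sep_entire B" shows "sep_entire (\<lambda>X. A X * B X)"
  unfolding sep_entire_def
  by (intro conjI allI continuous_on_mult holomorphic_on_mult sep_entireD assms)

lemma sep_entire_translate:
  assumes "sep_entire A" shows "sep_entire (\<lambda>X. A (w + X))"
  unfolding sep_entire_def
proof (intro conjI allI)
  show "continuous_on UNIV (\<lambda>X. A (w + X))"
    by (rule continuous_on_compose2[OF sep_entireD(1)[OF assms]]) (intro continuous_intros, auto)
  show "(\<lambda>s. A (w + (X + emb i s))) holomorphic_on UNIV" for i X
    using sep_entireD(2)[OF assms, of "w + X" i] by (simp only: add.assoc)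
qed

lemma sep_entire_exp_linear: "sep_entire (\<lambda>X. exp (\<Sum>i\<in>UNIV. b i * zc X i))"
  unfolding sep_entire_def
proof (intro conjI allI)
  show "continuous_on UNIV (\<lambda>X. exp (\<Sum>i\<in>UNIV. b i * zc X i))"
    by (intro continuous_intros)
  show "(\<lambda>s. exp (\<Sum>j\<in>UNIV. b j * zc (X + emb i s) j)) holomorphic_on UNIV" for i X
  proof -
    have h: "(\<lambda>s. if j = i then s else 0) holomorphic_on UNIV" for j
      by (cases "j = i") (auto intro: holomorphic_intros)
    show ?thesis unfolding zc_add zc_emb
      by (intro holomorphic_on_exp' holomorphic_on_sum holomorphic_on_mult holomorphic_on_add holomorphic_on_const h)
  qed
qed

text \<open>The Hermitian form of the coordinates \<open>zc\<close> has the Euclidean inner product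
  of phase space as real part, so that exponentials of inner products are moduli of holomorphic
  exponentials.\<close>

lemma sum_zc_inner: "Re (\<Sum>i\<in>UNIV. cnj (zc w i) * zc u i) = w \<bullet> u"
proof -
  have "w \<bullet> u = fst w \<bullet> fst u + snd w \<bullet> snd u" by (cases w; cases u) simp
  also have "\<dots> = (\<Sum>i\<in>UNIV. fst w $ i * fst u $ i + snd w $ i * snd u $ i)"
    by (simp add: inner_vec_def sum.distrib)
  also have "\<dots> = (\<Sum>i\<in>UNIV. Re (cnj (zc w i) * zc u i))"
    by (intro sum.cong) (auto simp: zc_def)
  finally show ?thesis by simp
qed

text \<open>With q = 1 / 4 these are moduli of Gaussian short-time Fourier transforms up to a
  constant, with q = 1 / 2 products of two of them; q = 1 and A = 1 give a Gaussian kernel.\<close>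

definition gmod :: "real \<Rightarrow> ((real ^ 'n) \<times> (real ^ 'n) \<Rightarrow> complex) \<Rightarrow> (real ^ 'n) \<times> (real ^
  'n) \<Rightarrow> real" where
  "gmod q A X = cmod (A X) * exp (- q * (norm X)\<^sup>2)"

lemma gmod_nonneg [simp]: "0 \<le> gmod q A X"
  by (simp add: gmod_def)

lemma continuous_gmod: "sep_entire A \<Longrightarrow> continuous_on UNIV (gmod q A)"
  unfolding gmod_def by (intro continuous_intros sep_entireD)

text \<open>The cross term exp (- 2 q (w . u)) of the shifted Gaussian is the modulus of the
  exponential of a complex linear form in u and is absorbed into the entire factor.\<close>

lemma gmod_translate:
  fixes A :: "(real ^ 'n) \<times> (real ^ 'n) \<Rightarrow> complex"
  assumes "sep_entire A"
  obtains B where "sep_entire B" "\<And>u. gmod q A (w + u) = exp (- q * (norm w)\<^sup>2) * gmod q B u"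
proof
  let ?B = "\<lambda>u. A (w + u) * exp (\<Sum>i\<in>UNIV. (- 2 * q * cnj (zc w i)) * zc u i)"
  show "sep_entire ?B"
    by (intro sep_entire_mult sep_entire_translate assms sep_entire_exp_linear)
  show "gmod q A (w + u) = exp (- q * (norm w)\<^sup>2) * gmod q ?B u" for u
  proof -
    have "(\<Sum>i\<in>UNIV. (- 2 * complex_of_real q * cnj (zc w i)) * zc u i)
      = complex_of_real (- 2 * q) * (\<Sum>i\<in>UNIV. cnj (zc w i) * zc u i)"
      by (simp add: sum_distrib_left mult.assoc)
    moreover have "Re (complex_of_real (- 2 * q) * z) = - 2 * q * Re z" for z by simp
    ultimately have "Re (\<Sum>i\<in>UNIV. (- 2 * complex_of_real q * cnj (zc w i)) * zc u i) = - 2 * q * (w \<bullet> u)"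
      by (simp only: sum_zc_inner)
    moreover have "(norm (w + u))\<^sup>2 = (norm w)\<^sup>2 + 2 * (w \<bullet> u) + (norm u)\<^sup>2"
      by (simp add: power2_norm_eq_inner inner_add_left inner_add_right inner_commute)
    then have "exp (- q * (norm (w + u))\<^sup>2) = exp (- q * (norm w)\<^sup>2) * (exp (- 2 * q * (w \<bullet> u)) * exp (- q * (norm u)\<^sup>2))"
      by (simp add: algebra_simps flip: exp_add)
    ultimately show ?thesis unfolding gmod_def norm_mult norm_exp_eq_Re by simp
  qed
qed

lemma cball_borel [measurable]: "cball a r \<in> sets borel"
  by (rule borel_closed[OF closed_cball])

text \<open>Translation moves w to 0, where the mean value over the polydisc of radius \<rho>
  applies. This polydisc contains the ball of radius \<rho>, which bounds its volume from below, and
  lies in the ball of radius b \<rho>, where the Gaussian is at least exp (- q b^2) since \<rho>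
  \<le> 1.\<close>

lemma gmod_mean_value:
  fixes A :: "(real ^ 'n) \<times> (real ^ 'n) \<Rightarrow> complex"
  defines "m \<equiv> DIM((real ^ 'n) \<times> (real ^ 'n))" and "b \<equiv> sqrt (real CARD('n))"
  assumes A: "sep_entire A" and q: "0 \<le> q" and \<rho>: "0 < \<rho>" "\<rho> \<le> 1"
  shows "ennreal (\<rho> ^ m * gmod q A w) \<le> ennreal (exp (q * b\<^sup>2) / unit_ball_vol (real m)) *
    (\<integral>\<^sup>+u. indicator (cball 0 (b * \<rho>)) u * ennreal (gmod q A (w + u)) \<partial>lborel)"
proof -
  let ?K = "polydisc \<rho> :: ((real ^ 'n) \<times> (real ^ 'n)) set"
  obtain B where B: "sep_entire B" "\<And>u. gmod q A (w + u) = exp (- q * (norm w)\<^sup>2) * gmod q B u"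
    using gmod_translate[OF A] by metis
  have [measurable]: "gmod q B \<in> borel_measurable borel"
    by (intro borel_measurable_continuous_onI continuous_gmod B)
  have [measurable]: "B \<in> borel_measurable borel"
    by (intro borel_measurable_continuous_onI sep_entireD(1) B)
  have nK: "norm u \<le> b * \<rho>" if "u \<in> ?K" for u
  proof -
    have "(norm u)\<^sup>2 \<le> (\<Sum>i\<in>(UNIV :: 'n set). \<rho>\<^sup>2)"
      unfolding norm_sq_zc using that by (intro sum_mono power_mono) (auto simp: polydisc_def)
    also have "\<dots> = (b * \<rho>)\<^sup>2" by (simp add: b_def power_mult_distrib)
    finally show ?thesis using \<rho> by (auto simp: b_def intro: power2_le_imp_le)
  qed
  have fin: "emeasure lborel ?K < \<infinity>"
    by (rule emeasure_bounded_finite[OF compact_imp_bounded[OF compact_polydisc]])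
  have vol: "unit_ball_vol (real m) * \<rho> ^ m \<le> measure lborel ?K"
  proof -
    have "measure lborel (ball 0 \<rho> :: ((real ^ 'n) \<times> (real ^ 'n)) set) \<le> measure lborel ?K"
      using fin by (intro measure_mono_fmeasurable ball_subset_polydisc fmeasurableI) auto
    then show ?thesis using \<rho> by (simp add: content_ball m_def)
  qed
  have v0: "0 < unit_ball_vol (real m)" by simp
  have int: "integrable lborel (\<lambda>u. indicator ?K u *\<^sub>R B u)"
    by (intro borel_integrable_compact compact_polydisc continuous_on_subset[OF sep_entireD(1)[OF B(1)]]) auto
  have "measure lborel ?K * cmod (B 0) = cmod (\<integral>u. indicator ?K u *\<^sub>R B u \<partial>lborel)"
    by (simp add: mean_value_polydisc[OF B(1)])
  also have "\<dots> \<le> (\<integral>u. norm (indicator ?K u *\<^sub>R B u) \<partial>lborel)" by (rule integral_norm_bound)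
  finally have "ennreal (measure lborel ?K * cmod (B 0)) \<le> (\<integral>\<^sup>+u. ennreal (norm (indicator ?K u *\<^sub>R B u)) \<partial>lborel)"
    by (subst nn_integral_eq_integral[OF integrable_norm[OF int]]) (auto intro: ennreal_leI)
  also have "\<dots> \<le> (\<integral>\<^sup>+u. ennreal (exp (q * b\<^sup>2)) * (indicator (cball 0 (b * \<rho>)) u * ennreal (gmod q B
    u)) \<partial>lborel)"
  proof (rule nn_integral_mono)
    fix u :: "(real ^ 'n) \<times> (real ^ 'n)"
    show "ennreal (norm (indicator ?K u *\<^sub>R B u))
      \<le> ennreal (exp (q * b\<^sup>2)) * (indicator (cball 0 (b * \<rho>)) u * ennreal (gmod q B u))"
    proof (cases "u \<in> ?K")
      case True
      have "norm u \<le> b" using nK[OF True] \<rho> by (metis b_def mult.right_neutral mult_left_mono of_nat_0_le_iff order.trans real_sqrt_ge_zero)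
      then have "q * (norm u)\<^sup>2 \<le> q * b\<^sup>2" using q by (intro mult_left_mono power_mono) auto
      then have "cmod (B u) \<le> cmod (B u) * exp (q * b\<^sup>2 - q * (norm u)\<^sup>2)"
        using mult_left_mono[of 1 "exp (q * b\<^sup>2 - q * (norm u)\<^sup>2)" "cmod (B u)"] by simp
      also have "\<dots> = exp (q * b\<^sup>2) * gmod q B u" by (simp add: gmod_def exp_diff exp_minus field_simps)
      finally have "ennreal (cmod (B u)) \<le> ennreal (exp (q * b\<^sup>2) * gmod q B u)" by (rule ennreal_leI)
      then show ?thesis using True nK[OF True] by (simp add: ennreal_mult)
    qed simp
  qed
  also have "\<dots> = ennreal (exp (q * b\<^sup>2)) * (\<integral>\<^sup>+u. (indicator (cball 0 (b * \<rho>)) u * ennreal (gmod q B u))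
    \<partial>lborel)"
    by (rule nn_integral_cmult) measurable
  finally have 1: "ennreal (measure lborel ?K * cmod (B 0))
    \<le> ennreal (exp (q * b\<^sup>2)) * (\<integral>\<^sup>+u. (indicator (cball 0 (b * \<rho>)) u * ennreal (gmod q B u)) \<partial>lborel)" .
  have "\<rho> ^ m * gmod q A w = exp (- q * (norm w)\<^sup>2) / unit_ball_vol (real m) * ((unit_ball_vol (real m) * \<rho> ^ m) * cmod (B 0))"
  proof -
    have "gmod q A w = exp (- q * (norm w)\<^sup>2) * cmod (B 0)"
      using B(2)[of 0] by (simp add: gmod_def[of q B])
    moreover have "p * (e * c) = e / v * (v * p * c)" if "0 < v" for p e c v :: real
      using that by simp
    ultimately show ?thesis using v0 by metis
  qed
  also have "\<dots> \<le> exp (- q * (norm w)\<^sup>2) / unit_ball_vol (real m) * (measure lborel ?K * cmod (B 0))"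
    using v0 vol by (intro mult_left_mono mult_right_mono) auto
  finally have "ennreal (\<rho> ^ m * gmod q A w)
    \<le> ennreal (exp (- q * (norm w)\<^sup>2) / unit_ball_vol (real m)) * ennreal (measure lborel ?K * cmod (B 0))"
    using v0 by (subst ennreal_mult[symmetric]) (auto intro: ennreal_leI)
  also have "\<dots> \<le> ennreal (exp (- q * (norm w)\<^sup>2) / unit_ball_vol (real m)) *
     (ennreal (exp (q * b\<^sup>2)) * (\<integral>\<^sup>+u. (indicator (cball 0 (b * \<rho>)) u * ennreal (gmod q B u)) \<partial>lborel))"
    by (rule mult_left_mono[OF 1]) simp
  also have "\<dots> = ennreal (exp (q * b\<^sup>2) / unit_ball_vol (real m)) *
     (ennreal (exp (- q * (norm w)\<^sup>2)) * (\<integral>\<^sup>+u. (indicator (cball 0 (b * \<rho>)) u * ennreal (gmod q B u)) \<partial>lborel))"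
  proof -
    have "ennreal (a / v) * (ennreal c * X) = ennreal (c / v) * (ennreal a * X)"
      if "0 \<le> a" "0 \<le> c" "0 < v" for a c v :: real and X :: ennreal
    proof -
      have "ennreal (a / v) * ennreal c = ennreal (a / v * c)"
        by (rule ennreal_mult[symmetric]) (use that in auto)
      also have "a / v * c = c / v * a" by simp
      also have "ennreal (c / v * a) = ennreal (c / v) * ennreal a"
        by (rule ennreal_mult) (use that in auto)
      finally have "(ennreal (a / v) * ennreal c) * X = (ennreal (c / v) * ennreal a) * X" by (rule arg_cong)
      then show ?thesis by (simp only: mult.assoc)
    qed
    then show ?thesis using v0 by simp
  qed
  also have "ennreal (exp (- q * (norm w)\<^sup>2)) * (\<integral>\<^sup>+u. (indicator (cball 0 (b * \<rho>)) u * ennreal (gmod q B u))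
    \<partial>lborel)
    = (\<integral>\<^sup>+u. indicator (cball 0 (b * \<rho>)) u * ennreal (gmod q A (w + u)) \<partial>lborel)"
  proof -
    have "ennreal (exp (- q * (norm w)\<^sup>2)) * (indicator (cball 0 (b * \<rho>)) u * ennreal (gmod q B u))
      = indicator (cball 0 (b * \<rho>)) u * ennreal (gmod q A (w + u))" for u
    proof -
      have "ennreal (gmod q A (w + u)) = ennreal (exp (- q * (norm w)\<^sup>2)) * ennreal (gmod q B u)"
        unfolding B(2) by (rule ennreal_mult) auto
      then show ?thesis by (simp only: ac_simps)
    qed
    moreover have "(\<lambda>u. indicator (cball 0 (b * \<rho>)) u * ennreal (gmod q B u)) \<in> borel_measurable lborel"
      by measurable
    ultimately show ?thesis by (subst nn_integral_cmult[symmetric]) auto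
  qed
  finally show ?thesis .
qed

text \<open>The passage from \<open>r = 1\<close> to \<open>r < 1\<close>: at a maximum point of \<open>(1 - |U|)\<^sup>N H (w + U)\<close> the
  factor \<open>H\<^bsup>1 - r\<^esup>\<close> in the mean value inequality is absorbed; \<open>N = m / r\<close> makes the
  powers of \<open>1 - |U|\<close> cancel.\<close>

lemma sub_mean_value_small_exponent:
  fixes H :: "'a::euclidean_space \<Rightarrow> real"
  assumes cont: "continuous_on UNIV H" and H0: "\<And>x. 0 \<le> H x" and C: "0 \<le> C" and b: "1 \<le> b" and m: "0 < m"
    and r: "0 < r" "r \<le> 1"
    and mv: "\<And>w \<rho>. 0 < \<rho> \<Longrightarrow> \<rho> \<le> 1 \<Longrightarrow> ennreal (\<rho> ^ m * H w) \<le> ennreal C *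
      (\<integral>\<^sup>+u. indicator (cball 0 (b * \<rho>)) u * ennreal (H (w + u)) \<partial>lborel)"
  shows "ennreal (H w powr r) \<le> ennreal (C * (2 * b) ^ m * 2 powr (real m / r * (1 - r))) *
    (\<integral>\<^sup>+u. indicator (cball 0 1) u * ennreal (H (w + u) powr r) \<partial>lborel)" (is "_ \<le> ennreal ?C' * ?I")
proof (cases "?I")
  case top
  show ?thesis
  \<comment> \<open>In \<open>ennreal\<close> 0 times infinity is 0, so an infinite integral gives
    no bound if C = 0; in that case \<open>mv\<close> itself yields H w = 0.\<close>
  proof (cases "?C' = 0")
    case True
    then have "C = 0" using b by auto
    then have "ennreal (1 ^ m * H w) \<le> 0" using mv[of 1 w] by simp
    then have "H w = 0" using H0[of w] by simp
    then show ?thesis by simp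
  next
    case False
    moreover have "0 \<le> ?C'" using C b by auto
    ultimately have "ennreal ?C' * ?I = top" using top by (simp add: ennreal_mult_eq_top_iff)
    then show ?thesis by simp
  qed
next
  case (real I)
  define N where "N = real m / r"
  define f where "f U = (1 - norm U) powr N * H (w + U)" for U
  have cH: "continuous_on S (\<lambda>U. H (a + U))" for S a
    by (rule continuous_on_compose2[OF cont]) (intro continuous_intros, auto)
  have [measurable]: "H \<in> borel_measurable borel" by (rule borel_measurable_continuous_onI[OF cont])
  have [measurable]: "(\<lambda>W. ennreal (H (w + W) powr r)) \<in> borel_measurable borel" by measurable
  have [measurable]: "(\<lambda>W. indicator (cball 0 1) (U + W) :: ennreal) \<in> borel_measurable borel" for U :: 'a
    by (rule measurable_compose[of "\<lambda>W. U + W" borel borel]) measurable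
  have [measurable]: "(\<lambda>W. ennreal (H (w + (U + W)) powr r)) \<in> borel_measurable borel" for U by measurable
  show ?thesis
  proof -
    have N: "0 < N" using r m by (simp add: N_def)
    have "continuous_on (cball 0 1) f" unfolding f_def using N
      by (intro continuous_intros cH continuous_on_powr') auto
    then obtain U0 where U0: "U0 \<in> cball 0 1" "\<And>U. U \<in> cball 0 1 \<Longrightarrow> f U \<le> f U0"
      using continuous_attains_sup[of "cball 0 1" f] by auto
    define S where "S = f U0"
    have HS: "H w \<le> S" using U0(2)[of 0] by (simp add: f_def S_def)
    show ?thesis
    proof (cases "S \<le> 0")
      case True
      then have "H w = 0" using HS H0[of w] by simp
      then show ?thesis by simp
    next
      case False
      define d where "d = 1 - norm U0"
      have d: "0 < d" "d \<le> 1"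
        using False U0(1) by (auto simp: d_def S_def f_def less_le)
      \<comment> \<open>The ball of radius b \<rho> = d / 2 around U0 stays at distance at least d /
        2 from the unit sphere.\<close>
      define \<rho> where "\<rho> = d / (2 * b)"
      have \<rho>: "0 < \<rho>" "\<rho> \<le> 1" "b * \<rho> = d / 2" using d b by (auto simp: \<rho>_def field_simps)
      \<comment> \<open>On the ball of radius d / 2 around U0 the factor (1 - |U|)^N is at least (d
        / 2)^N, while f \<le> S; the quotient bounds H there.\<close>
      define L where "L = S * (d / 2) powr (- N)"
      have L: "0 < L" using False d by (simp add: L_def)
      have HL: "H (w + U0 + W) \<le> L" if "W \<in> cball 0 (b * \<rho>)" for W
      proof -
        have W: "norm W \<le> d / 2" using that \<rho> by simp
        then have n: "norm (U0 + W) \<le> 1 - d / 2"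
          using norm_triangle_ineq[of U0 W] by (simp add: d_def field_simps)
        have "(d / 2) powr N * H (w + U0 + W) \<le> f (U0 + W)"
          unfolding f_def add.assoc using n d H0 N by (intro mult_right_mono powr_mono2) auto
        also have "\<dots> \<le> S" unfolding S_def using n d by (intro U0(2)) auto
        finally show ?thesis using d unfolding L_def by (simp add: powr_minus field_simps)
      qed
      have HS0: "H (w + U0) = S * d powr (- N)"
        using d by (simp add: S_def f_def powr_minus flip: d_def)
      have pw: "H (w + U0 + W) \<le> L powr (1 - r) * H (w + U0 + W) powr r" if "W \<in> cball 0 (b * \<rho>)" for W
      proof (cases "H (w + U0 + W) = 0")
        case False
        then have h: "0 < H (w + U0 + W)" using H0[of "w + U0 + W"] by simp
        then have "H (w + U0 + W) = H (w + U0 + W) powr (1 - r) * H (w + U0 + W) powr r"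
          by (simp flip: powr_add)
        also have "\<dots> \<le> L powr (1 - r) * H (w + U0 + W) powr r"
          using h HL[OF that] r by (intro mult_right_mono powr_mono2) auto
        finally show ?thesis .
      qed simp
      have "ennreal (\<rho> ^ m * H (w + U0)) \<le> ennreal C *
         (\<integral>\<^sup>+W. indicator (cball 0 (b * \<rho>)) W * ennreal (H (w + U0 + W)) \<partial>lborel)"
        by (rule mv[OF \<rho>(1,2)])
      also have "\<dots> \<le> ennreal C *
         (\<integral>\<^sup>+W. ennreal (L powr (1 - r)) * (indicator (cball 0 1) (U0 + W) * ennreal (H (w + (U0 + W)) powr r)) \<partial>lborel)"
      proof (intro mult_left_mono nn_integral_mono)
        fix W
        show "indicator (cball 0 (b * \<rho>)) W * ennreal (H (w + U0 + W))
          \<le> ennreal (L powr (1 - r)) * (indicator (cball 0 1) (U0 + W) * ennreal (H (w + (U0 + W)) powr r))"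
        proof (cases "W \<in> cball 0 (b * \<rho>)")
          case True
          then have "norm (U0 + W) \<le> 1"
            using norm_triangle_ineq[of U0 W] \<rho> d by (simp add: d_def)
          moreover have "ennreal (H (w + U0 + W)) \<le> ennreal (L powr (1 - r) * H (w + U0 + W) powr r)"
            by (rule ennreal_leI[OF pw[OF True]])
          ultimately show ?thesis using True by (simp add: ennreal_mult add.assoc)
        qed simp
      qed simp
      also have "(\<integral>\<^sup>+W. ennreal (L powr (1 - r)) * (indicator (cball 0 1) (U0 + W) * ennreal (H (w + (U0 + W)) powr r))
        \<partial>lborel)
        = ennreal (L powr (1 - r)) * (\<integral>\<^sup>+W. indicator (cball 0 1) (U0 + W) * ennreal (H (w + (U0 + W)) powr r) \<partial>lborel)"
        by (rule nn_integral_cmult) measurable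
      also have "(\<integral>\<^sup>+W. indicator (cball 0 1) (U0 + W) * ennreal (H (w + (U0 + W)) powr r) \<partial>lborel) = ?I"
        using nn_integral_lborel_shift[of "\<lambda>W. indicator (cball 0 1) W * ennreal (H (w + W) powr r)" U0]
        by (simp add: add.commute)
      finally have "ennreal (\<rho> ^ m * H (w + U0)) \<le> ennreal (C * (L powr (1 - r) * I))"
        using real C by (simp add: ennreal_mult)
      then have main: "\<rho> ^ m * (S * d powr (- N)) \<le> C * (L powr (1 - r) * I)"
        using C real unfolding HS0 by (subst (asm) ennreal_le_iff) auto
      have dm: "d ^ m = d powr (N * r)" using d r by (simp add: N_def powr_realpow)
      have "S powr r = S * S powr (- (1 - r))" using False by (simp add: powr_diff powr_minus field_simps)
      have "\<rho> ^ m * (S * d powr (- N)) = (d powr (N * r) * d powr (- N)) * S / (2 * b) ^ m"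
        by (simp add: \<rho>_def power_divide dm)
      also have "d powr (N * r) * d powr (- N) = d powr (- N * (1 - r))"
        by (simp add: algebra_simps flip: powr_add)
      finally have l1: "\<rho> ^ m * (S * d powr (- N)) = d powr (- N * (1 - r)) * S / (2 * b) ^ m" .
      have "L powr (1 - r) = S powr (1 - r) * (d powr (- N) * 2 powr N) powr (1 - r)"
        using False d unfolding L_def by (simp add: powr_mult powr_divide powr_minus field_simps)
      also have "\<dots> = S powr (1 - r) * (d powr (- N * (1 - r)) * 2 powr (N * (1 - r)))"
        using d by (simp add: powr_mult powr_powr)
      finally have l2: "L powr (1 - r) = S powr (1 - r) * (d powr (- N * (1 - r)) * 2 powr (N * (1 - r)))" .
      define D where "D = d powr (- N * (1 - r))"
      have D: "0 < D" using d by (simp add: D_def)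
      define s where "s = S powr (1 - r)"
      have s: "0 < s" "S = S powr r * s" using False by (auto simp: s_def simp flip: powr_add)
      have "D * S / (2 * b) ^ m \<le> C * (s * (D * 2 powr (N * (1 - r))) * I)"
        using main unfolding l1 l2 D_def s_def by simp
      then have "D * S \<le> C * (s * (D * 2 powr (N * (1 - r))) * I) * (2 * b) ^ m"
        using b by (simp add: pos_divide_le_eq)
      then have "(D * s) * S powr r \<le> (D * s) * (C * (2 * b) ^ m * 2 powr (N * (1 - r)) * I)"
        by (subst (asm) (1) s(2)) (simp add: ac_simps)
      then have "S powr r \<le> C * (2 * b) ^ m * 2 powr (N * (1 - r)) * I"
        using D s by (simp only: mult_le_cancel_left_pos[OF mult_pos_pos])
      moreover have "H w powr r \<le> S powr r" using HS H0 r by (intro powr_mono2) auto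
      ultimately have "H w powr r \<le> ?C' * I" by (simp add: N_def)
      then show ?thesis using real C b by (simp add: ennreal_leI flip: ennreal_mult)
    qed
  qed
qed

text \<open>Write H = H^(1-r) H^r. The supremum bound gives H^(1-r) \<le> (C I)^((1-r)/r), where I
  is the integral of H^r. After raising to the power r the total exponent of I is (1 - r) + r =
  1.\<close>

lemma small_exponent_integral:
  fixes H :: "'a \<Rightarrow> real"
  assumes [measurable]: "H \<in> borel_measurable M" and H0: "\<And>x. 0 \<le> H x" and r: "0 < r" "r \<le> 1" and C: "0 < C"
    and sup: "\<And>x. ennreal (H x powr r) \<le> ennreal C * (\<integral>\<^sup>+x. ennreal (H x powr r) \<partial>M)"
  shows "epow r (\<integral>\<^sup>+x. ennreal (H x) \<partial>M)
    \<le> ennreal (C powr (1 - r)) * (\<integral>\<^sup>+x. ennreal (H x powr r) \<partial>M)"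
proof (cases "\<integral>\<^sup>+x. ennreal (H x powr r) \<partial>M")
  case top
  then show ?thesis using C by (simp add: ennreal_mult_top)
next
  case (real I)
  have Hr: "H x powr r \<le> C * I" for x
    using sup[of x] real C by (simp flip: ennreal_mult)
  define L where "L = (C * I) powr (1 / r)"
  have "(H x powr r) powr (1 / r) \<le> L" for x
    unfolding L_def using Hr r by (intro powr_mono2) auto
  moreover have "(H x powr r) powr (1 / r) = H x" for x using r H0[of x] by (simp add: powr_powr)
  ultimately have HL: "H x \<le> L" for x by metis
  have pw: "H x \<le> L powr (1 - r) * H x powr r" for x
  proof (cases "H x = 0")
    case False
    then have h: "0 < H x" using H0[of x] by simp
    then have "H x = H x powr (1 - r) * H x powr r" by (simp flip: powr_add)
    also have "\<dots> \<le> L powr (1 - r) * H x powr r"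
      using h HL[of x] r by (intro mult_right_mono powr_mono2) auto
    finally show ?thesis .
  qed simp
  have "(\<integral>\<^sup>+x. ennreal (H x) \<partial>M) \<le> (\<integral>\<^sup>+x. ennreal (L powr (1 - r)) * ennreal (H x powr r) \<partial>M)"
    by (intro nn_integral_mono) (use pw in \<open>auto simp flip: ennreal_mult intro: ennreal_leI\<close>)
  also have "\<dots> = ennreal (L powr (1 - r)) * ennreal I"
    by (simp add: nn_integral_cmult real)
  finally have "epow r (\<integral>\<^sup>+x. ennreal (H x) \<partial>M) \<le> epow r (ennreal (L powr (1 - r) * I))"
    using real r by (intro epow_mono) (auto simp: ennreal_mult)
  also have "\<dots> = ennreal ((L powr (1 - r) * I) powr r)" using real by (intro epow_ennreal) auto
  also have "(L powr (1 - r) * I) powr r = C powr (1 - r) * I"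
  proof -
    have "(L powr (1 - r) * I) powr r = (L powr (1 - r)) powr r * I powr r"
      using real by (simp add: powr_mult)
    also have "(L powr (1 - r)) powr r = (C * I) powr (1 / r * ((1 - r) * r))"
      by (simp add: L_def powr_powr)
    also have "1 / r * ((1 - r) * r) = 1 - r" using r by simp
    finally have "(L powr (1 - r) * I) powr r = (C * I) powr (1 - r) * I powr r" .
    also have "\<dots> = C powr (1 - r) * (I powr (1 - r) * I powr r)" using real C by (simp add: powr_mult)
    also have "I powr (1 - r) * I powr r = I" using real by (cases "I = 0") (simp_all flip: powr_add)
    finally show ?thesis .
  qed
  finally show ?thesis using real C by (simp add: ennreal_mult)
qed

subsection \<open>Summation and integration\<close>

text \<open>Turns a family over a countable type into a sequence, with zeros off the range of
  \<open>to_nat\<close>, so that theorems on series apply to unordered sums.\<close>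

definition nat_ext :: "('i::countable \<Rightarrow> 'b::zero) \<Rightarrow> nat \<Rightarrow> 'b" where
  "nat_ext h n = (if n \<in> range (to_nat :: 'i \<Rightarrow> nat) then h (from_nat n) else 0)"

lemma nat_ext_has_sum:
  fixes h :: "'i::countable \<Rightarrow> 'b::banach"
  shows "(nat_ext h has_sum s) UNIV \<longleftrightarrow> (h has_sum s) UNIV"
proof -
  have "(nat_ext h has_sum s) UNIV \<longleftrightarrow> (nat_ext h has_sum s) (range (to_nat :: 'i \<Rightarrow> nat))"
    by (rule has_sum_cong_neutral) (auto simp: nat_ext_def)
  also have "\<dots> \<longleftrightarrow> ((nat_ext h \<circ> to_nat) has_sum s) (UNIV :: 'i set)"
    by (rule has_sum_reindex) simp
  also have "nat_ext h \<circ> to_nat = h" by (auto simp: nat_ext_def fun_eq_iff)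
  finally show ?thesis .
qed

lemma nat_ext_sums:
  fixes h :: "'i::countable \<Rightarrow> 'b::banach"
  assumes "(\<lambda>i. norm (h i)) summable_on UNIV"
  shows "(h has_sum suminf (nat_ext h)) UNIV" and "summable (\<lambda>n. norm (nat_ext h n))"
proof -
  have "(\<lambda>n. norm (nat_ext h n)) = nat_ext (\<lambda>i. norm (h i))" by (auto simp: nat_ext_def fun_eq_iff)
  then have "(\<lambda>n. norm (nat_ext h n)) summable_on UNIV"
    using assms nat_ext_has_sum[of "\<lambda>i. norm (h i)"] unfolding summable_on_def by simp
  then show s: "summable (\<lambda>n. norm (nat_ext h n))" by (rule summable_on_imp_summable)
  then have "(nat_ext h has_sum suminf (nat_ext h)) UNIV"
    using norm_summable_imp_has_sum[OF s summable_sums[OF summable_norm_cancel[OF s]]] by simp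
  then show "(h has_sum suminf (nat_ext h)) UNIV" by (simp add: nat_ext_has_sum)
qed

lemma infsum_integral:
  fixes f :: "'i::countable \<Rightarrow> 'a \<Rightarrow> complex"
  assumes int: "\<And>i. integrable M (f i)"
    and pt: "\<And>x. x \<in> space M \<Longrightarrow> (\<lambda>i. norm (f i x)) summable_on UNIV"
    and sum: "(\<lambda>i. \<integral>x. norm (f i x) \<partial>M) summable_on UNIV"
  shows "(\<integral>x. (\<Sum>\<^sub>\<infinity>i. f i x) \<partial>M) = (\<Sum>\<^sub>\<infinity>i. \<integral>x. f i x \<partial>M)"
    and "integrable M (\<lambda>x. \<Sum>\<^sub>\<infinity>i. f i x)"
proof -
  define F where "F n x = nat_ext (\<lambda>i. f i x) n" for n x
  have F: "F n = (if n \<in> range (to_nat :: 'i \<Rightarrow> nat) then f (from_nat n) else (\<lambda>_. 0))" for n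
    by (auto simp: F_def nat_ext_def fun_eq_iff)
  have intF: "integrable M (F n)" for n unfolding F using int by auto
  have sF: "AE x in M. summable (\<lambda>n. norm (F n x))"
    using nat_ext_sums(2)[OF pt] by (auto simp: F_def)
  have sI: "summable (\<lambda>n. \<integral>x. norm (F n x) \<partial>M)"
  proof -
    have "(\<lambda>n. \<integral>x. norm (F n x) \<partial>M) = (\<lambda>n. norm (nat_ext (\<lambda>i. \<integral>x. norm (f i x) \<partial>M) n))"
      by (auto simp: F nat_ext_def fun_eq_iff)
    then show ?thesis using nat_ext_sums(2)[of "\<lambda>i. \<integral>x. norm (f i x) \<partial>M"] sum by simp
  qed
  have eq: "(\<Sum>\<^sub>\<infinity>i. f i x) = (\<Sum>n. F n x)" if "x \<in> space M" for x
    using infsumI[OF nat_ext_sums(1)[OF pt[OF that]]] by (simp add: F_def[abs_def])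
  have "integrable M (\<lambda>x. \<Sum>n. F n x)" by (rule integrable_suminf[OF intF sF sI])
  then show "integrable M (\<lambda>x. \<Sum>\<^sub>\<infinity>i. f i x)"
    by (subst Bochner_Integration.integrable_cong[OF refl eq])
  have "(\<lambda>i. norm (\<integral>x. f i x \<partial>M)) summable_on UNIV"
    by (rule summable_on_comparison_test[OF sum]) (auto intro: integral_norm_bound)
  then have "(\<Sum>\<^sub>\<infinity>i. \<integral>x. f i x \<partial>M) = suminf (nat_ext (\<lambda>i. \<integral>x. f i x \<partial>M))"
    by (rule infsumI[OF nat_ext_sums(1)])
  also have "nat_ext (\<lambda>i. \<integral>x. f i x \<partial>M) = (\<lambda>n. \<integral>x. F n x \<partial>M)"
    by (auto simp: F nat_ext_def fun_eq_iff)
  also have "(\<Sum>n. \<integral>x. F n x \<partial>M) = (\<integral>x. (\<Sum>n. F n x) \<partial>M)"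
    by (rule integral_suminf[OF intF sF sI, symmetric])
  also have "\<dots> = (\<integral>x. (\<Sum>\<^sub>\<infinity>i. f i x) \<partial>M)"
    by (rule Bochner_Integration.integral_cong[OF refl eq[symmetric]])
  finally show "(\<integral>x. (\<Sum>\<^sub>\<infinity>i. f i x) \<partial>M) = (\<Sum>\<^sub>\<infinity>i. \<integral>x. f i x \<partial>M)" by simp
qed

subsection \<open>Hermite functions of one variable\<close>

text \<open>Up to sign the Hermite polynomials: \<open>(d/dt)\<^sup>n exp (- t\<^sup>2) = poly (hp n) t * exp (- t\<^sup>2)\<close>.\<close>

primrec hp :: "nat \<Rightarrow> real poly" where
  "hp 0 = 1"
| "hp (Suc n) = pderiv (hp n) - [:0, 2:] * hp n"

definition gd :: "nat \<Rightarrow> real \<Rightarrow> real" where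
  "gd n t = poly (hp n) t * exp (- t\<^sup>2)"

lemma gd_deriv: "(gd n has_real_derivative gd (Suc n) t) (at t)"
  unfolding gd_def by (auto intro!: derivative_eq_intros simp: algebra_simps)

lemma iterated_deriv_gaussian: "(deriv ^^ n) (\<lambda>s::real. exp (- s\<^sup>2)) = gd n"
proof (induction n)
  case (Suc n)
  have "(deriv ^^ Suc n) (\<lambda>s::real. exp (- s\<^sup>2)) = deriv (gd n)"
    unfolding funpow.simps o_apply Suc ..
  also have "\<dots> = gd (Suc n)" using DERIV_imp_deriv[OF gd_deriv] by auto
  finally show ?case .
qed (simp add: gd_def fun_eq_iff)

lemma hermite1_gd: "hermite1 n t = pi powr (- 1 / 4) * (- 1) ^ n / sqrt (2 ^ n * fact n) * exp (t\<^sup>2 / 2) * gd n t"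
  unfolding hermite1_def iterated_deriv_gaussian ..

text \<open>The rule that differentiation lowers the degree of a Hermite polynomial. The sign is
  negative because \<open>hp n\<close> is (-1)^n times the usual polynomial.\<close>

lemma pderiv_hp: "pderiv (hp (Suc n)) = smult (- 2 * real (Suc n)) (hp n)"
proof (induction n)
  case 0
  show ?case by (simp add: pderiv_diff pderiv_mult pderiv_pCons)
next
  case (Suc n)
  have "pderiv (hp (Suc (Suc n))) = pderiv (pderiv (hp (Suc n))) - [:2:] * hp (Suc n) - [:0, 2:] * pderiv (hp (Suc n))"
  proof -
    have "pderiv ([:0, 2:] * p) = [:2:] * p + [:0, 2:] * pderiv p" for p :: "real poly"
    proof -
      have "pderiv [:0, 2::real:] = [:2:]" by (simp add: pderiv_pCons)
      then show ?thesis by (simp only: pderiv_mult) (simp only: add.commute mult.commute)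
    qed
    then show ?thesis unfolding hp.simps(2)[of "Suc n"] pderiv_diff by (simp only: diff_diff_eq)
  qed
  also have "pderiv (pderiv (hp (Suc n))) = smult (- 2 * real (Suc n)) (pderiv (hp n))"
    unfolding Suc by (rule pderiv_smult)
  also have "smult (- 2 * real (Suc n)) (pderiv (hp n)) - [:2:] * hp (Suc n) - [:0, 2:] * pderiv (hp (Suc n))
    = smult (- 2 * real (Suc n)) (pderiv (hp n) - [:0, 2:] * hp n) - [:2:] * hp (Suc n)"
    unfolding Suc by (simp add: algebra_simps smult_diff_right del: hp.simps(2))
  also have "pderiv (hp n) - [:0, 2:] * hp n = hp (Suc n)" by simp
  also have "smult (- 2 * real (Suc n)) (hp (Suc n)) - [:2:] * hp (Suc n) = smult (- 2 * real (Suc (Suc n))) (hp (Suc n))"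
    by (simp add: smult_diff_left[symmetric] algebra_simps del: hp.simps(2))
  finally show ?case .
qed

lemma poly_exp_bound:
  fixes p :: "real poly"
  obtains C b where "0 \<le> C" "0 \<le> b" "\<And>t. \<bar>poly p t\<bar> \<le> C * exp (b * \<bar>t\<bar>)"
proof -
  have "\<exists>C b. 0 \<le> C \<and> 0 \<le> b \<and> (\<forall>t. \<bar>poly p t\<bar> \<le> C * exp (b * \<bar>t\<bar>))"
  proof (induction p)
    case 0
    show ?case by (intro exI[of _ 0]) auto
  next
    case (pCons a p)
    then obtain C b where C: "0 \<le> C" "0 \<le> b" "\<And>t. \<bar>poly p t\<bar> \<le> C * exp (b * \<bar>t\<bar>)" by auto
    have "\<bar>poly (pCons a p) t\<bar> \<le> (\<bar>a\<bar> + C) * exp ((b + 1) * \<bar>t\<bar>)" for t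
    proof -
      have "\<bar>t\<bar> \<le> exp \<bar>t\<bar>" using exp_ge_add_one_self[of "\<bar>t\<bar>"] by linarith
      then have "\<bar>t\<bar> * \<bar>poly p t\<bar> \<le> exp \<bar>t\<bar> * (C * exp (b * \<bar>t\<bar>))"
        using C by (intro mult_mono) auto
      also have "\<dots> = C * exp ((b + 1) * \<bar>t\<bar>)" by (simp add: algebra_simps exp_add)
      finally have "\<bar>t * poly p t\<bar> \<le> C * exp ((b + 1) * \<bar>t\<bar>)" by (simp add: abs_mult)
      moreover have "\<bar>a\<bar> \<le> \<bar>a\<bar> * exp ((b + 1) * \<bar>t\<bar>)"
        using C mult_left_mono[of 1 "exp ((b + 1) * \<bar>t\<bar>)" "\<bar>a\<bar>"] by simp
      ultimately show ?thesis by (simp add: distrib_right abs_triangle_ineq[THEN order.trans])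
    qed
    then show ?case using C by (intro exI[of _ "\<bar>a\<bar> + C"] exI[of _ "b + 1"]) auto
  qed
  then show ?thesis using that by blast
qed

lemma integrable_exp_quadratic: "integrable lborel (\<lambda>t::real. exp (b * t - t\<^sup>2))"
proof -
  \<comment> \<open>Completing the square gives a multiple of the normal density with mean b / 2 and
    variance 1 / 2.\<close>
  have "exp (b * t - t\<^sup>2) = (exp (b\<^sup>2 / 4) * sqrt pi) * normal_density (b / 2) (1 / sqrt 2) t" for t :: real
  proof -
    have "b * t - t\<^sup>2 = b\<^sup>2 / 4 - (t - b / 2)\<^sup>2" by (simp add: power2_eq_square field_simps)
    then have "exp (b * t - t\<^sup>2) = exp (b\<^sup>2 / 4) * exp (- (t - b / 2)\<^sup>2)" by (simp flip: exp_add)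
    moreover have sq: "(1 / sqrt 2)\<^sup>2 = (1 / 2 :: real)" by (simp add: power_divide)
    have "normal_density (b / 2) (1 / sqrt 2) t = 1 / sqrt pi * exp (- (t - b / 2)\<^sup>2)"
      unfolding normal_density_def sq by simp
    ultimately show ?thesis by simp
  qed
  then show ?thesis by (simp only:) (intro integrable_mult_right integrable_normal_density, simp)
qed

lemma integrable_exp_abs_quadratic: "integrable lborel (\<lambda>t::real. exp (b * \<bar>t\<bar> - t\<^sup>2))"
proof (rule Bochner_Integration.integrable_bound)
  show "integrable lborel (\<lambda>t::real. exp (b * t - t\<^sup>2) + exp ((- b) * t - t\<^sup>2))"
    by (intro Bochner_Integration.integrable_add integrable_exp_quadratic)
  show "AE t::real in lborel. norm (exp (b * \<bar>t\<bar> - t\<^sup>2)) \<le> norm (exp (b * t - t\<^sup>2) + exp ((- b) * t - t\<^sup>2))"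
  proof (rule AE_I2)
    fix t :: real
    have "norm (exp (b * t - t\<^sup>2) + exp ((- b) * t - t\<^sup>2)) = exp (b * t - t\<^sup>2) + exp ((- b) * t - t\<^sup>2)"
      by (simp add: add_pos_pos less_imp_le)
    then show "norm (exp (b * \<bar>t\<bar> - t\<^sup>2)) \<le> norm (exp (b * t - t\<^sup>2) + exp ((- b) * t - t\<^sup>2))"
      by (cases "0 \<le> t") auto
  qed
qed measurable

lemma exp_poly_gaussian_bound:
  fixes \<zeta> :: complex and p :: "real poly"
  obtains C b where "\<And>t::real. cmod (exp (\<zeta> * t) * of_real (poly p t * exp (- t\<^sup>2))) \<le> C * exp (b * \<bar>t\<bar> - t\<^sup>2)"
proof -
  obtain C b where C: "0 \<le> C" "0 \<le> b" "\<And>t. \<bar>poly p t\<bar> \<le> C * exp (b * \<bar>t\<bar>)"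
    using poly_exp_bound[of p] by metis
  show thesis
  proof (rule that[of C "b + cmod \<zeta>"])
    fix t :: real
    have "Re (\<zeta> * t) \<le> cmod \<zeta> * \<bar>t\<bar>" using complex_Re_le_cmod[of "\<zeta> * t"] by (simp add: norm_mult)
    then have "cmod (exp (\<zeta> * t)) \<le> exp (cmod \<zeta> * \<bar>t\<bar>)" unfolding norm_exp_eq_Re by simp
    then have "cmod (exp (\<zeta> * t)) * (\<bar>poly p t\<bar> * exp (- t\<^sup>2))
      \<le> exp (cmod \<zeta> * \<bar>t\<bar>) * ((C * exp (b * \<bar>t\<bar>)) * exp (- t\<^sup>2))"
      using C by (intro mult_mono) auto
    also have "\<dots> = C * exp ((b + cmod \<zeta>) * \<bar>t\<bar> - t\<^sup>2)"
      by (simp add: algebra_simps exp_add exp_diff exp_minus field_simps)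
    finally show "cmod (exp (\<zeta> * t) * of_real (poly p t * exp (- t\<^sup>2))) \<le> C * exp ((b + cmod \<zeta>) * \<bar>t\<bar> - t\<^sup>2)"
      by (simp add: norm_mult abs_mult)
  qed
qed

lemma exp_poly_gaussian_integrable:
  "complex_integrable lborel (\<lambda>t. exp (\<zeta> * of_real t) * of_real (poly p t * exp (- t\<^sup>2)))"
proof -
  obtain C b where C: "\<And>t::real. cmod (exp (\<zeta> * t) * of_real (poly p t * exp (- t\<^sup>2))) \<le> C * exp (b * \<bar>t\<bar> - t\<^sup>2)"
    using exp_poly_gaussian_bound by metis
  show ?thesis
  proof (rule Bochner_Integration.integrable_bound)
    show "integrable lborel (\<lambda>t::real. C * exp (b * \<bar>t\<bar> - t\<^sup>2))"
      by (intro integrable_mult_right integrable_exp_abs_quadratic)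
    show "AE t in lborel. norm (exp (\<zeta> * of_real t) * of_real (poly p t * exp (- t\<^sup>2)))
      \<le> norm (C * exp (b * \<bar>t\<bar> - t\<^sup>2))"
      using C by (intro AE_I2) (simp add: order.trans[OF _ abs_ge_self])
    show "(\<lambda>t. exp (\<zeta> * of_real t) * of_real (poly p t * exp (- t\<^sup>2))) \<in> borel_measurable lborel"
      by (simp, intro borel_measurable_continuous_onI continuous_intros)
  qed
qed

text \<open>The integrand is the derivative of a function that vanishes at both ends of the line.
  This is the integration by parts behind the Laplace transform and the norm of the Hermite
  functions.\<close>

lemma exp_poly_gaussian_integral_deriv:
  fixes \<zeta> :: complex
  shows "(\<integral>t. \<zeta> * (exp (\<zeta> * of_real t) * of_real (poly p t * exp (- t\<^sup>2)))
    + exp (\<zeta> * of_real t) * of_real (poly (pderiv p - [:0, 2:] * p) t * exp (- t\<^sup>2)) \<partial>lborel) = 0"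
proof -
  define F where "F t = exp (\<zeta> * of_real t) * of_real (poly p t * exp (- t\<^sup>2))" for t :: real
  define f where "f t = \<zeta> * F t + exp (\<zeta> * of_real t) * of_real (poly (pderiv p - [:0, 2:] * p) t * exp (- t\<^sup>2))" for t
  note F = F_def and f = f_def
  have d: "(F has_vector_derivative f t) (at t)" for t
  proof -
    have "((\<lambda>t. of_real (poly p t * exp (- t\<^sup>2)) :: complex) has_vector_derivative
       of_real (poly (pderiv p - [:0, 2:] * p) t * exp (- t\<^sup>2))) (at t)"
    proof -
      have "((\<lambda>t. poly p t * exp (- t\<^sup>2)) has_real_derivative poly (pderiv p - [:0, 2:] * p) t * exp (- t\<^sup>2)) (at t)"
        by (auto intro!: derivative_eq_intros simp: algebra_simps)
      then show ?thesis by (rule has_vector_derivative_of_real)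
    qed
    moreover have "((\<lambda>t. exp (\<zeta> * of_real t)) has_vector_derivative \<zeta> * exp (\<zeta> * of_real t)) (at t)"
      using exp_scaleR_has_vector_derivative_left[of \<zeta> t] by (simp add: scaleR_conv_of_real mult.commute)
    ultimately show ?thesis unfolding F[abs_def] f
      by (auto intro!: derivative_eq_intros simp: algebra_simps)
  qed
  obtain C b where C: "\<And>t::real. cmod (F t) \<le> C * exp (b * \<bar>t\<bar> - t\<^sup>2)"
    unfolding F using exp_poly_gaussian_bound by metis
  have top: "(F \<longlongrightarrow> 0) at_top"
  proof (rule Lim_null_comparison)
    show "\<forall>\<^sub>F t in at_top. norm (F t) \<le> C * exp (b * t - t\<^sup>2)"
      using eventually_ge_at_top[of 0] by eventually_elim (use C in \<open>metis abs_of_nonneg\<close>)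
    show "((\<lambda>t. C * exp (b * t - t\<^sup>2)) \<longlongrightarrow> 0) at_top"
      by (intro tendsto_mult_right_zero) real_asymp
  qed
  have bot: "(F \<longlongrightarrow> 0) at_bot"
  proof (rule Lim_null_comparison)
    show "\<forall>\<^sub>F t in at_bot. norm (F t) \<le> C * exp (- b * t - t\<^sup>2)"
      using eventually_le_at_bot[of 0] by eventually_elim (use C in \<open>metis abs_of_nonpos mult_minus_left mult_minus_right\<close>)
    show "((\<lambda>t. C * exp (- b * t - t\<^sup>2)) \<longlongrightarrow> 0) at_bot"
      by (intro tendsto_mult_right_zero) real_asymp
  qed
  have int: "integrable lborel f" unfolding f[abs_def] F
    by (intro Bochner_Integration.integrable_add integrable_mult_right exp_poly_gaussian_integrable)
  have cont: "isCont f t" for t unfolding f[abs_def] F by (intro continuous_intros)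
  have "(LBINT t=-\<infinity>..\<infinity>. f t) = 0 - 0"
  proof (rule interval_integral_FTC_integrable[where F = F])
    show "((F \<circ> real_of_ereal) \<longlongrightarrow> 0) (at_right (-\<infinity>))" "((F \<circ> real_of_ereal) \<longlongrightarrow>
      0) (at_left \<infinity>)"
      using top bot by (simp_all add: ereal_tendsto_simps1)
    show "set_integrable lborel (einterval (-\<infinity>) \<infinity>) f" using int by (simp add: set_integrable_def)
  qed (use d cont in auto)
  then have "(\<integral>t. f t \<partial>lborel) = 0" by (simp add: interval_lebesgue_integral_def set_lebesgue_integral_def)
  then show ?thesis by (simp only: f F)
qed

text \<open>The substitution t = x / 2 + u / sqrt 2 removes the real part x of the exponent; what
  remains is the characteristic function of the standard normal distribution at \<xi> / sqrt
  2.\<close>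

lemma gaussian_exp_integral:
  fixes \<zeta> :: complex
  shows "(\<integral>t. exp (\<zeta> * of_real t) * of_real (exp (- t\<^sup>2)) \<partial>lborel) = of_real (sqrt pi) * exp (\<zeta>\<^sup>2 / 4)"
proof -
  define x \<xi> where "x = Re \<zeta>" and "\<xi> = Im \<zeta>"
  have z: "\<zeta> = of_real x + \<i> * of_real \<xi>" by (simp add: x_def \<xi>_def complex_eq)
  define s where "s = \<xi> / sqrt 2"
  have ch: "(\<integral>u. of_real (std_normal_density u) * exp (\<i> * of_real (s * u)) \<partial>lborel) = complex_of_real (exp (- s\<^sup>2 / 2))"
  proof -
    have "complex_of_real (exp (- s\<^sup>2 / 2)) = char std_normal_distribution s"
      by (simp add: char_std_normal_distribution)
    also have "\<dots> = (\<integral>u. std_normal_density u *\<^sub>R exp (\<i> * of_real (s * u)) \<partial>lborel)"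
      unfolding char_def by (subst integral_density) auto
    finally show ?thesis by (simp add: scaleR_conv_of_real)
  qed
  have "(\<integral>t. exp (\<zeta> * of_real t) * of_real (exp (- t\<^sup>2)) \<partial>lborel)
    = \<bar>1 / sqrt 2\<bar> *\<^sub>R (\<integral>u. exp (\<zeta> * of_real (x / 2 + 1 / sqrt 2 * u)) * of_real (exp (- (x / 2 + 1 / sqrt 2
      * u)\<^sup>2)) \<partial>lborel)"
    by (rule lborel_integral_real_affine) simp
  also have "(\<lambda>u. exp (\<zeta> * of_real (x / 2 + 1 / sqrt 2 * u)) * of_real (exp (- (x / 2 + 1 / sqrt 2 * u)\<^sup>2)))
    = (\<lambda>u. (exp (of_real (x\<^sup>2 / 4) + \<i> * of_real (\<xi> * x / 2)) * of_real (sqrt (2 * pi))) * (of_real (std_normal_density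
      u) * exp (\<i> * of_real (s * u))))"
  proof
    fix u :: real
    have e: "\<zeta> * of_real (x / 2 + 1 / sqrt 2 * u) - of_real ((x / 2 + 1 / sqrt 2 * u)\<^sup>2)
      = (of_real (x\<^sup>2 / 4) + \<i> * of_real (\<xi> * x / 2)) + (of_real (- u\<^sup>2 / 2) + \<i> * of_real (s * u))"
      unfolding z by (simp add: complex_eq_iff s_def power2_eq_square field_simps)
    have "exp (\<zeta> * of_real (x / 2 + 1 / sqrt 2 * u)) * of_real (exp (- (x / 2 + 1 / sqrt 2 * u)\<^sup>2))
      = exp (\<zeta> * of_real (x / 2 + 1 / sqrt 2 * u) - of_real ((x / 2 + 1 / sqrt 2 * u)\<^sup>2))"
    proof -
      have "complex_of_real (exp (- a)) = exp (- complex_of_real a)" for a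
        by (simp only: of_real_minus[symmetric] exp_of_real)
      then show ?thesis by (simp only: exp_add[symmetric] diff_conv_add_uminus)
    qed
    also have "\<dots> = exp (of_real (x\<^sup>2 / 4) + \<i> * of_real (\<xi> * x / 2)) * (exp (of_real (- u\<^sup>2 / 2)) * exp (\<i> *
      of_real (s * u)))"
      unfolding e by (simp only: exp_add)
    also have "exp (of_real (- u\<^sup>2 / 2)) = of_real (sqrt (2 * pi)) * complex_of_real (std_normal_density u)"
      by (simp only: exp_of_real of_real_mult[symmetric]) (simp add: std_normal_density_def)
    finally show "exp (\<zeta> * of_real (x / 2 + 1 / sqrt 2 * u)) * of_real (exp (- (x / 2 + 1 / sqrt 2 * u)\<^sup>2))
      = (exp (of_real (x\<^sup>2 / 4) + \<i> * of_real (\<xi> * x / 2)) * of_real (sqrt (2 * pi))) * (of_real (std_normal_density u) * exp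
        (\<i> * of_real (s * u)))"
      by (simp only: mult.assoc)
  qed
  also have "\<bar>1 / sqrt 2\<bar> *\<^sub>R (\<integral>u. (exp (of_real (x\<^sup>2 / 4) + \<i> * of_real (\<xi> * x / 2)) * of_real (sqrt
    (2 * pi))) * (of_real (std_normal_density u) * exp (\<i> * of_real (s * u))) \<partial>lborel)
    = of_real (1 / sqrt 2 * sqrt (2 * pi)) * (exp (of_real (x\<^sup>2 / 4) + \<i> * of_real (\<xi> * x / 2)) * exp (of_real (- s\<^sup>2 / 2)))"
  proof -
    have "\<bar>1 / sqrt 2\<bar> = 1 / sqrt 2" by simp
    then show ?thesis
      unfolding integral_mult_right_zero unfolding ch unfolding scaleR_conv_of_real exp_of_real of_real_mult
      by (simp only: ac_simps)
  qed
  also have "1 / sqrt 2 * sqrt (2 * pi) = sqrt pi" by (simp add: real_sqrt_mult)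
  also have "exp (of_real (x\<^sup>2 / 4) + \<i> * of_real (\<xi> * x / 2)) * exp (of_real (- s\<^sup>2 / 2)) = exp (\<zeta>\<^sup>2 / 4)"
  proof -
    have "of_real (x\<^sup>2 / 4) + \<i> * of_real (\<xi> * x / 2) + of_real (- s\<^sup>2 / 2) = \<zeta>\<^sup>2 / 4"
      unfolding z by (simp add: complex_eq_iff s_def power2_eq_square field_simps)
    then show ?thesis by (simp only: exp_add[symmetric])
  qed
  finally show ?thesis .
qed

lemma gd_exp_integral:
  fixes \<zeta> :: complex
  shows "(\<integral>t. exp (\<zeta> * of_real t) * of_real (gd n t) \<partial>lborel)
    = (- \<zeta>) ^ n * (of_real (sqrt pi) * exp (\<zeta>\<^sup>2 / 4))"
proof (induction n)
  case 0
  then show ?case using gaussian_exp_integral by (simp add: gd_def)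
next
  case (Suc n)
  have "0 = (\<integral>t. \<zeta> * (exp (\<zeta> * of_real t) * of_real (gd n t)) + exp (\<zeta> * of_real t) * of_real (gd (Suc n) t)
    \<partial>lborel)"
    using exp_poly_gaussian_integral_deriv[of \<zeta> "hp n"] unfolding gd_def hp.simps by (rule sym)
  also have "\<dots> = \<zeta> * (\<integral>t. exp (\<zeta> * of_real t) * of_real (gd n t) \<partial>lborel)
     + (\<integral>t. exp (\<zeta> * of_real t) * of_real (gd (Suc n) t) \<partial>lborel)"
    unfolding gd_def
    by (subst Bochner_Integration.integral_add)
       (auto intro!: integrable_mult_right exp_poly_gaussian_integrable simp del: of_real_mult hp.simps)
  finally have "(\<integral>t. exp (\<zeta> * of_real t) * of_real (gd (Suc n) t) \<partial>lborel)
     = - \<zeta> * (\<integral>t. exp (\<zeta> * of_real t) * of_real (gd n t) \<partial>lborel)"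
    by (simp add: eq_neg_iff_add_eq_0 add.commute)
  then show ?case unfolding Suc by simp
qed

lemma poly_gaussian_integrable: "integrable lborel (\<lambda>t::real. poly p t * exp (- t\<^sup>2))"
proof -
  have "complex_integrable lborel (\<lambda>t. complex_of_real (poly p t * exp (- t\<^sup>2)))"
    using exp_poly_gaussian_integrable[of 0 p] by simp
  then show ?thesis by (simp only: complex_of_real_integrable_eq)
qed

text \<open>The derivative of hp (n+1) hp n exp (- t^2) integrates to 0. By \<open>pderiv_hp\<close>
  one term is - 2 (n+1) (hp n)^2 and by the recursion the other is (hp (n+1))^2, which yields the
  factor from n to n + 1.\<close>

lemma gd_norm_integral: "(\<integral>t. poly (hp n) t * gd n t \<partial>lborel) = 2 ^ n * fact n * sqrt pi"
proof (induction n)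
  case 0
  have "complex_of_real (\<integral>t. exp (- t\<^sup>2) \<partial>lborel) = of_real (sqrt pi)"
    using gaussian_exp_integral[of 0] by simp
  then show ?case by (simp only: of_real_eq_iff) (simp add: gd_def)
next
  case (Suc n)
  define p where "p = hp (Suc n) * hp n"
  define q where "q = pderiv p - [:0, 2:] * p"
  have "(\<integral>t. 0 * (exp (0 * of_real t) * of_real (poly p t * exp (- t\<^sup>2))) + exp (0 * of_real t) * complex_of_real (poly q t
    * exp (- t\<^sup>2)) \<partial>lborel) = 0"
    unfolding q_def by (rule exp_poly_gaussian_integral_deriv)
  then have q0: "(\<integral>t. poly q t * exp (- t\<^sup>2) \<partial>lborel) = 0"
    by (simp flip: of_real_mult)
  have "q = smult (- 2 * real (Suc n)) (hp n) * hp n + hp (Suc n) * hp (Suc n)"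
    unfolding q_def p_def pderiv_mult pderiv_hp[symmetric] by (simp add: algebra_simps)
  then have "poly q t = (- 2 * real (Suc n)) * (poly (hp n) t * poly (hp n) t) + poly (hp (Suc n)) t * poly (hp (Suc n)) t" for t
    by (simp only: poly_add poly_mult poly_smult mult.assoc)
  then have "poly q t * exp (- t\<^sup>2) = (- 2 * real (Suc n)) * (poly (hp n * hp n) t * exp (- t\<^sup>2)) + poly (hp (Suc n) * hp (Suc
    n)) t * exp (- t\<^sup>2)" for t
    by (simp only: poly_mult distrib_right mult.assoc)
  then have "0 = (\<integral>t. (- 2 * real (Suc n)) * (poly (hp n * hp n) t * exp (- t\<^sup>2)) + poly (hp (Suc n) * hp (Suc n)) t * exp
    (- t\<^sup>2) \<partial>lborel)"
    using q0 by (simp only:)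
  also have "\<dots> = (- 2 * real (Suc n)) * (\<integral>t. poly (hp n * hp n) t * exp (- t\<^sup>2) \<partial>lborel) + (\<integral>t.
    poly (hp (Suc n) * hp (Suc n)) t * exp (- t\<^sup>2) \<partial>lborel)"
    by (subst Bochner_Integration.integral_add)
       (auto intro!: integrable_mult_right poly_gaussian_integrable simp del: hp.simps poly_mult mult_minus_left)
  also have "(\<integral>t. poly (hp n * hp n) t * exp (- t\<^sup>2) \<partial>lborel) = 2 ^ n * fact n * sqrt pi"
    using Suc by (simp add: gd_def mult.assoc)
  finally have "(\<integral>t. poly (hp (Suc n) * hp (Suc n)) t * exp (- t\<^sup>2) \<partial>lborel) = 2 * real (Suc n) * (2 ^ n * fact n * sqrt pi)"
    by linarith
  then show ?case by (simp add: gd_def mult.assoc del: hp.simps)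
qed

subsection \<open>Hermite coefficients of time-frequency shifts of the Gaussian\<close>

lemma prod_multiindex_summable:
  fixes f :: "'n::finite \<Rightarrow> nat \<Rightarrow> complex"
  assumes "\<And>i. summable (\<lambda>k. norm (f i k))"
  shows "(\<lambda>\<alpha>. norm (\<Prod>i\<in>UNIV. f i (\<alpha> i))) summable_on UNIV"
    and "(\<Sum>\<^sub>\<infinity>\<alpha>. \<Prod>i\<in>UNIV. f i (\<alpha> i)) = (\<Prod>i\<in>UNIV. \<Sum>k. f i k)"
proof -
  have U: "PiE UNIV (\<lambda>_::'n. UNIV :: nat set) = UNIV" by (auto simp: PiE_def extensional_def)
  have abs: "(\<lambda>k. norm (f i k)) summable_on UNIV" for i
    using assms[of i] by (intro norm_summable_imp_summable_on) simp
  have "Infinite_Set_Sum.abs_summable_on (\<lambda>\<alpha>. \<Prod>i\<in>UNIV. f i (\<alpha> i)) (PiE UNIV (\<lambda>_::'n. UNIV :: nat set))"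
    by (rule abs_summable_on_prod_PiE) (use abs in \<open>auto simp: abs_summable_equivalent\<close>)
  then show "(\<lambda>\<alpha>. norm (\<Prod>i\<in>UNIV. f i (\<alpha> i))) summable_on UNIV"
    by (simp only: U abs_summable_equivalent)
  have "infsum (f i) UNIV = (\<Sum>k. f i k)" for i
    by (rule infsumI[OF norm_summable_imp_has_sum[OF assms summable_sums[OF summable_norm_cancel[OF assms]]]])
  moreover have "infsum (\<lambda>\<alpha>. \<Prod>i\<in>UNIV. f i (\<alpha> i)) (PiE UNIV (\<lambda>_::'n. UNIV :: nat set))
    = (\<Prod>i\<in>UNIV. infsum (f i) UNIV)"
    by (rule infsum_prod_PiE_abs) (use abs in auto)
  ultimately show "(\<Sum>\<^sub>\<infinity>\<alpha>. \<Prod>i\<in>UNIV. f i (\<alpha> i)) = (\<Prod>i\<in>UNIV. \<Sum>k. f i k)"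
    by (simp only: U)
qed

lemma summable_power_sqrt_fact:
  fixes s :: real assumes "0 \<le> s" shows "summable (\<lambda>k. s ^ k / sqrt (fact k))"
proof (rule summable_comparison_test')
  show "summable (\<lambda>k. ((4 * s\<^sup>2) ^ k / fact k + (1 / 4) ^ k) / 2)"
  proof (intro summable_divide summable_add summable_geometric)
    show "summable (\<lambda>k. (4 * s\<^sup>2) ^ k / fact k)"
      using summable_exp[of "4 * s\<^sup>2"] by (simp add: divide_inverse mult.commute)
  qed simp
  fix k :: nat
  \<comment> \<open>The power is split as (2 s)^k 2^(-k); the arithmetic-geometric mean inequality
    then trades the square root of the factorial for an exponential series plus a geometric
    one.\<close>
  define a b where "a = (2 * s) ^ k / sqrt (fact k)" and "b = (1 / 2 :: real) ^ k"
  have ab: "a * b \<le> (a\<^sup>2 + b\<^sup>2) / 2" using zero_le_power2[of "a - b"] by (simp add: power2_diff)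
  have ab1: "a * b = s ^ k / sqrt (fact k)" by (simp add: a_def b_def power_mult_distrib power_divide)
  have a2: "a\<^sup>2 = (4 * s\<^sup>2) ^ k / fact k"
  proof -
    have "((2 * s) ^ k)\<^sup>2 = ((2 * s)\<^sup>2) ^ k" by (simp only: power_mult[symmetric] mult.commute)
    then show ?thesis by (simp add: a_def power_divide power_mult_distrib[of 2 s 2])
  qed
  have b2: "b\<^sup>2 = (1 / 4) ^ k" by (simp add: b_def power_divide power2_eq_square flip: power_mult_distrib)
  have "s ^ k / sqrt (fact k) \<le> ((4 * s\<^sup>2) ^ k / fact k + (1 / 4) ^ k) / 2"
    by (rule ab[unfolded ab1 a2 b2])
  moreover have "0 \<le> s ^ k / sqrt (fact k)" using assms by simp
  ultimately show "norm (s ^ k / sqrt (fact k)) \<le> ((4 * s\<^sup>2) ^ k / fact k + (1 / 4) ^ k) / 2"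
    by (metis abs_of_nonneg real_norm_def)
qed

lemma summable_power_sqrt_fact2:
  fixes z :: complex shows "summable (\<lambda>k. norm (z ^ k / of_real (sqrt (2 ^ k * fact k))))"
proof -
  have "norm (z ^ k / of_real (sqrt (2 ^ k * fact k))) = (cmod z / sqrt 2) ^ k / sqrt (fact k)" for k
  proof -
    have "sqrt (2 ^ k * fact k) = sqrt 2 ^ k * sqrt (fact k)" by (simp add: real_sqrt_mult real_sqrt_power)
    then show ?thesis by (simp only: norm_divide norm_power norm_of_real) (simp add: power_divide abs_mult)
  qed
  then show ?thesis using summable_power_sqrt_fact[of "cmod z / sqrt 2"] by simp
qed

text \<open>The factor exp (t^2 / 2) of the Hermite function cancels the quadratic part of the
  window, so that modulation and translation combine into one exponential exp (\<zeta> t) with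
  \<zeta> = x + i \<xi>, integrated against \<open>gd n\<close>.\<close>

lemma gaussian_coefficient1:
  fixes x \<xi> :: real and n :: nat
  defines "\<zeta> \<equiv> of_real x + \<i> * of_real \<xi> :: complex"
  defines "g \<equiv> \<lambda>t. cis (t * \<xi>) * of_real (pi powr (- 1 / 4) * exp (- (t - x)\<^sup>2 / 2)) * of_real (hermite1 n t)"
  shows "complex_integrable lborel g"
    and "(\<integral>t. g t \<partial>lborel)
      = exp (of_real (- (x\<^sup>2 + \<xi>\<^sup>2) / 4) + \<i> * of_real (x * \<xi> / 2)) * (\<zeta> ^ n / of_real (sqrt (2 ^ n * fact n)))"
proof -
  define c where "c = (pi powr (- 1 / 4) * pi powr (- 1 / 4)) * (- 1) ^ n / sqrt (2 ^ n * fact n) * exp (- x\<^sup>2 / 2)"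
  have g: "g t = of_real c * (exp (\<zeta> * of_real t) * of_real (gd n t))" for t
  proof -
    have "cis (t * \<xi>) * of_real (exp (- (t - x)\<^sup>2 / 2)) * of_real (exp (t\<^sup>2 / 2))
      = of_real (exp (- x\<^sup>2 / 2)) * exp (\<zeta> * of_real t)"
    proof -
      have "\<i> * of_real (t * \<xi>) + of_real (- (t - x)\<^sup>2 / 2) + of_real (t\<^sup>2 / 2) = of_real (- x\<^sup>2 / 2) + \<zeta> * of_real t"
        by (simp add: \<zeta>_def complex_eq_iff power2_eq_square field_simps)
      then show ?thesis unfolding cis_conv_exp exp_of_real[symmetric] by (simp only: exp_add[symmetric])
    qed
    moreover have "g t = of_real ((pi powr (- 1 / 4) * pi powr (- 1 / 4)) * (- 1) ^ n / sqrt (2 ^ n * fact n)) *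
       (cis (t * \<xi>) * of_real (exp (- (t - x)\<^sup>2 / 2)) * of_real (exp (t\<^sup>2 / 2))) * of_real (gd n t)"
      unfolding g_def hermite1_gd by simp
    ultimately show ?thesis unfolding c_def by (simp only: of_real_mult mult.assoc)
  qed
  show "complex_integrable lborel g"
    unfolding g[abs_def] gd_def by (intro integrable_mult_right exp_poly_gaussian_integrable)
  have pp: "pi powr (- 1 / 4) * pi powr (- 1 / 4) * sqrt pi = 1"
    by (simp add: powr_half_sqrt[symmetric] flip: powr_add)
  have "(\<integral>t. g t \<partial>lborel) = of_real c * ((- \<zeta>) ^ n * (of_real (sqrt pi) * exp (\<zeta>\<^sup>2 / 4)))"
    unfolding g[abs_def] integral_mult_right_zero gd_exp_integral ..
  also have "\<dots> = of_real (pi powr (- 1 / 4) * pi powr (- 1 / 4) * sqrt pi) * ((- 1) ^ n * (- \<zeta>) ^ n / of_real (sqrt (2 ^ n * fact n)))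
      * (of_real (exp (- x\<^sup>2 / 2)) * exp (\<zeta>\<^sup>2 / 4))"
    unfolding c_def by simp
  also have "(- 1) ^ n * (- \<zeta>) ^ n = \<zeta> ^ n" by (simp flip: power_mult_distrib)
  also have "of_real (exp (- x\<^sup>2 / 2)) * exp (\<zeta>\<^sup>2 / 4)
    = exp (of_real (- (x\<^sup>2 + \<xi>\<^sup>2) / 4) + \<i> * of_real (x * \<xi> / 2))"
  proof -
    have "of_real (- x\<^sup>2 / 2) + \<zeta>\<^sup>2 / 4 = of_real (- (x\<^sup>2 + \<xi>\<^sup>2) / 4) + \<i> * of_real (x * \<xi> / 2)"
      by (simp add: \<zeta>_def complex_eq_iff power2_eq_square field_simps)
    then show ?thesis unfolding exp_of_real[symmetric] by (simp only: exp_add[symmetric])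
  qed
  finally show "(\<integral>t. g t \<partial>lborel)
    = exp (of_real (- (x\<^sup>2 + \<xi>\<^sup>2) / 4) + \<i> * of_real (x * \<xi> / 2)) * (\<zeta> ^ n / of_real (sqrt (2 ^ n * fact n)))"
    unfolding pp by simp
qed

lemma hermite1_norm:
  shows "integrable lborel (\<lambda>t. (hermite1 n t)\<^sup>2)" and "(\<integral>t. (hermite1 n t)\<^sup>2 \<partial>lborel) = 1"
proof -
  define c where "c = (pi powr (- 1 / 4))\<^sup>2 / (2 ^ n * fact n)"
  have h: "(hermite1 n t)\<^sup>2 = c * (poly (hp n * hp n) t * exp (- t\<^sup>2))" for t
  proof -
    have e: "(exp (t\<^sup>2 / 2))\<^sup>2 * (exp (- t\<^sup>2))\<^sup>2 = exp (- t\<^sup>2)"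
      by (simp add: power2_eq_square flip: exp_add)
    have "(hermite1 n t)\<^sup>2 = (pi powr (- 1 / 4))\<^sup>2 * ((- 1) ^ n)\<^sup>2 / (sqrt (2 ^ n * fact n))\<^sup>2 * ((exp (t\<^sup>2 /
      2))\<^sup>2 * (exp (- t\<^sup>2))\<^sup>2) * (poly (hp n) t)\<^sup>2"
      unfolding hermite1_gd gd_def by (simp add: power_mult_distrib power_divide)
    then show ?thesis unfolding e c_def by (simp add: power2_eq_square[of "poly (hp n) t"] flip: power_mult)
  qed
  show "integrable lborel (\<lambda>t. (hermite1 n t)\<^sup>2)" unfolding h
    by (intro integrable_mult_right poly_gaussian_integrable)
  have "(\<integral>t. (hermite1 n t)\<^sup>2 \<partial>lborel) = c * (2 ^ n * fact n * sqrt pi)"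
    unfolding h using gd_norm_integral[of n] by (simp add: gd_def mult.assoc)
  also have "\<dots> = (pi powr (- 1 / 4))\<^sup>2 * sqrt pi" by (simp add: c_def)
  also have "\<dots> = 1" by (simp add: power2_eq_square powr_half_sqrt[symmetric] flip: powr_add)
  finally show "(\<integral>t. (hermite1 n t)\<^sup>2 \<partial>lborel) = 1" .
qed

lemma continuous_hermite1: "continuous_on S (hermite1 n)"
  unfolding hermite1_gd[abs_def] gd_def[abs_def] by (intro continuous_intros) auto

text \<open>The generating function is the Taylor expansion of \<open>w \<mapsto> exp (- w\<^sup>2)\<close> at \<open>t\<close>.\<close>

lemma hermite1_generating:
  fixes \<zeta> :: complex and t :: real
  shows "summable (\<lambda>n. norm (\<zeta> ^ n / of_real (sqrt (2 ^ n * fact n)) * of_real (hermite1 n t)))"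
    and "(\<Sum>n. \<zeta> ^ n / of_real (sqrt (2 ^ n * fact n)) * of_real (hermite1 n t))
      = of_real (pi powr (- 1 / 4)) * exp (of_real (- t\<^sup>2 / 2) + of_real t * \<zeta> - \<zeta>\<^sup>2 / 4)"
proof -
  define cp where "cp n = map_poly complex_of_real (hp n)" for n
  define cg where "cg n w = poly (cp n) w * exp (- w\<^sup>2)" for n w
  have cp: "cp (Suc n) = pderiv (cp n) - [:0, 2:] * cp n" for n
    by (rule poly_eqI) (simp add: cp_def coeff_map_poly coeff_pderiv coeff_pCons split: nat.split)
  have cgd: "(cg n has_field_derivative cg (Suc n) w) (at w)" for n w
    unfolding cg_def cp by (auto intro!: derivative_eq_intros simp: algebra_simps)
  have it: "(deriv ^^ n) (\<lambda>w. exp (- w\<^sup>2)) = cg n" for n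
  proof (induction n)
    case 0
    then show ?case by (simp add: cg_def cp_def fun_eq_iff map_poly_1')
  next
    case (Suc n)
    have "(deriv ^^ Suc n) (\<lambda>w::complex. exp (- w\<^sup>2)) = deriv (cg n)"
      unfolding funpow.simps o_apply Suc ..
    also have "\<dots> = cg (Suc n)" using DERIV_imp_deriv[OF cgd] by auto
    finally show ?case .
  qed
  have cgt: "cg n (of_real t) = of_real (gd n t)" for n
  proof -
    have "poly (map_poly complex_of_real p) (of_real t) = of_real (poly p t)" for p
      by (induction p) (auto simp: map_poly_pCons)
    then show ?thesis by (simp add: cg_def cp_def gd_def exp_of_real[symmetric])
  qed
  have sums: "(\<lambda>n. of_real (gd n t) / fact n * z ^ n) sums exp (- (of_real t + z)\<^sup>2)" for z :: complex
  proof -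
    have "(\<lambda>n. (deriv ^^ n) (\<lambda>w. exp (- w\<^sup>2)) (of_real t) / fact n * ((of_real t + z) - of_real t) ^ n)
       sums exp (- (of_real t + z)\<^sup>2)"
      by (rule holomorphic_power_series[of _ _ "cmod z + 1"]) (auto intro!: holomorphic_intros simp: dist_norm)
    then show ?thesis unfolding it cgt by simp
  qed
  define c where "c = pi powr (- 1 / 4) * exp (t\<^sup>2 / 2)"
  \<comment> \<open>The Taylor series is evaluated at the displacement - \<zeta> / 2: the two square
    roots of 2^n n! combine to the n! of the series and a power of 1 / 2.\<close>
  have tm: "\<zeta> ^ n / of_real (sqrt (2 ^ n * fact n)) * of_real (hermite1 n t)
     = of_real c * (of_real (gd n t) / fact n * (- \<zeta> / 2) ^ n)" for n
  proof -
    have "\<zeta> ^ n / of_real (sqrt (2 ^ n * fact n)) * of_real (hermite1 n t)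
       = of_real c * (of_real (gd n t) * ((- 1) ^ n * \<zeta> ^ n) / of_real (sqrt (2 ^ n * fact n) * sqrt (2 ^ n * fact n)))"
    proof -
      have gen: "z / a * (p * m / a * e * g) = p * e * (g * (m * z) / (a * a))" for z a p m e g :: complex
        by (simp add: divide_inverse ac_simps)
      show ?thesis
        unfolding hermite1_gd c_def of_real_mult of_real_divide of_real_power of_real_minus of_real_1 by (rule gen)
    qed
    also have "sqrt (2 ^ n * fact n) * sqrt (2 ^ n * fact n) = 2 ^ n * fact n" by simp
    also have "(- 1) ^ n * \<zeta> ^ n = (- \<zeta>) ^ n" by (simp flip: power_mult_distrib)
    also have "of_real c * (of_real (gd n t) * (- \<zeta>) ^ n / of_real (2 ^ n * fact n))
      = of_real c * (of_real (gd n t) / fact n * (- \<zeta> / 2) ^ n)"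
      unfolding power_divide by (simp add: ac_simps)
    finally show ?thesis .
  qed
  have "summable (\<lambda>n. norm (of_real (gd n t) / fact n * (- \<zeta> / 2) ^ n))"
  proof (rule powser_insidea[OF sums_summable[OF sums]])
    have "norm (- \<zeta> / 2) = cmod \<zeta> / 2" by (simp add: norm_divide)
    moreover have "norm (complex_of_real (cmod \<zeta> + 1)) = cmod \<zeta> + 1" unfolding norm_of_real by simp
    ultimately show "norm (- \<zeta> / 2) < norm (complex_of_real (cmod \<zeta> + 1))"
      using norm_ge_zero[of \<zeta>] by linarith
  qed
  from summable_mult[OF this, of "\<bar>c\<bar>"]
  show "summable (\<lambda>n. norm (\<zeta> ^ n / of_real (sqrt (2 ^ n * fact n)) * of_real (hermite1 n t)))"
    unfolding tm norm_mult[of "of_real c"] norm_of_real .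
  have "(\<Sum>n. \<zeta> ^ n / of_real (sqrt (2 ^ n * fact n)) * of_real (hermite1 n t)) = of_real c * exp (- (of_real t + - \<zeta> / 2)\<^sup>2)"
    unfolding tm by (rule sums_unique[symmetric, OF sums_mult[OF sums]])
  also have "\<dots> = of_real (pi powr (- 1 / 4)) * (exp (of_real (t\<^sup>2 / 2)) * exp (- (of_real t + - \<zeta> / 2)\<^sup>2))"
    unfolding c_def of_real_mult exp_of_real by (simp only: mult.assoc)
  also have "exp (of_real (t\<^sup>2 / 2)) * exp (- (of_real t + - \<zeta> / 2)\<^sup>2)
    = exp (of_real (- t\<^sup>2 / 2) + of_real t * \<zeta> - \<zeta>\<^sup>2 / 4)"
  proof -
    have "of_real (t\<^sup>2 / 2) + (- (of_real t + - \<zeta> / 2)\<^sup>2) = of_real (- t\<^sup>2 / 2) + of_real t * \<zeta> - \<zeta>\<^sup>2 / 4"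
      by (simp add: power2_eq_square field_simps)
    then show ?thesis by (simp only: exp_add[symmetric])
  qed
  finally show "(\<Sum>n. \<zeta> ^ n / of_real (sqrt (2 ^ n * fact n)) * of_real (hermite1 n t))
      = of_real (pi powr (- 1 / 4)) * exp (of_real (- t\<^sup>2 / 2) + of_real t * \<zeta> - \<zeta>\<^sup>2 / 4)" .
qed

section \<open>From one variable to several\<close>

text \<open>Lebesgue measure is the image of a product measure indexed by \<open>Basis\<close>,
  whose elements are the vectors \<open>axis i 1\<close>; F carries the factors over to this index
  set.\<close>

lemma integral_prod_cart:
  fixes f :: "'n::finite \<Rightarrow> real \<Rightarrow> complex"
  assumes f: "\<And>i. integrable lborel (f i)"
  shows "(\<integral>x. (\<Prod>i\<in>UNIV. f i (x $ i)) \<partial>(lborel :: (real ^ 'n) measure))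
    = (\<Prod>i\<in>UNIV. \<integral>t. f i t \<partial>lborel)"
    and "integrable lborel (\<lambda>x::real ^ 'n. \<Prod>i\<in>UNIV. f i (x $ i))"
proof -
  interpret product_sigma_finite "\<lambda>_::real ^ 'n. lborel :: real measure" ..
  have inj: "inj (\<lambda>i::'n. axis i (1::real))" by (auto simp: inj_on_def axis_eq_axis)
  have B: "(Basis :: (real ^ 'n) set) = range (\<lambda>i. axis i 1)" by (auto simp: Basis_vec_def)
  define F where "F b = f (inv (\<lambda>i. axis i 1) b)" for b :: "real ^ 'n"
  have F: "F (axis i 1) = f i" for i unfolding F_def using inv_f_f[OF inj, of i] by simp
  have P: "(\<Prod>b\<in>Basis. G b) = (\<Prod>i\<in>UNIV. G (axis i 1))" for G :: "real ^ 'n \<Rightarrow> complex"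
    unfolding B by (subst prod.reindex[OF inj]) simp
  define T where "T x = (\<Sum>b\<in>Basis. x b *\<^sub>R b)" for x :: "real ^ 'n \<Rightarrow> real"
  have T: "T x $ i = x (axis i 1)" for x i
    unfolding T_def cart_eq_inner_axis by (rule inner_sum_left_Basis) (simp add: axis_in_Basis_iff)
  have intF: "integrable lborel (F b)" for b unfolding F_def by (rule f)
  have Tm: "T \<in> measurable (\<Pi>\<^sub>M b\<in>Basis. lborel) borel" unfolding T_def by measurable
  have fm: "(\<lambda>x::real ^ 'n. \<Prod>i\<in>UNIV. f i (x $ i)) \<in> borel_measurable borel"
  proof (rule borel_measurable_prod)
    fix i :: 'n
    have "f i \<in> borel_measurable borel" using f[of i] by auto
    moreover have "(\<lambda>x::real ^ 'n. x $ i) \<in> borel_measurable borel"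
      by (intro borel_measurable_continuous_onI continuous_intros)
    ultimately show "(\<lambda>x::real ^ 'n. f i (x $ i)) \<in> borel_measurable borel"
      by (rule measurable_compose[rotated])
  qed
  have eq: "(\<Prod>i\<in>UNIV. f i (T x $ i)) = (\<Prod>b\<in>Basis. F b (x b))" for x
    by (simp add: P F T)
  have lb: "lborel = distr (\<Pi>\<^sub>M b\<in>(Basis :: (real ^ 'n) set). lborel) borel T"
    unfolding T_def by (rule lborel_eq)
  show "(\<integral>x. (\<Prod>i\<in>UNIV. f i (x $ i)) \<partial>(lborel :: (real ^ 'n) measure))
    = (\<Prod>i\<in>UNIV. \<integral>t. f i t \<partial>lborel)"
    unfolding lb integral_distr[OF Tm fm] eq product_integral_prod[OF finite_Basis intF] by (simp add: P F)
  show "integrable lborel (\<lambda>x::real ^ 'n. \<Prod>i\<in>UNIV. f i (x $ i))"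
    unfolding lb integrable_distr_eq[OF Tm fm] eq by (rule product_integrable_prod[OF finite_Basis intF])
qed

text \<open>Monomials of the Bargmann-Fock space: with respect to the weight exp (- |X|^2 / 2) they
  are orthogonal, and their squared norms all equal (2 pi)^\<open>CARD('n)\<close>.\<close>

definition mon :: "('n::finite \<Rightarrow> nat) \<Rightarrow> (real ^ 'n) \<times> (real ^ 'n) \<Rightarrow> complex" where
  "mon \<alpha> X = (\<Prod>i\<in>UNIV. zc X i ^ \<alpha> i / of_real (sqrt (2 ^ \<alpha> i * fact (\<alpha> i))))"

text \<open>The factor shared by all Hermite coefficients of a shifted Gaussian. The modulus is the
  Gaussian of exponent 1 / 4; the phase stems from \<open>tf_shift\<close> modulating after it
  translates.\<close>

definition gph :: "(real ^ 'n) \<times> (real ^ 'n) \<Rightarrow> complex" where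
  "gph X = exp (of_real (- (norm X)\<^sup>2 / 4) + \<i> * of_real (fst X \<bullet> snd X / 2))"

lemma norm_gph: "cmod (gph X) = exp (- (norm X)\<^sup>2 / 4)"
  by (simp add: gph_def norm_exp_eq_Re)

lemma summable_mon: "(\<lambda>\<alpha>. norm (mon \<alpha> X)) summable_on UNIV"
  unfolding mon_def by (rule prod_multiindex_summable(1)[OF summable_power_sqrt_fact2])

lemma tf_shift_gaussian_prod:
  "tf_shift x \<xi> gaussian y =
    (\<Prod>i\<in>UNIV. cis (y $ i * \<xi> $ i) * of_real (pi powr (- 1 / 4) * exp (- (y $ i - x $ i)\<^sup>2 / 2)))"
proof -
  have "cis (y \<bullet> \<xi>) = (\<Prod>i\<in>UNIV. cis (y $ i * \<xi> $ i))"
    unfolding cis_conv_exp by (simp add: inner_vec_def sum_distrib_left flip: exp_sum)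
  moreover have "pi powr (- real CARD('a) / 4) = (\<Prod>i\<in>(UNIV :: 'a set). pi powr (- 1 / 4))"
  proof -
    have "(pi powr (- 1 / 4)) ^ CARD('a) = pi powr (- 1 / 4 * real CARD('a))"
      by (simp add: powr_realpow[symmetric] powr_powr)
    then show ?thesis by simp
  qed
  moreover have "exp (- (norm (y - x))\<^sup>2 / 2) = (\<Prod>i\<in>UNIV. exp (- (y $ i - x $ i)\<^sup>2 / 2))"
  proof -
    have "(norm (y - x))\<^sup>2 = (\<Sum>i\<in>UNIV. (y $ i - x $ i)\<^sup>2)"
      by (simp add: norm_vec_def L2_set_def sum_nonneg)
    then show ?thesis by (simp add: sum_negf sum_divide_distrib flip: exp_sum)
  qed
  ultimately show ?thesis
    by (simp add: tf_shift_def gaussian_def prod.distrib)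
qed

lemma continuous_hermite: "continuous_on S (hermite \<alpha>)"
  unfolding hermite_def[abs_def]
  by (intro continuous_intros continuous_on_compose2[OF continuous_hermite1[of UNIV]]) auto

lemma continuous_tf_shift_gaussian: "continuous_on S (tf_shift x \<xi> gaussian)"
  unfolding tf_shift_def[abs_def] gaussian_def[abs_def] cis_conv_exp by (intro continuous_intros) auto

lemma L2_form_continuous:
  assumes "continuous_on UNIV f" "continuous_on UNIV g"
  shows "L2_form f g = (\<integral>x. f x * cnj (g x) \<partial>lborel)"
  unfolding L2_form_def
  by (rule integral_completion) (simp, intro borel_measurable_continuous_onI continuous_intros assms)

lemma gph_prod:
  "gph (x, \<xi>) = (\<Prod>i\<in>UNIV. exp (of_real (- ((x $ i)\<^sup>2 + (\<xi> $ i)\<^sup>2) / 4) + \<i> * of_real (x $ i * \<xi> $ i / 2)))"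
proof -
  have "(norm (x, \<xi>))\<^sup>2 = (\<Sum>i\<in>UNIV. (x $ i)\<^sup>2 + (\<xi> $ i)\<^sup>2)"
    unfolding norm_sq_zc by (simp add: zc_def cmod_def)
  then have "of_real (- (norm (x, \<xi>))\<^sup>2 / 4) + \<i> * of_real (fst (x, \<xi>) \<bullet> snd (x, \<xi>) / 2)
    = (\<Sum>i\<in>UNIV. of_real (- ((x $ i)\<^sup>2 + (\<xi> $ i)\<^sup>2) / 4) + \<i> * of_real (x $ i * \<xi> $ i / 2))"
  proof -
    assume nrm: "(norm (x, \<xi>))\<^sup>2 = (\<Sum>i\<in>UNIV. (x $ i)\<^sup>2 + (\<xi> $ i)\<^sup>2)"
    have a: "- (norm (x, \<xi>))\<^sup>2 / 4 = (\<Sum>i\<in>UNIV. - ((x $ i)\<^sup>2 + (\<xi> $ i)\<^sup>2) / 4)"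
      unfolding nrm by (simp only: sum_negf[symmetric] sum_divide_distrib)
    have b: "fst (x, \<xi>) \<bullet> snd (x, \<xi>) / 2 = (\<Sum>i\<in>UNIV. x $ i * \<xi> $ i / 2)"
      by (simp add: inner_vec_def sum_divide_distrib)
    show ?thesis unfolding a b of_real_sum sum_distrib_left sum.distrib[symmetric] ..
  qed
  then show ?thesis unfolding gph_def by (simp only: exp_sum finite)
qed

text \<open>All factors split over the coordinates, which reduces the claim to one variable. The
  conjugate appears because x + i \<xi> is the conjugate of \<open>zc\<close>.\<close>

lemma hermite_series_gaussian:
  "hermite_series (tf_shift (fst X) (snd X) gaussian) \<alpha> = gph X * cnj (mon \<alpha> X)"
proof -
  obtain x \<xi> where X: "X = (x, \<xi>)" by (metis surj_pair)
  define g where "g i t = cis (t * \<xi> $ i) * of_real (pi powr (- 1 / 4) * exp (- (t - x $ i)\<^sup>2 / 2)) * of_real (hermite1 (\<alpha>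
    i) t)" for i t
  have "hermite_series (tf_shift x \<xi> gaussian) \<alpha> = (\<integral>y. tf_shift x \<xi> gaussian y * cnj (hermite \<alpha> y) \<partial>lborel)"
    unfolding hermite_series_def by (rule L2_form_continuous[OF continuous_tf_shift_gaussian continuous_hermite])
  also have "\<dots> = (\<integral>y. (\<Prod>i\<in>UNIV. g i (y $ i)) \<partial>lborel)"
    unfolding tf_shift_gaussian_prod hermite_def g_def by (simp add: prod.distrib)
  also have "\<dots> = (\<Prod>i\<in>UNIV. \<integral>t. g i t \<partial>lborel)"
    by (rule integral_prod_cart(1)) (unfold g_def, rule gaussian_coefficient1(1))
  also have "\<dots> = (\<Prod>i\<in>UNIV. exp (of_real (- ((x $ i)\<^sup>2 + (\<xi> $ i)\<^sup>2) / 4) + \<i> * of_real (x $ i * \<xi> $ i / 2)) *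
     ((of_real (x $ i) + \<i> * of_real (\<xi> $ i)) ^ \<alpha> i / of_real (sqrt (2 ^ \<alpha> i * fact (\<alpha> i)))))"
    unfolding g_def gaussian_coefficient1(2) ..
  also have "\<dots> = gph (x, \<xi>) * (\<Prod>i\<in>UNIV. cnj (zc X i) ^ \<alpha> i / of_real (sqrt (2 ^ \<alpha> i * fact (\<alpha> i))))"
  proof -
    have "of_real (x $ i) + \<i> * of_real (\<xi> $ i) = cnj (zc X i)" for i
      by (simp add: X zc_def complex_eq_iff)
    then show ?thesis by (simp only: prod.distrib gph_prod)
  qed
  also have "\<dots> = gph X * cnj (mon \<alpha> X)" unfolding mon_def X by simp
  finally show ?thesis by (simp add: X)
qed

text \<open>A product of one-dimensional generating functions at the points \<open>zc X i\<close>.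
  The conjugated form is the one that the L2 form integrates against a function.\<close>

lemma hermite_expansion_gaussian:
  shows "(\<lambda>\<alpha>. norm (mon \<alpha> X * hermite \<alpha> y)) summable_on UNIV"
    and "(\<Sum>\<^sub>\<infinity>\<alpha>. cnj (gph X * cnj (mon \<alpha> X)) * hermite \<alpha> y) = cnj (tf_shift (fst X) (snd X) gaussian y)"
proof -
  obtain x \<xi> where X: "X = (x, \<xi>)" by (metis surj_pair)
  define f where "f i k = zc X i ^ k / of_real (sqrt (2 ^ k * fact k)) * of_real (hermite1 k (y $ i))" for i k
  have f: "mon \<alpha> X * hermite \<alpha> y = (\<Prod>i\<in>UNIV. f i (\<alpha> i))" for \<alpha>
    unfolding f_def mon_def hermite_def of_real_prod prod.distrib ..
  have s: "summable (\<lambda>k. norm (f i k))" for i unfolding f_def by (rule hermite1_generating(1))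
  show "(\<lambda>\<alpha>. norm (mon \<alpha> X * hermite \<alpha> y)) summable_on UNIV"
    unfolding f by (rule prod_multiindex_summable(1)[OF s])
  have "(\<Sum>\<^sub>\<infinity>\<alpha>. cnj (gph X * cnj (mon \<alpha> X)) * hermite \<alpha> y)
    = cnj (gph X) * (\<Sum>\<^sub>\<infinity>\<alpha>. mon \<alpha> X * hermite \<alpha> y)"
    by (simp add: mult.assoc infsum_cmult_right')
  also have "(\<Sum>\<^sub>\<infinity>\<alpha>. mon \<alpha> X * hermite \<alpha> y) = (\<Prod>i\<in>UNIV. \<Sum>k. f i k)"
    unfolding f by (rule prod_multiindex_summable(2)[OF s])
  also have "\<dots> = (\<Prod>i\<in>UNIV. of_real (pi powr (- 1 / 4)) *
      exp (of_real (- (y $ i)\<^sup>2 / 2) + of_real (y $ i) * zc X i - (zc X i)\<^sup>2 / 4))"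
    unfolding f_def hermite1_generating(2) ..
  also have "cnj (gph X) * \<dots> = (\<Prod>i\<in>UNIV. cnj (cis (y $ i * \<xi> $ i) * of_real (pi powr (- 1 / 4) * exp (- (y $ i - x $
    i)\<^sup>2 / 2))))"
    unfolding X gph_prod cnj_prod prod.distrib[symmetric]
  proof (rule prod.cong[OF refl])
    fix i
    have "cnj (of_real (- ((x $ i)\<^sup>2 + (\<xi> $ i)\<^sup>2) / 4) + \<i> * of_real (x $ i * \<xi> $ i / 2)) +
      (of_real (- (y $ i)\<^sup>2 / 2) + of_real (y $ i) * zc (x, \<xi>) i - (zc (x, \<xi>) i)\<^sup>2 / 4)
      = cnj (\<i> * of_real (y $ i * \<xi> $ i)) + of_real (- (y $ i - x $ i)\<^sup>2 / 2)"
      by (simp add: zc_def complex_eq_iff power2_eq_square field_simps)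
    then have "cnj (exp (of_real (- ((x $ i)\<^sup>2 + (\<xi> $ i)\<^sup>2) / 4) + \<i> * of_real (x $ i * \<xi> $ i / 2))) *
      exp (of_real (- (y $ i)\<^sup>2 / 2) + of_real (y $ i) * zc (x, \<xi>) i - (zc (x, \<xi>) i)\<^sup>2 / 4)
      = cnj (cis (y $ i * \<xi> $ i)) * of_real (exp (- (y $ i - x $ i)\<^sup>2 / 2))"
      unfolding cis_conv_exp exp_cnj exp_of_real[symmetric] by (simp only: exp_add[symmetric])
    then show "cnj (exp (of_real (- ((x $ i)\<^sup>2 + (\<xi> $ i)\<^sup>2) / 4) + \<i> * of_real (x $ i * \<xi> $ i / 2))) *
      (of_real (pi powr (- 1 / 4)) * exp (of_real (- (y $ i)\<^sup>2 / 2) + of_real (y $ i) * zc (x, \<xi>) i - (zc (x, \<xi>) i)\<^sup>2 / 4))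
      = cnj (cis (y $ i * \<xi> $ i) * of_real (pi powr (- 1 / 4) * exp (- (y $ i - x $ i)\<^sup>2 / 2)))"
      by (simp add: mult.left_commute)
  qed
  also have "\<dots> = cnj (tf_shift (fst X) (snd X) gaussian y)"
    unfolding tf_shift_gaussian_prod X by simp
  finally show "(\<Sum>\<^sub>\<infinity>\<alpha>. cnj (gph X * cnj (mon \<alpha> X)) * hermite \<alpha> y)
    = cnj (tf_shift (fst X) (snd X) gaussian y)" .
qed

section \<open>Hermite coefficients of square-integrable functions\<close>

lemma hermite_square_integral:
  shows "integrable lborel (\<lambda>y :: real ^ 'n. (cmod (hermite \<alpha> y))\<^sup>2)"
    and "(\<integral>y. (cmod (hermite \<alpha> y))\<^sup>2 \<partial>(lborel :: (real ^ 'n) measure)) = 1"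
proof -
  have int: "complex_integrable lborel (\<lambda>t. of_real ((hermite1 (\<alpha> i) t)\<^sup>2))" for i
    using hermite1_norm(1) by (simp only: complex_of_real_integrable_eq)
  have eq: "complex_of_real ((cmod (hermite \<alpha> y))\<^sup>2)
    = (\<Prod>i\<in>UNIV. of_real ((hermite1 (\<alpha> i) (y $ i))\<^sup>2))" for y :: "real ^ 'n"
    unfolding hermite_def norm_of_real by (simp add: prod_power_distrib)
  have "complex_integrable lborel (\<lambda>y :: real ^ 'n. of_real ((cmod (hermite \<alpha> y))\<^sup>2))"
    unfolding eq by (rule integral_prod_cart(2)[OF int])
  then show "integrable lborel (\<lambda>y :: real ^ 'n. (cmod (hermite \<alpha> y))\<^sup>2)"
    by (simp only: complex_of_real_integrable_eq)
  have "complex_of_real (\<integral>y. (cmod (hermite \<alpha> y))\<^sup>2 \<partial>(lborel :: (real ^ 'n) measure))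
    = (\<Prod>i\<in>(UNIV :: 'n set). \<integral>t. of_real ((hermite1 (\<alpha> i) t)\<^sup>2) \<partial>lborel)"
    unfolding integral_complex_of_real[symmetric] eq by (rule integral_prod_cart(1)[OF int])
  also have "\<dots> = 1" unfolding integral_complex_of_real hermite1_norm(2) by simp
  finally show "(\<integral>y. (cmod (hermite \<alpha> y))\<^sup>2 \<partial>(lborel :: (real ^ 'n) measure)) = 1"
    by (simp only: of_real_eq_1_iff)
qed

lemma cnj_hermite [simp]: "cnj (hermite \<alpha> y) = hermite \<alpha> y"
  by (simp add: hermite_def)

text \<open>From 2 a b \<le> a^2 + b^2, the summand 1 being the squared norm of the Hermite
  function. What matters is that the bound is uniform in \<alpha>.\<close>

lemma L2_hermite_integrable:
  fixes \<psi> :: "real ^ 'n \<Rightarrow> complex"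
  assumes "\<psi> \<in> L2"
  shows "integrable lebesgue (\<lambda>y. \<psi> y * cnj (hermite \<alpha> y))"
    and "(\<integral>y. norm (\<psi> y * cnj (hermite \<alpha> y)) \<partial>lebesgue) \<le> (L2_norm_sq \<psi> + 1) / 2"
proof -
  have [measurable]: "\<psi> \<in> borel_measurable lebesgue" and i1: "integrable lebesgue (\<lambda>y. (cmod (\<psi> y))\<^sup>2)"
    using assms by (auto simp: L2_def)
  have hb: "hermite \<alpha> \<in> borel_measurable borel"
    by (rule borel_measurable_continuous_onI[OF continuous_hermite])
  have [measurable]: "hermite \<alpha> \<in> borel_measurable lebesgue"
    using hb by (intro measurable_completion) simp
  have nb: "(\<lambda>y. (cmod (hermite \<alpha> y))\<^sup>2) \<in> borel_measurable lborel" using hb by simp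
  have i2: "integrable lebesgue (\<lambda>y. (cmod (hermite \<alpha> y))\<^sup>2)"
    using hermite_square_integral(1)[of \<alpha>] nb by (simp add: integrable_completion)
  have e2: "(\<integral>y. (cmod (hermite \<alpha> y))\<^sup>2 \<partial>lebesgue) = 1"
    using hermite_square_integral(2)[of \<alpha>] nb by (simp add: integral_completion)
  have pw: "norm (\<psi> y * cnj (hermite \<alpha> y)) \<le> ((cmod (\<psi> y))\<^sup>2 + (cmod (hermite \<alpha> y))\<^sup>2) / 2" for y
    using zero_le_power2[of "cmod (\<psi> y) - cmod (hermite \<alpha> y)"] by (simp add: norm_mult power2_diff)
  have i3: "integrable lebesgue (\<lambda>y. ((cmod (\<psi> y))\<^sup>2 + (cmod (hermite \<alpha> y))\<^sup>2) / 2)"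
    using i1 i2 by auto
  show i: "integrable lebesgue (\<lambda>y. \<psi> y * cnj (hermite \<alpha> y))"
  proof (rule Bochner_Integration.integrable_bound[OF i3])
    show "(\<lambda>y. \<psi> y * cnj (hermite \<alpha> y)) \<in> borel_measurable lebesgue"
      unfolding cnj_hermite by measurable
    show "AE y in lebesgue. norm (\<psi> y * cnj (hermite \<alpha> y))
      \<le> norm (((cmod (\<psi> y))\<^sup>2 + (cmod (hermite \<alpha> y))\<^sup>2) / 2)"
      using pw by (intro AE_I2) (simp add: abs_of_nonneg)
  qed
  have "(\<integral>y. norm (\<psi> y * cnj (hermite \<alpha> y)) \<partial>lebesgue)
    \<le> (\<integral>y. ((cmod (\<psi> y))\<^sup>2 + (cmod (hermite \<alpha> y))\<^sup>2) / 2 \<partial>lebesgue)"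
    using i i3 pw by (intro integral_mono) auto
  also have "\<dots> = (L2_norm_sq \<psi> + 1) / 2"
    using i1 i2 e2 by (simp add: L2_norm_sq_def)
  finally show "(\<integral>y. norm (\<psi> y * cnj (hermite \<alpha> y)) \<partial>lebesgue) \<le> (L2_norm_sq \<psi> + 1) / 2" .
qed

lemma hermite_series_bound:
  assumes "\<psi> \<in> L2"
  shows "cmod (hermite_series \<psi> \<alpha>) \<le> (L2_norm_sq \<psi> + 1) / 2"
  unfolding hermite_series_def L2_form_def
  by (rule order.trans[OF integral_norm_bound L2_hermite_integrable(2)[OF assms]])

lemma mi_fact_powr: "mi_fact \<alpha> powr (1 / 2) = sqrt (mi_fact \<alpha>)"
  by (simp add: powr_half_sqrt mi_fact_def prod_nonneg)

lemma mi_fact_pos: "0 < mi_fact \<alpha>"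
  by (simp add: mi_fact_def prod_pos)

text \<open>For each r > 0 the numbers r^k sqrt (k!) stay away from 0, since (1 / r)^k / sqrt (k!)
  tends to 0; a constant is therefore dominated by every growth condition in
  \<open>H_flat_dual\<close>.\<close>

lemma bounded_in_H_flat_dual:
  fixes f :: "('n::finite) series"
  assumes "\<And>\<alpha>. cmod (f \<alpha>) \<le> M"
  shows "f \<in> H_flat_dual"
  unfolding H_flat_dual_def
proof (intro CollectI allI impI)
  fix r :: real assume r: "0 < r"
  have "(\<lambda>k. (1 / r) ^ k / sqrt (fact k)) \<longlonglongrightarrow> 0"
    using r by (intro summable_LIMSEQ_zero summable_power_sqrt_fact) auto
  then have "Bseq (\<lambda>k. (1 / r) ^ k / sqrt (fact k))"
    by (intro convergent_imp_Bseq) (auto simp: convergent_def)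
  then obtain B where B: "0 < B" "\<And>k. norm ((1 / r) ^ k / sqrt (fact k)) \<le> B"
    by (elim BseqE) blast
  have k: "1 \<le> B * (r ^ k * sqrt (fact k))" for k
  proof -
    have "(1 / r) ^ k / sqrt (fact k) \<le> B" using B(2)[of k] r by (simp add: abs_of_nonneg)
    then show ?thesis using r by (simp add: power_divide field_simps)
  qed
  have "1 \<le> (\<Prod>i\<in>UNIV. B * (r ^ \<alpha> i * sqrt (fact (\<alpha> i))))" for \<alpha> :: "'n \<Rightarrow> nat"
    using k by (intro prod_ge_1) auto
  moreover have "(\<Prod>i\<in>UNIV. B * (r ^ \<alpha> i * sqrt (fact (\<alpha> i))))
    = B ^ CARD('n) * (r ^ mi_length \<alpha> * sqrt (mi_fact \<alpha>))" for \<alpha> :: "'n \<Rightarrow> nat"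
  proof -
    have "sqrt (mi_fact \<alpha>) = (\<Prod>i\<in>UNIV. sqrt (fact (\<alpha> i)))"
    proof -
      have "sqrt (\<Prod>i\<in>S. h i) = (\<Prod>i\<in>S. sqrt (h i))" for S and h :: "'n \<Rightarrow> real"
        by (induction S rule: infinite_finite_induct) (auto simp: real_sqrt_mult)
      then show ?thesis by (simp add: mi_fact_def)
    qed
    then show ?thesis unfolding mi_length_def power_sum by (simp add: prod.distrib)
  qed
  ultimately have 1: "1 \<le> B ^ CARD('n) * (r ^ mi_length \<alpha> * sqrt (mi_fact \<alpha>))" for \<alpha> :: "'n \<Rightarrow> nat"
    by simp
  have "0 \<le> M" using assms[of undefined] norm_ge_zero order.trans by blast
  then have "M \<le> M * (B ^ CARD('n) * (r ^ mi_length \<alpha> * sqrt (mi_fact \<alpha>)))" for \<alpha> :: "'n \<Rightarrow> nat"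
    using mult_left_mono[OF 1] by simp
  then have "cmod (f \<alpha>) \<le> (M * B ^ CARD('n)) * r ^ mi_length \<alpha> * mi_fact \<alpha> powr (1 / 2)" for \<alpha>
    using assms[of \<alpha>] order.trans unfolding mi_fact_powr mult.assoc by blast
  then show "\<exists>C. \<forall>\<alpha>. cmod (f \<alpha>) \<le> C * r ^ mi_length \<alpha> * mi_fact \<alpha> powr (1 / 2)" by blast
qed

lemma hermite_series_H_flat_dual: "\<psi> \<in> L2 \<Longrightarrow> hermite_series \<psi> \<in> H_flat_dual"
  by (rule bounded_in_H_flat_dual[OF hermite_series_bound])

text \<open>Reconciles the pairing of coefficients with the L2 form: the expansion of the shifted
  Gaussian is integrated term by term, with the uniform coefficient bound and the summability of
  \<open>mon\<close> as majorant.\<close>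

lemma flat_form_hermite_series_gaussian:
  fixes \<psi> :: "real ^ 'n \<Rightarrow> complex"
  assumes \<psi>: "\<psi> \<in> L2"
  shows "flat_form (hermite_series \<psi>) (hermite_series (tf_shift (fst X) (snd X) gaussian))
    = L2_form \<psi> (tf_shift (fst X) (snd X) gaussian)"
proof -
  define f where "f \<alpha> y = \<psi> y * cnj (hermite \<alpha> y) * cnj (gph X * cnj (mon \<alpha> X))" for \<alpha> and y :: "real ^ 'n"

  have int: "integrable lebesgue (f \<alpha>)" for \<alpha>
    unfolding f_def by (intro integrable_mult_left L2_hermite_integrable(1)[OF \<psi>])
  have pt: "(\<lambda>\<alpha>. norm (f \<alpha> y)) summable_on UNIV" for y
  proof -
    have "(\<lambda>\<alpha>. cmod (\<psi> y) * cmod (gph X) * norm (mon \<alpha> X * hermite \<alpha> y)) summable_on UNIV"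
      by (intro summable_on_cmult_right hermite_expansion_gaussian(1))
    moreover have "norm (f \<alpha> y) = cmod (\<psi> y) * cmod (gph X) * norm (mon \<alpha> X * hermite \<alpha> y)" for \<alpha>
      by (simp add: f_def norm_mult)
    ultimately show ?thesis by simp
  qed
  have sum: "(\<lambda>\<alpha>. \<integral>y. norm (f \<alpha> y) \<partial>lebesgue) summable_on UNIV"
  proof (rule summable_on_comparison_test)
    show "(\<lambda>\<alpha>. ((L2_norm_sq \<psi> + 1) / 2 * cmod (gph X)) * norm (mon \<alpha> X)) summable_on UNIV"
      by (intro summable_on_cmult_right summable_mon)
    fix \<alpha>
    have "(\<integral>y. norm (f \<alpha> y) \<partial>lebesgue)
      = (\<integral>y. norm (\<psi> y * cnj (hermite \<alpha> y)) \<partial>lebesgue) * (cmod (gph X) * norm (mon \<alpha> X))"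
      unfolding f_def norm_mult[of "\<psi> _ * cnj (hermite \<alpha> _)"] by (simp add: norm_mult)
    also have "\<dots> \<le> (L2_norm_sq \<psi> + 1) / 2 * (cmod (gph X) * norm (mon \<alpha> X))"
      by (intro mult_right_mono L2_hermite_integrable(2)[OF \<psi>]) auto
    finally show "(\<integral>y. norm (f \<alpha> y) \<partial>lebesgue) \<le> ((L2_norm_sq \<psi> + 1) / 2 * cmod (gph X)) * norm (mon \<alpha> X)"
      by (simp only: mult.assoc)
  qed auto
  have "L2_form \<psi> (tf_shift (fst X) (snd X) gaussian) = (\<integral>y. (\<Sum>\<^sub>\<infinity>\<alpha>. f \<alpha> y) \<partial>lebesgue)"
  proof -
    have "\<psi> y * cnj (tf_shift (fst X) (snd X) gaussian y) = (\<Sum>\<^sub>\<infinity>\<alpha>. f \<alpha> y)" for y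
    proof -
      have "(\<Sum>\<^sub>\<infinity>\<alpha>. f \<alpha> y)
        = (\<Sum>\<^sub>\<infinity>\<alpha>. \<psi> y * (cnj (gph X * cnj (mon \<alpha> X)) * hermite \<alpha> y))"
        unfolding f_def cnj_hermite by (simp only: ac_simps)
      also have "\<dots> = \<psi> y * cnj (tf_shift (fst X) (snd X) gaussian y)"
        unfolding hermite_expansion_gaussian(2)[symmetric] by (rule infsum_cmult_right')
      finally show ?thesis by simp
    qed
    then show ?thesis by (simp only: L2_form_def)
  qed
  also have "\<dots> = (\<Sum>\<^sub>\<infinity>\<alpha>. \<integral>y. f \<alpha> y \<partial>lebesgue)"
    by (rule infsum_integral(1)[OF int pt sum])
  also have "\<dots> = flat_form (hermite_series \<psi>) (hermite_series (tf_shift (fst X) (snd X) gaussian))"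
    unfolding flat_form_def hermite_series_gaussian f_def integral_mult_left_zero
    unfolding hermite_series_def L2_form_def ..
  finally show ?thesis by simp
qed

subsection \<open>The Bargmann transform of a formal Hermite series\<close>

definition barg :: "('n::finite) series \<Rightarrow> (real ^ 'n) \<times> (real ^ 'n) \<Rightarrow> complex" where
  "barg f X = (\<Sum>\<^sub>\<infinity>\<alpha>. f \<alpha> * mon \<alpha> X)"

lemma summable_mi_geometric: "(\<lambda>\<alpha>::('n::finite \<Rightarrow> nat). (1 / 2 :: real) ^ mi_length \<alpha>) summable_on UNIV"
proof -
  have "(\<lambda>\<alpha>::'n \<Rightarrow> nat. norm (\<Prod>i\<in>UNIV. (1 / 2 :: complex) ^ \<alpha> i)) summable_on UNIV"
    by (rule prod_multiindex_summable(1)) (simp add: norm_power norm_divide summable_geometric)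
  moreover have "norm (\<Prod>i\<in>UNIV. (1 / 2 :: complex) ^ \<alpha> i) = (1 / 2) ^ mi_length \<alpha>" for \<alpha> :: "'n \<Rightarrow> nat"
    by (simp add: mi_length_def power_sum norm_power norm_divide flip: prod_norm)
  ultimately show ?thesis by simp
qed

lemma norm_mon: "cmod (mon \<alpha> X) = (\<Prod>i\<in>UNIV. cmod (zc X i) ^ \<alpha> i / sqrt (2 ^ \<alpha> i * fact (\<alpha> i)))"
  unfolding mon_def by (simp add: norm_divide norm_power abs_of_nonneg flip: prod_norm)

lemma sqrt_mi_fact: "sqrt (mi_fact \<alpha>) = (\<Prod>i\<in>UNIV. sqrt (fact (\<alpha> i)))"
proof -
  have "sqrt (\<Prod>i\<in>S. h i) = (\<Prod>i\<in>S. sqrt (h i))" for S :: "'a set" and h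
    by (induction S rule: infinite_finite_induct) (auto simp: real_sqrt_mult)
  then show ?thesis by (simp add: mi_fact_def)
qed

lemma norm_mon_le:
  assumes "\<And>i. cmod (zc X i) \<le> R"
  shows "cmod (mon \<alpha> X) \<le> R ^ mi_length \<alpha> / sqrt (mi_fact \<alpha>)"
proof -
  have "cmod (mon \<alpha> X) \<le> (\<Prod>i\<in>UNIV. R ^ \<alpha> i / sqrt (fact (\<alpha> i)))"
    unfolding norm_mon
  proof (intro prod_mono conjI)
    fix i
    have "cmod (zc X i) ^ \<alpha> i \<le> R ^ \<alpha> i" by (intro power_mono assms) auto
    moreover have "0 \<le> R" using assms[of i] norm_ge_zero order.trans by blast
    ultimately show "cmod (zc X i) ^ \<alpha> i / sqrt (2 ^ \<alpha> i * fact (\<alpha> i)) \<le> R ^ \<alpha> i / sqrt (fact (\<alpha> i))"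
      by (intro frac_le) auto
  qed auto
  then show ?thesis by (simp add: mi_length_def power_sum sqrt_mi_fact prod_dividef)
qed

text \<open>The growth sqrt (\<alpha>!) allowed to coefficients is cancelled by the normalisation of
  the monomials. Since r in \<open>H_flat_dual\<close> is arbitrary, it can be taken with r R \<le>
  1 / 2.\<close>

lemma H_flat_dual_bound:
  fixes f :: "('n::finite) series"
  assumes f: "f \<in> H_flat_dual" and R: "0 \<le> R"
  obtains C where "0 \<le> C" "\<And>\<alpha> X. (\<And>i. cmod (zc X i) \<le> R) \<Longrightarrow> cmod (f \<alpha> * mon \<alpha> X)
    \<le> C * (1 / 2) ^ mi_length \<alpha>"
proof -
  define r where "r = 1 / (2 * (R + 1))"
  have r: "0 < r" "r * R \<le> 1 / 2" using R by (auto simp: r_def field_simps)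
  obtain C where C: "\<And>\<alpha>. cmod (f \<alpha>) \<le> C * r ^ mi_length \<alpha> * mi_fact \<alpha> powr (1 / 2)"
    using f r(1) unfolding H_flat_dual_def by blast
  show thesis
  proof (rule that[of "\<bar>C\<bar>"])
    fix \<alpha> :: "'n \<Rightarrow> nat" and X :: "(real ^ 'n) \<times> (real ^ 'n)"
    assume X: "\<And>i. cmod (zc X i) \<le> R"
    have m: "0 < sqrt (mi_fact \<alpha>)" by (simp add: mi_fact_pos)
    have "cmod (f \<alpha> * mon \<alpha> X) \<le> (C * r ^ mi_length \<alpha> * sqrt (mi_fact \<alpha>)) * (R ^ mi_length \<alpha> / sqrt
      (mi_fact \<alpha>))"
      unfolding norm_mult using C[of \<alpha>] norm_mon_le[OF X, of \<alpha>]
      by (intro mult_mono) (auto simp: mi_fact_powr intro: order.trans[OF norm_ge_zero])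
    also have "\<dots> = C * (r * R) ^ mi_length \<alpha>" using m by (simp add: power_mult_distrib)
    also have "\<dots> \<le> \<bar>C\<bar> * (r * R) ^ mi_length \<alpha>" using r R by (intro mult_right_mono) auto
    also have "\<dots> \<le> \<bar>C\<bar> * (1 / 2) ^ mi_length \<alpha>" using r R by (intro mult_left_mono power_mono) auto
    finally show "cmod (f \<alpha> * mon \<alpha> X) \<le> \<bar>C\<bar> * (1 / 2) ^ mi_length \<alpha>" .
  qed simp
qed

lemma H_flat_dual_summable:
  assumes "f \<in> H_flat_dual"
  shows "(\<lambda>\<alpha>. norm (f \<alpha> * mon \<alpha> X)) summable_on UNIV"
proof -
  obtain C where "0 \<le> C" "\<And>\<alpha> Y. (\<And>i. cmod (zc Y i) \<le> norm X) \<Longrightarrow> cmod (f \<alpha> * mon \<alpha> Y)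
    \<le> C * (1 / 2) ^ mi_length \<alpha>"
    using H_flat_dual_bound[OF assms norm_ge_zero[of X]] by metis
  then show ?thesis
    by (intro summable_on_comparison_test[OF summable_on_cmult_right[OF summable_mi_geometric, of C]])
       (auto simp: cmod_zc_le)
qed

lemma continuous_mon: "continuous_on S (mon \<alpha>)"
  unfolding mon_def[abs_def] by (intro continuous_intros) auto

lemma continuous_gph: "continuous_on S gph"
  unfolding gph_def[abs_def] by (intro continuous_intros) auto

text \<open>The partial sums are polynomials and converge uniformly on bounded sets by the geometric
  majorant; continuity and holomorphy survive in the limit.\<close>

lemma sep_entire_barg:
  fixes f :: "('n::finite) series"
  assumes f: "f \<in> H_flat_dual"
  shows "sep_entire (barg f)"
  unfolding sep_entire_def
proof (intro conjI allI)
  have ul: "uniform_limit S (\<lambda>F y. \<Sum>\<alpha>\<in>F. f \<alpha> * mon \<alpha> (u y)) (\<lambda>y. barg f (u y))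
    (finite_subsets_at_top UNIV)"
    if S: "\<And>y. y \<in> S \<Longrightarrow> norm (u y) \<le> R" and "0 \<le> R" for S :: "'x set" and u R
  proof -
    obtain C where C: "0 \<le> C" "\<And>\<alpha> Y. (\<And>i. cmod (zc Y i) \<le> R) \<Longrightarrow> cmod (f \<alpha> * mon \<alpha> Y)
      \<le> C * (1 / 2) ^ mi_length \<alpha>"
      using H_flat_dual_bound[OF f \<open>0 \<le> R\<close>] by metis
    show ?thesis unfolding barg_def
      by (rule Weierstrass_m_test_general[OF _ summable_on_cmult_right[OF summable_mi_geometric, of C]])
         (rule C(2), rule order.trans[OF cmod_zc_le S])
  qed
  show "continuous_on UNIV (barg f)"
  proof (rule continuous_at_imp_continuous_on, rule ballI)
    fix X :: "(real ^ 'n) \<times> (real ^ 'n)"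
    have "continuous_on (ball 0 (norm X + 1)) (barg f)"
      by (rule uniform_limit_theorem[OF _ ul[of _ "\<lambda>y. y" "norm X + 1"]])
         (auto intro!: always_eventually continuous_intros continuous_mon)
    then show "isCont (barg f) X" by (simp add: continuous_on_eq_continuous_at)
  qed
  fix i :: 'n and X :: "(real ^ 'n) \<times> (real ^ 'n)"
  have emb: "norm (emb i s) \<le> cmod s" for s
  proof -
    have "(norm (emb i s))\<^sup>2 = (cmod s)\<^sup>2"
      unfolding norm_sq_zc by (simp add: zc_emb if_distrib[of cmod] if_distrib[of "\<lambda>x. x\<^sup>2"] cong: if_cong)
    then show ?thesis by (simp add: power2_eq_iff_nonneg)
  qed
  have "(\<lambda>s. barg f (X + emb i s)) holomorphic_on ball 0 r" for r
  proof (rule holomorphic_uniform_limit)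
    have "uniform_limit (cball 0 r) (\<lambda>F s. \<Sum>\<alpha>\<in>F. f \<alpha> * mon \<alpha> (X + emb i s)) (\<lambda>s. barg f (X +
      emb i s)) (finite_subsets_at_top UNIV)"
    proof (cases "0 \<le> r")
      case True
      show ?thesis
      proof (rule ul[of _ _ "norm X + r"])
        fix s :: complex assume "s \<in> cball 0 r"
        then show "norm (X + emb i s) \<le> norm X + r"
          using norm_triangle_ineq[of X "emb i s"] emb[of s] by simp
      qed (use True in simp)
    qed simp
    then show "uniform_limit (cball 0 r) (\<lambda>F s. \<Sum>\<alpha>\<in>F. f \<alpha> * mon \<alpha> (X + emb i s)) (\<lambda>s. barg f
      (X + emb i s)) (finite_subsets_at_top UNIV)" .
    have hol: "(\<lambda>s. mon \<alpha> (X + emb i s)) holomorphic_on T" for \<alpha> T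
    proof -
      have h: "(\<lambda>s. if j = i then s else 0) holomorphic_on T" for j
        by (cases "j = i") (auto intro: holomorphic_intros)
      show ?thesis unfolding mon_def zc_add zc_emb
        by (intro holomorphic_on_prod holomorphic_on_divide holomorphic_on_power holomorphic_on_add holomorphic_on_const h) auto
    qed
    show "\<forall>\<^sub>F F in finite_subsets_at_top UNIV. continuous_on (cball 0 r) (\<lambda>s. \<Sum>\<alpha>\<in>F. f \<alpha> * mon
      \<alpha> (X + emb i s)) \<and>
       (\<lambda>s. \<Sum>\<alpha>\<in>F. f \<alpha> * mon \<alpha> (X + emb i s)) holomorphic_on ball 0 r"
      by (intro always_eventually allI conjI holomorphic_on_imp_continuous_on holomorphic_on_sum holomorphic_on_mult holomorphic_on_const hol)
  qed auto
  then have "(\<lambda>s. barg f (X + emb i s)) holomorphic_on (\<Union>n\<in>(UNIV :: nat set). ball 0 (real n))"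
    by (intro holomorphic_on_UN_open) auto
  moreover have "(\<Union>n\<in>(UNIV :: nat set). ball (0 :: complex) (real n)) = UNIV"
    by (simp add: set_eq_iff dist_norm reals_Archimedean2)
  ultimately show "(\<lambda>s. barg f (X + emb i s)) holomorphic_on UNIV" by simp
qed

text \<open>The source of all local estimates: the dependence on f is confined to an entire factor,
  and the rest is a fixed Gaussian with a phase.\<close>

lemma gauss_stft_barg:
  "gauss_stft f X = stft_const TYPE('n) * cnj (gph X) * barg f X" for f :: "('n::finite) series"
proof -
  obtain x \<xi> where X: "X = (x, \<xi>)" by (metis surj_pair)
  have "gauss_stft f X = stft_const TYPE('n) * (\<Sum>\<^sub>\<infinity>\<alpha>. f \<alpha> * cnj (gph X * cnj (mon \<alpha> X)))"
    using hermite_series_gaussian[of X] by (simp add: gauss_stft_def flat_form_def X)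
  also have "(\<Sum>\<^sub>\<infinity>\<alpha>. f \<alpha> * cnj (gph X * cnj (mon \<alpha> X)))
    = (\<Sum>\<^sub>\<infinity>\<alpha>. cnj (gph X) * (f \<alpha> * mon \<alpha> X))"
    by (simp add: ac_simps)
  also have "\<dots> = cnj (gph X) * barg f X" unfolding barg_def by (rule infsum_cmult_right')
  finally show ?thesis by (simp add: mult.assoc)
qed

definition c0 :: "'n::finite itself \<Rightarrow> real" where
  "c0 _ = (2 * pi) powr (- real CARD('n) / 2)"

lemma c0_pos: "0 < c0 TYPE('n::finite)"
  by (simp add: c0_def)

lemma stft_const_c0: "stft_const TYPE('n::finite) = of_real (c0 TYPE('n))"
  by (simp add: stft_const_def c0_def)

lemma norm_gauss_stft: "cmod (gauss_stft f X) = c0 TYPE('n) * gmod (1 / 4) (barg f) X" for f :: "('n::finite) series"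
  unfolding gauss_stft_barg gmod_def stft_const_c0 using c0_pos[where 'n = 'n]
  by (simp add: norm_mult norm_gph)

lemma continuous_gauss_stft: "f \<in> H_flat_dual \<Longrightarrow> continuous_on S (gauss_stft f)"
  unfolding gauss_stft_barg[abs_def]
  by (intro continuous_intros continuous_gph continuous_on_subset[OF sep_entireD(1)[OF sep_entire_barg]]) auto

lemma H_flat_dual_diff:
  assumes "f \<in> H_flat_dual" "g \<in> H_flat_dual"
  shows "(\<lambda>\<alpha>. f \<alpha> - g \<alpha>) \<in> H_flat_dual"
  unfolding H_flat_dual_def
proof (intro CollectI allI impI)
  fix r :: real assume r: "0 < r"
  obtain C D where C: "\<And>\<alpha>. cmod (f \<alpha>) \<le> C * r ^ mi_length \<alpha> * mi_fact \<alpha> powr (1 / 2)"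
    and D: "\<And>\<alpha>. cmod (g \<alpha>) \<le> D * r ^ mi_length \<alpha> * mi_fact \<alpha> powr (1 / 2)"
    using assms r unfolding H_flat_dual_def by blast
  have "cmod (f \<alpha> - g \<alpha>) \<le> (C + D) * r ^ mi_length \<alpha> * mi_fact \<alpha> powr (1 / 2)" for \<alpha>
    unfolding distrib_right by (rule order.trans[OF norm_triangle_ineq4 add_mono[OF C D]])
  then show "\<exists>C. \<forall>\<alpha>. cmod (f \<alpha> - g \<alpha>) \<le> C * r ^ mi_length \<alpha> * mi_fact \<alpha> powr (1 / 2)" by blast
qed

lemma gauss_stft_diff:
  assumes "f \<in> H_flat_dual" "g \<in> H_flat_dual"
  shows "gauss_stft (\<lambda>\<alpha>. f \<alpha> - g \<alpha>) X = gauss_stft f X - gauss_stft g X"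
proof -
  have "barg (\<lambda>\<alpha>. f \<alpha> - g \<alpha>) X = barg f X - barg g X"
    unfolding barg_def left_diff_distrib
  proof -
    have 1: "(\<lambda>\<alpha>. f \<alpha> * mon \<alpha> X) summable_on UNIV" and 2: "(\<lambda>\<alpha>. g \<alpha> * mon \<alpha> X)
      summable_on UNIV"
      by (rule abs_summable_summable[OF H_flat_dual_summable[OF assms(1)]],
          rule abs_summable_summable[OF H_flat_dual_summable[OF assms(2)]])
    have "(\<lambda>\<alpha>. - (g \<alpha> * mon \<alpha> X)) summable_on UNIV" using 2 by (simp add: summable_on_uminus)
    from infsum_add[OF 1 this] show "(\<Sum>\<^sub>\<infinity>\<alpha>. f \<alpha> * mon \<alpha> X - g \<alpha> * mon \<alpha> X) =
      (\<Sum>\<^sub>\<infinity>\<alpha>. f \<alpha> * mon \<alpha> X) - (\<Sum>\<^sub>\<infinity>\<alpha>. g \<alpha> * mon \<alpha> X)"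
      by (simp add: infsum_uminus)
  qed
  then show ?thesis by (simp add: gauss_stft_barg right_diff_distrib)
qed

lemma H_flat_bound:
  assumes "h \<in> H_flat"
  obtains C r where "0 \<le> C" "0 < r" "\<And>\<alpha>. cmod (h \<alpha>) \<le> C * (r ^ mi_length \<alpha> / sqrt (mi_fact \<alpha>))"
proof -
  obtain C r where r: "0 < r" and C: "\<And>\<alpha>. cmod (h \<alpha>) \<le> C * r ^ mi_length \<alpha> * mi_fact \<alpha> powr (- 1 / 2)"
    using assms unfolding H_flat_def by blast
  have p: "mi_fact \<alpha> powr (- 1 / 2) = 1 / sqrt (mi_fact \<alpha>)" for \<alpha> :: "'a \<Rightarrow> nat"
    using powr_minus_divide[of "mi_fact \<alpha>" "1 / 2"] by (simp add: mi_fact_powr)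
  have "cmod (h \<alpha>) \<le> \<bar>C\<bar> * (r ^ mi_length \<alpha> / sqrt (mi_fact \<alpha>))" for \<alpha>
  proof -
    have "cmod (h \<alpha>) \<le> C * (r ^ mi_length \<alpha> / sqrt (mi_fact \<alpha>))" using C[of \<alpha>] unfolding p by simp
    also have "\<dots> \<le> \<bar>C\<bar> * (r ^ mi_length \<alpha> / sqrt (mi_fact \<alpha>))"
      using r mi_fact_pos[of \<alpha>] by (intro mult_right_mono) auto
    finally show ?thesis .
  qed
  then show ?thesis using that[of "\<bar>C\<bar>" r] r by auto
qed

text \<open>The two square roots of factorials multiply to a full factorial, and the sum is
  dominated by a product of exponential series in r |z_i|. Growth of exponential type is harmless
  against a Gaussian, so this is the majorant for exchanging sums over \<alpha> with
  integrals.\<close>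

lemma prod_exp_partial_sums:
  fixes X :: "(real ^ 'n) \<times> (real ^ 'n)"
  assumes r: "0 \<le> r" and "finite S"
  shows "(\<Sum>\<alpha>\<in>S. r ^ mi_length \<alpha> / sqrt (mi_fact \<alpha>) * cmod (mon \<alpha> X)) \<le> exp (r * real CARD('n) * norm X)"
proof -
  define u where "u i k = complex_of_real ((r * cmod (zc X i)) ^ k / fact k)" for i k
  have s: "summable (\<lambda>k. norm (u i k))" for i
  proof -
    have "norm (u i k) = (r * cmod (zc X i)) ^ k / fact k" for k
      unfolding u_def norm_of_real using r by (simp add: abs_of_nonneg)
    then show ?thesis using summable_exp[of "r * cmod (zc X i)"] by (simp add: divide_inverse mult.commute)
  qed
  have le: "r ^ mi_length \<alpha> / sqrt (mi_fact \<alpha>) * cmod (mon \<alpha> X) \<le> norm (\<Prod>i\<in>UNIV. u i (\<alpha> i))" for \<alpha>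
  proof -
    have "r ^ mi_length \<alpha> / sqrt (mi_fact \<alpha>) * cmod (mon \<alpha> X)
      = (\<Prod>i\<in>UNIV. r ^ \<alpha> i / sqrt (fact (\<alpha> i)) * (cmod (zc X i) ^ \<alpha> i / sqrt (2 ^ \<alpha> i * fact (\<alpha> i))))"
      unfolding norm_mon sqrt_mi_fact mi_length_def power_sum by (simp add: prod.distrib prod_dividef)
    also have "\<dots> \<le> (\<Prod>i\<in>UNIV. (r * cmod (zc X i)) ^ \<alpha> i / fact (\<alpha> i))"
    proof (intro prod_mono conjI)
      fix i
      show "0 \<le> r ^ \<alpha> i / sqrt (fact (\<alpha> i)) * (cmod (zc X i) ^ \<alpha> i / sqrt (2 ^ \<alpha> i * fact (\<alpha> i)))"
        using r by auto
      have "r ^ \<alpha> i / sqrt (fact (\<alpha> i)) * (cmod (zc X i) ^ \<alpha> i / sqrt (2 ^ \<alpha> i * fact (\<alpha> i)))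
        \<le> r ^ \<alpha> i / sqrt (fact (\<alpha> i)) * (cmod (zc X i) ^ \<alpha> i / sqrt (fact (\<alpha> i)))"
        using r by (intro mult_left_mono frac_le) auto
      also have "\<dots> = (r * cmod (zc X i)) ^ \<alpha> i / fact (\<alpha> i)"
        by (simp add: power_mult_distrib)
      finally show "r ^ \<alpha> i / sqrt (fact (\<alpha> i)) * (cmod (zc X i) ^ \<alpha> i / sqrt (2 ^ \<alpha> i * fact (\<alpha> i)))
        \<le> (r * cmod (zc X i)) ^ \<alpha> i / fact (\<alpha> i)" .
    qed
    also have "\<dots> = norm (\<Prod>i\<in>UNIV. u i (\<alpha> i))"
      using r by (simp add: u_def norm_divide norm_power norm_mult abs_mult flip: prod_norm)
    finally show ?thesis .
  qed
  have nu: "norm (\<Prod>i\<in>UNIV. u i (\<alpha> i)) = Re (\<Prod>i\<in>UNIV. u i (\<alpha> i))" for \<alpha> :: "'n \<Rightarrow> nat"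
  proof -
    have "(\<Prod>i\<in>UNIV. u i (\<alpha> i)) = of_real (\<Prod>i\<in>UNIV. (r * cmod (zc X i)) ^ \<alpha> i / fact (\<alpha> i))"
      unfolding u_def by (simp only: of_real_prod)
    moreover have "0 \<le> (\<Prod>i\<in>UNIV. (r * cmod (zc X i)) ^ \<alpha> i / fact (\<alpha> i))"
      using r by (intro prod_nonneg) auto
    ultimately show ?thesis by (simp only: norm_of_real Re_complex_of_real abs_of_nonneg)
  qed
  have us: "(\<Sum>k. u i k) = of_real (exp (r * cmod (zc X i)))" for i
    unfolding u_def using exp_converges[of "r * cmod (zc X i)"]
    by (intro sums_unique[symmetric] sums_of_real) (simp add: divide_inverse mult.commute)
  have hs: "((\<lambda>\<alpha>. norm (\<Prod>i\<in>UNIV. u i (\<alpha> i))) has_sum Re (\<Prod>i\<in>UNIV. \<Sum>k. u i k)) UNIV"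
    unfolding nu prod_multiindex_summable(2)[OF s, symmetric]
    by (rule has_sum_Re[OF has_sum_infsum[OF abs_summable_summable[OF prod_multiindex_summable(1)[OF s]]]])
  have "(\<Sum>\<alpha>\<in>S. r ^ mi_length \<alpha> / sqrt (mi_fact \<alpha>) * cmod (mon \<alpha> X))
    \<le> (\<Sum>\<alpha>\<in>S. norm (\<Prod>i\<in>UNIV. u i (\<alpha> i)))"
    by (intro sum_mono le)
  also have "\<dots> \<le> Re (\<Prod>i\<in>UNIV. \<Sum>k. u i k)"
    by (rule has_sum_mono2[OF has_sum_finite[OF \<open>finite S\<close>] hs]) auto
  also have "Re (\<Prod>i\<in>UNIV. \<Sum>k. u i k) = exp (\<Sum>i\<in>UNIV. r * cmod (zc X i))"
    unfolding us of_real_prod[symmetric] Re_complex_of_real exp_sum[OF finite] ..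
  also have "\<dots> \<le> exp (r * real CARD('n) * norm X)"
  proof -
    have "(\<Sum>i\<in>UNIV. r * cmod (zc X i)) \<le> (\<Sum>i\<in>(UNIV :: 'n set). r * norm X)"
      using r by (intro sum_mono mult_left_mono cmod_zc_le)
    then show ?thesis by (simp add: ac_simps)
  qed
  finally show ?thesis .
qed

lemma H_flat_subset_dual: "h \<in> H_flat \<Longrightarrow> h \<in> H_flat_dual"
proof -
  assume "h \<in> H_flat"
  then obtain C r where C: "0 \<le> C" "0 < r" "\<And>\<alpha>. cmod (h \<alpha>) \<le> C * (r ^ mi_length \<alpha> / sqrt (mi_fact \<alpha>))"
    using H_flat_bound by metis
  have "(\<lambda>k. r ^ k / sqrt (fact k)) \<longlonglongrightarrow> 0"
    using C by (intro summable_LIMSEQ_zero summable_power_sqrt_fact) auto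
  then have "Bseq (\<lambda>k. r ^ k / sqrt (fact k))"
    by (intro convergent_imp_Bseq) (auto simp: convergent_def)
  then obtain B where B: "0 < B" "\<And>k. norm (r ^ k / sqrt (fact k)) \<le> B"
    by (elim BseqE) blast
  have b: "r ^ k / sqrt (fact k) \<le> B" for k using B(2)[of k] C by (simp add: abs_of_nonneg)
  have "r ^ mi_length \<alpha> / sqrt (mi_fact \<alpha>) \<le> B ^ CARD('a)" for \<alpha> :: "'a \<Rightarrow> nat"
  proof -
    have "r ^ mi_length \<alpha> / sqrt (mi_fact \<alpha>) = (\<Prod>i\<in>UNIV. r ^ \<alpha> i / sqrt (fact (\<alpha> i)))"
      by (simp add: sqrt_mi_fact mi_length_def power_sum prod_dividef)
    also have "\<dots> \<le> (\<Prod>i\<in>(UNIV :: 'a set). B)" using b C by (intro prod_mono conjI) auto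
    finally show ?thesis by simp
  qed
  then have "cmod (h \<alpha>) \<le> C * B ^ CARD('a)" for \<alpha>
    using C(3)[of \<alpha>] C(1) by (meson mult_left_mono order.trans)
  then show ?thesis by (rule bounded_in_H_flat_dual)
qed

lemma infsum_integral_dominated:
  fixes f :: "'i::countable \<Rightarrow> 'a \<Rightarrow> complex"
  assumes meas: "\<And>i. f i \<in> borel_measurable M" and D: "integrable M D"
    and dom: "\<And>S x. finite S \<Longrightarrow> x \<in> space M \<Longrightarrow> (\<Sum>i\<in>S. norm (f i x)) \<le> D x"
  shows "(\<integral>x. (\<Sum>\<^sub>\<infinity>i. f i x) \<partial>M) = (\<Sum>\<^sub>\<infinity>i. \<integral>x. f i x \<partial>M)"
    and "integrable M (\<lambda>x. \<Sum>\<^sub>\<infinity>i. f i x)"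
proof -
  have int: "integrable M (f i)" for i
  proof (rule Bochner_Integration.integrable_bound[OF D meas], rule AE_I2)
    fix x assume "x \<in> space M"
    then show "norm (f i x) \<le> norm (D x)" using dom[of "{i}" x] by simp
  qed
  have pt: "(\<lambda>i. norm (f i x)) summable_on UNIV" if "x \<in> space M" for x
    using dom[OF _ that] by (intro nonneg_bdd_above_summable_on) (auto intro!: bdd_aboveI)
  have sum: "(\<lambda>i. \<integral>x. norm (f i x) \<partial>M) summable_on UNIV"
  proof (intro nonneg_bdd_above_summable_on bdd_aboveI)
    fix y assume "y \<in> sum (\<lambda>i. \<integral>x. norm (f i x) \<partial>M) ` {F. F \<subseteq> UNIV \<and> finite F}"
    then obtain S where S: "finite S" "y = (\<Sum>i\<in>S. \<integral>x. norm (f i x) \<partial>M)" by auto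
    have "y = (\<integral>x. (\<Sum>i\<in>S. norm (f i x)) \<partial>M)"
      unfolding S(2) using int by (subst Bochner_Integration.integral_sum) auto
    also have "\<dots> \<le> (\<integral>x. D x \<partial>M)"
      using int S D by (intro integral_mono dom) auto
    finally show "y \<le> (\<integral>x. D x \<partial>M)" .
  qed auto
  show "(\<integral>x. (\<Sum>\<^sub>\<infinity>i. f i x) \<partial>M) = (\<Sum>\<^sub>\<infinity>i. \<integral>x. f i x \<partial>M)"
    and "integrable M (\<lambda>x. \<Sum>\<^sub>\<infinity>i. f i x)"
    using infsum_integral[OF int pt sum] by auto
qed

subsection \<open>Orthogonality of monomials and the coefficient formula\<close>

text \<open>The norm is at most the sum of the absolute coordinates and its square is the sum of
  their squares, so a product of one-variable functions dominates.\<close>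

lemma integrable_exp_norm_gaussian:
  assumes q: "0 < q"
  shows "integrable lborel (\<lambda>X::'a::euclidean_space. exp (b * norm X - q * (norm X)\<^sup>2))"
proof -
  define f where "f t = exp (\<bar>b\<bar> * \<bar>t\<bar> - q * t\<^sup>2)" for t :: real
  have "integrable lborel (\<lambda>t. exp (\<bar>b\<bar> / sqrt q * \<bar>0 + sqrt q * t\<bar> - (0 + sqrt q * t)\<^sup>2))"
    using q by (intro lborel_integrable_real_affine integrable_exp_abs_quadratic) auto
  then have f: "integrable lborel f"
    using q by (simp add: f_def[abs_def] abs_mult power_mult_distrib)
  have fm: "(\<integral>\<^sup>+t. ennreal (f t) \<partial>lborel) < \<infinity>"
    using f unfolding integrable_iff_bounded by (simp add: f_def)
  have [measurable]: "f \<in> borel_measurable borel" unfolding f_def by measurable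
  have le: "exp (b * norm X - q * (norm X)\<^sup>2) \<le> (\<Prod>j\<in>Basis. f (X \<bullet> j))" for X :: 'a
  proof -
    have "b * norm X \<le> \<bar>b\<bar> * norm X" by (intro mult_right_mono) auto
    also have "\<dots> \<le> \<bar>b\<bar> * (\<Sum>j\<in>Basis. \<bar>X \<bullet> j\<bar>)" by (intro mult_left_mono norm_le_l1) auto
    finally have "b * norm X \<le> (\<Sum>j\<in>Basis. \<bar>b\<bar> * \<bar>X \<bullet> j\<bar>)" by (simp add: sum_distrib_left)
    moreover have "q * (norm X)\<^sup>2 = (\<Sum>j\<in>Basis. q * (X \<bullet> j)\<^sup>2)"
      by (simp add: norm_eq_sqrt_inner euclidean_inner[of X X] power2_eq_square sum_nonneg sum_distrib_left)
    ultimately have "b * norm X - q * (norm X)\<^sup>2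
      \<le> (\<Sum>j\<in>Basis. \<bar>b\<bar> * \<bar>X \<bullet> j\<bar> - q * (X \<bullet> j)\<^sup>2)"
      by (simp add: sum_subtractf)
    then show ?thesis unfolding f_def exp_sum[OF finite_Basis, symmetric] by simp
  qed
  show ?thesis
  proof (rule integrableI_bounded)
    have "(\<integral>\<^sup>+X. norm (exp (b * norm X - q * (norm X)\<^sup>2)) \<partial>(lborel :: 'a measure))
      \<le> (\<integral>\<^sup>+X. (\<Prod>j\<in>Basis. ennreal (f (X \<bullet> j))) \<partial>(lborel :: 'a measure))"
      using le by (intro nn_integral_mono) (simp add: prod_ennreal f_def ennreal_leI)
    also have "\<dots> = (\<Prod>j\<in>(Basis :: 'a set). \<integral>\<^sup>+t. ennreal (f t) \<partial>lborel)"
      by (rule nn_integral_lborel_prod) auto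
    also have "\<dots> < \<infinity>" using fm by (simp add: power_less_top_ennreal)
    finally show "(\<integral>\<^sup>+X. norm (exp (b * norm X - q * (norm X)\<^sup>2)) \<partial>(lborel :: 'a measure)) < \<infinity>" .
  qed measurable
qed

lemma mon_rot: "mon \<alpha> (rot i t X) = cis (t * real (\<alpha> i)) * mon \<alpha> X"
proof -
  have "mon \<alpha> (rot i t X) = (\<Prod>j\<in>UNIV. (if j
    = i then cis t ^ \<alpha> i else 1) * (zc X j ^ \<alpha> j / of_real (sqrt (2 ^ \<alpha> j * fact (\<alpha> j)))))"
    unfolding mon_def zc_rot by (intro prod.cong) (auto simp: power_mult_distrib)
  also have "\<dots> = cis t ^ \<alpha> i * mon \<alpha> X"
    unfolding mon_def prod.distrib by (simp add: prod.delta)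
  moreover have "cis t ^ \<alpha> i = cis (t * real (\<alpha> i))" by (simp only: Complex.DeMoivre mult.commute)
  ultimately show ?thesis by (simp only:)
qed

lemma norm_rot: "norm (rot i t X) = norm X"
proof -
  have "(norm (rot i t X))\<^sup>2 = (norm X)\<^sup>2"
    unfolding norm_sq_zc zc_rot by (intro sum.cong) (auto simp: norm_mult)
  then show ?thesis by (simp add: power2_eq_iff_nonneg)
qed

text \<open>Rotation of a coordinate in which the exponents differ by m, through the angle t = 1 /
  m, multiplies the integrand by \<open>cis 1\<close>, which is not 1, yet keeps the integral. As
  |m| \<ge> 1, the angle satisfies |t| \<le> 1, hence sin t \<noteq> 0.\<close>

lemma mon_orthogonal_polydisc:
  assumes "\<alpha> \<noteq> \<beta>"
  shows "(\<integral>X. indicator (polydisc R) X *\<^sub>R (mon \<alpha> X * cnj (mon \<beta> X) * of_real (exp (- (norm X)\<^sup>2 / 2)))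
    \<partial>lborel) = 0"
    (is "?I = 0")
proof -
  obtain i where i: "\<alpha> i \<noteq> \<beta> i" using assms by auto
  define m where "m = real (\<alpha> i) - real (\<beta> i)"
  define t where "t = 1 / m"
  have m: "1 \<le> \<bar>m\<bar>"
  proof -
    have "1 \<le> \<bar>int (\<alpha> i) - int (\<beta> i)\<bar>" using i by auto
    then have "1 \<le> \<bar>real_of_int (int (\<alpha> i) - int (\<beta> i))\<bar>" by linarith
    then show ?thesis by (simp add: m_def)
  qed
  have s1: "sin (1::real) > 0" using pi_gt3 by (intro sin_gt_zero) auto
  have st: "sin t \<noteq> 0"
  proof -
    have "t \<noteq> 0" "\<bar>t\<bar> \<le> 1" using m by (auto simp: t_def abs_divide divide_le_eq_1)
    then have "sin \<bar>t\<bar> > 0" using pi_gt3 by (intro sin_gt_zero) auto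
    then show ?thesis by (auto simp: abs_if split: if_splits)
  qed
  define F where "F X = indicator (polydisc R) X *\<^sub>R (mon \<alpha> X * cnj (mon \<beta> X) * of_real (exp (- (norm X)\<^sup>2 / 2)))" for X
  have Fm: "F \<in> borel_measurable borel"
    unfolding F_def
    by (intro borel_measurable_scaleR borel_measurable_indicator polydisc_borel borel_measurable_continuous_onI
        continuous_intros continuous_mon) auto
  have "F (rot i t X) = cis 1 * F X" for X
  proof -
    have "cis (t * real (\<alpha> i)) * cnj (cis (t * real (\<beta> i))) = cis (t * m)"
      by (simp add: cis_mult cis_cnj m_def right_diff_distrib)
    also have "t * m = 1" using m by (auto simp: t_def)
    finally have c: "cis (t * real (\<alpha> i)) * cnj (cis (t * real (\<beta> i))) = cis 1" .
    have "F (rot i t X) = (cis (t * real (\<alpha> i)) * cnj (cis (t * real (\<beta> i)))) * F X"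
      unfolding F_def mon_rot norm_rot by (cases "X \<in> polydisc R") (simp_all add: mult.assoc mult.left_commute)
    then show ?thesis by (simp only: c)
  qed
  then have "(\<integral>X. F X \<partial>lborel) = cis 1 * (\<integral>X. F X \<partial>lborel)"
    using integral_rot[OF st Fm, of i] by simp
  moreover have "cis 1 \<noteq> 1" using s1 by (auto simp: complex_eq_iff)
  ultimately have "(\<integral>X. F X \<partial>lborel) = 0" by simp
  then show ?thesis by (simp add: F_def)
qed

text \<open>Uniqueness of power series coefficients from values on [0, 1) only: with the lower
  coefficients settled, divide by s^k and let s decrease to 0.\<close>

lemma power_series_geometric_unique:
  fixes a :: "nat \<Rightarrow> real"
  assumes a: "\<And>s. 0 \<le> s \<Longrightarrow> s < 1 \<Longrightarrow> (\<lambda>k. a k * s ^ k) sums (A / (1 - s))"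
  shows "a k = A"
proof (induction k rule: less_induct)
  case (less k)
  define b where "b j = a j - A" for j
  have b: "(\<lambda>j. b j * s ^ j) sums 0" if "0 \<le> s" "s < 1" for s
  proof -
    have "(\<lambda>j. A * s ^ j) sums (A * (1 / (1 - s)))"
      using that by (intro sums_mult geometric_sums) auto
    from sums_diff[OF a[OF that] this] show ?thesis by (simp add: b_def left_diff_distrib)
  qed
  have b0: "b j = 0" if "j < k" for j using less.IH[OF that] by (simp add: b_def)
  have shift: "(\<lambda>j. b (j + k) * s ^ j) sums 0" if s: "0 < s" "s < 1" for s
  proof -
    have "(\<lambda>j. b (j + k) * s ^ (j + k)) sums 0"
      using b[of s] s b0 sums_iff_shift'[of "\<lambda>j. b j * s ^ j" k 0] by simp
    from sums_mult[OF this, of "1 / s ^ k"] show ?thesis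
      using s by (simp add: power_add)
  qed
  have "((\<lambda>s. \<Sum>j. b (j + k) * s ^ j) \<longlongrightarrow> b (0 + k)) (at 0)"
  proof (rule powser_limit_0)
    fix s :: real assume "norm s < 1 / 2"
    then have "summable (\<lambda>j. b (j + k) * s ^ j)"
      by (intro powser_inside[OF sums_summable[OF shift[of "1 / 2"]]]) auto
    then show "(\<lambda>j. b (j + k) * s ^ j) sums (\<Sum>j. b (j + k) * s ^ j)" by (rule summable_sums)
  qed simp
  then have "((\<lambda>s. \<Sum>j. b (j + k) * s ^ j) \<longlongrightarrow> b (0 + k)) (at_right 0)"
    by (rule Lim_at_imp_Lim_at_within)
  moreover have "((\<lambda>s. \<Sum>j. b (j + k) * s ^ j) \<longlongrightarrow> 0) (at_right 0)"
  proof (rule tendsto_eventually)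
    have "\<forall>\<^sub>F s in at_right (0::real). s \<in> {0<..<1}" by (intro eventually_at_right_real) simp
    then show "\<forall>\<^sub>F s in at_right 0. (\<Sum>j. b (j + k) * s ^ j) = 0"
      by (rule eventually_mono) (use shift[THEN sums_unique, symmetric] in auto)
  qed
  ultimately have "b (0 + k) = 0" by (intro tendsto_unique[OF trivial_limit_at_right_real])
  then show ?case by (simp add: b_def)
qed

section \<open>Norms of the monomials and recovery of the coefficients\<close>

definition gwt :: "('n::finite \<Rightarrow> nat) \<Rightarrow> (real ^ 'n) \<times> (real ^ 'n) \<Rightarrow> real" where
  "gwt \<beta> X = (cmod (mon \<beta> X))\<^sup>2 * exp (- (norm X)\<^sup>2 / 2)"

lemma gwt_prod: "gwt \<beta> X = (\<Prod>i\<in>UNIV. ((cmod (zc X i))\<^sup>2 / 2) ^ \<beta> i / fact (\<beta> i) * exp (- (cmod (zc X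
  i))\<^sup>2 / 2))"
proof -
  have "exp (- (norm X)\<^sup>2 / 2) = (\<Prod>i\<in>UNIV. exp (- (cmod (zc X i))\<^sup>2 / 2))"
    unfolding norm_sq_zc exp_sum[OF finite, symmetric] by (simp add: sum_negf sum_divide_distrib)
  moreover have "(cmod (mon \<beta> X))\<^sup>2 = (\<Prod>i\<in>UNIV. ((cmod (zc X i))\<^sup>2 / 2) ^ \<beta> i / fact (\<beta> i))"
  proof -
    have "(cmod (zc X i) ^ \<beta> i / sqrt (2 ^ \<beta> i * fact (\<beta> i)))\<^sup>2
      = ((cmod (zc X i))\<^sup>2 / 2) ^ \<beta> i / fact (\<beta> i)" for i
    proof -
      have "(cmod (zc X i) ^ \<beta> i)\<^sup>2 = ((cmod (zc X i))\<^sup>2) ^ \<beta> i" by (simp only: power_mult[symmetric] mult.commute)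
      then show ?thesis by (simp add: power_divide)
    qed
    then show ?thesis unfolding norm_mon prod_power_distrib by simp
  qed
  ultimately show ?thesis unfolding gwt_def prod.distrib by (simp only:)
qed

lemma gwt_nonneg [simp]: "0 \<le> gwt \<beta> X"
  by (simp add: gwt_def)

lemma continuous_gwt: "continuous_on S (gwt \<beta>)"
  unfolding gwt_def[abs_def] by (intro continuous_intros continuous_mon) auto

lemma gwt_measurable [measurable]: "gwt \<beta> \<in> borel_measurable borel"
  by (rule borel_measurable_continuous_onI[OF continuous_gwt])

definition cscale :: "'n \<Rightarrow> real \<Rightarrow> (real ^ 'n) \<times> (real ^ 'n) \<Rightarrow> (real ^ 'n) \<times> (real ^ 'n)" where
  "cscale i c X = X + emb i (of_real (c - 1) * zc X i)"

lemma zc_cscale: "zc (cscale i c X) j = (if j = i then of_real c * zc X i else zc X j)"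
  by (auto simp: cscale_def zc_emb algebra_simps)

lemma nn_integral_cscale:
  fixes f :: "(real ^ 'n) \<times> (real ^ 'n) \<Rightarrow> ennreal" and i :: "'n::finite"
  assumes f: "f \<in> borel_measurable borel" and c: "0 < c"
  shows "(\<integral>\<^sup>+X. f X \<partial>lborel) = ennreal (c\<^sup>2) * (\<integral>\<^sup>+X. f (cscale i c X) \<partial>lborel)"
proof -
  \<comment> \<open>The two real directions of the i-th complex coordinate; scaling both by c
    produces the Jacobian c^2.\<close>
  define e1 e2 where "e1 = (axis i 1 :: real ^ 'n, 0 :: real ^ 'n)" and "e2 = (0 :: real ^ 'n, axis i 1 :: real ^ 'n)"
  define d where "d j = (if j = e1 \<or> j = e2 then c else 1)" for j
  define T where "T X = 0 + (\<Sum>j\<in>Basis. (d j * (X \<bullet> j)) *\<^sub>R j)" for X :: "(real ^ 'n) \<times> (real ^ 'n)"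
  have ne: "e1 \<noteq> e2" by (auto simp: e1_def e2_def axis_eq_0_iff)
  have inB: "e1 \<in> Basis" "e2 \<in> Basis" by (auto simp: e1_def e2_def Basis_prod_def axis_in_Basis_iff)
  have pr: "(\<Prod>j\<in>Basis. \<bar>d j\<bar>) = c\<^sup>2"
  proof -
    have "(\<Prod>j\<in>Basis. \<bar>d j\<bar>) = (\<Prod>j\<in>{e1, e2}. \<bar>d j\<bar>)"
      using inB by (intro prod.mono_neutral_right) (auto simp: d_def)
    then show ?thesis using ne c by (simp add: d_def power2_eq_square)
  qed
  have T: "T = cscale i c"
  proof
    fix X
    have Tj: "T X \<bullet> j = d j * (X \<bullet> j)" if "j \<in> Basis" for j
      unfolding T_def using that by (simp add: inner_sum_left_Basis)
    show "T X = cscale i c X"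
    proof (rule euclidean_eqI)
      fix j :: "(real ^ 'n) \<times> (real ^ 'n)" assume j: "j \<in> Basis"
      then obtain k where "j = (axis k 1, 0) \<or> j = (0, axis k 1)"
        by (auto simp: Basis_prod_def Basis_vec_def)
      moreover have "d (axis k 1, 0) = (if k = i then c else 1)" "d (0, axis k 1) = (if k = i then c else 1)"
        by (auto simp: d_def e1_def e2_def axis_eq_axis axis_eq_0_iff)
      moreover have "Y \<bullet> (axis k 1, 0) = fst Y $ k" "Y \<bullet> (0, axis k 1) = snd Y $ k" for Y :: "(real ^ 'n) \<times> (real ^ 'n)"
        by (simp_all add: inner_axis inner_prod_def)
      moreover have "fst (cscale i c X) $ k = (if k = i then c else 1) * fst X $ k"
        "snd (cscale i c X) $ k = (if k = i then c else 1) * snd X $ k"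
        by (auto simp: cscale_def emb_def zc_def axis_def algebra_simps)
      ultimately show "T X \<bullet> j = cscale i c X \<bullet> j"
        unfolding Tj[OF j] by (elim disjE) simp_all
    qed
  qed
  have Tm: "T \<in> borel_measurable borel" unfolding T
    unfolding cscale_def[abs_def] by (intro borel_measurable_continuous_onI continuous_intros)
  have "lborel = density (distr lborel borel T) (\<lambda>_. ennreal (c\<^sup>2))"
    using lborel_affine_euclidean[of d 0] c unfolding T_def[symmetric] pr by (auto simp: d_def)
  then have "(\<integral>\<^sup>+X. f X \<partial>lborel)
    = (\<integral>\<^sup>+X. f X \<partial>density (distr lborel borel T) (\<lambda>_. ennreal (c\<^sup>2)))" by simp
  also have "\<dots> = (\<integral>\<^sup>+X. ennreal (c\<^sup>2) * f X \<partial>distr lborel borel T)"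
    using f by (subst nn_integral_density) auto
  also have "\<dots> = ennreal (c\<^sup>2) * (\<integral>\<^sup>+X. f X \<partial>distr lborel borel T)"
    using f by (intro nn_integral_cmult) auto
  also have "(\<integral>\<^sup>+X. f X \<partial>distr lborel borel T) = (\<integral>\<^sup>+X. f (T X) \<partial>lborel)"
    using f Tm by (intro nn_integral_distr) auto
  finally show ?thesis unfolding T .
qed

text \<open>A generating function in the exponent k: with w = |z_i|^2 / 2 the sum over k of (s w)^k
  / k! exp (- w) is exp (- (1 - s) w). Scaling z_i by sqrt (1 - s) maps this to the case k = 0 at
  the cost of the factor 1 / (1 - s), whose power series has all coefficients 1.\<close>

lemma gwt_integral_update:
  fixes \<beta> :: "'n::finite \<Rightarrow> nat" and i :: 'n
  assumes fin: "(\<integral>\<^sup>+X. ennreal (gwt (\<beta>(i := 0)) X) \<partial>lborel) = ennreal A" and A: "0 \<le> A"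
  shows "(\<integral>\<^sup>+X. ennreal (gwt (\<beta>(i := k)) X) \<partial>lborel) = ennreal A"
proof -
  define J where "J k = (\<integral>\<^sup>+X. ennreal (gwt (\<beta>(i := k)) X) \<partial>lborel)" for k
  define w where "w X = (cmod (zc X i))\<^sup>2 / 2" for X
  define rest where "rest X = (\<Prod>j\<in>UNIV - {i}. ((cmod (zc X j))\<^sup>2 / 2) ^ \<beta> j / fact (\<beta> j) * exp (- (cmod (zc X
    j))\<^sup>2 / 2))" for X
  have rest0: "0 \<le> rest X" for X unfolding rest_def by (intro prod_nonneg) auto
  have w0: "0 \<le> w X" for X by (simp add: w_def)
  have g: "gwt (\<beta>(i := k)) X = rest X * (w X ^ k / fact k * exp (- w X))" for k X
    unfolding gwt_prod rest_def w_def by (subst prod.remove[of _ i]) (auto intro!: prod.cong simp: mult.commute)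
  have sumJ: "(\<Sum>k. ennreal (s ^ k) * J k) = ennreal (A / (1 - s))" if s: "0 \<le> s" "s < 1" for s
  proof -
    have "(\<Sum>k. ennreal (s ^ k) * J k) = (\<Sum>k. \<integral>\<^sup>+X. ennreal (s ^ k) * ennreal (gwt (\<beta>(i := k)) X) \<partial>lborel)"
      unfolding J_def by (intro suminf_cong nn_integral_cmult[symmetric]) measurable
    also have "\<dots> = (\<integral>\<^sup>+X. (\<Sum>k. ennreal (s ^ k) * ennreal (gwt (\<beta>(i := k)) X)) \<partial>lborel)"
      by (intro nn_integral_suminf[symmetric]) measurable
    also have "\<dots> = (\<integral>\<^sup>+X. ennreal (rest X * exp (- ((1 - s) * w X))) \<partial>lborel)"
    proof (intro nn_integral_cong)
      fix X
      have "(\<lambda>k. rest X * exp (- w X) * ((s * w X) ^ k / fact k)) sums (rest X * exp (- w X) * exp (s * w X))"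
        using exp_converges[of "s * w X"] by (intro sums_mult) (simp add: divide_inverse mult.commute)
      moreover have "rest X * exp (- w X) * ((s * w X) ^ k / fact k) = s ^ k * gwt (\<beta>(i := k)) X" for k
        unfolding g by (simp add: power_mult_distrib)
      moreover have "rest X * exp (- w X) * exp (s * w X) = rest X * exp (- ((1 - s) * w X))"
        by (simp add: algebra_simps flip: exp_add)
      ultimately have "(\<lambda>k. s ^ k * gwt (\<beta>(i := k)) X) sums (rest X * exp (- ((1 - s) * w X)))" by simp
      then have "(\<Sum>k. ennreal (s ^ k * gwt (\<beta>(i := k)) X)) = ennreal (rest X * exp (- ((1 - s) * w X)))"
        using s by (intro sums_unique[symmetric] sums_ennreal[THEN iffD2]) (auto simp: rest0)
      then show "(\<Sum>k. ennreal (s ^ k) * ennreal (gwt (\<beta>(i := k)) X)) = ennreal (rest X * exp (- ((1 - s) * w X)))"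
        using s by (simp add: ennreal_mult)
    qed
    also have "\<dots> = ennreal (1 / (1 - s)) * (ennreal (1 - s) * (\<integral>\<^sup>+X. ennreal (rest X * exp (- ((1 - s) * w X)))
      \<partial>lborel))"
      using s by (simp flip: mult.assoc ennreal_mult)
    also have "ennreal (1 - s) * (\<integral>\<^sup>+X. ennreal (rest X * exp (- ((1 - s) * w X))) \<partial>lborel) = ennreal A"
    proof -
      define c where "c = sqrt (1 - s)"
      have c: "0 < c" "c\<^sup>2 = 1 - s" using s by (auto simp: c_def)
      have "gwt (\<beta>(i := 0)) (cscale i c X) = rest X * exp (- ((1 - s) * w X))" for X
      proof -
        have "rest (cscale i c X) = rest X" unfolding rest_def by (intro prod.cong) (auto simp: zc_cscale)
        moreover have "w (cscale i c X) = (1 - s) * w X"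
          using c by (simp add: w_def zc_cscale norm_mult power_mult_distrib)
        ultimately show ?thesis unfolding g by simp
      qed
      then show ?thesis
        using nn_integral_cscale[of "\<lambda>X. ennreal (gwt (\<beta>(i := 0)) X)" c i] c fin by simp
    qed
    also have "ennreal (1 / (1 - s)) * ennreal A = ennreal (A / (1 - s))"
      using s A by (simp flip: ennreal_mult)
    finally show ?thesis .
  qed
  \<comment> \<open>Finiteness is read off the series at s = 1 / 2 before real coefficients can be
    compared.\<close>
  have Jfin: "J k < top" for k
  proof -
    have "ennreal ((1 / 2) ^ k) * J k \<le> (\<Sum>k. ennreal ((1 / 2) ^ k) * J k)"
      using sum_le_suminf[of "\<lambda>k. ennreal ((1 / 2) ^ k) * J k" "{k}"] by simp
    also have "\<dots> < top" using sumJ[of "1 / 2"] by simp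
    finally show ?thesis by (auto simp: ennreal_mult_less_top)
  qed
  define a where "a k = enn2real (J k)" for k
  have a: "J k = ennreal (a k)" "0 \<le> a k" for k using Jfin[of k] by (auto simp: a_def)
  have "a k = A"
  proof (rule power_series_geometric_unique)
    fix s :: real assume s: "0 \<le> s" "s < 1"
    have "(\<Sum>k. ennreal (a k * s ^ k)) = ennreal (A / (1 - s))"
      using sumJ[OF s] a s by (simp add: ennreal_mult mult.commute)
    then have "(\<lambda>k. ennreal (a k * s ^ k)) sums ennreal (A / (1 - s))"
      by (metis summableI summable_sums)
    then show "(\<lambda>k. a k * s ^ k) sums (A / (1 - s))"
      using a s A by (subst (asm) sums_ennreal) auto
  qed
  then show ?thesis using a(1)[of k] by (simp add: J_def)
qed

lemma gwt_integral:
  fixes \<beta> :: "'n::finite \<Rightarrow> nat"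
  shows "(\<integral>\<^sup>+X. ennreal (gwt \<beta> X) \<partial>lborel) = ennreal ((2 * pi) ^ CARD('n))"
proof -
  have base: "(\<integral>\<^sup>+X. ennreal (gwt (\<lambda>_::'n. 0) X) \<partial>lborel) = ennreal ((2 * pi) ^ CARD('n))"
  proof -
    have g1: "(\<integral>\<^sup>+t. ennreal (exp (- t\<^sup>2 / 2)) \<partial>lborel) = ennreal (sqrt (2 * pi))"
    proof -
      have e: "exp (- t\<^sup>2 / 2) = sqrt (2 * pi) * std_normal_density t" for t by (simp add: std_normal_density_def)
      have "(\<integral>\<^sup>+t. ennreal (exp (- t\<^sup>2 / 2)) \<partial>lborel)
        = ennreal (\<integral>t. sqrt (2 * pi) * std_normal_density t \<partial>lborel)"
        unfolding e by (rule nn_integral_eq_integral) auto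
      then show ?thesis by simp
    qed
    have "gwt (\<lambda>_::'n. 0) X = (\<Prod>j\<in>Basis. exp (- (X \<bullet> j)\<^sup>2 / 2))" for X
    proof -
      have "(norm X)\<^sup>2 = (\<Sum>j\<in>Basis. (X \<bullet> j)\<^sup>2)"
        by (simp add: norm_eq_sqrt_inner euclidean_inner[of X X] power2_eq_square sum_nonneg)
      then show ?thesis
        by (simp add: gwt_def mon_def sum_negf sum_divide_distrib flip: exp_sum)
    qed
    then have "(\<integral>\<^sup>+X. ennreal (gwt (\<lambda>_::'n. 0) X) \<partial>lborel)
       = (\<integral>\<^sup>+X. (\<Prod>j\<in>Basis. ennreal (exp (- (X \<bullet> j)\<^sup>2 / 2))) \<partial>(lborel :: ((real ^ 'n)
         \<times> (real ^ 'n)) measure))"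
      by (simp add: prod_ennreal)
    also have "\<dots> = (\<Prod>j\<in>(Basis :: ((real ^ 'n) \<times> (real ^ 'n)) set). \<integral>\<^sup>+t. ennreal (exp (- t\<^sup>2 /
      2)) \<partial>lborel)"
      by (rule nn_integral_lborel_prod) auto
    also have "\<dots> = ennreal (sqrt (2 * pi) ^ (2 * CARD('n)))"
    proof -
      have "card (Basis :: ((real ^ 'n) \<times> (real ^ 'n)) set) = 2 * CARD('n)" by simp
      then show ?thesis unfolding g1 prod_constant by (simp only: ennreal_power real_sqrt_ge_zero)
        (simp add: ennreal_power)
    qed
    also have "sqrt (2 * pi) ^ (2 * CARD('n)) = (2 * pi) ^ CARD('n)" by (simp add: power_mult)
    finally show ?thesis .
  qed
  \<comment> \<open>Induction on a set containing all indices with nonzero exponent, starting from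
    the pure Gaussian.\<close>
  have "finite S \<Longrightarrow> (\<forall>\<beta>. (\<forall>i. i \<notin> S \<longrightarrow> \<beta> i = 0)
    \<longrightarrow> (\<integral>\<^sup>+X. ennreal (gwt \<beta> X) \<partial>lborel) = ennreal ((2 * pi) ^ CARD('n)))" for S :: "'n set"
  proof (induction S rule: finite_induct)
    case empty
    then show ?case using base by (auto simp: fun_eq_iff[symmetric] simp flip: ext)
  next
    case (insert i S)
    show ?case
    proof (intro allI impI)
      fix \<beta> :: "'n \<Rightarrow> nat" assume \<beta>: "\<forall>j. j \<notin> insert i S \<longrightarrow> \<beta> j = 0"
      have "(\<integral>\<^sup>+X. ennreal (gwt (\<beta>(i := 0)) X) \<partial>lborel) = ennreal ((2 * pi) ^ CARD('n))"
        using insert.IH \<beta> by simp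
      from gwt_integral_update[OF this, of "\<beta> i"] show "(\<integral>\<^sup>+X. ennreal (gwt \<beta> X) \<partial>lborel)
        = ennreal ((2 * pi) ^ CARD('n))"
        by simp
    qed
  qed
  from this[of UNIV] show ?thesis by simp
qed

text \<open>On a bounded polydisc the series converges uniformly, so termwise integration is
  legitimate for every element of \<open>H_flat_dual\<close>, whatever the growth of its transform;
  orthogonality leaves the term \<beta>.\<close>

lemma coefficient_polydisc:
  fixes f :: "('n::finite) series"
  assumes f: "f \<in> H_flat_dual" and R: "0 \<le> R"
  shows "(\<integral>X. indicator (polydisc R) X *\<^sub>R (barg f X * cnj (mon \<beta> X) * of_real (exp (- (norm X)\<^sup>2 / 2))) \<partial>lborel)
    = f \<beta> * of_real (\<integral>X. indicator (polydisc R) X * gwt \<beta> X \<partial>lborel)"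
proof -
  let ?K = "polydisc R :: ((real ^ 'n) \<times> (real ^ 'n)) set"
  obtain C where C: "0 \<le> C" "\<And>\<alpha> X. (\<And>i. cmod (zc X i) \<le> R) \<Longrightarrow> cmod (f \<alpha> * mon \<alpha> X)
    \<le> C * (1 / 2) ^ mi_length \<alpha>"
    using H_flat_dual_bound[OF f R] by metis
  define S where "S = (\<Sum>\<^sub>\<infinity>\<alpha>::'n \<Rightarrow> nat. (1 / 2 :: real) ^ mi_length \<alpha>)"
  have S: "(\<Sum>\<alpha>\<in>F. (1 / 2 :: real) ^ mi_length \<alpha>) \<le> S" if "finite F" for F :: "('n \<Rightarrow> nat) set"
    unfolding S_def by (rule finite_sum_le_infsum[OF summable_mi_geometric that]) auto
  define M where "M = R ^ mi_length \<beta> / sqrt (mi_fact \<beta>)"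
  define F where "F \<alpha> X = indicator ?K X *\<^sub>R (f \<alpha> * mon \<alpha> X * cnj (mon \<beta> X) * of_real (exp (- (norm
    X)\<^sup>2 / 2)))" for \<alpha> X
  have "F \<alpha> \<in> borel_measurable borel" for \<alpha>
    unfolding F_def
    by (intro borel_measurable_scaleR borel_measurable_indicator polydisc_borel borel_measurable_continuous_onI
        continuous_intros continuous_mon) auto
  then have meas: "F \<alpha> \<in> borel_measurable lborel" for \<alpha> by simp
  have M0: "0 \<le> M" using R mi_fact_pos[of \<beta>] by (simp add: M_def)
  have D: "integrable lborel (\<lambda>X. indicator ?K X * (C * S * M))"
    using borel_integrable_compact[OF compact_polydisc continuous_on_const, of R "C * S * M"] by simp
  have dom: "(\<Sum>\<alpha>\<in>A. norm (F \<alpha> X)) \<le> indicator ?K X * (C * S * M)" if A: "finite A" for A X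
  proof (cases "X \<in> ?K")
    case True
    then have z: "cmod (zc X i) \<le> R" for i by (simp add: polydisc_def)
    have nF: "norm (F \<alpha> X) \<le> C * (1 / 2) ^ mi_length \<alpha> * M" for \<alpha>
    proof -
      have "norm (F \<alpha> X) = cmod (f \<alpha> * mon \<alpha> X) * (cmod (mon \<beta> X) * exp (- (norm X)\<^sup>2 / 2))"
        using True by (simp add: F_def norm_mult)
      also have "cmod (mon \<beta> X) * exp (- (norm X)\<^sup>2 / 2) \<le> M * 1"
        by (rule mult_mono) (use norm_mon_le[OF z, of \<beta>] M0 in \<open>auto simp: M_def\<close>)
      then have "cmod (f \<alpha> * mon \<alpha> X) * (cmod (mon \<beta> X) * exp (- (norm X)\<^sup>2 / 2))
        \<le> (C * (1 / 2) ^ mi_length \<alpha>) * M"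
        using C(1) by (intro mult_mono C(2) z) auto
      finally show ?thesis .
    qed
    have "(\<Sum>\<alpha>\<in>A. norm (F \<alpha> X)) \<le> (\<Sum>\<alpha>\<in>A. C * (1 / 2) ^ mi_length \<alpha> * M)" by (intro sum_mono nF)
    also have "\<dots> = C * (\<Sum>\<alpha>\<in>A. (1 / 2) ^ mi_length \<alpha>) * M" by (simp add: sum_distrib_left sum_distrib_right)
    also have "\<dots> \<le> C * S * M"
      by (rule mult_right_mono[OF mult_left_mono[OF S[OF A] C(1)] M0])
    finally show ?thesis using True by simp
  qed (simp add: F_def)
  have "barg f X * cnj (mon \<beta> X) * of_real (exp (- (norm X)\<^sup>2 / 2))
      = (\<Sum>\<^sub>\<infinity>\<alpha>. f \<alpha> * mon \<alpha> X * cnj (mon \<beta> X) * of_real (exp (- (norm X)\<^sup>2 / 2)))" for X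
  proof -
    have "barg f X * c = (\<Sum>\<^sub>\<infinity>\<alpha>. f \<alpha> * mon \<alpha> X * c)" for c
      unfolding barg_def by (rule infsum_cmult_left'[symmetric])
    from this[of "cnj (mon \<beta> X) * of_real (exp (- (norm X)\<^sup>2 / 2))"] show ?thesis by (simp only: mult.assoc)
  qed
  then have eq: "indicator ?K X *\<^sub>R (barg f X * cnj (mon \<beta> X) * of_real (exp (- (norm X)\<^sup>2 / 2)))
    = (\<Sum>\<^sub>\<infinity>\<alpha>. F \<alpha> X)" for X
    unfolding F_def by (cases "X \<in> ?K") auto
  have "(\<integral>X. F \<alpha> X \<partial>lborel)
    = f \<alpha> * (\<integral>X. indicator ?K X *\<^sub>R (mon \<alpha> X * cnj (mon \<beta> X) * of_real (exp (- (norm X)\<^sup>2 / 2)))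
      \<partial>lborel)" for \<alpha>
    unfolding F_def integral_mult_right_zero[symmetric] by (simp add: mult.assoc)
  then have z: "(\<integral>X. F \<alpha> X \<partial>lborel) = 0" if "\<alpha> \<noteq> \<beta>" for \<alpha>
    using mon_orthogonal_polydisc[OF that] by simp
  have "(\<integral>X. indicator ?K X *\<^sub>R (barg f X * cnj (mon \<beta> X) * of_real (exp (- (norm X)\<^sup>2 / 2))) \<partial>lborel)
    = (\<Sum>\<^sub>\<infinity>\<alpha>. \<integral>X. F \<alpha> X \<partial>lborel)"
    unfolding eq by (rule infsum_integral_dominated(1)[OF meas D dom])
  also have "\<dots> = (\<integral>X. F \<beta> X \<partial>lborel)"
    using infsum_cong_neutral[of "{\<beta>}" UNIV "\<lambda>\<alpha>. \<integral>X. F \<alpha> X \<partial>lborel" "\<lambda>\<alpha>.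
      \<integral>X. F \<alpha> X \<partial>lborel"] by (simp add: z)
  also have "F \<beta> = (\<lambda>X. f \<beta> * complex_of_real (indicator ?K X * gwt \<beta> X))"
    unfolding F_def gwt_def scaleR_conv_of_real of_real_mult complex_norm_square by (simp only: ac_simps)
  also have "(\<integral>X. f \<beta> * complex_of_real (indicator ?K X * gwt \<beta> X) \<partial>lborel)
    = f \<beta> * of_real (\<integral>X. indicator ?K X * gwt \<beta> X \<partial>lborel)"
    unfolding integral_mult_right_zero integral_complex_of_real ..
  finally show ?thesis .
qed

lemma indicator_polydisc_tendsto:
  fixes c :: "'b::real_normed_vector"
  shows "(\<lambda>n. indicator (polydisc (real n)) X *\<^sub>R c) \<longlonglongrightarrow> c"
proof (rule tendsto_eventually)
  obtain N where N: "norm X < real N" using reals_Archimedean2 by blast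
  show "\<forall>\<^sub>F n in sequentially. indicator (polydisc (real n)) X *\<^sub>R c = c"
    using eventually_ge_at_top[of N]
  proof eventually_elim
    case (elim n)
    then have "X \<in> polydisc (real n)"
      using ball_subset_polydisc[of "real n"] N by (auto simp: dist_norm)
    then show ?case by simp
  qed
qed

text \<open>The polydiscs exhaust phase space. The growth hypothesis serves only to supply an
  integrable majorant for this limit.\<close>

lemma coefficient_formula:
  fixes f :: "('n::finite) series"
  assumes f: "f \<in> H_flat_dual" and gr: "\<And>X. cmod (barg f X) * exp (- (norm X)\<^sup>2 / 4) \<le> C * exp (a * norm X)"
  shows "(\<integral>X. barg f X * cnj (mon \<beta> X) * of_real (exp (- (norm X)\<^sup>2 / 2)) \<partial>lborel)
    = f \<beta> * of_real ((2 * pi) ^ CARD('n))"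
proof -
  define G where "G X = barg f X * cnj (mon \<beta> X) * of_real (exp (- (norm X)\<^sup>2 / 2))" for X
  \<comment> \<open>One half of the Gaussian goes with \<open>barg f\<close> into the growth
    hypothesis, the other half absorbs the monomial, which is at most sqrt (\<beta>!) times an
    exponential of the norm.\<close>
  define D where "D X = (C * sqrt (mi_fact \<beta>)) * exp ((a + real CARD('n)) * norm X - 1 / 4 * (norm X)\<^sup>2)" for X :: "(real ^ 'n)
    \<times> (real ^ 'n)"
  have C0: "0 \<le> C"
  proof -
    have "cmod (barg f 0) \<le> C" using gr[of 0] by simp
    then show ?thesis using norm_ge_zero[of "barg f 0"] by linarith
  qed
  have Gb: "norm (G X) \<le> D X" for X
  proof -
    have m: "0 < sqrt (mi_fact \<beta>)" by (simp add: mi_fact_pos)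
    have "1 / sqrt (mi_fact \<beta>) * cmod (mon \<beta> X) \<le> exp (real CARD('n) * norm X)"
      using prod_exp_partial_sums[of 1 "{\<beta>}" X] by simp
    then have mb: "cmod (mon \<beta> X) \<le> sqrt (mi_fact \<beta>) * exp (real CARD('n) * norm X)"
      using m by (simp add: field_simps)
    have "(cmod (barg f X) * exp (- (norm X)\<^sup>2 / 4)) * (cmod (mon \<beta> X) * exp (- (norm X)\<^sup>2 / 4))
      \<le> (C * exp (a * norm X)) * ((sqrt (mi_fact \<beta>) * exp (real CARD('n) * norm X)) * exp (- (norm X)\<^sup>2 / 4))"
      by (rule mult_mono[OF gr mult_right_mono[OF mb]]) (auto simp: C0)
    moreover have "exp (- (norm X)\<^sup>2 / 4) * exp (- (norm X)\<^sup>2 / 4) = exp (- (norm X)\<^sup>2 / 2)" by (simp flip: exp_add)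
    then have "norm (G X) = (cmod (barg f X) * exp (- (norm X)\<^sup>2 / 4)) * (cmod (mon \<beta> X) * exp (- (norm X)\<^sup>2 / 4))"
      by (simp add: G_def norm_mult ac_simps)
    moreover have "(C * exp (a * norm X)) * ((sqrt (mi_fact \<beta>) * exp (real CARD('n) * norm X)) * exp (- (norm X)\<^sup>2 / 4)) = D X"
    proof -
      have "exp (a * norm X) * (exp (real CARD('n) * norm X) * exp (- (norm X)\<^sup>2 / 4))
        = exp ((a + real CARD('n)) * norm X - 1 / 4 * (norm X)\<^sup>2)"
        by (simp add: algebra_simps flip: exp_add)
      then show ?thesis unfolding D_def by (simp add: mult.assoc mult.left_commute)
    qed
    ultimately show ?thesis by (simp only:)
  qed
  have Dint: "integrable lborel D"
    unfolding D_def by (intro integrable_mult_right integrable_exp_norm_gaussian) simp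
  have Gm: "G \<in> borel_measurable borel"
    unfolding G_def
    by (intro borel_measurable_continuous_onI continuous_intros continuous_mon sep_entireD(1)[OF sep_entire_barg[OF f]]) auto
  have "(\<lambda>n. \<integral>X. indicator (polydisc (real n)) X *\<^sub>R G X \<partial>lborel) \<longlonglongrightarrow> (\<integral>X.
    G X \<partial>lborel)"
  proof (rule integral_dominated_convergence[OF _ _ Dint])
    show "G \<in> borel_measurable lborel" using Gm by simp
    show "(\<lambda>X. indicator (polydisc (real n)) X *\<^sub>R G X) \<in> borel_measurable lborel" for n
    proof -
      have "(\<lambda>X. indicator (polydisc (real n)) X *\<^sub>R G X) \<in> borel_measurable borel"
        by (intro borel_measurable_scaleR borel_measurable_indicator polydisc_borel Gm)
      then show ?thesis by simp
    qed
    show "AE X in lborel. (\<lambda>n. indicator (polydisc (real n)) X *\<^sub>R G X) \<longlonglongrightarrow> G X"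
      by (intro AE_I2 indicator_polydisc_tendsto)
    show "AE X in lborel. norm (indicator (polydisc (real n)) X *\<^sub>R G X) \<le> D X" for n
    proof (rule AE_I2)
      fix X :: "(real ^ 'n) \<times> (real ^ 'n)"
      have "norm (indicator (polydisc (real n)) X *\<^sub>R G X) \<le> norm (G X)" by (simp add: indicator_def)
      then show "norm (indicator (polydisc (real n)) X *\<^sub>R G X) \<le> D X" using Gb[of X] by simp
    qed
  qed
  moreover have "(\<lambda>n. \<integral>X. indicator (polydisc (real n)) X *\<^sub>R G X \<partial>lborel) \<longlonglongrightarrow> f
    \<beta> * of_real ((2 * pi) ^ CARD('n))"
  proof -
    have wint: "integrable lborel (gwt \<beta> :: (real ^ 'n) \<times> (real ^ 'n) \<Rightarrow> real)"
      by (rule integrableI_nonneg) (auto simp: gwt_integral)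
    have w: "(\<integral>X. gwt \<beta> X \<partial>lborel) = (2 * pi) ^ CARD('n)"
      using nn_integral_eq_integral[OF wint] gwt_integral[of \<beta>] by (simp add: integral_nonneg)
    have "(\<lambda>n. \<integral>X. indicator (polydisc (real n)) X *\<^sub>R gwt \<beta> X \<partial>lborel) \<longlonglongrightarrow>
      (\<integral>X. gwt \<beta> X \<partial>lborel)"
    proof (rule integral_dominated_convergence[OF _ _ wint])
      show "gwt \<beta> \<in> borel_measurable lborel" by simp
      show "(\<lambda>X. indicator (polydisc (real n)) X *\<^sub>R gwt \<beta> X) \<in> borel_measurable lborel" for n
      proof -
        have "(\<lambda>X. indicator (polydisc (real n)) X *\<^sub>R gwt \<beta> X) \<in> borel_measurable borel"
          by (intro borel_measurable_scaleR borel_measurable_indicator polydisc_borel gwt_measurable)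
        then show ?thesis by simp
      qed
      show "AE X in lborel. (\<lambda>n. indicator (polydisc (real n)) X *\<^sub>R gwt \<beta> X) \<longlonglongrightarrow> gwt \<beta> X"
        by (intro AE_I2 indicator_polydisc_tendsto)
    qed (auto simp: indicator_def)
    then show ?thesis
      unfolding G_def coefficient_polydisc[OF f of_nat_0_le_iff] w
      by (intro tendsto_mult tendsto_const tendsto_of_real) simp
  qed
  ultimately show ?thesis unfolding G_def by (rule LIMSEQ_unique)
qed

lemma c0_square: "(c0 TYPE('n::finite))\<^sup>2 * (2 * pi) ^ CARD('n) = 1"
proof -
  have "(c0 TYPE('n))\<^sup>2 = (2 * pi) powr (- real CARD('n))"
    by (simp add: c0_def power2_eq_square flip: powr_add)
  also have "\<dots> = 1 / (2 * pi) ^ CARD('n)"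
    by (simp add: powr_minus_divide powr_realpow)
  finally show ?thesis by simp
qed

text \<open>The inversion formula of the Gaussian transform, coefficient by coefficient: gph times
  its conjugate is the weight exp (- |X|^2 / 2), and \<open>c0_square\<close> cancels the power of 2
  pi.\<close>

lemma coefficient_stft:
  fixes f :: "('n::finite) series"
  assumes f: "f \<in> H_flat_dual" and gr: "\<And>X. cmod (gauss_stft f X) \<le> C * exp (a * norm X)"
  shows "f \<beta> = (\<integral>X. stft_const TYPE('n) * gauss_stft f X * gph X * cnj (mon \<beta> X) \<partial>lborel)"
proof -
  have "cmod (barg f X) * exp (- (norm X)\<^sup>2 / 4) \<le> (C / c0 TYPE('n)) * exp (a * norm X)" for X
    using gr[of X] c0_pos[where 'n = 'n] unfolding norm_gauss_stft gmod_def by (simp add: field_simps)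
  note eq = coefficient_formula[OF f this, of \<beta>]
  have g: "gph X * cnj (gph X) = of_real (exp (- (norm X)\<^sup>2 / 2))" for X :: "(real ^ 'n) \<times> (real ^ 'n)"
    unfolding complex_norm_square[symmetric] norm_gph by (simp add: power2_eq_square flip: exp_add of_real_mult)
  have "(\<integral>X. stft_const TYPE('n) * gauss_stft f X * gph X * cnj (mon \<beta> X) \<partial>lborel)
    = (\<integral>X. of_real ((c0 TYPE('n))\<^sup>2) * (barg f X * cnj (mon \<beta> X) * of_real (exp (- (norm X)\<^sup>2 / 2))) \<partial>lborel)"
    unfolding gauss_stft_barg stft_const_c0 g[symmetric] by (simp add: power2_eq_square ac_simps)
  also have "\<dots> = of_real ((c0 TYPE('n))\<^sup>2) * (f \<beta> * of_real ((2 * pi) ^ CARD('n)))"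
    unfolding integral_mult_right_zero eq ..
  also have "\<dots> = f \<beta> * of_real ((c0 TYPE('n))\<^sup>2 * (2 * pi) ^ CARD('n))" by simp
  also have "\<dots> = f \<beta>" unfolding c0_square by simp
  finally show ?thesis by simp
qed

text \<open>Moyal's identity. The inversion formula is inserted for each coefficient of f, and the
  sum is moved inside; the decay of h in \<open>H_flat\<close> turns the sum over the monomials into
  an exponential, which the Gaussian of \<open>gph\<close> dominates.\<close>

lemma flat_form_eq_integral:
  fixes f :: "('n::finite) series"
  assumes f: "f \<in> H_flat_dual" and gr: "\<And>X. cmod (gauss_stft f X) \<le> C * exp (a * norm X)" and h: "h \<in> H_flat"
  shows "flat_form f h = (\<integral>X. gauss_stft f X * cnj (gauss_stft h X) \<partial>lborel)"
    and "integrable lborel (\<lambda>X. gauss_stft f X * cnj (gauss_stft h X))"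
proof -
  obtain B r where B: "0 \<le> B" "0 < r" "\<And>\<alpha>. cmod (h \<alpha>) \<le> B * (r ^ mi_length \<alpha> / sqrt (mi_fact \<alpha>))"
    using H_flat_bound[OF h] by metis
  let ?c = "c0 TYPE('n)"
  define F where "F \<beta> X = stft_const TYPE('n) * gauss_stft f X * gph X * cnj (mon \<beta> X) * cnj (h \<beta>)" for \<beta> X
  define D where "D X = (?c * C * B) * exp ((a + r * real CARD('n)) * norm X - 1 / 4 * (norm X)\<^sup>2)" for X :: "(real ^ 'n) \<times> (real ^ 'n)"
  have C0: "0 \<le> C" using gr[of 0] order.trans[OF norm_ge_zero gr[of 0]] by simp
  have Dint: "integrable lborel D"
    unfolding D_def by (intro integrable_mult_right integrable_exp_norm_gaussian) simp
  have "F \<beta> \<in> borel_measurable borel" for \<beta>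
    unfolding F_def
    by (intro borel_measurable_continuous_onI continuous_intros continuous_mon continuous_gph continuous_gauss_stft f)
  then have meas: "F \<beta> \<in> borel_measurable lborel" for \<beta> by simp
  have dom: "(\<Sum>\<beta>\<in>S. norm (F \<beta> X)) \<le> D X" if S: "finite S" for S X
  proof -
    have nF: "norm (F \<beta> X) \<le> (?c * (C * exp (a * norm X)) * exp (- (norm X)\<^sup>2 / 4) * B) * (r ^ mi_length \<beta> / sqrt
      (mi_fact \<beta>) * cmod (mon \<beta> X))" for \<beta>
    proof -
      have "norm (F \<beta> X) = (?c * cmod (gauss_stft f X) * exp (- (norm X)\<^sup>2 / 4) * cmod (mon \<beta> X)) * cmod (h \<beta>)"
        using c0_pos[where 'n = 'n] by (simp add: F_def norm_mult norm_gph stft_const_c0)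
      also have "\<dots> \<le> (?c * (C * exp (a * norm X)) * exp (- (norm X)\<^sup>2 / 4) * cmod (mon \<beta> X)) * (B * (r ^ mi_length
        \<beta> / sqrt (mi_fact \<beta>)))"
        using c0_pos[where 'n = 'n] C0 by (intro mult_mono mult_right_mono mult_left_mono gr B(3)) auto
      finally show ?thesis by (simp add: ac_simps)
    qed
    have "(\<Sum>\<beta>\<in>S. norm (F \<beta> X))
      \<le> (\<Sum>\<beta>\<in>S. (?c * (C * exp (a * norm X)) * exp (- (norm X)\<^sup>2 / 4) * B) * (r ^ mi_length \<beta> / sqrt (mi_fact
        \<beta>) * cmod (mon \<beta> X)))"
      by (intro sum_mono nF)
    also have "\<dots> = (?c * (C * exp (a * norm X)) * exp (- (norm X)\<^sup>2 / 4) * B) * (\<Sum>\<beta>\<in>S. r ^ mi_length \<beta> /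
      sqrt (mi_fact \<beta>) * cmod (mon \<beta> X))"
      by (rule sum_distrib_left[symmetric])
    also have "\<dots> \<le> (?c * (C * exp (a * norm X)) * exp (- (norm X)\<^sup>2 / 4) * B) * exp (r * real CARD('n) * norm X)"
      using c0_pos[where 'n = 'n] C0 B S by (intro mult_left_mono prod_exp_partial_sums) auto
    also have "\<dots> = D X"
    proof -
      have "exp (a * norm X) * (exp (- (norm X)\<^sup>2 / 4) * exp (r * real CARD('n) * norm X))
        = exp ((a + r * real CARD('n)) * norm X - 1 / 4 * (norm X)\<^sup>2)"
        by (simp add: algebra_simps flip: exp_add)
      then show ?thesis unfolding D_def by (simp add: mult.assoc mult.left_commute)
    qed
    finally show ?thesis .
  qed
  have eq: "(\<Sum>\<^sub>\<infinity>\<beta>. F \<beta> X) = gauss_stft f X * cnj (gauss_stft h X)" for X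
  proof -
    have "cnj (gauss_stft h X) = stft_const TYPE('n) * gph X * cnj (barg h X)"
      unfolding gauss_stft_barg stft_const_c0 by simp
    moreover have "cnj (barg h X) = (\<Sum>\<^sub>\<infinity>\<beta>. cnj (h \<beta> * mon \<beta> X))"
      unfolding barg_def by (rule infsum_cnj[symmetric])
    moreover have "(\<Sum>\<^sub>\<infinity>\<beta>. F \<beta> X)
      = (\<Sum>\<^sub>\<infinity>\<beta>. (gauss_stft f X * (stft_const TYPE('n) * gph X)) * cnj (h \<beta> * mon \<beta> X))"
      unfolding F_def by (simp add: ac_simps)
    ultimately show ?thesis by (simp only: infsum_cmult_right' mult.assoc)
  qed
  have "flat_form f h = (\<Sum>\<^sub>\<infinity>\<beta>. \<integral>X. F \<beta> X \<partial>lborel)"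
    unfolding flat_form_def F_def integral_mult_left_zero coefficient_stft[OF f gr, symmetric] ..
  also have "\<dots> = (\<integral>X. (\<Sum>\<^sub>\<infinity>\<beta>. F \<beta> X) \<partial>lborel)"
    by (rule infsum_integral_dominated(1)[OF meas Dint dom, symmetric])
  finally show "flat_form f h = (\<integral>X. gauss_stft f X * cnj (gauss_stft h X) \<partial>lborel)" unfolding eq .
  show "integrable lborel (\<lambda>X. gauss_stft f X * cnj (gauss_stft h X))"
    using infsum_integral_dominated(2)[OF meas Dint dom] unfolding eq .
qed

subsection \<open>Time-frequency shifts of square-integrable windows\<close>

text \<open>Windows in \<open>L2\<close> are Lebesgue measurable only, so translations are
  considered on the completed measure.\<close>

lemma lebesgue_translation:
  fixes t :: "'a::euclidean_space"
  shows "(\<lambda>y. t + y) \<in> lebesgue \<rightarrow>\<^sub>M lebesgue" and "distr lebesgue lebesgue (\<lambda>y. t + y) = lebesgue"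
proof -
  have T: "(\<lambda>x. t + (\<Sum>j\<in>Basis. (1 * (x \<bullet> j)) *\<^sub>R j)) = (\<lambda>y. t + y)"
    by (simp add: euclidean_representation)
  show "(\<lambda>y. t + y) \<in> lebesgue \<rightarrow>\<^sub>M lebesgue"
    using lebesgue_affine_measurable[of "\<lambda>_. 1" t] unfolding T by simp
  have "lebesgue = density (distr lebesgue lebesgue (\<lambda>y. t + y)) (\<lambda>_. 1)"
    using lebesgue_affine_euclidean[of "\<lambda>_. 1" t] unfolding T by simp
  then show "distr lebesgue lebesgue (\<lambda>y. t + y) = lebesgue" by (simp add: density_1)
qed

lemma integral_lebesgue_translation:
  fixes f :: "'a::euclidean_space \<Rightarrow> complex"
  assumes "f \<in> borel_measurable lebesgue"
  shows "(\<integral>y. f (t + y) \<partial>lebesgue) = (\<integral>y. f y \<partial>lebesgue)"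
proof -
  have "(\<integral>y. f y \<partial>lebesgue) = (\<integral>y. f y \<partial>distr lebesgue lebesgue (\<lambda>y. t + y))"
    by (simp add: lebesgue_translation(2))
  also have "\<dots> = (\<integral>y. f (t + y) \<partial>lebesgue)"
    by (rule integral_distr[OF lebesgue_translation(1) assms])
  finally show ?thesis by simp
qed

lemma continuous_measurable_lebesgue:
  fixes f :: "'a::euclidean_space \<Rightarrow> complex"
  shows "continuous_on UNIV f \<Longrightarrow> f \<in> borel_measurable lebesgue"
  by (rule measurable_completion) (simp add: borel_measurable_continuous_onI)

lemma tf_shift_measurable:
  fixes \<phi> :: "real ^ 'n \<Rightarrow> complex"
  assumes "\<phi> \<in> borel_measurable lebesgue"
  shows "tf_shift x \<xi> \<phi> \<in> borel_measurable lebesgue"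
proof -
  have "(\<lambda>y. \<phi> (y - x)) \<in> borel_measurable lebesgue"
    using measurable_compose[OF lebesgue_translation(1)[of "- x"] assms] by simp
  moreover have "(\<lambda>y. cis (y \<bullet> \<xi>)) \<in> borel_measurable lebesgue"
    unfolding cis_conv_exp by (intro continuous_measurable_lebesgue continuous_intros)
  ultimately show ?thesis unfolding tf_shift_def[abs_def] by simp
qed

lemma tf_shift_L2:
  fixes \<phi> :: "real ^ 'n \<Rightarrow> complex"
  assumes "\<phi> \<in> L2"
  shows "tf_shift x \<xi> \<phi> \<in> L2"
proof -
  have m: "\<phi> \<in> borel_measurable lebesgue" and i: "integrable lebesgue (\<lambda>y. (cmod (\<phi> y))\<^sup>2)"
    using assms by (auto simp: L2_def)
  have "integrable (distr lebesgue lebesgue (\<lambda>y. - x + y)) (\<lambda>y. (cmod (\<phi> y))\<^sup>2)"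
    using i by (simp only: lebesgue_translation(2))
  then have "integrable lebesgue (\<lambda>y. (cmod (\<phi> (- x + y)))\<^sup>2)"
    by (rule integrable_distr[OF lebesgue_translation(1)])
  then show ?thesis using tf_shift_measurable[OF m] by (simp add: L2_def tf_shift_def norm_mult)
qed

lemma gauss_stft_L2:
  fixes \<psi> :: "real ^ 'n \<Rightarrow> complex"
  assumes "\<psi> \<in> L2"
  shows "gauss_stft (hermite_series \<psi>) X = stft_const TYPE('n) * L2_form \<psi> (tf_shift (fst X) (snd X) gaussian)"
  using flat_form_hermite_series_gaussian[OF assms, of X] by (cases X) (simp add: gauss_stft_def)

lemma L2_form_tf_shift:
  fixes \<phi> :: "real ^ 'n \<Rightarrow> complex"
  assumes "\<phi> \<in> L2"
  shows "L2_form (tf_shift x \<xi> \<phi>) (tf_shift y \<eta> gaussian)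
    = cis (x \<bullet> (\<xi> - \<eta>)) * L2_form \<phi> (tf_shift (y - x) (\<eta> - \<xi>) gaussian)"
proof -
  define f where "f u = tf_shift x \<xi> \<phi> u * cnj (tf_shift y \<eta> gaussian u)" for u
  have m: "\<phi> \<in> borel_measurable lebesgue" using assms by (simp add: L2_def)
  have "(\<lambda>u. cnj (tf_shift y \<eta> gaussian u)) \<in> borel_measurable lebesgue"
    by (intro continuous_measurable_lebesgue continuous_intros continuous_tf_shift_gaussian)
  then have fm: "f \<in> borel_measurable lebesgue"
    unfolding f_def[abs_def] using tf_shift_measurable[OF m, of x \<xi>] by simp
  have f: "f (x + w) = cis (x \<bullet> (\<xi> - \<eta>)) * (\<phi> w * cnj (tf_shift (y - x) (\<eta> - \<xi>) gaussian w))" for w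
  proof -
    have *: "cis ((x + w) \<bullet> \<xi>) * cnj (cis ((x + w) \<bullet> \<eta>))
      = cis (x \<bullet> (\<xi> - \<eta>)) * cnj (cis (w \<bullet> (\<eta> - \<xi>)))"
      by (simp add: cis_cnj cis_mult inner_add_left inner_diff_right algebra_simps)
    have sh: "x + w - y = w - (y - x)" "x + w - x = w" by simp_all
    have "f (x + w) = (cis ((x + w) \<bullet> \<xi>) * cnj (cis ((x + w) \<bullet> \<eta>))) * (\<phi> w * cnj (gaussian (w - (y - x))))"
      unfolding f_def tf_shift_def sh complex_cnj_mult by (simp only: mult.assoc mult.commute mult.left_commute)
    also have "\<dots> = cis (x \<bullet> (\<xi> - \<eta>)) * (\<phi> w * cnj (tf_shift (y - x) (\<eta> - \<xi>) gaussian w))"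
      unfolding * tf_shift_def complex_cnj_mult by (simp only: mult.assoc mult.commute mult.left_commute)
    finally show ?thesis .
  qed
  have "L2_form (tf_shift x \<xi> \<phi>) (tf_shift y \<eta> gaussian) = (\<integral>u. f u \<partial>lebesgue)"
    by (simp add: L2_form_def f_def)
  also have "\<dots> = (\<integral>w. f (x + w) \<partial>lebesgue)" by (rule integral_lebesgue_translation[OF fm, symmetric])
  also have "\<dots> = cis (x \<bullet> (\<xi> - \<eta>)) * L2_form \<phi> (tf_shift (y - x) (\<eta> - \<xi>) gaussian)"
    unfolding f integral_mult_right_zero L2_form_def ..
  finally show ?thesis .
qed

text \<open>Covariance of the short-time Fourier transform; taking moduli removes the phase in
  \<open>L2_form_tf_shift\<close>.\<close>

lemma norm_gauss_stft_shift:
  fixes \<phi> :: "real ^ 'n \<Rightarrow> complex"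
  assumes "\<phi> \<in> L2"
  shows "cmod (gauss_stft (hermite_series (tf_shift x \<xi> \<phi>)) Y) = cmod (gauss_stft (hermite_series \<phi>) (Y - (x, \<xi>)))"
  unfolding gauss_stft_L2[OF assms] gauss_stft_L2[OF tf_shift_L2[OF assms]]
  by (simp add: L2_form_tf_shift[OF assms] norm_mult)

subsection \<open>Weights\<close>

text \<open>A weight is bounded only off a null set N, yet a bound at every point is wanted. The
  translates of N by x / 2 and - x / 2 do not cover the unit ball, so x = y - z with y and z outside
  N, and submultiplicativity with evenness bounds v at x.\<close>

lemma submultiplicative_bounded_unit_ball:
  fixes v :: "'a::euclidean_space \<Rightarrow> real"
  assumes v: "submultiplicative v"
  obtains M where "1 \<le> M" "\<And>x. norm x \<le> 1 \<Longrightarrow> v x \<le> M"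
proof -
  have pos: "0 < v x" and even: "v (- x) = v x" for x
    using v by (auto simp: submultiplicative_def weight_def)
  obtain C where C: "0 < C" "\<And>x y. v (x + y) \<le> C * v x * v y"
    using v unfolding submultiplicative_def by blast
  have "locally_ess_bounded v" using v by (simp add: submultiplicative_def weight_def)
  then obtain B where B: "AE x in lebesgue. x \<in> cball 0 2 \<longrightarrow> \<bar>v x\<bar> \<le> B"
    unfolding locally_ess_bounded_def using compact_cball by blast
  then obtain N where N: "N \<in> null_sets lebesgue" "{x \<in> space lebesgue. \<not> (x \<in> cball 0 2 \<longrightarrow> \<bar>v x\<bar>
    \<le> B)} \<subseteq> N"
    by (auto simp: eventually_ae_filter)
  then have neg: "negligible N" by (simp add: negligible_iff_null_sets)
  have vB: "v x \<le> B" if "norm x \<le> 2" "x \<notin> N" for x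
    using N(2) that pos[of x] by auto
  have bd: "v x \<le> C * B * B" if x: "norm x \<le> 1" for x
  proof -
    have "negligible ((+) (- ((1 / 2) *\<^sub>R x)) ` N \<union> (+) ((1 / 2) *\<^sub>R x) ` N)"
      by (intro negligible_Un negligible_translation neg)
    moreover have "\<not> negligible (ball (0::'a) 1)"
      by (simp add: open_not_negligible)
    ultimately have "\<not> ball 0 1 \<subseteq> (+) (- ((1 / 2) *\<^sub>R x)) ` N \<union> (+) ((1 / 2) *\<^sub>R x) ` N"
      using negligible_subset by blast
    then obtain w where w: "norm w < 1" "w \<notin> (+) (- ((1 / 2) *\<^sub>R x)) ` N" "w \<notin> (+) ((1 / 2) *\<^sub>R x) ` N"
      unfolding subset_iff mem_ball Un_iff by (auto simp only: dist_0_norm)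
    define y z where "y = (1 / 2) *\<^sub>R x + w" and "z = w - (1 / 2) *\<^sub>R x"
    have "y \<notin> N"
    proof
      assume "y \<in> N"
      then have "- ((1 / 2) *\<^sub>R x) + y \<in> (+) (- ((1 / 2) *\<^sub>R x)) ` N" by (rule imageI)
      then show False using w(2) by (simp add: y_def)
    qed
    moreover have "z \<notin> N"
    proof
      assume "z \<in> N"
      then have "(1 / 2) *\<^sub>R x + z \<in> (+) ((1 / 2) *\<^sub>R x) ` N" by (rule imageI)
      then show False using w(3) by (simp add: z_def)
    qed
    moreover have "norm y \<le> 2" unfolding y_def using norm_triangle_ineq[of "(1 / 2) *\<^sub>R x" w] x w by simp
    moreover have "norm z \<le> 2" unfolding z_def using norm_triangle_ineq4[of w "(1 / 2) *\<^sub>R x"] x w by simp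
    ultimately have yz: "v y \<le> B" "v z \<le> B" by (auto intro: vB)
    have "x = (1 / 2) *\<^sub>R x + (1 / 2) *\<^sub>R x" by (simp flip: scaleR_add_left)
    then have "x = y + (- z)" by (simp add: y_def z_def)
    then have "v x \<le> C * v y * v z" using C(2)[of y "- z"] even[of z] by simp
    also have "\<dots> \<le> C * B * B"
      using yz C(1) pos[of y] pos[of z] by (intro mult_mono) auto
    finally show ?thesis .
  qed
  show thesis by (rule that[of "max 1 (C * B * B)"]) (use bd in \<open>auto intro: le_max_iff_disj[THEN iffD2]\<close>)
qed

text \<open>Above: x is cut into about |x| pieces of norm at most 1, each costing a factor C M.
  Below: v 0 \<le> C (v x)^2 by evenness.\<close>

lemma submultiplicative_bounds:
  fixes v :: "'a::euclidean_space \<Rightarrow> real"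
  assumes v: "submultiplicative v"
  obtains A a c where "0 < A" "\<And>x. v x \<le> A * exp (a * norm x)" "0 < c" "\<And>x. c \<le> v x"
proof -
  have pos: "0 < v x" and even: "v (- x) = v x" for x
    using v by (auto simp: submultiplicative_def weight_def)
  obtain C' where C': "0 < C'" "\<And>x y. v (x + y) \<le> C' * v x * v y"
    using v unfolding submultiplicative_def by blast
  define C where "C = max 1 C'"
  have C: "1 \<le> C" "v (x + y) \<le> C * v x * v y" for x y
  proof -
    have "C' * v x * v y \<le> C * v x * v y"
      using pos[of x] pos[of y] by (intro mult_right_mono) (auto simp: C_def)
    then show "v (x + y) \<le> C * v x * v y" using C'(2)[of x y] by simp
  qed (simp add: C_def)
  obtain M where M: "1 \<le> M" "\<And>x. norm x \<le> 1 \<Longrightarrow> v x \<le> M"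
    using submultiplicative_bounded_unit_ball[OF v] by metis
  have pw: "norm x \<le> real (Suc n) \<Longrightarrow> v x \<le> M * (C * M) ^ n" for x n
  proof (induction n arbitrary: x)
    case 0
    then show ?case using M(2) by simp
  next
    case (Suc n)
    \<comment> \<open>With s = 1 / (n + 2) the part (1 - s) x has norm at most n + 1, fit for the
      induction hypothesis, and s x has norm at most 1.\<close>
    define s where "s = 1 / real (Suc (Suc n))"
    have s: "0 < s" "s \<le> 1" by (auto simp: s_def)
    have "norm ((1 - s) *\<^sub>R x) \<le> (1 - s) * real (Suc (Suc n))"
      using Suc.prems s by (simp add: mult_left_mono)
    also have "\<dots> = real (Suc n)" by (simp add: s_def field_simps)
    finally have 1: "v ((1 - s) *\<^sub>R x) \<le> M * (C * M) ^ n" by (rule Suc.IH)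
    have "norm (s *\<^sub>R x) \<le> s * real (Suc (Suc n))" using Suc.prems s by (simp add: mult_left_mono)
    also have "\<dots> = 1" by (simp add: s_def)
    finally have 2: "v (s *\<^sub>R x) \<le> M" by (rule M(2))
    have "x = (1 - s) *\<^sub>R x + s *\<^sub>R x" by (simp add: algebra_simps)
    then have "v x \<le> C * v ((1 - s) *\<^sub>R x) * v (s *\<^sub>R x)" using C(2) by metis
    also have "\<dots> \<le> C * (M * (C * M) ^ n) * M"
      using 1 2 C(1) pos M(1) less_imp_le by (intro mult_mono) auto
    finally show ?case by (simp add: ac_simps)
  qed
  define a where "a = ln (C * M)"
  have CM: "1 \<le> C * M" using C(1) M(1) by (metis mult_1 mult_mono' zero_le_one order.trans)
  have up: "v x \<le> (M * (C * M)) * exp (a * norm x)" for x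
  proof -
    define n where "n = nat \<lfloor>norm x\<rfloor>"
    have n: "real n \<le> norm x" "norm x \<le> real (Suc n)"
    proof -
      have "real n = of_int \<lfloor>norm x\<rfloor>" by (simp add: n_def)
      then show "real n \<le> norm x" using of_int_floor_le[of "norm x"] by simp
      have "norm x \<le> of_int \<lfloor>norm x\<rfloor> + 1" using real_of_int_floor_add_one_ge by blast
      then show "norm x \<le> real (Suc n)" using \<open>real n = _\<close> unfolding of_nat_Suc by linarith
    qed
    have "0 < C * M" using CM by linarith
    then have "(C * M) ^ n = exp (a * real n)"
      using exp_of_nat_mult[of n a] by (simp add: a_def mult.commute)
    also have "\<dots> \<le> exp (a * norm x)" using n CM by (simp add: a_def mult_left_mono)
    finally have "M * (C * M) ^ n \<le> M * exp (a * norm x)" using M(1) by simp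
    also have "\<dots> \<le> (M * (C * M)) * exp (a * norm x)" using CM M(1) by (simp add: mult_le_cancel_left1 mult.assoc)
    finally show ?thesis using pw[OF n(2)] by simp
  qed
  have low: "1 / sqrt (C / v 0) \<le> v x" for x
  proof -
    have "v 0 \<le> C * v x * v x" using C(2)[of x "- x"] even[of x] by simp
    then have "1 / (C / v 0) \<le> (v x)\<^sup>2" using C(1) pos[of 0] by (simp add: field_simps power2_eq_square)
    then have "sqrt (1 / (C / v 0)) \<le> v x" using pos[of x] by (intro real_le_lsqrt) auto
    then show ?thesis by (simp add: real_sqrt_divide)
  qed
  have "0 < M" "0 < C * M" using M(1) CM by auto
  then have "0 < M * (C * M)" by (rule mult_pos_pos)
  moreover have "0 < 1 / sqrt (C / v 0)" using C(1) pos[of 0] by auto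
  ultimately show thesis using that up low by blast
qed

section \<open>Slowly varying weights and Borel majorants\<close>

text \<open>Comparability of values at distance at most 1. Unlike moderateness with respect to a
  fixed v, it passes directly to reciprocals and to suprema over unit balls, and it is exactly what
  unit-ball averages ask of a weight.\<close>

definition slow :: "real \<Rightarrow> ('a::euclidean_space \<Rightarrow> real) \<Rightarrow> bool" where
  "slow K u \<longleftrightarrow> 1 \<le> K \<and> (\<forall>x. 0 < u x) \<and> (\<forall>x y. norm (x - y) \<le> 1 \<longrightarrow> u x
    \<le> K * u y)"

lemma moderate_slow:
  assumes v: "submultiplicative v" and m: "moderate v u" and pos: "\<And>x. 0 < u x"
  obtains K where "slow K u"
proof -
  obtain C where C: "0 < C" "\<And>x y. u (x + y) \<le> C * u x * v y"
    using m unfolding moderate_def by blast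
  obtain M where M: "1 \<le> M" "\<And>x. norm x \<le> 1 \<Longrightarrow> v x \<le> M"
    using submultiplicative_bounded_unit_ball[OF v] by metis
  have "u x \<le> max 1 (C * M) * u y" if "norm (x - y) \<le> 1" for x y
  proof -
    have "u x \<le> C * u y * v (x - y)" using C(2)[of y "x - y"] by simp
    also have "\<dots> \<le> C * u y * M" using C(1) pos[of y] M(2)[OF that] by (intro mult_left_mono) auto
    also have "\<dots> = (C * M) * u y" by simp
    also have "\<dots> \<le> max 1 (C * M) * u y" using pos[of y] by (intro mult_right_mono) auto
    finally show ?thesis .
  qed
  then have "slow (max 1 (C * M)) u" using pos by (simp add: slow_def)
  then show thesis by (rule that)
qed

lemma slow_inverse:
  assumes "slow K u" shows "slow K (\<lambda>x. 1 / u x)"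
  unfolding slow_def
proof (intro conjI allI impI)
  show "1 \<le> K" using assms by (simp add: slow_def)
  show "0 < 1 / u x" for x using assms by (simp add: slow_def)
  fix x y :: 'a assume "norm (x - y) \<le> 1"
  then have "u y \<le> K * u x" using assms by (simp add: slow_def norm_minus_commute)
  moreover have "0 < u x" "0 < u y" using assms by (auto simp: slow_def)
  ultimately show "1 / u x \<le> K * (1 / u y)" by (simp add: field_simps)
qed

text \<open>The supremum over unit balls is lower semicontinuous, hence Borel; the weights themselves are only
  Lebesgue measurable, so that their sections need not be measurable.\<close>

lemma slow_borel_majorant:
  fixes u :: "'a::euclidean_space \<Rightarrow> real"
  assumes u: "slow K u"
  obtains w where "w \<in> borel_measurable borel" "\<And>x. u x \<le> w x" "\<And>x. w x \<le> K * u x" "slow (K * K) w"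
proof -
  have K: "1 \<le> K" and pos: "\<And>x. 0 < u x" and sl: "\<And>x y. norm (x - y) \<le> 1 \<Longrightarrow> u x \<le> K * u y"
    using u by (auto simp: slow_def)
  define w where "w x = (SUP z\<in>ball x 1. u z)" for x
  have ub: "u z \<le> K * u x" if "z \<in> ball x 1" for z x
    using that by (intro sl) (simp add: dist_norm norm_minus_commute less_imp_le)
  have bdd: "bdd_above (u ` ball x 1)" for x using ub by (intro bdd_aboveI2) blast
  have le: "u x \<le> w x" for x unfolding w_def by (rule cSUP_upper[OF _ bdd]) simp
  have ge: "w x \<le> K * u x" for x unfolding w_def by (rule cSUP_least) (auto intro: ub)
  have gr: "t < w x \<longleftrightarrow> (\<exists>z\<in>ball x 1. t < u z)" for t x
    unfolding w_def by (rule less_cSUP_iff) (auto intro: bdd)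
  have "w \<in> borel_measurable borel"
  proof (rule borel_measurableI_greater)
    fix t
    have "{x \<in> space borel. t < w x} = (\<Union>z\<in>{z. t < u z}. ball z 1)"
      unfolding gr by (auto simp: dist_commute)
    then show "{x \<in> space borel. t < w x} \<in> sets borel" by (simp add: borel_open open_UN)
  qed
  moreover have "slow (K * K) w"
    unfolding slow_def
  proof (intro conjI allI impI)
    show "1 \<le> K * K" using K mult_mono[of 1 K 1 K] by simp
    show "0 < w x" for x using pos[of x] le[of x] by simp
    fix x y :: 'a assume "norm (x - y) \<le> 1"
    then have "K * u x \<le> K * (K * u y)" using sl K by (intro mult_left_mono) auto
    also have "\<dots> \<le> K * (K * w y)" using le K by (intro mult_left_mono) auto
    finally show "w x \<le> K * K * w y" using ge[of x] by simp
  qed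
  ultimately show thesis using that le ge by blast
qed

subsection \<open>Weighted local estimates\<close>

text \<open>The constant depends on q, r and the dimension only. Therefore the entire factor may
  later vary with the function and with the point of evaluation.\<close>

lemma gmod_local:
  fixes q r :: real
  assumes q: "0 \<le> q" and r: "0 < r" "r \<le> 1"
  obtains C where "0 < C" "\<And>A w. sep_entire (A :: (real ^ 'n) \<times> (real ^ 'n) \<Rightarrow> complex) \<Longrightarrow>
    ennreal (gmod q A w powr r) \<le> ennreal C * (\<integral>\<^sup>+u. indicator (cball 0 1) u * ennreal (gmod q A (w + u) powr r)
      \<partial>lborel)"
proof -
  define m where "m = DIM((real ^ 'n) \<times> (real ^ 'n))"
  define b where "b = sqrt (real CARD('n))"
  define C where "C = exp (q * b\<^sup>2) / unit_ball_vol (real m)"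
  have b: "1 \<le> b" unfolding b_def by (simp add: Suc_le_eq)
  have C: "0 < C" unfolding C_def by (intro divide_pos_pos) auto
  show thesis
  proof (rule that[of "C * (2 * b) ^ m * 2 powr (real m / r * (1 - r))"])
    show "0 < C * (2 * b) ^ m * 2 powr (real m / r * (1 - r))" using C b by auto
    fix A :: "(real ^ 'n) \<times> (real ^ 'n) \<Rightarrow> complex" and w
    assume A: "sep_entire A"
    show "ennreal (gmod q A w powr r) \<le> ennreal (C * (2 * b) ^ m * 2 powr (real m / r * (1 - r))) *
      (\<integral>\<^sup>+u. indicator (cball 0 1) u * ennreal (gmod q A (w + u) powr r) \<partial>lborel)"
    proof (rule sub_mean_value_small_exponent[OF continuous_gmod[OF A] gmod_nonneg less_imp_le[OF C] b _ r])
      show "0 < m" unfolding m_def by simp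
      show "ennreal (\<rho> ^ m * gmod q A w) \<le> ennreal C * (\<integral>\<^sup>+u. indicator (cball 0 (b * \<rho>)) u * ennreal (gmod q
        A (w + u)) \<partial>lborel)"
        if "0 < \<rho>" "\<rho> \<le> 1" for w \<rho>
        unfolding C_def m_def b_def by (rule gmod_mean_value[OF A q that])
    qed
  qed
qed

text \<open>The weight at the centre is at most L times its value at x + u, so it can be drawn into
  the average at the cost of L^r.\<close>

lemma weighted_local:
  fixes H w :: "'a::euclidean_space \<Rightarrow> real"
  assumes loc: "\<And>x. ennreal (H x powr r)
    \<le> ennreal C * (\<integral>\<^sup>+u. indicator (cball 0 1) u * ennreal (H (x + u) powr r) \<partial>lborel)"
    and w: "slow L w" and H0: "\<And>x. 0 \<le> H x" and r: "0 < r" and C: "0 < C"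
    and [measurable]: "H \<in> borel_measurable borel" "w \<in> borel_measurable borel"
  shows "ennreal ((H x * w x) powr r) \<le> ennreal (C * L powr r) *
    (\<integral>\<^sup>+u. indicator (cball 0 1) u * ennreal ((H (x + u) * w (x + u)) powr r) \<partial>lborel)"
proof -
  have L: "1 \<le> L" and pos: "\<And>x. 0 < w x" and sl: "\<And>x y. norm (x - y) \<le> 1 \<Longrightarrow> w x \<le> L * w y"
    using w by (auto simp: slow_def)
  have [measurable]: "(\<lambda>u. indicator (cball 0 1) u * ennreal ((H (x + u) * w (x + u)) powr r)) \<in> borel_measurable borel"
    by measurable
  have "ennreal ((H x * w x) powr r) = ennreal (w x powr r) * ennreal (H x powr r)"
    using H0[of x] pos[of x] by (simp add: powr_mult ennreal_mult mult.commute)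
  also have "\<dots> \<le> ennreal (w x powr r) * (ennreal C * (\<integral>\<^sup>+u. indicator (cball 0 1) u * ennreal (H (x + u) powr r)
    \<partial>lborel))"
    by (intro mult_left_mono loc) auto
  also have "\<dots> = ennreal C * (\<integral>\<^sup>+u. ennreal (w x powr r) * (indicator (cball 0 1) u * ennreal (H (x + u) powr r))
    \<partial>lborel)"
    by (subst nn_integral_cmult) (auto simp: mult.left_commute)
  also have "\<dots> \<le> ennreal C * (\<integral>\<^sup>+u. ennreal (L powr r) * (indicator (cball 0 1) u * ennreal ((H (x + u) * w (x +
    u)) powr r)) \<partial>lborel)"
  proof (intro mult_left_mono nn_integral_mono)
    fix u :: 'a
    show "ennreal (w x powr r) * (indicator (cball 0 1) u * ennreal (H (x + u) powr r))
      \<le> ennreal (L powr r) * (indicator (cball 0 1) u * ennreal ((H (x + u) * w (x + u)) powr r))"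
    proof (cases "u \<in> cball 0 1")
      case True
      then have "w x \<le> L * w (x + u)" by (intro sl) simp
      then have "w x powr r \<le> (L * w (x + u)) powr r" using pos[of x] r by (intro powr_mono2) auto
      also have "\<dots> = L powr r * w (x + u) powr r" using L pos[of "x + u"] by (simp add: powr_mult)
      finally have "w x powr r * H (x + u) powr r \<le> (L powr r * w (x + u) powr r) * H (x + u) powr r"
        by (rule mult_right_mono) simp
      also have "\<dots> = L powr r * (H (x + u) * w (x + u)) powr r"
        using H0[of "x + u"] pos[of "x + u"] by (simp add: powr_mult)
      finally have "ennreal (w x powr r * H (x + u) powr r) \<le> ennreal (L powr r * (H (x + u) * w (x + u)) powr r)"
        by (rule ennreal_leI)
      then show ?thesis using True by (simp add: ennreal_mult)
    qed simp
  qed simp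
  also have "\<dots> = ennreal C * (ennreal (L powr r) * (\<integral>\<^sup>+u. indicator (cball 0 1) u * ennreal ((H (x + u) * w (x + u))
    powr r) \<partial>lborel))"
    by (subst nn_integral_cmult) auto
  finally show ?thesis using C by (simp add: ennreal_mult mult.assoc)
qed

lemma local_imp_global:
  fixes \<kappa> :: "'a::euclidean_space \<Rightarrow> ennreal"
  assumes loc: "\<kappa> x \<le> C * (\<integral>\<^sup>+u. indicator (cball 0 1) u * \<kappa> (x + u) \<partial>lborel)"
    and [measurable]: "\<kappa> \<in> borel_measurable borel"
  shows "\<kappa> x \<le> C * (\<integral>\<^sup>+u. \<kappa> u \<partial>lborel)"
proof -
  have "(\<integral>\<^sup>+u. indicator (cball 0 1) u * \<kappa> (x + u) \<partial>lborel)
    \<le> (\<integral>\<^sup>+u. \<kappa> (x + u) \<partial>lborel)"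
    by (intro nn_integral_mono) (auto simp: indicator_def)
  also have "\<dots> = (\<integral>\<^sup>+u. \<kappa> u \<partial>lborel)"
    using nn_integral_lborel_shift[of \<kappa> x] by (simp add: add.commute)
  finally show ?thesis using loc by (meson mult_left_mono order.trans zero_le)
qed

subsection \<open>Synthesis with Gaussian atoms\<close>

abbreviation atom :: "(real ^ 'n) \<times> (real ^ 'n) \<Rightarrow> ('n::finite) series" where
  "atom Y \<equiv> hermite_series (tf_shift (fst Y) (snd Y) gaussian)"

text \<open>The coefficients of the superposition of the atoms with density u, the adjoint of the
  Gaussian transform, since \<open>gph Y * cnj (mon \<alpha> Y)\<close> is the \<alpha>-th
  coefficient of \<open>atom Y\<close>. A scalar integral for each coefficient replaces a
  vector-valued one.\<close>

definition synth :: "((real ^ 'n) \<times> (real ^ 'n) \<Rightarrow> complex) \<Rightarrow> ('n::finite) series" where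
  "synth u \<alpha> = (\<integral>Y. stft_const TYPE('n) * u Y * gph Y * cnj (mon \<alpha> Y) \<partial>lborel)"

lemma synth_gauss_stft:
  fixes f :: "('n::finite) series"
  assumes "f \<in> H_flat_dual" and "\<And>X. cmod (gauss_stft f X) \<le> C * exp (a * norm X)"
  shows "synth (gauss_stft f) = f"
  unfolding synth_def using coefficient_stft[OF assms] by auto

lemma mon_zero: "mon \<alpha> 0 = (if \<alpha> = (\<lambda>_. 0) then 1 else 0)"
proof (cases "\<alpha> = (\<lambda>_. 0)")
  case False
  then obtain i where "\<alpha> i \<noteq> 0" by auto
  then show ?thesis unfolding mon_def using False by (auto intro!: prod_zero)
qed (simp add: mon_def)

lemma gaussian_L2: "(gaussian :: real ^ 'n \<Rightarrow> complex) \<in> L2"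
proof -
  have h: "hermite (\<lambda>_. 0) = (gaussian :: real ^ 'n \<Rightarrow> complex)"
  proof
    fix y :: "real ^ 'n"
    have "(\<Prod>i\<in>UNIV. hermite1 0 (y $ i)) = pi powr (- real CARD('n) / 4) * exp (- (norm y)\<^sup>2 / 2)"
    proof -
      have "(\<Prod>i\<in>(UNIV::'n set). pi powr (- 1 / 4)) = pi powr (- real CARD('n) / 4)"
        by (simp add: powr_power)
      moreover have "(\<Prod>i\<in>UNIV. exp (- (y $ i)\<^sup>2 / 2)) = exp (- (norm y)\<^sup>2 / 2)"
        by (simp add: exp_sum[symmetric] norm_vec_def L2_set_def sum_nonneg sum_divide_distrib sum_negf)
      moreover have "hermite1 0 t = pi powr (- 1 / 4) * exp (- t\<^sup>2 / 2)" for t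
        by (simp add: hermite1_def flip: exp_add)
      ultimately show ?thesis by (simp add: prod.distrib)
    qed
    then show "hermite (\<lambda>_. 0) y = gaussian y" by (simp add: hermite_def gaussian_def)
  qed
  have "(\<lambda>y :: real ^ 'n. (cmod (hermite (\<lambda>_. 0) y))\<^sup>2) \<in> borel_measurable borel"
    by (intro borel_measurable_continuous_onI continuous_intros continuous_hermite)
  then have "integrable lebesgue (\<lambda>y :: real ^ 'n. (cmod (hermite (\<lambda>_. 0) y))\<^sup>2)"
    using hermite_square_integral(1)[of "\<lambda>_. 0"] by (simp add: integrable_completion)
  moreover have "hermite (\<lambda>_. 0) \<in> borel_measurable (lebesgue :: (real ^ 'n) measure)"
    by (intro continuous_measurable_lebesgue continuous_hermite)
  ultimately show ?thesis unfolding L2_def h by simp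
qed

text \<open>By covariance only the unshifted Gaussian matters; its Hermite series has the single
  coefficient 1 at 0, so its Bargmann transform is the constant 1.\<close>

lemma norm_gauss_stft_atom:
  fixes Y Z :: "(real ^ 'n) \<times> (real ^ 'n)"
  shows "cmod (gauss_stft (atom Y) Z) = c0 TYPE('n) * exp (- (norm (Z - Y))\<^sup>2 / 4)"
proof -
  have b: "barg (hermite_series gaussian) U = 1" for U :: "(real ^ 'n) \<times> (real ^ 'n)"
  proof -
    have g: "gaussian = tf_shift (fst 0) (snd 0) (gaussian :: real ^ 'n \<Rightarrow> complex)"
      by (auto simp: tf_shift_def)
    have "hermite_series (gaussian :: real ^ 'n \<Rightarrow> complex) \<alpha> = (if \<alpha> = (\<lambda>_. 0) then 1 else 0)" for \<alpha>
      using hermite_series_gaussian[of "0 :: (real ^ 'n) \<times> (real ^ 'n)" \<alpha>] unfolding g[symmetric]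
      by (simp add: mon_zero gph_def)
    then have "barg (hermite_series gaussian) U = (\<Sum>\<^sub>\<infinity>\<alpha>\<in>{\<lambda>_. 0}. mon \<alpha> U)"
      unfolding barg_def by (intro infsum_cong_neutral) auto
    then show ?thesis by (simp add: mon_def)
  qed
  have "cmod (gauss_stft (atom Y) Z) = cmod (gauss_stft (hermite_series gaussian) (Z - Y))"
    using norm_gauss_stft_shift[OF gaussian_L2, of "fst Y" "snd Y" Z] by simp
  also have "\<dots> = c0 TYPE('n) * exp (- (norm (Z - Y))\<^sup>2 / 4)"
    by (simp add: norm_gauss_stft gmod_def b)
  finally show ?thesis .
qed

lemma synth_integrable:
  fixes u :: "(real ^ 'n) \<times> (real ^ 'n) \<Rightarrow> complex"
  assumes um: "u \<in> borel_measurable borel" and gr: "\<And>X. cmod (u X) \<le> C * exp (a * norm X)"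
  shows "integrable lborel (\<lambda>Y. stft_const TYPE('n) * u Y * gph Y * cnj (mon \<alpha> Y))"
    and "gauss_stft (synth u) Z = (\<integral>Y. stft_const TYPE('n) * u Y * gauss_stft (atom Y) Z \<partial>lborel)"
    and "integrable lborel (\<lambda>Y. stft_const TYPE('n) * u Y * gauss_stft (atom Y) Z)"
proof -
  let ?c = "c0 TYPE('n)"

  have C0: "0 \<le> C" using order.trans[OF norm_ge_zero gr[of 0]] by simp
  have F: "(\<lambda>Y. stft_const TYPE('n) * u Y * gph Y * cnj (mon \<alpha> Y)) \<in> borel_measurable lborel" for \<alpha> :: "'n
    \<Rightarrow> nat"
  proof -
    have "(\<lambda>Y. stft_const TYPE('n) * u Y * gph Y * cnj (mon \<alpha> Y)) \<in> borel_measurable borel"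
      by (intro borel_measurable_times borel_measurable_const um borel_measurable_continuous_onI continuous_intros continuous_gph continuous_mon)
    then show ?thesis by simp
  qed
  \<comment> \<open>One majorant for two purposes: a single coefficient, with c = 1, and the whole
    series for the transform at Z, with c the factor of the \<alpha>-th coefficient there.\<close>
  have key: "(\<Sum>\<alpha>\<in>S. norm (stft_const TYPE('n) * u Y * gph Y * cnj (mon \<alpha> Y) * c \<alpha>))
      \<le> (?c * C * B) * exp ((a + R * real CARD('n)) * norm Y - 1 / 4 * (norm Y)\<^sup>2)"
    if S: "finite S" and R: "0 \<le> R" and B: "0 \<le> B" and c: "\<And>\<alpha>. \<alpha> \<in> S \<Longrightarrow> cmod (c \<alpha>)
      \<le> B * (R ^ mi_length \<alpha> / sqrt (mi_fact \<alpha>))" for S Y R B c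
  proof -
    have nF: "norm (stft_const TYPE('n) * u Y * gph Y * cnj (mon \<alpha> Y) * c \<alpha>)
      \<le> (?c * (C * exp (a * norm Y)) * exp (- (norm Y)\<^sup>2 / 4) * B) * (R ^ mi_length \<alpha> / sqrt (mi_fact \<alpha>) * cmod (mon
        \<alpha> Y))" if \<alpha>: "\<alpha> \<in> S" for \<alpha>
    proof -
      have "norm (stft_const TYPE('n) * u Y * gph Y * cnj (mon \<alpha> Y) * c \<alpha>)
        = (?c * cmod (u Y) * exp (- (norm Y)\<^sup>2 / 4) * cmod (mon \<alpha> Y)) * cmod (c \<alpha>)"
        using c0_pos[where 'n = 'n] by (simp add: norm_mult norm_gph stft_const_c0)
      also have "\<dots> \<le> (?c * (C * exp (a * norm Y)) * exp (- (norm Y)\<^sup>2 / 4) * cmod (mon \<alpha> Y)) * (B * (R ^ mi_length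
        \<alpha> / sqrt (mi_fact \<alpha>)))"
        using c0_pos[where 'n = 'n] C0 by (intro mult_mono mult_right_mono mult_left_mono gr c \<alpha>) auto
      finally show ?thesis by (simp add: ac_simps)
    qed
    have "(\<Sum>\<alpha>\<in>S. norm (stft_const TYPE('n) * u Y * gph Y * cnj (mon \<alpha> Y) * c \<alpha>))
      \<le> (\<Sum>\<alpha>\<in>S. (?c * (C * exp (a * norm Y)) * exp (- (norm Y)\<^sup>2 / 4) * B) * (R ^ mi_length \<alpha> / sqrt
        (mi_fact \<alpha>) * cmod (mon \<alpha> Y)))"
      by (intro sum_mono nF)
    also have "\<dots> = (?c * (C * exp (a * norm Y)) * exp (- (norm Y)\<^sup>2 / 4) * B) * (\<Sum>\<alpha>\<in>S. R ^ mi_length \<alpha> /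
      sqrt (mi_fact \<alpha>) * cmod (mon \<alpha> Y))"
      by (rule sum_distrib_left[symmetric])
    also have "\<dots> \<le> (?c * (C * exp (a * norm Y)) * exp (- (norm Y)\<^sup>2 / 4) * B) * exp (R * real CARD('n) * norm Y)"
      using c0_pos[where 'n = 'n] C0 B R S by (intro mult_left_mono prod_exp_partial_sums) auto
    also have "\<dots> = (?c * C * B) * exp ((a + R * real CARD('n)) * norm Y - 1 / 4 * (norm Y)\<^sup>2)"
    proof -
      have "exp (a * norm Y) * (exp (- (norm Y)\<^sup>2 / 4) * exp (R * real CARD('n) * norm Y))
        = exp ((a + R * real CARD('n)) * norm Y - 1 / 4 * (norm Y)\<^sup>2)"
        by (simp add: algebra_simps flip: exp_add)
      then show ?thesis by (simp add: mult.assoc mult.left_commute)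
    qed
    finally show ?thesis .
  qed
  have Dint: "integrable lborel (\<lambda>Y::(real ^ 'n) \<times> (real ^ 'n). K * exp (b * norm Y - 1 / 4 * (norm Y)\<^sup>2))" for K b
    by (intro integrable_mult_right integrable_exp_norm_gaussian) simp
  show "integrable lborel (\<lambda>Y. stft_const TYPE('n) * u Y * gph Y * cnj (mon \<alpha> Y))"
  proof (rule Bochner_Integration.integrable_bound[OF Dint F])
    let ?B = "sqrt (mi_fact \<alpha>)"
    have bd: "norm (stft_const TYPE('n) * u Y * gph Y * cnj (mon \<alpha> Y))
      \<le> (?c * C * ?B) * exp ((a + 1 * real CARD('n)) * norm Y - 1 / 4 * (norm Y)\<^sup>2)" for Y
      using key[of "{\<alpha>}" 1 ?B "\<lambda>_. 1" Y] mi_fact_pos[of \<alpha>] by simp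
    show "AE Y in lborel. norm (stft_const TYPE('n) * u Y * gph Y * cnj (mon \<alpha> Y))
      \<le> norm ((?c * C * ?B) * exp ((a + 1 * real CARD('n)) * norm Y - 1 / 4 * (norm Y)\<^sup>2))"
    proof (rule AE_I2)
      fix Y :: "(real ^ 'n) \<times> (real ^ 'n)"
      show "norm (stft_const TYPE('n) * u Y * gph Y * cnj (mon \<alpha> Y))
        \<le> norm ((?c * C * ?B) * exp ((a + 1 * real CARD('n)) * norm Y - 1 / 4 * (norm Y)\<^sup>2))"
        unfolding real_norm_def by (rule order.trans[OF bd abs_ge_self])
    qed
  qed
  define f where "f \<alpha> Y = (stft_const TYPE('n) * u Y * gph Y * cnj (mon \<alpha> Y)) * (stft_const TYPE('n) * cnj (gph Z) * mon
    \<alpha> Z)" for \<alpha> Y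
  have fm: "f \<alpha> \<in> borel_measurable lborel" for \<alpha> unfolding f_def by (intro borel_measurable_times F borel_measurable_const)
  define B where "B = cmod (stft_const TYPE('n) * cnj (gph Z))"
  have cb: "cmod (stft_const TYPE('n) * cnj (gph Z) * mon \<alpha> Z) \<le> B * (norm Z ^ mi_length \<alpha> / sqrt (mi_fact \<alpha>))" for \<alpha>
    unfolding norm_mult[of _ "mon \<alpha> Z"] B_def by (intro mult_left_mono norm_mon_le cmod_zc_le) auto
  have dom: "(\<Sum>\<alpha>\<in>S. norm (f \<alpha> Y))
    \<le> (?c * C * B) * exp ((a + norm Z * real CARD('n)) * norm Y - 1 / 4 * (norm Y)\<^sup>2)" if "finite S" for S Y
    unfolding f_def
    using key[of S "norm Z" B "\<lambda>\<alpha>. stft_const TYPE('n) * cnj (gph Z) * mon \<alpha> Z" Y, OF that norm_ge_zero _ cb]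
      by (simp add: B_def)
  have a: "gauss_stft h Z = (\<Sum>\<^sub>\<infinity>\<alpha>. h \<alpha> * (stft_const TYPE('n) * cnj (gph Z) * mon \<alpha> Z))" for h ::
    "'n series"
  proof -
    have "(\<Sum>\<^sub>\<infinity>\<alpha>. h \<alpha> * (stft_const TYPE('n) * cnj (gph Z) * mon \<alpha> Z))
      = (\<Sum>\<^sub>\<infinity>\<alpha>. (stft_const TYPE('n) * cnj (gph Z)) * (h \<alpha> * mon \<alpha> Z))"
      by (simp only: mult.left_commute mult.assoc)
    then show ?thesis unfolding gauss_stft_barg barg_def infsum_cmult_right' by simp
  qed
  have fs: "(\<Sum>\<^sub>\<infinity>\<alpha>. f \<alpha> Y) = stft_const TYPE('n) * u Y * gauss_stft (atom Y) Z" for Y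
  proof -
    have "f \<alpha> Y = (stft_const TYPE('n) * u Y) * (atom Y \<alpha> * (stft_const TYPE('n) * cnj (gph Z) * mon \<alpha> Z))" for \<alpha>
      unfolding f_def hermite_series_gaussian by (simp only: mult.assoc)
    then show ?thesis unfolding a by (simp only: infsum_cmult_right')
  qed
  have fi: "(\<integral>Y. f \<alpha> Y \<partial>lborel) = synth u \<alpha> * (stft_const TYPE('n) * cnj (gph Z) * mon \<alpha> Z)" for \<alpha>
    unfolding f_def synth_def integral_mult_left_zero ..
  show "gauss_stft (synth u) Z = (\<integral>Y. stft_const TYPE('n) * u Y * gauss_stft (atom Y) Z \<partial>lborel)"
    using infsum_integral_dominated(1)[OF fm Dint dom] unfolding fs fi a[symmetric] by simp
  show "integrable lborel (\<lambda>Y. stft_const TYPE('n) * u Y * gauss_stft (atom Y) Z)"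
    using infsum_integral_dominated(2)[OF fm Dint dom] unfolding fs .
qed

lemma norm_gauss_stft_synth:
  fixes u :: "(real ^ 'n) \<times> (real ^ 'n) \<Rightarrow> complex"
  assumes um: "u \<in> borel_measurable borel" and gr: "\<And>X. cmod (u X) \<le> C * exp (a * norm X)"
  shows "ennreal (cmod (gauss_stft (synth u) Z))
    \<le> (\<integral>\<^sup>+Y. ennreal ((c0 TYPE('n))\<^sup>2 * cmod (u Y) * exp (- (norm (Z - Y))\<^sup>2 / 4)) \<partial>lborel)"
proof -
  have n: "norm (stft_const TYPE('n) * u Y * gauss_stft (atom Y) Z) = (c0 TYPE('n))\<^sup>2 * cmod (u Y) * exp (- (norm (Z - Y))\<^sup>2 / 4)" for Y
    using c0_pos[where 'n = 'n] by (simp add: norm_mult norm_gauss_stft_atom stft_const_c0 power2_eq_square)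
  show ?thesis
    using integral_norm_bound_ennreal[OF synth_integrable(3)[OF um gr], of Z]
    unfolding synth_integrable(2)[OF um gr, symmetric] n .
qed

lemma synth_diff:
  assumes "u \<in> borel_measurable borel" "\<And>X. cmod (u X) \<le> C * exp (a * norm X)"
    and "u' \<in> borel_measurable borel" "\<And>X. cmod (u' X) \<le> C' * exp (a' * norm X)"
  shows "synth (\<lambda>X. u X - u' X) \<alpha> = synth u \<alpha> - synth u' \<alpha>"
  unfolding synth_def
  using Bochner_Integration.integral_diff[OF synth_integrable(1)[OF assms(1,2)] synth_integrable(1)[OF assms(3,4)], of \<alpha> \<alpha>]
  by (simp add: algebra_simps)

text \<open>On the polydisc of radius R the monomials are at most R^|\<alpha>| / sqrt (\<alpha>!),
  which is precisely the decay required of an element of \<open>H_flat\<close>.\<close>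

lemma synth_compact_support_H_flat:
  fixes u :: "(real ^ 'n) \<times> (real ^ 'n) \<Rightarrow> complex"
  assumes um: "u \<in> borel_measurable borel" and gr: "\<And>X. cmod (u X) \<le> C * exp (a * norm X)"
    and sp: "\<And>X. X \<notin> polydisc R \<Longrightarrow> u X = 0" and R: "0 < R"
  shows "synth u \<in> H_flat"
proof -
  define D where "D Y = (c0 TYPE('n) * C) * exp (a * norm Y - 1 / 4 * (norm Y)\<^sup>2)" for Y :: "(real ^ 'n) \<times> (real ^ 'n)"
  have Dint: "integrable lborel D" unfolding D_def by (intro integrable_mult_right integrable_exp_norm_gaussian) simp
  have C0: "0 \<le> C" using order.trans[OF norm_ge_zero gr[of 0]] by simp
  have b: "norm (stft_const TYPE('n) * u Y * gph Y * cnj (mon \<alpha> Y))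
    \<le> D Y * (R ^ mi_length \<alpha> / sqrt (mi_fact \<alpha>))" for \<alpha> Y
  proof (cases "Y \<in> polydisc R")
    case True
    then have "cmod (mon \<alpha> Y) \<le> R ^ mi_length \<alpha> / sqrt (mi_fact \<alpha>)" by (intro norm_mon_le) (simp add: polydisc_def)
    then have "(c0 TYPE('n) * cmod (u Y) * exp (- (norm Y)\<^sup>2 / 4)) * cmod (mon \<alpha> Y)
      \<le> (c0 TYPE('n) * (C * exp (a * norm Y)) * exp (- (norm Y)\<^sup>2 / 4)) * (R ^ mi_length \<alpha> / sqrt (mi_fact \<alpha>))"
      using c0_pos[where 'n = 'n] C0 by (intro mult_mono mult_right_mono mult_left_mono gr) auto
    moreover have "exp (a * norm Y) * exp (- (norm Y)\<^sup>2 / 4) = exp (a * norm Y - 1 / 4 * (norm Y)\<^sup>2)" by (simp flip: exp_add)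
    then have "c0 TYPE('n) * (C * exp (a * norm Y)) * exp (- (norm Y)\<^sup>2 / 4) = D Y" by (simp add: D_def mult.assoc)
    moreover have "norm (stft_const TYPE('n) * u Y * gph Y * cnj (mon \<alpha> Y))
      = (c0 TYPE('n) * cmod (u Y) * exp (- (norm Y)\<^sup>2 / 4)) * cmod (mon \<alpha> Y)"
      using c0_pos[where 'n = 'n] by (simp add: norm_mult norm_gph stft_const_c0)
    ultimately show ?thesis by (simp only:)
  next
    case False
    then show ?thesis using sp[of Y] C0 R c0_pos[where 'n = 'n] mi_fact_pos[of \<alpha>] by (simp add: D_def)
  qed
  have "cmod (synth u \<alpha>) \<le> (\<integral>Y. D Y \<partial>lborel) * R ^ mi_length \<alpha> * mi_fact \<alpha> powr (- 1 / 2)" for \<alpha>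
  proof -
    have "cmod (synth u \<alpha>) \<le> (\<integral>Y. D Y * (R ^ mi_length \<alpha> / sqrt (mi_fact \<alpha>)) \<partial>lborel)"
      unfolding synth_def
      by (rule Bochner_Integration.integral_norm_bound_integral[OF synth_integrable(1)[OF um gr] integrable_mult_left[OF Dint] b])
    also have "\<dots> = (\<integral>Y. D Y \<partial>lborel) * (R ^ mi_length \<alpha> / sqrt (mi_fact \<alpha>))"
      by (rule integral_mult_left_zero)
    also have "\<dots> = (\<integral>Y. D Y \<partial>lborel) * R ^ mi_length \<alpha> * mi_fact \<alpha> powr (- 1 / 2)"
    proof -
      have "mi_fact \<alpha> powr (- 1 / 2) = 1 / sqrt (mi_fact \<alpha>)"
        using mi_fact_powr[of \<alpha>] by (simp add: powr_minus_divide)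
      then show ?thesis by simp
    qed
    finally show ?thesis .
  qed
  then show ?thesis unfolding H_flat_def using R by blast
qed

subsection \<open>The weighted duality\<close>

lemma Mp_norm_1:
  assumes "\<And>X. 0 < W X"
  shows "Mp_norm 1 W h = (\<integral>\<^sup>+X. ennreal (cmod (gauss_stft h X) * W X) \<partial>lborel)"
proof -
  have "(cmod (gauss_stft h X) * W X) powr 1 = cmod (gauss_stft h X) * W X" for X
    using assms[of X] by simp
  then have "(\<integral>\<^sup>+X. ennreal ((cmod (gauss_stft h X) * W X) powr 1) \<partial>lebesgue)
    = (\<integral>\<^sup>+X. ennreal (cmod (gauss_stft h X) * W X) \<partial>lborel)"
    by (simp only: nn_integral_completion)
  then show ?thesis
    unfolding Mp_norm_def Lp_norm_def Let_def by (simp add: less_top)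
qed

text \<open>The transform of a synthesis is dominated by a convolution with a Gaussian, which stays
  integrable after multiplication by the exponential that compares W with W'. The Borel majorant W'
  makes the exchange of integrals possible, and I is uniform in u.\<close>

lemma Mp_norm_synth:
  fixes W W' :: "(real ^ 'n) \<times> (real ^ 'n) \<Rightarrow> real"
  assumes W: "\<And>Z Y. W Z \<le> E * exp (b * norm (Z - Y)) * W' Y" and W0: "\<And>Z. 0 < W Z" and W0': "\<And>Z. 0 \<le> W' Z" and E: "0 \<le> E"
    and [measurable]: "W' \<in> borel_measurable borel"
  shows "\<exists>I. \<forall>u C a. u \<in> borel_measurable borel \<longrightarrow> (\<forall>X. cmod (u X)
    \<le> C * exp (a * norm X)) \<longrightarrow>
     Mp_norm 1 W (synth u :: 'n series) \<le> ennreal I * (\<integral>\<^sup>+Y. ennreal (cmod (u Y) * W' Y) \<partial>lborel)"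
proof -
  define k where "k U = ((c0 TYPE('n))\<^sup>2 * E) * exp (b * norm U - 1 / 4 * (norm U)\<^sup>2)" for U :: "(real ^ 'n) \<times> (real ^ 'n)"
  have k0: "0 \<le> k U" for U using E by (simp add: k_def)
  have [measurable]: "k \<in> borel_measurable borel"
    unfolding k_def by measurable
  have ki: "integrable lborel k" unfolding k_def by (intro integrable_mult_right integrable_exp_norm_gaussian) simp
  show ?thesis
  proof (intro exI[of _ "\<integral>U. k U \<partial>lborel"] allI impI)
    fix u :: "(real ^ 'n) \<times> (real ^ 'n) \<Rightarrow> complex" and C a
    assume um[measurable]: "u \<in> borel_measurable borel" and "\<forall>X. cmod (u X) \<le> C * exp (a * norm X)"
    then have gr: "cmod (u X) \<le> C * exp (a * norm X)" for X by blast
    have pt: "ennreal (cmod (gauss_stft (synth u) Z) * W Z)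
      \<le> (\<integral>\<^sup>+Y. ennreal (cmod (u Y) * W' Y) * ennreal (k (Z - Y)) \<partial>lborel)" for Z
    proof -
      have "ennreal (cmod (gauss_stft (synth u) Z) * W Z) = ennreal (W Z) * ennreal (cmod (gauss_stft (synth u) Z))"
        using W0[of Z] by (simp add: ennreal_mult mult.commute)
      also have "\<dots> \<le> ennreal (W Z) * (\<integral>\<^sup>+Y. ennreal ((c0 TYPE('n))\<^sup>2 * cmod (u Y) * exp (- (norm (Z -
        Y))\<^sup>2 / 4)) \<partial>lborel)"
        by (intro mult_left_mono norm_gauss_stft_synth[OF um gr]) simp
      also have "\<dots> = (\<integral>\<^sup>+Y. ennreal (W Z) * ennreal ((c0 TYPE('n))\<^sup>2 * cmod (u Y) * exp (- (norm (Z -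
        Y))\<^sup>2 / 4)) \<partial>lborel)"
        by (rule nn_integral_cmult[symmetric]) measurable
      also have "\<dots> \<le> (\<integral>\<^sup>+Y. ennreal (cmod (u Y) * W' Y) * ennreal (k (Z - Y)) \<partial>lborel)"
      proof (intro nn_integral_mono)
        fix Y :: "(real ^ 'n) \<times> (real ^ 'n)"
        have "W Z * ((c0 TYPE('n))\<^sup>2 * cmod (u Y) * exp (- (norm (Z - Y))\<^sup>2 / 4))
          \<le> (E * exp (b * norm (Z - Y)) * W' Y) * ((c0 TYPE('n))\<^sup>2 * cmod (u Y) * exp (- (norm (Z - Y))\<^sup>2 / 4))"
          by (intro mult_right_mono W) auto
        also have "\<dots> = (cmod (u Y) * W' Y) * k (Z - Y)"
        proof -
          have "exp (b * norm (Z - Y)) * exp (- (norm (Z - Y))\<^sup>2 / 4) = exp (b * norm (Z - Y) - 1 / 4 * (norm (Z - Y))\<^sup>2)"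
            by (simp flip: exp_add)
          then show ?thesis unfolding k_def by (simp add: mult.assoc mult.left_commute mult.commute)
        qed
        finally show "ennreal (W Z) * ennreal ((c0 TYPE('n))\<^sup>2 * cmod (u Y) * exp (- (norm (Z - Y))\<^sup>2 / 4))
          \<le> ennreal (cmod (u Y) * W' Y) * ennreal (k (Z - Y))"
          using W0[of Z] W0'[of Y] k0[of "Z - Y"] by (simp add: ennreal_leI flip: ennreal_mult)
      qed
      finally show ?thesis .
    qed
    have "Mp_norm 1 W (synth u) \<le> (\<integral>\<^sup>+Z. (\<integral>\<^sup>+Y. ennreal (cmod (u Y) * W' Y) * ennreal (k (Z - Y))
      \<partial>lborel) \<partial>lborel)"
      unfolding Mp_norm_1[OF W0] by (intro nn_integral_mono pt)
    also have "\<dots> = (\<integral>\<^sup>+Y. (\<integral>\<^sup>+Z. ennreal (cmod (u Y) * W' Y) * ennreal (k (Z - Y)) \<partial>lborel)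
      \<partial>lborel)"
      by (rule lborel_pair.Fubini') measurable
    also have "\<dots> = (\<integral>\<^sup>+Y. ennreal (\<integral>U. k U \<partial>lborel) * ennreal (cmod (u Y) * W' Y) \<partial>lborel)"
    proof (intro nn_integral_cong)
      fix Y :: "(real ^ 'n) \<times> (real ^ 'n)"
      have "(\<integral>\<^sup>+Z. ennreal (cmod (u Y) * W' Y) * ennreal (k (Z - Y)) \<partial>lborel)
        = ennreal (cmod (u Y) * W' Y) * (\<integral>\<^sup>+Z. ennreal (k (Z + (- Y))) \<partial>lborel)"
        by (subst nn_integral_cmult) auto
      also have "(\<integral>\<^sup>+Z. ennreal (k (Z + (- Y))) \<partial>lborel) = (\<integral>\<^sup>+Z. ennreal (k Z) \<partial>lborel)"
        by (rule nn_integral_lborel_shift) measurable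
      also have "\<dots> = ennreal (\<integral>U. k U \<partial>lborel)"
        by (rule nn_integral_eq_integral[OF ki]) (simp add: k0)
      finally show "(\<integral>\<^sup>+Z. ennreal (cmod (u Y) * W' Y) * ennreal (k (Z - Y)) \<partial>lborel)
        = ennreal (\<integral>U. k U \<partial>lborel) * ennreal (cmod (u Y) * W' Y)"
        by (simp add: mult.commute)
    qed
    also have "\<dots> = ennreal (\<integral>U. k U \<partial>lborel) * (\<integral>\<^sup>+Y. ennreal (cmod (u Y) * W' Y) \<partial>lborel)"
      by (rule nn_integral_cmult) measurable
    finally show "Mp_norm 1 W (synth u) \<le> ennreal (\<integral>U. k U \<partial>lborel) * (\<integral>\<^sup>+Y. ennreal (cmod (u Y) * W'
      Y) \<partial>lborel)" .
  qed
qed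

text \<open>The generating sets shrink with e, so a single one of them decides.\<close>

lemma eventually_M1_approx:
  "eventually P (M1_approx W g) \<longleftrightarrow> (\<exists>e>0. \<forall>h\<in>H_flat. Mp_norm 1 W (\<lambda>\<alpha>. h \<alpha> - g
    \<alpha>) < ennreal e \<longrightarrow> P h)"
proof -
  have "eventually P (M1_approx W g) \<longleftrightarrow>
    (\<exists>e\<in>{0<..}. eventually P (principal {h \<in> H_flat. Mp_norm 1 W (\<lambda>\<alpha>. h \<alpha> - g \<alpha>) < ennreal e}))"
    unfolding M1_approx_def
  proof (rule eventually_INF_base)
    fix a b :: real assume ab: "a \<in> {0<..}" "b \<in> {0<..}"
    have "x < ennreal (min a b) \<Longrightarrow> x < ennreal a \<and> x < ennreal b" for x
      by (meson ennreal_leI less_le_trans min.cobounded1 min.cobounded2)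
    then show "\<exists>x\<in>{0<..}. principal {h \<in> H_flat. Mp_norm 1 W (\<lambda>\<alpha>. h \<alpha> - g \<alpha>) < ennreal x}
      \<le> principal {h \<in> H_flat. Mp_norm 1 W (\<lambda>\<alpha>. h \<alpha> - g \<alpha>) < ennreal a} \<sqinter>
        principal {h \<in> H_flat. Mp_norm 1 W (\<lambda>\<alpha>. h \<alpha> - g \<alpha>) < ennreal b}"
      using ab by (intro bexI[of _ "min a b"]) auto
  qed simp
  then show ?thesis by (auto simp: eventually_principal)
qed

text \<open>Density of \<open>H_flat\<close> near g: truncations of V g to polydiscs synthesise to
  elements of \<open>H_flat\<close>. As g is the synthesis of V g, the error is the synthesis of the
  tail, whose weighted integral tends to 0 by dominated convergence.\<close>

lemma M1_approx_nontrivial: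
  fixes g :: "('n::finite) series"
  assumes W: "\<And>Z Y. W Z \<le> E * exp (b * norm (Z - Y)) * W' Y" and W0: "\<And>Z. 0 < W Z" and W0': "\<And>Z. 0 \<le> W' Z" and E: "0 \<le> E"
    and [measurable]: "W' \<in> borel_measurable borel"
    and g: "g \<in> H_flat_dual" and gr: "\<And>X. cmod (gauss_stft g X) \<le> C * exp (a * norm X)"
    and fin: "(\<integral>\<^sup>+X. ennreal (cmod (gauss_stft g X) * W' X) \<partial>lborel) < top"
  shows "M1_approx W g \<noteq> bot"
proof -
  define G where "G = gauss_stft g"
  have Gm[measurable]: "G \<in> borel_measurable borel" unfolding G_def by (intro borel_measurable_continuous_onI continuous_gauss_stft g)
  obtain I where I: "\<And>u C a. u \<in> borel_measurable borel \<Longrightarrow> (\<And>X. cmod (u X) \<le> C * exp (a * norm X)) \<Longrightarrow>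
     Mp_norm 1 W (synth u :: 'n series) \<le> ennreal I * (\<integral>\<^sup>+Y. ennreal (cmod (u Y) * W' Y) \<partial>lborel)"
    using Mp_norm_synth[OF W W0 W0' E assms(5)] by blast
  \<comment> \<open>\<open>Suc n\<close> keeps the radius positive, as
    \<open>synth_compact_support_H_flat\<close> demands.\<close>
  define u where "u n X = indicator (polydisc (real (Suc n))) X *\<^sub>R G X" for n X
  have um: "u n \<in> borel_measurable borel" for n
    unfolding u_def by (intro borel_measurable_scaleR borel_measurable_indicator polydisc_borel Gm)
  have C0: "0 \<le> C" using order.trans[OF norm_ge_zero gr[of 0]] by simp
  have ugr: "cmod (u n X) \<le> C * exp (a * norm X)" for n X
    using gr[of X] C0 by (auto simp: u_def G_def indicator_def)
  have ggr: "cmod (G X) \<le> C * exp (a * norm X)" for X using gr by (simp add: G_def)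
  have h: "synth (u n) \<in> H_flat" for n
    by (rule synth_compact_support_H_flat[OF um ugr, of "real (Suc n)"]) (auto simp: u_def)
  have d: "(\<lambda>\<alpha>. synth (u n) \<alpha> - g \<alpha>) = synth (\<lambda>X. u n X - G X)" for n
    using synth_diff[OF um ugr Gm ggr] synth_gauss_stft[OF g gr] by (auto simp: G_def)
  have dgr: "cmod (u n X - G X) \<le> C * exp (a * norm X)" for n X
    using ggr[of X] C0 by (auto simp: u_def indicator_def)
  have Mp: "Mp_norm 1 W (\<lambda>\<alpha>. synth (u n) \<alpha> - g \<alpha>)
    \<le> ennreal I * (\<integral>\<^sup>+Y. ennreal (cmod (u n Y - G Y) * W' Y) \<partial>lborel)" for n
    unfolding d by (rule I[OF _ dgr]) (intro borel_measurable_diff um Gm)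
  have "(\<lambda>n. \<integral>\<^sup>+Y. ennreal (cmod (u n Y - G Y) * W' Y) \<partial>lborel) \<longlonglongrightarrow>
    (\<integral>\<^sup>+Y. 0 \<partial>(lborel :: ((real ^ 'n) \<times> (real ^ 'n)) measure))"
  proof (rule nn_integral_dominated_convergence[where w = "\<lambda>Y. ennreal (cmod (G Y) * W' Y)"])
    show "(\<lambda>Y. ennreal (cmod (u n Y - G Y) * W' Y)) \<in> borel_measurable lborel" for n
      using um[of n] Gm by measurable
    show "(\<lambda>Y. ennreal (cmod (G Y) * W' Y)) \<in> borel_measurable lborel" by measurable
    show "(\<integral>\<^sup>+Y. ennreal (cmod (G Y) * W' Y) \<partial>lborel) < \<infinity>" using fin by (simp add: G_def)
    show "AE Y in lborel. ennreal (cmod (u n Y - G Y) * W' Y) \<le> ennreal (cmod (G Y) * W' Y)" for n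
      using W0' by (intro AE_I2 ennreal_leI mult_right_mono) (auto simp: u_def indicator_def)
    have "(\<lambda>n. ennreal (cmod (u n Y - G Y) * W' Y)) \<longlonglongrightarrow> ennreal (cmod (G Y - G Y) * W' Y)" for Y
      unfolding u_def
      by (intro tendsto_ennrealI tendsto_mult tendsto_norm tendsto_diff tendsto_const
          filterlim_compose[OF indicator_polydisc_tendsto filterlim_Suc])
    then show "AE Y in lborel. (\<lambda>n. ennreal (cmod (u n Y - G Y) * W' Y)) \<longlonglongrightarrow> 0" by (intro AE_I2) simp
  qed simp
  then have "(\<lambda>n. ennreal I * (\<integral>\<^sup>+Y. ennreal (cmod (u n Y - G Y) * W' Y) \<partial>lborel))
    \<longlonglongrightarrow> ennreal I * 0"
    by (intro ennreal_tendsto_cmult) auto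
  then have "(\<lambda>n. ennreal I * (\<integral>\<^sup>+Y. ennreal (cmod (u n Y - G Y) * W' Y) \<partial>lborel))
    \<longlonglongrightarrow> 0" by simp
  then have small: "\<exists>h\<in>H_flat. Mp_norm 1 W (\<lambda>\<alpha>. h \<alpha> - g \<alpha>) < ennreal e" if "0 < e" for e
  proof -
    have "\<forall>\<^sub>F n in sequentially. ennreal I * (\<integral>\<^sup>+Y. ennreal (cmod (u n Y - G Y) * W' Y) \<partial>lborel) < ennreal e"
      using that by (intro order_tendstoD(2)[OF \<open>_ \<longlonglongrightarrow> 0\<close>]) simp
    then obtain n where "ennreal I * (\<integral>\<^sup>+Y. ennreal (cmod (u n Y - G Y) * W' Y) \<partial>lborel) < ennreal e"
      using eventually_happens'[OF sequentially_bot] by blast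
    then show ?thesis using h[of n] Mp[of n] by (meson le_less_trans)
  qed
  have "\<not> eventually (\<lambda>_. False) (M1_approx W g)"
  proof
    assume "eventually (\<lambda>_. False) (M1_approx W g)"
    then obtain e where "0 < e" "\<forall>h\<in>H_flat. \<not> Mp_norm 1 W (\<lambda>\<alpha>. h \<alpha> - g \<alpha>) < ennreal e"
      unfolding eventually_M1_approx by auto
    then show False using small by blast
  qed
  then show ?thesis by (auto simp: trivial_limit_def)
qed

text \<open>By Moyal's identity the error is the integral of V f against the conjugate of V (h - g),
  and |V f| \<le> B W bounds it by B times the norm that defines the filter.\<close>

lemma flat_form_tendsto:
  fixes f g :: "('n::finite) series"
  assumes f: "f \<in> H_flat_dual" and g: "g \<in> H_flat_dual"
    and fW: "\<And>X. cmod (gauss_stft f X) \<le> B * W X" and B: "0 \<le> B" and W0: "\<And>Z. 0 < W Z"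
    and Wm: "W \<in> borel_measurable lebesgue"
    and gr: "\<And>X. cmod (gauss_stft f X) \<le> C * exp (a * norm X)"
    and Vi: "integrable lborel (\<lambda>X. gauss_stft f X * cnj (gauss_stft g X))"
  shows "(flat_form f \<longlongrightarrow> (\<integral>X. gauss_stft f X * cnj (gauss_stft g X) \<partial>lborel)) (M1_approx W g)"
proof (rule tendstoI)
  fix e :: real assume e: "0 < e"
  let ?l = "\<integral>X. gauss_stft f X * cnj (gauss_stft g X) \<partial>lborel"
  \<comment> \<open>The denominator B + 1 covers B = 0.\<close>
  have "dist (flat_form f h) ?l < e" if h: "h \<in> H_flat" and small: "Mp_norm 1 W (\<lambda>\<alpha>. h \<alpha> - g \<alpha>) < ennreal
    (e / (B + 1))" for h
  proof -
    note hd = H_flat_subset_dual[OF h]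
    have D: "gauss_stft f X * cnj (gauss_stft h X) - gauss_stft f X * cnj (gauss_stft g X)
        = gauss_stft f X * cnj (gauss_stft (\<lambda>\<alpha>. h \<alpha> - g \<alpha>) X)" for X
      by (simp add: gauss_stft_diff[OF hd g] right_diff_distrib)
    have i: "integrable lborel (\<lambda>X. gauss_stft f X * cnj (gauss_stft (\<lambda>\<alpha>. h \<alpha> - g \<alpha>) X))"
      using Bochner_Integration.integrable_diff[OF flat_form_eq_integral(2)[OF f gr h] Vi] unfolding D .
    have "flat_form f h - ?l = (\<integral>X. gauss_stft f X * cnj (gauss_stft (\<lambda>\<alpha>. h \<alpha> - g \<alpha>) X) \<partial>lborel)"
      unfolding flat_form_eq_integral(1)[OF f gr h]
        Bochner_Integration.integral_diff[OF flat_form_eq_integral(2)[OF f gr h] Vi, symmetric] D ..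
    then have "ennreal (cmod (flat_form f h - ?l))
      \<le> (\<integral>\<^sup>+X. ennreal (norm (gauss_stft f X * cnj (gauss_stft (\<lambda>\<alpha>. h \<alpha> - g \<alpha>) X)))
        \<partial>lborel)"
      using integral_norm_bound_ennreal[OF i] by simp
    also have "\<dots> \<le> (\<integral>\<^sup>+X. ennreal B * ennreal (cmod (gauss_stft (\<lambda>\<alpha>. h \<alpha> - g \<alpha>) X) *
      W X) \<partial>lborel)"
    proof (intro nn_integral_mono)
      fix X :: "(real ^ 'n) \<times> (real ^ 'n)"
      have "norm (gauss_stft f X * cnj (gauss_stft (\<lambda>\<alpha>. h \<alpha> - g \<alpha>) X))
        \<le> (B * W X) * cmod (gauss_stft (\<lambda>\<alpha>. h \<alpha> - g \<alpha>) X)"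
        unfolding norm_mult complex_mod_cnj by (intro mult_right_mono fW) simp
      then show "ennreal (norm (gauss_stft f X * cnj (gauss_stft (\<lambda>\<alpha>. h \<alpha> - g \<alpha>) X)))
        \<le> ennreal B * ennreal (cmod (gauss_stft (\<lambda>\<alpha>. h \<alpha> - g \<alpha>) X) * W X)"
        using B W0[of X] by (simp add: ennreal_leI mult.assoc mult.commute mult.left_commute flip: ennreal_mult)
    qed
    also have "\<dots> \<le> ennreal B * Mp_norm 1 W (\<lambda>\<alpha>. h \<alpha> - g \<alpha>)"
    proof -
      have "(\<lambda>X. ennreal (cmod (gauss_stft (\<lambda>\<alpha>. h \<alpha> - g \<alpha>) X) * W X)) \<in> borel_measurable lebesgue"
        using continuous_measurable_lebesgue[OF continuous_gauss_stft[OF H_flat_dual_diff[OF hd g]]] Wm by measurable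
      then have "(\<integral>\<^sup>+X. ennreal B * ennreal (cmod (gauss_stft (\<lambda>\<alpha>. h \<alpha> - g \<alpha>) X) * W X)
        \<partial>lebesgue)
        = ennreal B * (\<integral>\<^sup>+X. ennreal (cmod (gauss_stft (\<lambda>\<alpha>. h \<alpha> - g \<alpha>) X) * W X) \<partial>lebesgue)"
        by (rule nn_integral_cmult)
      then show ?thesis unfolding Mp_norm_1[OF W0] nn_integral_completion by simp
    qed
    also have "\<dots> \<le> ennreal B * ennreal (e / (B + 1))" using small by (intro mult_left_mono) auto
    also have "\<dots> = ennreal (B * (e / (B + 1)))" using B e by (intro ennreal_mult[symmetric]) auto
    finally have "cmod (flat_form f h - ?l) \<le> B * (e / (B + 1))" using B e by simp
    also have "\<dots> < e" using B e by (simp add: field_simps)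
    finally show ?thesis by (simp add: dist_norm)
  qed
  moreover have "0 < e / (B + 1)" using B e by simp
  ultimately show "\<forall>\<^sub>F h in M1_approx W g. dist (flat_form f h) ?l < e"
    unfolding eventually_M1_approx by blast
qed

subsection \<open>Local estimates for short-time Fourier transforms\<close>

lemma stft_local:
  fixes r :: real
  assumes r: "0 < r" "r \<le> 1"
  shows "\<exists>C>0. \<forall>f::('n::finite) series. \<forall>w. f \<in> H_flat_dual \<longrightarrow> ennreal (cmod (gauss_stft f w) powr r)
    \<le> ennreal C * (\<integral>\<^sup>+u. indicator (cball 0 1) u * ennreal (cmod (gauss_stft f (w + u)) powr r) \<partial>lborel)"
proof -
  have q: "(0::real) \<le> 1 / 4" by simp
  obtain C where C: "0 < C" "\<And>A w. sep_entire (A :: (real ^ 'n) \<times> (real ^ 'n) \<Rightarrow> complex) \<Longrightarrow>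
    ennreal (gmod (1 / 4) A w powr r) \<le> ennreal C * (\<integral>\<^sup>+u. indicator (cball 0 1) u * ennreal (gmod (1 / 4) A (w + u)
      powr r) \<partial>lborel)"
    using gmod_local[OF q r] by blast
  have "ennreal (cmod (gauss_stft f w) powr r)
    \<le> ennreal C * (\<integral>\<^sup>+u. indicator (cball 0 1) u * ennreal (cmod (gauss_stft f (w + u)) powr r) \<partial>lborel)"
    if f: "f \<in> H_flat_dual" for f :: "'n series" and w
  proof -
    have c: "sep_entire (\<lambda>_ :: (real ^ 'n) \<times> (real ^ 'n). complex_of_real (c0 TYPE('n)))" by (simp add: sep_entire_def)
    have e: "cmod (gauss_stft f X) = gmod (1 / 4) (\<lambda>X. of_real (c0 TYPE('n)) * barg f X) X" for X
      using c0_pos[where 'n = 'n] by (simp add: norm_gauss_stft gmod_def norm_mult)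
    show ?thesis unfolding e by (rule C(2)[OF sep_entire_mult[OF c sep_entire_barg[OF f]]])
  qed
  then show ?thesis using C(1) by blast
qed

text \<open>The exponents of the two Gaussians add to 1 / 4 + 1 / 4 = 1 / 2 once
  \<open>gmod_translate\<close> has recentred the shifted factor. The constant is the same for all
  f, g and X.\<close>

lemma stft_product_local:
  fixes r :: real
  assumes r: "0 < r" "r \<le> 1"
  shows "\<exists>C>0. \<forall>f g::('n::finite) series. \<forall>X w. f \<in> H_flat_dual \<longrightarrow> g \<in> H_flat_dual \<longrightarrow>
    ennreal ((cmod (gauss_stft f w) * cmod (gauss_stft g (w - X))) powr r)
    \<le> ennreal C * (\<integral>\<^sup>+u. indicator (cball 0 1) u * ennreal ((cmod (gauss_stft f (w + u)) * cmod (gauss_stft g (w + u -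
      X))) powr r) \<partial>lborel)"
proof -
  have q: "(0::real) \<le> 1 / 2" by simp
  obtain C where C: "0 < C" "\<And>A w. sep_entire (A :: (real ^ 'n) \<times> (real ^ 'n) \<Rightarrow> complex) \<Longrightarrow>
    ennreal (gmod (1 / 2) A w powr r) \<le> ennreal C * (\<integral>\<^sup>+u. indicator (cball 0 1) u * ennreal (gmod (1 / 2) A (w + u)
      powr r) \<partial>lborel)"
    using gmod_local[OF q r] by blast
  have "ennreal ((cmod (gauss_stft f w) * cmod (gauss_stft g (w - X))) powr r)
    \<le> ennreal C * (\<integral>\<^sup>+u. indicator (cball 0 1) u * ennreal ((cmod (gauss_stft f (w + u)) * cmod (gauss_stft g (w + u -
      X))) powr r) \<partial>lborel)"
    if f: "f \<in> H_flat_dual" and g: "g \<in> H_flat_dual" for f g :: "'n series" and X w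
  proof -
    obtain B where B: "sep_entire B" "\<And>u. gmod (1 / 4) (barg g) (- X + u) = exp (- (1 / 4) * (norm (- X))\<^sup>2) * gmod (1 / 4) B u"
      using gmod_translate[OF sep_entire_barg[OF g], of "1 / 4" "- X"] by metis
    define c where "c = (c0 TYPE('n))\<^sup>2 * exp (- (1 / 4) * (norm (- X))\<^sup>2)"
    have c0: "0 \<le> c" by (simp add: c_def)
    have cs: "sep_entire (\<lambda>_ :: (real ^ 'n) \<times> (real ^ 'n). complex_of_real c)" by (simp add: sep_entire_def)
    have e: "cmod (gauss_stft f u) * cmod (gauss_stft g (u - X)) = gmod (1 / 2) (\<lambda>u. of_real c * (barg f u * B u)) u" for u
    proof -
      have h: "exp (- (1 / 4) * (norm u)\<^sup>2) * exp (- (1 / 4) * (norm u)\<^sup>2) = exp (- (1 / 2) * (norm u)\<^sup>2)"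
        by (simp flip: exp_add)
      have "cmod (gauss_stft f u) * cmod (gauss_stft g (u - X))
        = c * (gmod (1 / 4) (barg f) u * gmod (1 / 4) B u)"
        using B(2)[of u] by (simp add: norm_gauss_stft c_def power2_eq_square)
      also have "\<dots> = c * (cmod (barg f u) * cmod (B u) * (exp (- (1 / 4) * (norm u)\<^sup>2) * exp (- (1 / 4) * (norm u)\<^sup>2)))"
        by (simp add: gmod_def)
      also have "\<dots> = gmod (1 / 2) (\<lambda>u. of_real c * (barg f u * B u)) u"
        unfolding h using c0 by (simp add: gmod_def norm_mult)
      finally show ?thesis .
    qed
    show ?thesis unfolding e by (rule C(2)[OF sep_entire_mult[OF cs sep_entire_mult[OF sep_entire_barg[OF f] B(1)]]])
  qed
  then show ?thesis using C(1) by blast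
qed

lemma gauss_stft_measurable [measurable]: "f \<in> H_flat_dual \<Longrightarrow> gauss_stft f \<in> borel_measurable borel"
  by (intro borel_measurable_continuous_onI continuous_gauss_stft)

lemma weighted_stft_local:
  fixes w :: "(real ^ 'n) \<times> (real ^ 'n) \<Rightarrow> real"
  assumes r: "0 < r" "r \<le> 1" and w: "slow L w" and wm: "w \<in> borel_measurable borel"
  shows "\<exists>C>0. \<forall>f::('n::finite) series. \<forall>X. f \<in> H_flat_dual
    \<longrightarrow> ennreal ((cmod (gauss_stft f X) * w X) powr r) \<le> ennreal C *
      (\<integral>\<^sup>+u. indicator (cball 0 1) u * ennreal ((cmod (gauss_stft f (X + u)) * w (X + u)) powr r) \<partial>lborel)"
proof -
  have L: "1 \<le> L" using w by (simp add: slow_def)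
  obtain C where C: "0 < C" "\<And>f::'n series. \<And>w. f \<in> H_flat_dual \<Longrightarrow> ennreal (cmod (gauss_stft f w) powr r)
    \<le> ennreal C * (\<integral>\<^sup>+u. indicator (cball 0 1) u * ennreal (cmod (gauss_stft f (w + u)) powr r) \<partial>lborel)"
    using stft_local[OF r, where 'n = 'n] by blast
  have loc: "ennreal ((cmod (gauss_stft f X) * w X) powr r) \<le> ennreal (C * L powr r) *
      (\<integral>\<^sup>+u. indicator (cball 0 1) u * ennreal ((cmod (gauss_stft f (X + u)) * w (X + u)) powr r) \<partial>lborel)"
    if f: "f \<in> H_flat_dual" for f :: "'n series" and X
  proof -
    note gauss_stft_measurable[OF f, measurable]
    have cm: "(\<lambda>X. cmod (gauss_stft f X)) \<in> borel_measurable borel" by measurable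
    show ?thesis by (rule weighted_local[OF C(2)[OF f] w norm_ge_zero r(1) C(1) cm wm])
  qed
  have Cp: "0 < C * L powr r" using C(1) L by simp
  show ?thesis using loc Cp by blast
qed

text \<open>The embeddings of a weighted M^r into the corresponding spaces with exponents infinity
  and 1: the local estimate gives a supremum bound, which then raises the exponent of integrability
  from r to 1.\<close>

lemma weighted_stft_bounds:
  fixes f :: "('n::finite) series" and w :: "(real ^ 'n) \<times> (real ^ 'n) \<Rightarrow> real"
  assumes r: "0 < r" "r \<le> 1" and f: "f \<in> H_flat_dual" and w: "slow L w" and wm[measurable]: "w \<in> borel_measurable borel"
    and fin: "(\<integral>\<^sup>+X. ennreal ((cmod (gauss_stft f X) * w X) powr r) \<partial>lborel) < top"
  shows "\<exists>M. \<forall>X. cmod (gauss_stft f X) * w X \<le> M"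
    and "(\<integral>\<^sup>+X. ennreal (cmod (gauss_stft f X) * w X) \<partial>lborel) < top"
proof -
  note gauss_stft_measurable[OF f, measurable]
  have w0: "0 < w X" for X using w unfolding slow_def by blast
  define H where "H X = cmod (gauss_stft f X) * w X" for X
  have H0: "0 \<le> H X" for X using w0[of X] by (simp add: H_def)
  have Hm[measurable]: "H \<in> borel_measurable borel" unfolding H_def by measurable
  obtain C where Cp: "0 < C" and loc: "\<And>X. ennreal (H X powr r) \<le> ennreal C *
      (\<integral>\<^sup>+u. indicator (cball 0 1) u * ennreal (H (X + u) powr r) \<partial>lborel)"
    using weighted_stft_local[OF r w wm] f unfolding H_def by blast
  have Hrm: "(\<lambda>X. ennreal (H X powr r)) \<in> borel_measurable borel" by measurable
  have glob: "ennreal (H X powr r) \<le> ennreal C * (\<integral>\<^sup>+X. ennreal (H X powr r) \<partial>lborel)" for X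
    using local_imp_global[OF loc Hrm] .
  have I: "(\<integral>\<^sup>+X. ennreal (H X powr r) \<partial>lborel) < top" using fin by (simp add: H_def)
  then have "ennreal C * (\<integral>\<^sup>+X. ennreal (H X powr r) \<partial>lborel) < top"
    by (simp add: ennreal_mult_less_top)
  then obtain M where M: "0 \<le> M" "ennreal C * (\<integral>\<^sup>+X. ennreal (H X powr r) \<partial>lborel) = ennreal M"
    by (metis less_top_ennreal)
  have "H X \<le> M powr (1 / r)" for X
  proof -
    have "H X powr r \<le> M" using glob[of X] M by simp
    then have "(H X powr r) powr (1 / r) \<le> M powr (1 / r)" using r by (intro powr_mono2) auto
    then show ?thesis using r H0[of X] by (simp add: powr_powr)
  qed
  then show "\<exists>M. \<forall>X. cmod (gauss_stft f X) * w X \<le> M" unfolding H_def by blast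
  have Hl: "H \<in> borel_measurable lborel" by simp
  have "epow r (\<integral>\<^sup>+X. ennreal (H X) \<partial>lborel)
    \<le> ennreal (C powr (1 - r)) * (\<integral>\<^sup>+X. ennreal (H X powr r) \<partial>lborel)"
    by (rule small_exponent_integral[OF Hl H0 r Cp glob])
  also have "\<dots> < top" using I by (simp add: ennreal_mult_less_top)
  finally have "epow r (\<integral>\<^sup>+X. ennreal (H X) \<partial>lborel) < top" .
  then have "(\<integral>\<^sup>+X. ennreal (H X) \<partial>lborel) \<noteq> top" using epow_top[of r] by fastforce
  then show "(\<integral>\<^sup>+X. ennreal (cmod (gauss_stft f X) * w X) \<partial>lborel) < top" by (simp add: H_def less_top)
qed

text \<open>Transfers the membership of the window from the weight v to a Borel majorant, and from
  \<open>lebesgue\<close> to \<open>lborel\<close>.\<close>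

lemma Mp_norm_majorant_finite:
  fixes f :: "('n::finite) series"
  assumes r: "0 < r" and f: "f \<in> H_flat_dual" and fin: "Mp_norm r v f < top"
    and vm: "v \<in> borel_measurable lebesgue" and v0: "\<And>X. 0 < v X" and w0: "\<And>X. 0 \<le> w X" and wv: "\<And>X. w X
      \<le> K * v X" and K: "0 < K"
  shows "(\<integral>\<^sup>+X. ennreal ((cmod (gauss_stft f X) * w X) powr r) \<partial>lborel) < top"
proof -
  have "(\<integral>\<^sup>+X. ennreal ((cmod (gauss_stft f X) * w X) powr r) \<partial>lborel)
    = (\<integral>\<^sup>+X. ennreal ((cmod (gauss_stft f X) * w X) powr r) \<partial>lebesgue)" by (simp only: nn_integral_completion)
  also have "\<dots> \<le> (\<integral>\<^sup>+X. ennreal (K powr r) * ennreal ((cmod (gauss_stft f X) * v X) powr r) \<partial>lebesgue)"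
  proof (intro nn_integral_mono)
    fix X :: "(real ^ 'n) \<times> (real ^ 'n)"
    have "cmod (gauss_stft f X) * w X \<le> K * (cmod (gauss_stft f X) * v X)"
      using mult_left_mono[OF wv[of X] norm_ge_zero[of "gauss_stft f X"]] by (simp add: ac_simps)
    then have "(cmod (gauss_stft f X) * w X) powr r \<le> (K * (cmod (gauss_stft f X) * v X)) powr r"
      using w0[of X] r by (intro powr_mono2) auto
    also have "\<dots> = K powr r * (cmod (gauss_stft f X) * v X) powr r"
      using K v0[of X] by (simp add: powr_mult less_imp_le)
    finally show "ennreal ((cmod (gauss_stft f X) * w X) powr r) \<le> ennreal (K powr r) * ennreal ((cmod (gauss_stft f X) * v X) powr r)"
      by (simp add: ennreal_leI flip: ennreal_mult)
  qed
  also have "\<dots> = ennreal (K powr r) * (\<integral>\<^sup>+X. ennreal ((cmod (gauss_stft f X) * v X) powr r) \<partial>lebesgue)"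
  proof (rule nn_integral_cmult)
    show "(\<lambda>X. ennreal ((cmod (gauss_stft f X) * v X) powr r)) \<in> borel_measurable lebesgue"
      using continuous_measurable_lebesgue[OF continuous_gauss_stft[OF f]] vm by measurable
  qed
  also have "\<dots> < top"
    using fin by (auto simp: Mp_norm_def Lp_norm_def Let_def ennreal_mult_less_top less_top split: if_splits)
  finally show ?thesis .
qed

subsection \<open>The short-time Fourier transform as an integral\<close>

text \<open>The weight 1 / \<omega> at Y is at most a constant depending on X times v (Y - X), so
  every time-frequency shift of the window has finite M^1 norm for 1 / \<omega>. Nontriviality of
  the filter makes the limit unique, and continuity of the pairing identifies it.\<close>

lemma dual_form_eq_integral:
  fixes f :: "('n::finite) series" and \<omega> W' p :: "(real ^ 'n) \<times> (real ^ 'n) \<Rightarrow> real"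
  assumes \<phi>: "\<phi> \<in> L2" and f: "f \<in> H_flat_dual"
    and \<omega>0: "\<And>X. 0 < \<omega> X" and \<omega>m: "(\<lambda>X. 1 / \<omega> X) \<in> borel_measurable lebesgue"
    and mod: "\<And>X Y. \<omega> (X + Y) \<le> C\<^sub>v * \<omega> X * v Y" and Cv: "0 < C\<^sub>v" and v0: "\<And>X. 0 < v X" and even:
      "\<And>X. v (- X) = v X"
    and vexp: "\<And>X. v X \<le> A * exp (a * norm X)" and A: "0 < A"
    and W'm[measurable]: "W' \<in> borel_measurable borel" and W'l: "\<And>X. 1 / \<omega> X \<le> W' X" and W'u: "\<And>X. W' X
      \<le> K * (1 / \<omega> X)" and K: "0 < K"
    and vv: "\<And>X. v X \<le> v' X" and v'm[measurable]: "v' \<in> borel_measurable borel"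
    and P1: "\<And>X. cmod (gauss_stft (hermite_series \<phi>) X) \<le> M"
    and P2: "(\<integral>\<^sup>+X. ennreal (cmod (gauss_stft (hermite_series \<phi>) X) * v' X) \<partial>lborel) < top"
    and fB: "\<And>X. cmod (gauss_stft f X) * \<omega> X \<le> B"
  shows "dual_form \<omega> f (hermite_series (tf_shift x \<xi> \<phi>))
    = (\<integral>Y. gauss_stft f Y * cnj (gauss_stft (hermite_series (tf_shift x \<xi> \<phi>)) Y) \<partial>lborel)"
    and "integrable lborel (\<lambda>Y. gauss_stft f Y * cnj (gauss_stft (hermite_series (tf_shift x \<xi> \<phi>)) Y))"
proof -
  define g :: "'n series" where "g = hermite_series (tf_shift x \<xi> \<phi>)"
  define X where "X = (x, \<xi>)"
  define P where "P = (\<lambda>X. cmod (gauss_stft (hermite_series \<phi>) X))"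
  define W where "W = (\<lambda>X. 1 / \<omega> X)"
  have g: "g \<in> H_flat_dual" unfolding g_def by (intro hermite_series_H_flat_dual tf_shift_L2 \<phi>)
  have gP: "cmod (gauss_stft g Y) = P (Y - X)" for Y
    unfolding g_def X_def P_def by (rule norm_gauss_stft_shift[OF \<phi>])
  note gauss_stft_measurable[OF g, measurable] gauss_stft_measurable[OF f, measurable]
    gauss_stft_measurable[OF hermite_series_H_flat_dual[OF \<phi>], measurable]
  have Pm[measurable]: "P \<in> borel_measurable borel" unfolding P_def by measurable
  have W0: "0 < W Y" for Y using \<omega>0[of Y] by (simp add: W_def)
  have W'0: "0 \<le> W' Y" for Y using W'l[of Y] W0[of Y] unfolding W_def by linarith
  \<comment> \<open>Moderateness is applied to Y = Z + (Y - Z), and evenness of v restores Z -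
    Y.\<close>
  have Winv: "W Z \<le> C\<^sub>v * v (Z - Y) * W Y" for Z Y
  proof -
    have "\<omega> Y \<le> C\<^sub>v * \<omega> Z * v (Z - Y)" using mod[of Z "Y - Z"] even[of "Z - Y"] by simp
    then show ?thesis using \<omega>0[of Z] \<omega>0[of Y] by (simp add: W_def field_simps)
  qed
  have W1: "W Z \<le> (C\<^sub>v * A) * exp (a * norm (Z - Y)) * W' Y" for Z Y
  proof -
    have "C\<^sub>v * v (Z - Y) * W Y \<le> C\<^sub>v * (A * exp (a * norm (Z - Y))) * W' Y"
      using Cv vexp[of "Z - Y"] v0[of "Z - Y"] W0[of Y] W'l[of Y] A
      by (intro mult_mono mult_left_mono) (auto simp: W_def)
    then show ?thesis using Winv[of Z Y] by simp
  qed
  have B0: "0 \<le> B"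
    by (rule order.trans[OF _ fB[of 0]]) (use \<omega>0[of 0] in simp)
  have fW: "cmod (gauss_stft f Y) \<le> B * W Y" for Y
    using fB[of Y] \<omega>0[of Y] by (simp add: W_def field_simps)
  have fgr: "cmod (gauss_stft f Y) \<le> (B * (C\<^sub>v * A) * W' 0) * exp (a * norm Y)" for Y
  proof -
    have "B * W Y \<le> B * ((C\<^sub>v * A) * exp (a * norm (Y - 0)) * W' 0)" by (intro mult_left_mono W1 B0)
    then show ?thesis using fW[of Y] by (simp add: ac_simps)
  qed
  have ggr: "cmod (gauss_stft g Y) \<le> M * exp (0 * norm Y)" for Y
    unfolding gP P_def using P1 by simp
  have fin: "(\<integral>\<^sup>+Y. ennreal (cmod (gauss_stft g Y) * W' Y) \<partial>lborel) < top"
  proof -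
    have "(\<integral>\<^sup>+Y. ennreal (cmod (gauss_stft g Y) * W' Y) \<partial>lborel)
      \<le> (\<integral>\<^sup>+Y. ennreal (K * C\<^sub>v * W X) * ennreal (P (Y + (- X)) * v' (Y + (- X))) \<partial>lborel)"
    proof (intro nn_integral_mono)
      fix Y :: "(real ^ 'n) \<times> (real ^ 'n)"
      have "W' Y \<le> K * W Y" using W'u[of Y] by (simp add: W_def)
      also have "\<dots> \<le> K * (C\<^sub>v * v (Y - X) * W X)" using K by (intro mult_left_mono Winv) auto
      also have "\<dots> \<le> K * (C\<^sub>v * v' (Y - X) * W X)" using K Cv W0[of X] by (intro mult_left_mono mult_right_mono vv) auto
      finally have "P (Y - X) * W' Y \<le> P (Y - X) * (K * (C\<^sub>v * v' (Y - X) * W X))" by (intro mult_left_mono) (auto simp: P_def)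
      then show "ennreal (cmod (gauss_stft g Y) * W' Y) \<le> ennreal (K * C\<^sub>v * W X) * ennreal (P (Y + (- X)) * v' (Y + (- X)))"
        unfolding gP using K Cv W0[of X] vv[of "Y - X"] v0[of "Y - X"]
        by (subst ennreal_mult[symmetric]) (auto simp: P_def ac_simps intro!: ennreal_leI)
    qed
    also have "\<dots> = ennreal (K * C\<^sub>v * W X) * (\<integral>\<^sup>+Y. ennreal (P (Y + (- X)) * v' (Y + (- X))) \<partial>lborel)"
      by (rule nn_integral_cmult) measurable
    also have "(\<integral>\<^sup>+Y. ennreal (P (Y + (- X)) * v' (Y + (- X))) \<partial>lborel)
      = (\<integral>\<^sup>+Y. ennreal (P Y * v' Y) \<partial>lborel)"
      by (rule nn_integral_lborel_shift) measurable
    also have "ennreal (K * C\<^sub>v * W X) * \<dots> < top" using P2 by (simp add: P_def ennreal_mult_less_top)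
    finally show ?thesis .
  qed
  have nb: "M1_approx W g \<noteq> bot"
    by (rule M1_approx_nontrivial[OF W1 W0 W'0 _ W'm g ggr fin]) (use Cv A in simp)
  have Vi: "integrable lborel (\<lambda>Y. gauss_stft f Y * cnj (gauss_stft g Y))"
  proof (rule integrableI_bounded)
    show "(\<lambda>Y. gauss_stft f Y * cnj (gauss_stft g Y)) \<in> borel_measurable lborel"
    proof -
      have "(\<lambda>Y. gauss_stft f Y * cnj (gauss_stft g Y)) \<in> borel_measurable borel"
        by (intro borel_measurable_continuous_onI continuous_intros continuous_gauss_stft f g)
      then show ?thesis by simp
    qed
    have "(\<integral>\<^sup>+Y. ennreal (norm (gauss_stft f Y * cnj (gauss_stft g Y))) \<partial>lborel)
      \<le> (\<integral>\<^sup>+Y. ennreal B * ennreal (cmod (gauss_stft g Y) * W' Y) \<partial>lborel)"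
    proof (intro nn_integral_mono)
      fix Y :: "(real ^ 'n) \<times> (real ^ 'n)"
      have "cmod (gauss_stft f Y) \<le> B * W' Y"
        using fW[of Y] mult_left_mono[OF W'l[of Y] B0] by (simp add: W_def)
      then have "norm (gauss_stft f Y * cnj (gauss_stft g Y)) \<le> (B * W' Y) * cmod (gauss_stft g Y)"
        unfolding norm_mult complex_mod_cnj by (intro mult_right_mono) auto
      then show "ennreal (norm (gauss_stft f Y * cnj (gauss_stft g Y))) \<le> ennreal B * ennreal (cmod (gauss_stft g Y) * W' Y)"
        using B0 W'0[of Y] by (subst ennreal_mult[symmetric]) (auto simp: ac_simps intro!: ennreal_leI)
    qed
    also have "\<dots> = ennreal B * (\<integral>\<^sup>+Y. ennreal (cmod (gauss_stft g Y) * W' Y) \<partial>lborel)"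
      by (rule nn_integral_cmult) measurable
    also have "\<dots> < \<infinity>" using fin by (simp add: ennreal_mult_less_top)
    finally show "(\<integral>\<^sup>+Y. ennreal (norm (gauss_stft f Y * cnj (gauss_stft g Y))) \<partial>lborel) < \<infinity>" .
  qed
  have Wm: "W \<in> borel_measurable lebesgue" using \<omega>m by (simp add: W_def)
  show "integrable lborel (\<lambda>Y. gauss_stft f Y * cnj (gauss_stft (hermite_series (tf_shift x \<xi> \<phi>)) Y))"
    using Vi unfolding g_def .
  have "(flat_form f \<longlongrightarrow> (\<integral>Y. gauss_stft f Y * cnj (gauss_stft g Y) \<partial>lborel)) (M1_approx W g)"
    by (rule flat_form_tendsto[OF f g fW B0 W0 Wm fgr Vi])
  then show "dual_form \<omega> f (hermite_series (tf_shift x \<xi> \<phi>))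
    = (\<integral>Y. gauss_stft f Y * cnj (gauss_stft (hermite_series (tf_shift x \<xi> \<phi>)) Y) \<partial>lborel)"
    unfolding dual_form_def using tendsto_Lim[OF nb] unfolding W_def g_def by blast
qed

subsection \<open>Lattices\<close>

lemma countable_lattice: "countable (lattice \<epsilon> :: (real ^ 'n) set)"
proof -
  have "lattice \<epsilon> \<subseteq> (\<lambda>k :: int ^ 'n. \<chi> i. \<epsilon> * of_int (k $ i)) ` UNIV"
  proof
    fix x :: "real ^ 'n" assume "x \<in> lattice \<epsilon>"
    then have "\<forall>i. \<exists>k :: int. x $ i = \<epsilon> * of_int k" by (simp add: lattice_def)
    then obtain k :: "'n \<Rightarrow> int" where "\<forall>i. x $ i = \<epsilon> * of_int (k i)" by metis
    then have "x = (\<chi> i. \<epsilon> * of_int ((\<chi> i. k i) $ i))" by (simp add: vec_eq_iff)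
    then show "x \<in> (\<lambda>k :: int ^ 'n. \<chi> i. \<epsilon> * of_int (k $ i)) ` UNIV" by blast
  qed
  moreover have "countable (UNIV :: (int ^ 'n) set)"
  proof -
    have "UNIV \<subseteq> vec_lambda ` (UNIV :: ('n \<Rightarrow> int) set)" by (metis UNIV_I image_eqI subsetI vec_lambda_eta)
    then show ?thesis by (meson countable_image countableI_type countable_subset)
  qed
  ultimately show ?thesis by (meson countable_image countable_subset)
qed

lemma lattice_count:
  fixes \<epsilon> :: real
  assumes \<epsilon>: "0 < \<epsilon>"
  shows "\<exists>N>0. \<forall>u :: real ^ 'n. (\<integral>\<^sup>+j. indicator (cball 0 1) (u + j) \<partial>count_space (lattice
    \<epsilon>)) \<le> ennreal N"
proof -
  \<comment> \<open>In each coordinate the admissible integers fill an interval of length 2 /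
    \<epsilon>, which holds at most this many of them, wherever it lies.\<close>
  define m where "m = nat \<lceil>2 / \<epsilon>\<rceil> + 1"
  have "(\<integral>\<^sup>+j. indicator (cball 0 1) (u + j) \<partial>count_space (lattice \<epsilon>))
    \<le> ennreal (real (m ^ CARD('n)))" for u :: "real ^ 'n"
  proof -
    define S where "S = {j \<in> lattice \<epsilon>. u + j \<in> cball 0 1}"
    define F where "F i = {\<lceil>(- 1 - u $ i) / \<epsilon>\<rceil>..\<lfloor>(1 - u $ i) / \<epsilon>\<rfloor>}" for i
    have cF: "card (F i) \<le> m" for i
    proof -
      have "(1 - u $ i) / \<epsilon> - (- 1 - u $ i) / \<epsilon> = 2 / \<epsilon>" using \<epsilon> by (simp add: field_simps)
      then have "\<lfloor>(1 - u $ i) / \<epsilon>\<rfloor> - \<lceil>(- 1 - u $ i) / \<epsilon>\<rceil>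
        \<le> \<lceil>2 / \<epsilon>\<rceil>" by linarith
      moreover have "0 < 2 / \<epsilon>" using \<epsilon> by simp
      then have "0 \<le> \<lceil>2 / \<epsilon>\<rceil>" by linarith
      ultimately show ?thesis unfolding F_def m_def by simp
    qed
    have sub: "S \<subseteq> (\<lambda>k. \<chi> i. \<epsilon> * of_int (k i)) ` (PiE UNIV F)"
    proof
      fix x assume "x \<in> S"
      then have x: "x \<in> lattice \<epsilon>" "norm (u + x) \<le> 1" by (auto simp: S_def)
      then have "\<forall>i. \<exists>k :: int. x $ i = \<epsilon> * of_int k" by (simp add: lattice_def)
      then obtain k :: "'n \<Rightarrow> int" where k: "\<And>i. x $ i = \<epsilon> * of_int (k i)" by metis
      have "k i \<in> F i" for i
      proof -
        have "\<bar>(u + x) $ i\<bar> \<le> 1" using component_le_norm_cart[of "u + x" i] x(2) by linarith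
        then have 1: "- 1 - u $ i \<le> \<epsilon> * of_int (k i)" and 2: "\<epsilon> * of_int (k i) \<le> 1 - u $ i" using k[of i] by auto
        have "(- 1 - u $ i) / \<epsilon> \<le> of_int (k i)" using 1 \<epsilon> by (simp add: field_simps)
        moreover have "of_int (k i) \<le> (1 - u $ i) / \<epsilon>" using 2 \<epsilon> by (simp add: field_simps)
        ultimately show ?thesis unfolding F_def by (simp add: ceiling_le_iff le_floor_iff)
      qed
      then have "k \<in> PiE UNIV F" by auto
      moreover have "x = (\<chi> i. \<epsilon> * of_int (k i))" using k by (simp add: vec_eq_iff)
      ultimately show "x \<in> (\<lambda>k. \<chi> i. \<epsilon> * of_int (k i)) ` (PiE UNIV F)" by blast
    qed
    have fin: "finite (PiE UNIV F)" by (intro finite_PiE) (auto simp: F_def)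
    have "card S \<le> card (PiE UNIV F)" using card_mono[OF finite_imageI[OF fin] sub] card_image_le[OF fin] by (meson le_trans)
    also have "\<dots> = (\<Prod>i\<in>UNIV. card (F i))" by (simp add: card_PiE)
    also have "\<dots> \<le> (\<Prod>i\<in>(UNIV::'n set). m)" by (intro prod_mono) (simp add: cF)
    finally have card: "card S \<le> m ^ CARD('n)" by simp
    have fS: "finite S" using sub fin finite_surj by blast
    have "(\<integral>\<^sup>+j. indicator (cball 0 1) (u + j) \<partial>count_space (lattice \<epsilon>))
      = (\<integral>\<^sup>+j. indicator S j \<partial>count_space (lattice \<epsilon>))"
      by (intro nn_integral_cong) (auto simp: S_def indicator_def)
    also have "\<dots> = emeasure (count_space (lattice \<epsilon>)) S"
      by (rule nn_integral_indicator) (auto simp: S_def)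
    also have "\<dots> = of_nat (card S)" using fS by (intro emeasure_count_space_finite) (auto simp: S_def)
    also have "\<dots> \<le> of_nat (m ^ CARD('n))" by (rule of_nat_mono[OF card])
    finally show ?thesis by (simp add: ennreal_of_nat_eq_real_of_nat)
  qed
  moreover have "0 < real (m ^ CARD('n))" by (simp add: m_def)
  ultimately show ?thesis by blast
qed

subsection \<open>Mixed norms and point evaluations\<close>

text \<open>Choose T with \<Psi> T > 1. If f a > T c then \<Psi> (f a / c) \<ge> \<Psi> T > 1, so c
  is not admissible.\<close>

lemma orlicz_norm_point:
  assumes y: "young \<Psi>"
  shows "\<exists>T>0. \<forall>a f. f a \<le> ennreal T * orlicz_norm (count_space {a}) \<Psi> f"
proof -
  have "(\<Psi> \<longlongrightarrow> top) at_top" using y by (simp add: young_def)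
  then have "\<forall>\<^sub>F t in at_top. 1 < \<Psi> t" by (rule order_tendstoD) simp
  then have "\<forall>\<^sub>F t in at_top. 1 < \<Psi> t \<and> 0 < t" using eventually_gt_at_top[of 0] by (rule eventually_conj)
  then obtain T where T: "1 < \<Psi> T" "0 < T" using eventually_happens'[OF trivial_limit_at_top_linorder] by blast
  have pt: "f a \<le> ennreal T * orlicz_norm (count_space {a}) \<Psi> f" for a f
  proof (rule le_cmult_orlicz_norm[OF T(2)])
    fix c :: real assume c: "0 < c" and i: "(\<integral>\<^sup>+ x. at_ennreal \<Psi> (f x / ennreal c) \<partial>count_space {a}) \<le> 1"
    then have i: "at_ennreal \<Psi> (f a / ennreal c) \<le> 1" by (simp add: nn_integral_count_space_finite)
    show "f a \<le> ennreal (T * c)"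
    proof (rule ccontr)
      assume "\<not> f a \<le> ennreal (T * c)"
      then have "ennreal (T * c) / ennreal c \<le> f a / ennreal c" by (intro divide_right_mono_ennreal) auto
      moreover have "ennreal (T * c) / ennreal c = ennreal T" using c T by (simp add: divide_ennreal)
      ultimately have "\<Psi> T \<le> at_ennreal \<Psi> (f a / ennreal c)"
        using at_ennreal_mono[OF y, of "ennreal T"] T(2) by (simp add: at_ennreal_ennreal)
      then show False using i T(1) by auto
    qed
  qed
  show ?thesis
  proof (intro exI[of _ T] conjI allI)
    show "0 < T" by (rule T(2))
    show "f a \<le> ennreal T * orlicz_norm (count_space {a}) \<Psi> f" for a f by (rule pt[of f a])
  qed
qed

lemma epow_mixed_orlicz_norm:
  assumes r: "0 < r" and \<Phi>\<^sub>1: "\<And>t. 0 \<le> t \<Longrightarrow> \<Phi>\<^sub>1 t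
    = \<Psi>\<^sub>1 (t powr r)" and \<Phi>\<^sub>2: "\<And>t. 0 \<le> t \<Longrightarrow> \<Phi>\<^sub>2 t = \<Psi>\<^sub>2 (t powr r)"
    and w: "\<And>X. 0 \<le> w X"
  shows "epow r (mixed_orlicz_norm \<mu> \<Phi>\<^sub>1 \<Phi>\<^sub>2 w F)
    = orlicz_norm \<mu> \<Psi>\<^sub>2 (\<lambda>\<xi>. orlicz_norm \<mu> \<Psi>\<^sub>1 (\<lambda>x. ennreal ((cmod (F (x, \<xi>)) * w (x,
      \<xi>)) powr r)))"
proof -
  have "epow r (mixed_orlicz_norm \<mu> \<Phi>\<^sub>1 \<Phi>\<^sub>2 w F)
    = orlicz_norm \<mu> \<Psi>\<^sub>2 (\<lambda>\<xi>. epow r (orlicz_norm \<mu> \<Phi>\<^sub>1 (\<lambda>x. ennreal (cmod (F (x, \<xi>)) *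
      w (x, \<xi>)))))"
    unfolding mixed_orlicz_norm_def by (rule epow_orlicz_norm[where \<Phi> = \<Phi>\<^sub>2 and \<Psi> = \<Psi>\<^sub>2, OF r \<Phi>\<^sub>2])
  also have "\<dots> = orlicz_norm \<mu> \<Psi>\<^sub>2 (\<lambda>\<xi>. orlicz_norm \<mu> \<Psi>\<^sub>1 (\<lambda>x. epow r (ennreal (cmod
    (F (x, \<xi>)) * w (x, \<xi>)))))"
    by (simp only: epow_orlicz_norm[where \<Phi> = \<Phi>\<^sub>1 and \<Psi> = \<Psi>\<^sub>1, OF r \<Phi>\<^sub>1])
  also have "\<dots> = orlicz_norm \<mu> \<Psi>\<^sub>2 (\<lambda>\<xi>. orlicz_norm \<mu> \<Psi>\<^sub>1 (\<lambda>x. ennreal ((cmod (F (x,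
    \<xi>)) * w (x, \<xi>)) powr r)))"
  proof -
    have "0 \<le> cmod (F (x, \<xi>)) * w (x, \<xi>)" for x \<xi> using w by simp
    then show ?thesis by (simp only: epow_ennreal)
  qed
  finally show ?thesis .
qed

lemma mixed_orlicz_mono:
  assumes y: "young \<Psi>\<^sub>1" "young \<Psi>\<^sub>2" and c: "0 < c"
    and le: "\<And>x \<xi>. x \<in> space \<mu> \<Longrightarrow> \<xi> \<in> space \<nu> \<Longrightarrow> G x \<xi> \<le> ennreal c * H x \<xi>"
  shows "orlicz_norm \<nu> \<Psi>\<^sub>2 (\<lambda>\<xi>. orlicz_norm \<mu> \<Psi>\<^sub>1 (\<lambda>x. G x \<xi>))
    \<le> ennreal c * orlicz_norm \<nu> \<Psi>\<^sub>2 (\<lambda>\<xi>. orlicz_norm \<mu> \<Psi>\<^sub>1 (\<lambda>x. H x \<xi>))"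
proof -
  have "orlicz_norm \<nu> \<Psi>\<^sub>2 (\<lambda>\<xi>. orlicz_norm \<mu> \<Psi>\<^sub>1 (\<lambda>x. G x \<xi>))
    \<le> orlicz_norm \<nu> \<Psi>\<^sub>2 (\<lambda>\<xi>. ennreal c * orlicz_norm \<mu> \<Psi>\<^sub>1 (\<lambda>x. H x \<xi>))"
  proof (rule orlicz_norm_mono[OF y(2)])
    fix \<xi> assume "\<xi> \<in> space \<nu>"
    then have "orlicz_norm \<mu> \<Psi>\<^sub>1 (\<lambda>x. G x \<xi>) \<le> orlicz_norm \<mu> \<Psi>\<^sub>1 (\<lambda>x. ennreal c * H x \<xi>)"
      by (intro orlicz_norm_mono[OF y(1)] le)
    also have "\<dots> \<le> ennreal c * orlicz_norm \<mu> \<Psi>\<^sub>1 (\<lambda>x. H x \<xi>)" by (rule orlicz_norm_cmult_le[OF c])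
    finally show "orlicz_norm \<mu> \<Psi>\<^sub>1 (\<lambda>x. G x \<xi>)
      \<le> ennreal c * orlicz_norm \<mu> \<Psi>\<^sub>1 (\<lambda>x. H x \<xi>)" .
  qed
  also have "\<dots> \<le> ennreal c * orlicz_norm \<nu> \<Psi>\<^sub>2 (\<lambda>\<xi>. orlicz_norm \<mu> \<Psi>\<^sub>1 (\<lambda>x. H x \<xi>))"
    by (rule orlicz_norm_cmult_le[OF c])
  finally show ?thesis .
qed

text \<open>Nonnegative integrals over a measure and over its completion agree for arbitrary
  integrands, so this holds even though the inner integrands may fail to be measurable.\<close>

lemma orlicz_norm_lebesgue: "orlicz_norm lebesgue \<Psi> f = orlicz_norm lborel \<Psi> f"
  by (simp add: orlicz_norm_def nn_integral_completion)

text \<open>The unit ball of phase space is contained in the product of the unit balls of the two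
  variables.\<close>

lemma local_iterated:
  fixes \<kappa> :: "'b::euclidean_space \<times> 'b \<Rightarrow> ennreal"
  assumes loc: "\<And>X. \<kappa> X \<le> D * (\<integral>\<^sup>+u. indicator (cball 0 1) u * \<kappa> (X + u) \<partial>lborel)"
    and [measurable]: "\<kappa> \<in> borel_measurable borel"
  shows "\<kappa> (x, \<eta>) \<le> D * (\<integral>\<^sup>+w2. indicator (cball 0 1) w2 * (\<integral>\<^sup>+w1. indicator (cball 0 1) w1
    * \<kappa> (x + w1, \<eta> + w2) \<partial>lborel) \<partial>lborel)"
proof -
  have m: "(\<lambda>u. indicator (cball 0 1) u * \<kappa> ((x, \<eta>) + u)) \<in> borel_measurable borel" by measurable
  have "(\<integral>\<^sup>+u. indicator (cball 0 1) u * \<kappa> ((x, \<eta>) + u) \<partial>lborel)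
    = (\<integral>\<^sup>+w2. \<integral>\<^sup>+w1. indicator (cball 0 1) (w1, w2) * \<kappa> ((x, \<eta>) + (w1, w2)) \<partial>lborel
      \<partial>lborel)"
    by (rule nn_integral_lborel_pair[OF m])
  also have "\<dots> \<le> (\<integral>\<^sup>+w2. indicator (cball 0 1) w2 * (\<integral>\<^sup>+w1. indicator (cball 0 1) w1 * \<kappa> (x
    + w1, \<eta> + w2) \<partial>lborel) \<partial>lborel)"
  proof (intro nn_integral_mono)
    fix w2 :: 'b
    have "(\<integral>\<^sup>+w1. indicator (cball 0 1) (w1, w2) * \<kappa> ((x, \<eta>) + (w1, w2)) \<partial>lborel)
      \<le> (\<integral>\<^sup>+w1. indicator (cball 0 1) w2 * (indicator (cball 0 1) w1 * \<kappa> (x + w1, \<eta> + w2)) \<partial>lborel)"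
    proof (intro nn_integral_mono)
      fix w1 :: 'b
      have "norm w1 \<le> norm (w1, w2)" "norm w2 \<le> norm (w1, w2)" by (simp_all add: norm_Pair)
      then show "indicator (cball 0 1) (w1, w2) * \<kappa> ((x, \<eta>) + (w1, w2))
        \<le> indicator (cball 0 1) w2 * (indicator (cball 0 1) w1 * \<kappa> (x + w1, \<eta> + w2))"
        by (auto simp: indicator_def)
    qed
    also have "\<dots> = indicator (cball 0 1) w2 * (\<integral>\<^sup>+w1. indicator (cball 0 1) w1 * \<kappa> (x + w1, \<eta> + w2)
      \<partial>lborel)"
      by (rule nn_integral_cmult) measurable
    finally show "(\<integral>\<^sup>+w1. indicator (cball 0 1) (w1, w2) * \<kappa> ((x, \<eta>) + (w1, w2)) \<partial>lborel)
      \<le> indicator (cball 0 1) w2 * (\<integral>\<^sup>+w1. indicator (cball 0 1) w1 * \<kappa> (x + w1, \<eta> + w2) \<partial>lborel)" .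
  qed
  finally show ?thesis using loc[of "(x, \<eta>)"] by (meson mult_left_mono order.trans zero_le)
qed

lemma emeasure_cball_bound: "\<exists>N\<ge>1. emeasure lborel (cball 0 1 :: 'b::euclidean_space set) \<le> ennreal N"
proof -
  have "emeasure lborel (cball 0 1 :: 'b set) < top" unfolding infinity_ennreal_def[symmetric] by (rule emeasure_lborel_cball_finite)
  then obtain M where "emeasure lborel (cball 0 1 :: 'b set) = ennreal M" "0 \<le> M" by (metis less_top_ennreal)
  then have "emeasure lborel (cball 0 1 :: 'b set) \<le> ennreal (max 1 M)" by (simp add: ennreal_leI)
  then show ?thesis by (intro exI[of _ "max 1 M"]) auto
qed

text \<open>Evaluation at a point is the one-point case of the sampling estimate, with a Gaussian kernel.\<close>

lemma local_le_mixed_orlicz_norm: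
  assumes y1: "young \<Psi>\<^sub>1" and y2: "young \<Psi>\<^sub>2"
  shows "\<exists>C>0. \<forall>g c. g \<in> borel_measurable borel \<longrightarrow>
    (\<forall>X. g X \<le> c * (\<integral>\<^sup>+u. indicator (cball 0 1) u * g (X + u) \<partial>lborel)) \<longrightarrow>
    (\<forall>X :: (real ^ 'n) \<times> (real ^ 'n). g X
      \<le> c * (ennreal C * orlicz_norm lborel \<Psi>\<^sub>2 (\<lambda>\<xi>. orlicz_norm lborel \<Psi>\<^sub>1 (\<lambda>x. g (x, \<xi>)))))"
proof -
  define \<kappa> where "\<kappa> U = ennreal (exp (- (norm U)\<^sup>2))" for U :: "(real ^ 'n) \<times> (real ^ 'n)"
  have \<kappa>m[measurable]: "\<kappa> \<in> borel_measurable borel" unfolding \<kappa>_def by measurable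
  have q: "(0::real) \<le> 1" "(0::real) < 1" "(1::real) \<le> 1" by auto
  obtain D where D: "0 < D" "\<And>A w. sep_entire (A :: (real ^ 'n) \<times> (real ^ 'n) \<Rightarrow> complex) \<Longrightarrow>
    ennreal (gmod 1 A w powr 1) \<le> ennreal D * (\<integral>\<^sup>+u. indicator (cball 0 1) u * ennreal (gmod 1 A (w + u) powr 1)
      \<partial>lborel)"
    using gmod_local[OF q] by blast
  have one: "sep_entire (\<lambda>_ :: (real ^ 'n) \<times> (real ^ 'n). 1)" by (simp add: sep_entire_def)
  have g1: "ennreal (gmod 1 (\<lambda>_. 1) U powr 1) = \<kappa> U" for U :: "(real ^ 'n) \<times> (real ^ 'n)" by (simp add: gmod_def \<kappa>_def)
  have loc: "\<kappa> X \<le> ennreal D * (\<integral>\<^sup>+u. indicator (cball 0 1) u * \<kappa> (X + u) \<partial>lborel)" for X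
    using D(2)[OF one, of X] unfolding g1 .
  have ki: "integrable lborel (\<lambda>U :: (real ^ 'n) \<times> (real ^ 'n). exp (0 * norm U - 1 * (norm U)\<^sup>2))"
    by (rule integrable_exp_norm_gaussian) simp
  have I: "(\<integral>\<^sup>+U. \<kappa> U \<partial>lborel)
    \<le> ennreal (1 + (\<integral>U. exp (0 * norm U - 1 * (norm U)\<^sup>2) \<partial>(lborel :: ((real ^ 'n) \<times> (real ^ 'n)) measure)))"
    using nn_integral_eq_integral[OF ki] by (simp add: \<kappa>_def ennreal_leI)
  \<comment> \<open>The summand 1 secures the positivity required by
    \<open>orlicz_kernel_bound\<close>.\<close>
  define I where "I = 1 + (\<integral>U. exp (0 * norm U - 1 * (norm U)\<^sup>2) \<partial>(lborel :: ((real ^ 'n) \<times> (real ^ 'n)) measure))"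
  have I0: "0 < I" unfolding I_def by (intro add_pos_nonneg Bochner_Integration.integral_nonneg) auto
  obtain N where N: "1 \<le> N" "emeasure lborel (cball 0 1 :: (real ^ 'n) set) \<le> ennreal N" using emeasure_cball_bound by blast
  have N0: "0 < N" using N by simp
  have cnt: "(\<integral>\<^sup>+j. indicator (cball 0 1) (u + j) \<partial>count_space {a}) \<le> ennreal N" for u a :: "real ^ 'n"
  proof -
    have "(\<integral>\<^sup>+j. indicator (cball 0 1) (u + j) \<partial>count_space {a}) \<le> (\<integral>\<^sup>+j. 1 \<partial>count_space {a})"
      by (intro nn_integral_mono) (auto simp: indicator_def)
    also have "\<dots> \<le> ennreal N" using N(1) by simp
    finally show ?thesis .
  qed
  from orlicz_norm_point[OF y1] obtain T\<^sub>1
    where T1: "0 < T\<^sub>1 \<and> (\<forall>(a :: real ^ 'n) f. f a \<le> ennreal T\<^sub>1 * orlicz_norm (count_space {a}) \<Psi>\<^sub>1 f)" ..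
  from orlicz_norm_point[OF y2] obtain T\<^sub>2
    where T2: "0 < T\<^sub>2 \<and> (\<forall>(a :: real ^ 'n) f. f a \<le> ennreal T\<^sub>2 * orlicz_norm (count_space {a}) \<Psi>\<^sub>2 f)" ..
  define C where "C = exp 1 * (T\<^sub>1 * (T\<^sub>2 * (4 * D * N * N * I)))"
  have C0: "0 < C" unfolding C_def using T1[THEN conjunct1] T2[THEN conjunct1] D(1) N0 I0 by simp
  have "g X \<le> c * (ennreal C * orlicz_norm lborel \<Psi>\<^sub>2 (\<lambda>\<xi>. orlicz_norm lborel \<Psi>\<^sub>1 (\<lambda>x. g (x, \<xi>))))"
    if gm[measurable]: "g \<in> borel_measurable borel" and gl: "\<And>X. g X
      \<le> c * (\<integral>\<^sup>+u. indicator (cball 0 1) u * g (X + u) \<partial>lborel)"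
    for g :: "(real ^ 'n) \<times> (real ^ 'n) \<Rightarrow> ennreal" and c X
  proof -
    obtain a b where X: "X = (a, b)" by fastforce
    let ?N = "orlicz_norm lborel \<Psi>\<^sub>2 (\<lambda>\<xi>. orlicz_norm lborel \<Psi>\<^sub>1 (\<lambda>x. g (x, \<xi>)))"
    \<comment> \<open>On the unit ball exp 1 times \<kappa> is at least 1, so the local average of g
      at X is dominated by a Gaussian-weighted integral, to which the kernel estimate
      applies.\<close>
    have "(\<integral>\<^sup>+u. indicator (cball 0 1) u * g (X + u) \<partial>lborel)
      \<le> (\<integral>\<^sup>+u. ennreal (exp 1) * (g (u + X) * \<kappa> (u + X - X)) \<partial>lborel)"
    proof (intro nn_integral_mono)
      fix u :: "(real ^ 'n) \<times> (real ^ 'n)"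
      show "indicator (cball 0 1) u * g (X + u) \<le> ennreal (exp 1) * (g (u + X) * \<kappa> (u + X - X))"
      proof (cases "u \<in> cball 0 1")
        case True
        then have "(norm u)\<^sup>2 \<le> 1" by (simp add: power_le_one)
        then have "1 \<le> ennreal (exp 1 * exp (- (norm u)\<^sup>2))"
          unfolding exp_add[symmetric] ennreal_1[symmetric] by (intro ennreal_leI) simp
        then have "1 \<le> ennreal (exp 1) * \<kappa> u" by (simp add: \<kappa>_def ennreal_mult)
        then have "1 * g (X + u) \<le> (ennreal (exp 1) * \<kappa> u) * g (X + u)" by (rule mult_right_mono) simp
        then show ?thesis using True by (simp add: ac_simps)
      qed simp
    qed
    also have "\<dots> = ennreal (exp 1) * (\<integral>\<^sup>+u. g (u + X) * \<kappa> (u + X - X) \<partial>lborel)"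
      by (rule nn_integral_cmult) measurable
    also have "(\<integral>\<^sup>+u. g (u + X) * \<kappa> (u + X - X) \<partial>lborel)
      = (\<integral>\<^sup>+Y. g Y * \<kappa> (Y - X) \<partial>lborel)"
      by (rule nn_integral_lborel_shift[of "\<lambda>Y. g Y * \<kappa> (Y - X)"]) measurable
    also have "\<dots> \<le> ennreal T\<^sub>1 * orlicz_norm (count_space {a}) \<Psi>\<^sub>1 (\<lambda>j. \<integral>\<^sup>+Y. g Y *
      \<kappa> (Y - (j, b)) \<partial>lborel)"
      unfolding X using T1[THEN conjunct2, rule_format, of "\<lambda>j. \<integral>\<^sup>+Y. g Y * \<kappa> (Y - (j, b)) \<partial>lborel" a] by simp
    also have "\<dots> \<le> ennreal T\<^sub>1 * (ennreal T\<^sub>2 * orlicz_norm (count_space {b}) \<Psi>\<^sub>2 (\<lambda>i. orlicz_norm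
      (count_space {a}) \<Psi>\<^sub>1 (\<lambda>j. \<integral>\<^sup>+Y. g Y * \<kappa> (Y - (j, i)) \<partial>lborel)))"
      using T2[THEN conjunct2, rule_format, of "\<lambda>i. orlicz_norm (count_space {a}) \<Psi>\<^sub>1 (\<lambda>j. \<integral>\<^sup>+Y.
        g Y * \<kappa> (Y - (j, i)) \<partial>lborel)" b]
      by (intro mult_left_mono) simp_all
    also have "\<dots> \<le> ennreal T\<^sub>1 * (ennreal T\<^sub>2 * (ennreal (4 * D * N * N * I) * ?N))"
      by (intro mult_left_mono orlicz_kernel_bound[OF y1 y2 gm \<kappa>m cball_borel N(2) _ _ cnt cnt local_iterated[OF loc \<kappa>m]
        I[folded I_def] D(1) N0 I0]) auto
    finally have "(\<integral>\<^sup>+u. indicator (cball 0 1) u * g (X + u) \<partial>lborel) \<le> ennreal C * ?N"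
      unfolding C_def using T1[THEN conjunct1] T2[THEN conjunct1] D(1) N0 I0 by (simp add: ennreal_mult mult.assoc mult_left_mono)
    then show ?thesis using gl[of X] by (meson mult_left_mono order.trans zero_le)
  qed
  then show ?thesis using C0 by blast
qed

subsection \<open>Sampling of the short-time Fourier transform\<close>

text \<open>The situation after all choices have been made: \<Psi>1 and \<Psi>2 are the Young
  functions behind the quasi-Young ones, \<omega>', v' and W' are Borel majorants of \<omega>, v and
  1 / \<omega>, and \<open>P1\<close>, \<open>P2\<close>, \<open>Pr\<close> record what membership
  of the window in M^r yields.\<close>

locale weighted_window =
  fixes r C\<^sub>v A a K L\<^sub>\<omega> L\<^sub>v M :: real
    and \<Phi>\<^sub>1 \<Phi>\<^sub>2 \<Psi>\<^sub>1 \<Psi>\<^sub>2 :: "real \<Rightarrow> ennreal"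
    and \<omega> \<omega>' W' v v' :: "(real ^ 'n) \<times> (real ^ 'n) \<Rightarrow> real"
    and \<phi> :: "real ^ 'n \<Rightarrow> complex"
  assumes r: "0 < r" "r \<le> 1" and y1: "young \<Psi>\<^sub>1" and y2: "young \<Psi>\<^sub>2"
    and \<Phi>1: "\<And>t. 0 \<le> t \<Longrightarrow> \<Phi>\<^sub>1 t = \<Psi>\<^sub>1 (t powr r)" and \<Phi>2: "\<And>t. 0 \<le> t
      \<Longrightarrow> \<Phi>\<^sub>2 t = \<Psi>\<^sub>2 (t powr r)"
    and \<omega>0: "\<And>X. 0 < \<omega> X" and \<omega>im: "(\<lambda>X. 1 / \<omega> X) \<in> borel_measurable lebesgue"
    and K: "0 < K" and \<omega>'m: "\<omega>' \<in> borel_measurable borel"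
    and \<omega>'l: "\<And>X. \<omega> X \<le> \<omega>' X" and \<omega>'u: "\<And>X. \<omega>' X
      \<le> K * \<omega> X" and \<omega>'s: "slow L\<^sub>\<omega> \<omega>'"
    and mod: "\<And>X Y. \<omega> (X + Y) \<le> C\<^sub>v * \<omega> X * v Y" and Cv: "0 < C\<^sub>v"
    and v0: "\<And>X. 0 < v X" and even: "\<And>X. v (- X) = v X"
    and vexp: "\<And>X. v X \<le> A * exp (a * norm X)" and A: "0 < A"
    and W'm: "W' \<in> borel_measurable borel" and W'l: "\<And>X. 1 / \<omega> X \<le> W' X" and W'u: "\<And>X. W' X \<le> K * (1 / \<omega> X)"
    and vv: "\<And>X. v X \<le> v' X" and v'm: "v' \<in> borel_measurable borel" and v's: "slow L\<^sub>v v'"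
    and \<phi>: "\<phi> \<in> L2"
    and P1: "\<And>X. cmod (gauss_stft (hermite_series \<phi>) X) \<le> M"
    and P2: "(\<integral>\<^sup>+X. ennreal (cmod (gauss_stft (hermite_series \<phi>) X) * v' X) \<partial>lborel) < top"
    and Pr: "(\<integral>\<^sup>+X. ennreal ((cmod (gauss_stft (hermite_series \<phi>) X) * v' X) powr r) \<partial>lborel) < top"
begin

definition dens :: "'n series \<Rightarrow> (real ^ 'n) \<times> (real ^ 'n) \<Rightarrow> ennreal" where
  "dens f Y = ennreal ((cmod (gauss_stft f Y) * \<omega>' Y) powr r)"

definition kern :: "(real ^ 'n) \<times> (real ^ 'n) \<Rightarrow> ennreal" where
  "kern U = ennreal ((cmod (gauss_stft (hermite_series \<phi>) U) * v' U) powr r)"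

definition dens_norm :: "'n series \<Rightarrow> ennreal" where
  "dens_norm f = orlicz_norm lborel \<Psi>\<^sub>2 (\<lambda>\<xi>. orlicz_norm lborel \<Psi>\<^sub>1 (\<lambda>x. dens f (x, \<xi>)))"

lemma \<phi>_series: "hermite_series \<phi> \<in> H_flat_dual" by (rule hermite_series_H_flat_dual[OF \<phi>])

lemma dens_measurable: "f \<in> H_flat_dual \<Longrightarrow> dens f \<in> borel_measurable borel"
  unfolding dens_def using gauss_stft_measurable \<omega>'m by measurable

lemma kern_measurable: "kern \<in> borel_measurable borel"
  unfolding kern_def using gauss_stft_measurable[OF \<phi>_series] v'm by measurable

lemma dens_norm_le: "dens_norm f \<le> ennreal (K powr r) * epow r (mod_norm \<Phi>\<^sub>1 \<Phi>\<^sub>2 \<omega> f)"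
proof -
  have "dens_norm f \<le> ennreal (K powr r) * orlicz_norm lborel \<Psi>\<^sub>2 (\<lambda>\<xi>. orlicz_norm lborel \<Psi>\<^sub>1
    (\<lambda>x. ennreal ((cmod (gauss_stft f (x, \<xi>)) * \<omega> (x, \<xi>)) powr r)))"
    unfolding dens_norm_def
  proof (rule mixed_orlicz_mono[OF y1 y2])
    show "0 < K powr r" using K by simp
    fix x \<xi> :: "real ^ 'n"
    have "cmod (gauss_stft f (x, \<xi>)) * \<omega>' (x, \<xi>) \<le> K * (cmod (gauss_stft f (x, \<xi>)) * \<omega> (x, \<xi>))"
      using mult_left_mono[OF \<omega>'u[of "(x, \<xi>)"] norm_ge_zero[of "gauss_stft f (x, \<xi>)"]] by (simp add: ac_simps)
    then have "(cmod (gauss_stft f (x, \<xi>)) * \<omega>' (x, \<xi>)) powr r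
      \<le> (K * (cmod (gauss_stft f (x, \<xi>)) * \<omega> (x, \<xi>))) powr r"
      using order.trans[OF less_imp_le[OF \<omega>0] \<omega>'l, of "(x, \<xi>)"] r by (intro powr_mono2) auto
    also have "\<dots> = K powr r * (cmod (gauss_stft f (x, \<xi>)) * \<omega> (x, \<xi>)) powr r"
      using K \<omega>0[of "(x, \<xi>)"] by (simp add: powr_mult less_imp_le)
    finally show "dens f (x, \<xi>) \<le> ennreal (K powr r) * ennreal ((cmod (gauss_stft f (x, \<xi>)) * \<omega> (x, \<xi>)) powr r)"
      unfolding dens_def by (simp add: ennreal_leI flip: ennreal_mult)
  qed
  also have "orlicz_norm lborel \<Psi>\<^sub>2 (\<lambda>\<xi>. orlicz_norm lborel \<Psi>\<^sub>1 (\<lambda>x. ennreal ((cmod (gauss_stft f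
    (x, \<xi>)) * \<omega> (x, \<xi>)) powr r)))
    = epow r (mod_norm \<Phi>\<^sub>1 \<Phi>\<^sub>2 \<omega> f)"
    unfolding mod_norm_def orlicz_norm_lebesgue[symmetric]
    by (rule epow_mixed_orlicz_norm[symmetric, where \<Phi>\<^sub>1 = \<Phi>\<^sub>1 and \<Phi>\<^sub>2
      = \<Phi>\<^sub>2, OF r(1) \<Phi>1 \<Phi>2 less_imp_le[OF \<omega>0]])
  finally show ?thesis .
qed

text \<open>The embedding into weighted M^infinity. It must come before any statement on V_phi f,
  because the duality that defines V_phi f rests on it.\<close>

lemma mod_space_bounded:
  assumes f: "f \<in> mod_space \<Phi>\<^sub>1 \<Phi>\<^sub>2 \<omega>"
  shows "\<exists>B. \<forall>X. cmod (gauss_stft f X) * \<omega> X \<le> B"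
proof -
  have fd: "f \<in> H_flat_dual" and fin: "mod_norm \<Phi>\<^sub>1 \<Phi>\<^sub>2 \<omega> f < top" using f by (auto simp: mod_space_def)
  obtain C where C: "0 < C" "\<And>X. dens f X \<le> ennreal C * (\<integral>\<^sup>+u. indicator (cball 0 1) u * dens f (X + u) \<partial>lborel)"
    using weighted_stft_local[OF r \<omega>'s \<omega>'m] fd unfolding dens_def by blast
  from local_le_mixed_orlicz_norm[OF y1 y2] obtain D where D: "0 < D \<and> (\<forall>g c. g \<in> borel_measurable borel \<longrightarrow>
    (\<forall>X. g X \<le> c * (\<integral>\<^sup>+u. indicator (cball 0 1) u * g (X + u) \<partial>lborel)) \<longrightarrow>
    (\<forall>X :: (real ^ 'n) \<times> (real ^ 'n). g X
      \<le> c * (ennreal D * orlicz_norm lborel \<Psi>\<^sub>2 (\<lambda>\<xi>. orlicz_norm lborel \<Psi>\<^sub>1 (\<lambda>x. g (x, \<xi>))))))" ..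
  have le: "dens f X \<le> ennreal C * (ennreal D * dens_norm f)" for X
    unfolding dens_norm_def
    using D[THEN conjunct2, rule_format, of "dens f" "ennreal C" X, OF dens_measurable[OF fd] C(2)] .
  have "epow r (mod_norm \<Phi>\<^sub>1 \<Phi>\<^sub>2 \<omega> f) < top" using fin by (auto simp: epow_def less_top)
  then have "ennreal (K powr r) * epow r (mod_norm \<Phi>\<^sub>1 \<Phi>\<^sub>2 \<omega> f) < top" by (simp add: ennreal_mult_less_top)
  then have "dens_norm f < top" using dens_norm_le[of f] by (rule le_less_trans[rotated])
  then have "ennreal C * (ennreal D * dens_norm f) < top" by (simp add: ennreal_mult_less_top)
  then obtain M where M: "0 \<le> M" "ennreal C * (ennreal D * dens_norm f) = ennreal M" by (metis less_top_ennreal)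
  have "cmod (gauss_stft f X) * \<omega> X \<le> M powr (1 / r)" for X
  proof -
    let ?h = "cmod (gauss_stft f X) * \<omega>' X"
    have \<omega>'0: "0 \<le> \<omega>' X" using \<omega>0[of X] \<omega>'l[of X] by simp
    have "?h powr r \<le> M" using le[of X] M by (simp add: dens_def)
    then have "(?h powr r) powr (1 / r) \<le> M powr (1 / r)" using r by (intro powr_mono2) auto
    then have "?h \<le> M powr (1 / r)" using r \<omega>'0 by (simp add: powr_powr)
    moreover have "cmod (gauss_stft f X) * \<omega> X \<le> ?h" by (intro mult_left_mono \<omega>'l) simp
    ultimately show ?thesis by simp
  qed
  then show ?thesis by blast
qed

lemma stft_integral:
  assumes f: "f \<in> mod_space \<Phi>\<^sub>1 \<Phi>\<^sub>2 \<omega>"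
  shows "stft \<omega> \<phi> f X = stft_const TYPE('n) * (\<integral>Y. gauss_stft f Y * cnj (gauss_stft (hermite_series (tf_shift (fst X)
    (snd X) \<phi>)) Y) \<partial>lborel)"
    and "integrable lborel (\<lambda>Y. gauss_stft f Y * cnj (gauss_stft (hermite_series (tf_shift (fst X) (snd X) \<phi>)) Y))"
proof -
  have fd: "f \<in> H_flat_dual" using f by (simp add: mod_space_def)
  obtain B where B: "\<And>X. cmod (gauss_stft f X) * \<omega> X \<le> B" using mod_space_bounded[OF f] by blast
  note * = dual_form_eq_integral[OF \<phi> fd \<omega>0 \<omega>im mod Cv v0 even vexp A W'm W'l W'u K vv v'm P1 P2 B, of "fst X" "snd X"]
  show "stft \<omega> \<phi> f X = stft_const TYPE('n) * (\<integral>Y. gauss_stft f Y * cnj (gauss_stft (hermite_series (tf_shift (fst X)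
    (snd X) \<phi>)) Y) \<partial>lborel)"
    unfolding stft_def case_prod_beta *(1) ..
  show "integrable lborel (\<lambda>Y. gauss_stft f Y * cnj (gauss_stft (hermite_series (tf_shift (fst X) (snd X) \<phi>)) Y))"
    by (rule *(2))
qed

text \<open>\<open>dual_form\<close> is a \<open>Lim\<close>, so additivity is not formal; it is
  read off the integral representation of all three terms.\<close>

lemma stft_diff:
  assumes f: "f \<in> mod_space \<Phi>\<^sub>1 \<Phi>\<^sub>2 \<omega>" and g: "g \<in> mod_space \<Phi>\<^sub>1 \<Phi>\<^sub>2 \<omega>"
    and h: "(\<lambda>\<alpha>. g \<alpha> - f \<alpha>) \<in> mod_space \<Phi>\<^sub>1 \<Phi>\<^sub>2 \<omega>"
  shows "stft \<omega> \<phi> (\<lambda>\<alpha>. g \<alpha> - f \<alpha>) X = stft \<omega> \<phi> g X - stft \<omega> \<phi> f X"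
proof -
  have fd: "f \<in> H_flat_dual" "g \<in> H_flat_dual" using f g by (auto simp: mod_space_def)
  show ?thesis
    unfolding stft_integral(1)[OF f] stft_integral(1)[OF g] stft_integral(1)[OF h] gauss_stft_diff[OF fd(2,1)] left_diff_distrib
      Bochner_Integration.integral_diff[OF stft_integral(2)[OF g] stft_integral(2)[OF f]] right_diff_distrib ..
qed

lemma stft_bound:
  shows "\<exists>C>0. \<forall>f\<in>mod_space \<Phi>\<^sub>1 \<Phi>\<^sub>2 \<omega>. \<forall>X. ennreal ((cmod (stft \<omega> \<phi> f
    X) * \<omega> X) powr r)
    \<le> ennreal C * (\<integral>\<^sup>+Y. dens f Y * kern (Y - X) \<partial>lborel)"
proof -
  let ?V = "gauss_stft (hermite_series \<phi>)"
  obtain C where C: "0 < C" and loc: "\<And>f X w. f \<in> H_flat_dual \<Longrightarrow>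
    ennreal ((cmod (gauss_stft f w) * cmod (?V (w - X))) powr r)
    \<le> ennreal C * (\<integral>\<^sup>+u. indicator (cball 0 1) u * ennreal ((cmod (gauss_stft f (w + u)) * cmod (?V (w + u - X))) powr
      r) \<partial>lborel)"
    using stft_product_local[OF r] \<phi>_series by blast
  define D where "D = c0 TYPE('n) powr r * C powr (1 - r)"
  have D: "0 < D" using C c0_pos[where 'n = 'n] by (simp add: D_def)
  have "ennreal ((cmod (stft \<omega> \<phi> f X) * \<omega> X) powr r)
    \<le> ennreal (D * C\<^sub>v powr r) * (\<integral>\<^sup>+Y. dens f Y * kern (Y - X) \<partial>lborel)"
    if f: "f \<in> mod_space \<Phi>\<^sub>1 \<Phi>\<^sub>2 \<omega>" for f X
  proof -
    have fd: "f \<in> H_flat_dual" using f by (simp add: mod_space_def)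
    note gauss_stft_measurable[OF fd, measurable] gauss_stft_measurable[OF \<phi>_series, measurable]
      dens_measurable[OF fd, measurable] kern_measurable[measurable]
    define H where "H Y = cmod (gauss_stft f Y) * cmod (?V (Y - X))" for Y
    have H0: "0 \<le> H Y" for Y by (simp add: H_def)
    have Hb: "H \<in> borel_measurable borel" unfolding H_def by measurable
    then have Hm[measurable]: "H \<in> borel_measurable lborel" by simp
    have Hr: "(\<lambda>Y. ennreal (H Y powr r)) \<in> borel_measurable borel" using Hb by measurable
    have Hloc: "ennreal (H w powr r) \<le> ennreal C * (\<integral>\<^sup>+u. indicator (cball 0 1) u * ennreal (H (w + u) powr r)
      \<partial>lborel)" for w
      unfolding H_def by (rule loc[OF fd])
    \<comment> \<open>The supremum bound lets \<open>small_exponent_integral\<close> replace the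
      r-th power of an integral by the integral of the r-th power.\<close>
    have glob: "ennreal (H w powr r) \<le> ennreal C * (\<integral>\<^sup>+Y. ennreal (H Y powr r) \<partial>lborel)" for w
      by (rule local_imp_global[OF Hloc Hr])
    have n: "norm (gauss_stft f Y * cnj (gauss_stft (hermite_series (tf_shift (fst X) (snd X) \<phi>)) Y)) = H Y" for Y
      using norm_gauss_stft_shift[OF \<phi>, of "fst X" "snd X" Y] by (simp add: norm_mult H_def)
    have "ennreal (cmod (\<integral>Y. gauss_stft f Y * cnj (gauss_stft (hermite_series (tf_shift (fst X) (snd X) \<phi>)) Y)
      \<partial>lborel)) \<le> (\<integral>\<^sup>+Y. ennreal (H Y) \<partial>lborel)"
      using integral_norm_bound_ennreal[OF stft_integral(2)[OF f, of X]] unfolding n .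
    then have "ennreal (c0 TYPE('n)) * ennreal (cmod (\<integral>Y. gauss_stft f Y * cnj (gauss_stft (hermite_series (tf_shift (fst X) (snd
      X) \<phi>)) Y) \<partial>lborel))
      \<le> ennreal (c0 TYPE('n)) * (\<integral>\<^sup>+Y. ennreal (H Y) \<partial>lborel)" by (rule mult_left_mono) simp
    then have "ennreal (cmod (stft \<omega> \<phi> f X)) \<le> ennreal (c0 TYPE('n)) * (\<integral>\<^sup>+Y. ennreal (H Y) \<partial>lborel)"
      unfolding stft_integral(1)[OF f] norm_mult stft_const_c0 using c0_pos[where 'n = 'n] by (simp add: ennreal_mult)
    then have "epow r (ennreal (cmod (stft \<omega> \<phi> f X)))
      \<le> epow r (ennreal (c0 TYPE('n)) * (\<integral>\<^sup>+Y. ennreal (H Y) \<partial>lborel))"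
      by (rule epow_mono[OF r(1)])
    also have "\<dots> = ennreal (c0 TYPE('n) powr r) * epow r (\<integral>\<^sup>+Y. ennreal (H Y) \<partial>lborel)"
      by (rule epow_mult_ennreal[OF r(1) c0_pos])
    also have "\<dots> \<le> ennreal (c0 TYPE('n) powr r) * (ennreal (C powr (1 - r)) * (\<integral>\<^sup>+Y. ennreal (H Y powr r)
      \<partial>lborel))"
      by (intro mult_left_mono small_exponent_integral[OF Hm H0 r C glob]) simp
    finally have st: "ennreal (cmod (stft \<omega> \<phi> f X) powr r)
      \<le> ennreal D * (\<integral>\<^sup>+Y. ennreal (H Y powr r) \<partial>lborel)"
      by (simp add: epow_ennreal D_def ennreal_mult mult.assoc)
    have "ennreal ((cmod (stft \<omega> \<phi> f X) * \<omega> X) powr r)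
      = ennreal (\<omega> X powr r) * ennreal (cmod (stft \<omega> \<phi> f X) powr r)"
      using \<omega>0[of X] by (simp add: powr_mult mult.commute less_imp_le flip: ennreal_mult)
    also have "\<dots> \<le> ennreal (\<omega> X powr r) * (ennreal D * (\<integral>\<^sup>+Y. ennreal (H Y powr r) \<partial>lborel))"
      by (intro mult_left_mono st) simp
    also have "\<dots> = ennreal D * (\<integral>\<^sup>+Y. ennreal (\<omega> X powr r) * ennreal (H Y powr r) \<partial>lborel)"
      by (subst nn_integral_cmult) (auto simp: mult.left_commute)
    also have "\<dots> \<le> ennreal D * (\<integral>\<^sup>+Y. ennreal (C\<^sub>v powr r) * (dens f Y * kern (Y - X)) \<partial>lborel)"
    proof (intro mult_left_mono nn_integral_mono)
      fix Y :: "(real ^ 'n) \<times> (real ^ 'n)"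
      have p: "0 < \<omega> X" "0 < \<omega> Y" "0 < \<omega>' Y" "0 < v (Y - X)" "0 < v' (Y - X)"
        using \<omega>0[of X] \<omega>0[of Y] \<omega>'l[of Y] v0[of "Y - X"] vv[of "Y - X"] by auto
      \<comment> \<open>Moderateness for X = Y + (X - Y) and evenness of v distribute the weight:
        \<omega>' goes to V f at Y, and v' to V phi at Y - X.\<close>
      have "\<omega> X \<le> C\<^sub>v * \<omega> Y * v (Y - X)" using mod[of Y "X - Y"] even[of "Y - X"] by simp
      also have "\<dots> \<le> C\<^sub>v * \<omega>' Y * v' (Y - X)"
        using p Cv \<omega>'l[of Y] vv[of "Y - X"] by (intro mult_mono) auto
      finally have "\<omega> X * H Y \<le> (C\<^sub>v * \<omega>' Y * v' (Y - X)) * H Y" by (rule mult_right_mono[OF _ H0])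
      also have "\<dots> = C\<^sub>v * ((cmod (gauss_stft f Y) * \<omega>' Y) * (cmod (?V (Y - X)) * v' (Y - X)))"
        by (simp add: H_def ac_simps)
      finally have "(\<omega> X * H Y) powr r \<le> (C\<^sub>v * ((cmod (gauss_stft f Y) * \<omega>' Y) * (cmod (?V (Y - X)) * v' (Y - X)))) powr r"
        using p H0[of Y] r by (intro powr_mono2) auto
      also have "\<dots> = C\<^sub>v powr r * ((cmod (gauss_stft f Y) * \<omega>' Y) powr r * (cmod (?V (Y - X)) * v' (Y - X)) powr r)"
      proof -
        have "0 \<le> cmod (gauss_stft f Y) * \<omega>' Y" "0 \<le> cmod (?V (Y - X)) * v' (Y - X)" using p by auto
        then show ?thesis using Cv by (simp only: powr_mult mult_nonneg_nonneg less_imp_le)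
      qed
      finally have "(\<omega> X * H Y) powr r \<le> C\<^sub>v powr r * ((cmod (gauss_stft f Y) * \<omega>' Y) powr r * (cmod (?V (Y - X)) *
        v' (Y - X)) powr r)" .
      moreover have "(\<omega> X * H Y) powr r = \<omega> X powr r * H Y powr r" using p(1) H0[of Y] by (simp add: powr_mult)
      ultimately show "ennreal (\<omega> X powr r) * ennreal (H Y powr r) \<le> ennreal (C\<^sub>v powr r) * (dens f Y * kern (Y - X))"
        unfolding dens_def kern_def by (simp add: ennreal_leI flip: ennreal_mult)
    qed simp
    also have "\<dots> = ennreal D * (ennreal (C\<^sub>v powr r) * (\<integral>\<^sup>+Y. dens f Y * kern (Y - X) \<partial>lborel))"
      by (subst nn_integral_cmult) auto
    finally show ?thesis using D by (simp add: ennreal_mult mult.assoc)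
  qed
  moreover have "0 < D * C\<^sub>v powr r" using D Cv by simp
  ultimately show ?thesis by blast
qed

text \<open>Formulated for any b that agrees with the transform on the lattice: this covers the
  restricted values of \<open>analysis_op\<close> and also the difference of two of them, whatever
  stands off the lattice.\<close>

lemma sampling_bound:
  assumes \<epsilon>: "0 < \<epsilon>"
  shows "\<exists>c>0. \<forall>f\<in>mod_space \<Phi>\<^sub>1 \<Phi>\<^sub>2 \<omega>. \<forall>b. (\<forall>k\<in>lattice \<epsilon>
    \<times> lattice \<epsilon>. b k = stft \<omega> \<phi> f k) \<longrightarrow>
    ell_norm \<epsilon> \<Phi>\<^sub>1 \<Phi>\<^sub>2 \<omega> b \<le> ennreal c * mod_norm \<Phi>\<^sub>1 \<Phi>\<^sub>2 \<omega> f"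
proof -
  obtain C where C: "0 < C" "\<And>f X. f \<in> mod_space \<Phi>\<^sub>1 \<Phi>\<^sub>2 \<omega>
    \<Longrightarrow> ennreal ((cmod (stft \<omega> \<phi> f X) * \<omega> X) powr r)
    \<le> ennreal C * (\<integral>\<^sup>+Y. dens f Y * kern (Y - X) \<partial>lborel)"
    using stft_bound by blast
  obtain D where D: "0 < D" "\<And>X. kern X \<le> ennreal D * (\<integral>\<^sup>+u. indicator (cball 0 1) u * kern (X + u) \<partial>lborel)"
    using weighted_stft_local[OF r v's v'm] \<phi>_series unfolding kern_def by blast
  obtain N\<^sub>1 where N1: "1 \<le> N\<^sub>1" "emeasure lborel (cball 0 1 :: (real ^ 'n) set) \<le> ennreal N\<^sub>1"
    using emeasure_cball_bound by blast
  obtain N\<^sub>2 where N2: "0 < N\<^sub>2" "\<And>u :: real ^ 'n. (\<integral>\<^sup>+j. indicator (cball 0 1) (u + j)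
    \<partial>count_space (lattice \<epsilon>)) \<le> ennreal N\<^sub>2"
    using lattice_count[OF \<epsilon>] by blast
  \<comment> \<open>\<open>orlicz_kernel_bound\<close> uses one N both for the volume of the unit
    ball and for the number of lattice points in its translates.\<close>
  define N where "N = max N\<^sub>1 N\<^sub>2"
  have N0: "0 < N" using N1 by (simp add: N_def)
  have Nb: "emeasure lborel (cball 0 1 :: (real ^ 'n) set) \<le> ennreal N"
    using N1(2) by (rule order.trans) (simp add: N_def ennreal_leI)
  have Nc: "(\<integral>\<^sup>+j. indicator (cball 0 1) (u + j) \<partial>count_space (lattice \<epsilon>)) \<le> ennreal N" for u :: "real ^ 'n"
    using N2(2) by (rule order.trans) (simp add: N_def ennreal_leI)
  have "(\<integral>\<^sup>+U. kern U \<partial>lborel) < top" using Pr by (simp only: kern_def)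
  then obtain I' where I': "0 \<le> I'" "(\<integral>\<^sup>+U. kern U \<partial>lborel) = ennreal I'" unfolding less_top_ennreal by blast
  define I where "I = 1 + I'"
  have I: "(\<integral>\<^sup>+U. kern U \<partial>lborel) \<le> ennreal I" "0 < I" using I' by (auto simp: I_def intro!: ennreal_leI)
  define S where "S = C * (4 * D * N * N * I) * K powr r"
  have S: "0 < S" unfolding S_def using C(1) D(1) N0 I(2) K by simp
  have "ell_norm \<epsilon> \<Phi>\<^sub>1 \<Phi>\<^sub>2 \<omega> b
    \<le> ennreal (S powr (1 / r)) * mod_norm \<Phi>\<^sub>1 \<Phi>\<^sub>2 \<omega> f"
    if f: "f \<in> mod_space \<Phi>\<^sub>1 \<Phi>\<^sub>2 \<omega>" and b: "\<forall>k\<in>lattice \<epsilon> \<times> lattice \<epsilon>.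
      b k = stft \<omega> \<phi> f k" for f b
  proof -
    have fd: "f \<in> H_flat_dual" using f by (simp add: mod_space_def)
    have "epow r (ell_norm \<epsilon> \<Phi>\<^sub>1 \<Phi>\<^sub>2 \<omega> b) = orlicz_norm (count_space (lattice \<epsilon>)) \<Psi>\<^sub>2
        (\<lambda>\<xi>. orlicz_norm (count_space (lattice \<epsilon>)) \<Psi>\<^sub>1 (\<lambda>x. ennreal ((cmod (b (x, \<xi>)) * \<omega>
          (x, \<xi>)) powr r)))"
      unfolding ell_norm_def
      by (rule epow_mixed_orlicz_norm[where \<Phi>\<^sub>1 = \<Phi>\<^sub>1 and \<Phi>\<^sub>2
        = \<Phi>\<^sub>2, OF r(1) \<Phi>1 \<Phi>2 less_imp_le[OF \<omega>0]])
    also have "\<dots> \<le> ennreal C * orlicz_norm (count_space (lattice \<epsilon>)) \<Psi>\<^sub>2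
        (\<lambda>\<xi>. orlicz_norm (count_space (lattice \<epsilon>)) \<Psi>\<^sub>1 (\<lambda>x. \<integral>\<^sup>+Y. dens f Y * kern (Y
          - (x, \<xi>)) \<partial>lborel))"
      by (rule mixed_orlicz_mono[OF y1 y2 C(1)]) (use b C(2)[OF f] in auto)
    also have "\<dots> \<le> ennreal C * (ennreal (4 * D * N * N * I) * dens_norm f)"
      unfolding dens_norm_def
      by (rule mult_left_mono[OF orlicz_kernel_bound[OF y1 y2 dens_measurable[OF fd] kern_measurable cball_borel Nb
          countable_lattice countable_lattice Nc Nc local_iterated[OF D(2) kern_measurable] I(1) D(1) N0 I(2)]]) simp
    also have "\<dots> \<le> ennreal C * (ennreal (4 * D * N * N * I) * (ennreal (K powr r) * epow r (mod_norm \<Phi>\<^sub>1 \<Phi>\<^sub>2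
      \<omega> f)))"
      by (intro mult_left_mono dens_norm_le) auto
    also have "\<dots> = ennreal S * epow r (mod_norm \<Phi>\<^sub>1 \<Phi>\<^sub>2 \<omega> f)"
      unfolding S_def using C(1) D(1) N0 I(2) by (simp add: ennreal_mult mult.assoc)
    also have "\<dots> = epow r (ennreal (S powr (1 / r)) * mod_norm \<Phi>\<^sub>1 \<Phi>\<^sub>2 \<omega> f)"
      using S r by (subst epow_mult_ennreal) (auto simp: powr_powr)
    finally show ?thesis unfolding epow_le_iff[OF r(1)] .
  qed
  moreover have "0 < S powr (1 / r)" using S by simp
  ultimately show ?thesis by blast
qed

lemma analysis_op_continuous:
  assumes \<epsilon>: "0 < \<epsilon>"
  shows "(\<forall>f \<in> mod_space \<Phi>\<^sub>1 \<Phi>\<^sub>2 \<omega>. analysis_op \<epsilon> \<omega> \<phi> f \<in> ell_space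
    \<epsilon> \<Phi>\<^sub>1 \<Phi>\<^sub>2 \<omega>) \<and>
    qn_continuous (mod_space \<Phi>\<^sub>1 \<Phi>\<^sub>2 \<omega>) (mod_norm \<Phi>\<^sub>1 \<Phi>\<^sub>2 \<omega>) (ell_norm \<epsilon>
      \<Phi>\<^sub>1 \<Phi>\<^sub>2 \<omega>) (analysis_op \<epsilon> \<omega> \<phi>) \<and>
    (\<exists>c>0. \<forall>f \<in> mod_space \<Phi>\<^sub>1 \<Phi>\<^sub>2 \<omega>. ell_norm \<epsilon> \<Phi>\<^sub>1 \<Phi>\<^sub>2
      \<omega> (analysis_op \<epsilon> \<omega> \<phi> f) \<le> ennreal c * mod_norm \<Phi>\<^sub>1 \<Phi>\<^sub>2 \<omega> f)"
proof -
  obtain c where c: "0 < c" and cb: "\<And>f b. f \<in> mod_space \<Phi>\<^sub>1 \<Phi>\<^sub>2 \<omega>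
    \<Longrightarrow> \<forall>k\<in>lattice \<epsilon> \<times> lattice \<epsilon>. b k = stft \<omega> \<phi> f k \<Longrightarrow>
    ell_norm \<epsilon> \<Phi>\<^sub>1 \<Phi>\<^sub>2 \<omega> b \<le> ennreal c * mod_norm \<Phi>\<^sub>1 \<Phi>\<^sub>2 \<omega> f"
    using sampling_bound[OF \<epsilon>] by blast
  have bd: "ell_norm \<epsilon> \<Phi>\<^sub>1 \<Phi>\<^sub>2 \<omega> (analysis_op \<epsilon> \<omega> \<phi> f)
    \<le> ennreal c * mod_norm \<Phi>\<^sub>1 \<Phi>\<^sub>2 \<omega> f" if "f \<in> mod_space \<Phi>\<^sub>1 \<Phi>\<^sub>2 \<omega>" for f
    by (rule cb[OF that]) (simp add: analysis_op_def)
  have "analysis_op \<epsilon> \<omega> \<phi> f \<in> ell_space \<epsilon> \<Phi>\<^sub>1 \<Phi>\<^sub>2 \<omega>" if f: "f \<in> mod_space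
    \<Phi>\<^sub>1 \<Phi>\<^sub>2 \<omega>" for f
  proof -
    have "ennreal c * mod_norm \<Phi>\<^sub>1 \<Phi>\<^sub>2 \<omega> f < top" using f by (simp add: mod_space_def ennreal_mult_less_top)
    then have "ell_norm \<epsilon> \<Phi>\<^sub>1 \<Phi>\<^sub>2 \<omega> (analysis_op \<epsilon> \<omega> \<phi> f) < top" using bd[OF f]
      by (rule le_less_trans[rotated])
    moreover have "analysis_op \<epsilon> \<omega> \<phi> f \<in> extensional (lattice \<epsilon> \<times> lattice \<epsilon>)"
      unfolding analysis_op_def by (rule restrict_extensional)
    ultimately show ?thesis by (simp add: ell_space_def)
  qed
  moreover have "qn_continuous (mod_space \<Phi>\<^sub>1 \<Phi>\<^sub>2 \<omega>) (mod_norm \<Phi>\<^sub>1 \<Phi>\<^sub>2 \<omega>)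
    (ell_norm \<epsilon> \<Phi>\<^sub>1 \<Phi>\<^sub>2 \<omega>) (analysis_op \<epsilon> \<omega> \<phi>)"
    unfolding qn_continuous_def
  proof (intro ballI allI impI)
    fix f :: "'n series" and e :: real
    assume f: "f \<in> mod_space \<Phi>\<^sub>1 \<Phi>\<^sub>2 \<omega>" and e: "0 < e"
    have "ell_norm \<epsilon> \<Phi>\<^sub>1 \<Phi>\<^sub>2 \<omega> (\<lambda>k. analysis_op \<epsilon> \<omega> \<phi> g k - analysis_op
      \<epsilon> \<omega> \<phi> f k) < ennreal e"
      if g: "g \<in> mod_space \<Phi>\<^sub>1 \<Phi>\<^sub>2 \<omega>" and small: "mod_norm \<Phi>\<^sub>1 \<Phi>\<^sub>2 \<omega>
        (\<lambda>i. g i - f i) < ennreal (e / c)" for g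
    proof -
      have fd: "f \<in> H_flat_dual" "g \<in> H_flat_dual" using f g by (auto simp: mod_space_def)
      have h: "(\<lambda>i. g i - f i) \<in> mod_space \<Phi>\<^sub>1 \<Phi>\<^sub>2 \<omega>"
        using H_flat_dual_diff[OF fd(2,1)] less_trans[OF small ennreal_less_top] by (simp add: mod_space_def)
      have "ell_norm \<epsilon> \<Phi>\<^sub>1 \<Phi>\<^sub>2 \<omega> (\<lambda>k. analysis_op \<epsilon> \<omega> \<phi> g k - analysis_op
        \<epsilon> \<omega> \<phi> f k) \<le> ennreal c * mod_norm \<Phi>\<^sub>1 \<Phi>\<^sub>2 \<omega> (\<lambda>i. g i - f i)"
        by (rule cb[OF h]) (simp add: analysis_op_def stft_diff[OF f g h])
      also have "\<dots> < ennreal e"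
      proof -
        obtain t where t: "0 \<le> t" "mod_norm \<Phi>\<^sub>1 \<Phi>\<^sub>2 \<omega> (\<lambda>i. g i - f i) = ennreal t"
          using small less_trans[OF small ennreal_less_top] by (metis less_top_ennreal)
        have "t < e / c" using small t by (simp add: ennreal_less_iff)
        then have "c * t < e" using c by (simp add: field_simps)
        then show ?thesis using c t e by (simp add: ennreal_less_iff flip: ennreal_mult)
      qed
      finally show ?thesis .
    qed
    moreover have "0 < e / c" using e c by simp
    ultimately show "\<exists>\<delta>>0. \<forall>g\<in>mod_space \<Phi>\<^sub>1 \<Phi>\<^sub>2 \<omega>. mod_norm \<Phi>\<^sub>1
      \<Phi>\<^sub>2 \<omega> (\<lambda>i. g i - f i) < ennreal \<delta> \<longrightarrow>
      ell_norm \<epsilon> \<Phi>\<^sub>1 \<Phi>\<^sub>2 \<omega> (\<lambda>k. analysis_op \<epsilon> \<omega> \<phi> g k - analysis_op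
        \<epsilon> \<omega> \<phi> f k) < ennreal e" by blast
  qed
  ultimately show ?thesis using bd c by blast
qed

end

theorem theorem4p5:
  fixes \<epsilon> r\<^sub>0 :: real
    and \<Phi>\<^sub>1 \<Phi>\<^sub>2 :: "real \<Rightarrow> ennreal"
    and \<omega> v :: "(real ^ 'n) \<times> (real ^ 'n) \<Rightarrow> real"
    and \<phi> :: "real ^ 'n \<Rightarrow> complex"
  assumes "\<epsilon> > 0"
    and "0 < r\<^sub>0" and "r\<^sub>0 \<le> 1"
    and "quasi_young r\<^sub>0 \<Phi>\<^sub>1" and "quasi_young r\<^sub>0 \<Phi>\<^sub>2"
    and "\<omega> \<in> moderate_weights" and "v \<in> moderate_weights"
    and "submultiplicative v" and "moderate v \<omega>"
    and "\<phi> \<in> window_space r\<^sub>0 v"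
    and "\<exists>\<psi> \<in> window_space r\<^sub>0 v. dual_window \<epsilon> \<phi> \<psi>"
  shows "(\<forall>f \<in> mod_space \<Phi>\<^sub>1 \<Phi>\<^sub>2 \<omega>. analysis_op \<epsilon> \<omega> \<phi> f \<in> ell_space
    \<epsilon> \<Phi>\<^sub>1 \<Phi>\<^sub>2 \<omega>) \<and>
    qn_continuous (mod_space \<Phi>\<^sub>1 \<Phi>\<^sub>2 \<omega>) (mod_norm \<Phi>\<^sub>1 \<Phi>\<^sub>2 \<omega>) (ell_norm \<epsilon>
      \<Phi>\<^sub>1 \<Phi>\<^sub>2 \<omega>)
      (analysis_op \<epsilon> \<omega> \<phi>) \<and>
    (\<exists>c>0. \<forall>f \<in> mod_space \<Phi>\<^sub>1 \<Phi>\<^sub>2 \<omega>.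
       ell_norm \<epsilon> \<Phi>\<^sub>1 \<Phi>\<^sub>2 \<omega> (analysis_op \<epsilon> \<omega> \<phi> f)
         \<le> ennreal c * mod_norm \<Phi>\<^sub>1 \<Phi>\<^sub>2 \<omega> f)"
proof -
  note \<epsilon> = assms(1) and r = assms(2,3) and sub = assms(8) and mod = assms(9)
  obtain \<Psi>\<^sub>1 where \<Psi>1: "young \<Psi>\<^sub>1" "\<And>t. 0 \<le> t \<Longrightarrow> \<Phi>\<^sub>1 t
    = \<Psi>\<^sub>1 (t powr r\<^sub>0)" using assms(4) unfolding quasi_young_def by blast
  obtain \<Psi>\<^sub>2 where \<Psi>2: "young \<Psi>\<^sub>2" "\<And>t. 0 \<le> t \<Longrightarrow> \<Phi>\<^sub>2 t
    = \<Psi>\<^sub>2 (t powr r\<^sub>0)" using assms(5) unfolding quasi_young_def by blast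
  have w\<omega>: "weight \<omega>" using assms(6) by (simp add: moderate_weights_def)
  have wv: "weight v" using sub by (simp add: submultiplicative_def)
  have \<omega>0: "0 < \<omega> X" for X using w\<omega> unfolding weight_def by blast
  have v0: "0 < v X" for X using wv unfolding weight_def by blast
  have \<omega>im: "(\<lambda>X. 1 / \<omega> X) \<in> borel_measurable lebesgue" using w\<omega> by (simp add: weight_def locally_ess_bounded_def)
  have vm: "v \<in> borel_measurable lebesgue" using wv by (simp add: weight_def locally_ess_bounded_def)
  have even: "v (- X) = v X" for X using sub unfolding submultiplicative_def by blast
  obtain C\<^sub>v where Cv: "0 < C\<^sub>v" "\<And>X Y. \<omega> (X + Y) \<le> C\<^sub>v * \<omega> X * v Y" using mod
    unfolding moderate_def by blast
  \<comment> \<open>Submultiplicativity is moderateness of v with respect to itself, so the lemmas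
    on slow variation and majorants apply to v as to \<omega>.\<close>
  have modv: "moderate v v" using sub unfolding submultiplicative_def moderate_def by blast
  obtain A a c where A: "0 < A" "\<And>X. v X \<le> A * exp (a * norm X)" "0 < c" "\<And>X. c \<le> v X"
    using submultiplicative_bounds[OF sub] by metis
  obtain K\<^sub>\<omega> where K\<omega>: "slow K\<^sub>\<omega> \<omega>" using moderate_slow[OF sub mod \<omega>0] by blast
  obtain K\<^sub>v where Kv: "slow K\<^sub>v v" using moderate_slow[OF sub modv v0] by blast
  have K0: "0 < K\<^sub>\<omega>" "0 < K\<^sub>v" using K\<omega> Kv by (auto simp: slow_def)
  obtain \<omega>' where \<omega>': "\<omega>' \<in> borel_measurable borel" "\<And>X. \<omega> X \<le> \<omega>' X" "\<And>X. \<omega>' X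
    \<le> K\<^sub>\<omega> * \<omega> X" "slow (K\<^sub>\<omega> * K\<^sub>\<omega>) \<omega>'"
    using slow_borel_majorant[OF K\<omega>] by metis
  obtain W' where W': "W' \<in> borel_measurable borel" "\<And>X. 1 / \<omega> X \<le> W' X" "\<And>X. W' X \<le> K\<^sub>\<omega> * (1 / \<omega> X)"
    using slow_borel_majorant[OF slow_inverse[OF K\<omega>]] by metis
  obtain v' where v': "v' \<in> borel_measurable borel" "\<And>X. v X \<le> v' X" "\<And>X. v' X
    \<le> K\<^sub>v * v X" "slow (K\<^sub>v * K\<^sub>v) v'"
    using slow_borel_majorant[OF Kv] by metis
  have \<phi>: "\<phi> \<in> L2" and fin: "Mp_norm r\<^sub>0 v (hermite_series \<phi>) < top"
    using assms(10) by (auto simp: window_space_def Mp_space_def)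
  note \<phi>d = hermite_series_H_flat_dual[OF \<phi>]
  let ?V = "gauss_stft (hermite_series \<phi>)"
  have v'0: "0 \<le> v' X" for X using v0[of X] v'(2)[of X] by linarith
  have Pr: "(\<integral>\<^sup>+X. ennreal ((cmod (?V X) * v' X) powr r\<^sub>0) \<partial>lborel) < top"
    by (rule Mp_norm_majorant_finite[OF r(1) \<phi>d fin vm v0 v'0 v'(3) K0(2)])
  obtain M where M: "\<And>X. cmod (?V X) * v' X \<le> M" using weighted_stft_bounds(1)[OF r \<phi>d v'(4,1) Pr] by blast
  \<comment> \<open>The lower bound c of v turns the weighted supremum bound into an unweighted
    one.\<close>
  have P1: "cmod (?V X) \<le> M / c" for X
  proof -
    have "cmod (?V X) * c \<le> cmod (?V X) * v' X"
      using A(4)[of X] v'(2)[of X] by (intro mult_left_mono) auto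
    then show ?thesis using M[of X] A(3) by (simp add: field_simps)
  qed
  note P2 = weighted_stft_bounds(2)[OF r \<phi>d v'(4,1) Pr]
  interpret weighted_window r\<^sub>0 C\<^sub>v A a K\<^sub>\<omega> "K\<^sub>\<omega> * K\<^sub>\<omega>" "K\<^sub>v * K\<^sub>v" "M / c"
    \<Phi>\<^sub>1 \<Phi>\<^sub>2 \<Psi>\<^sub>1 \<Psi>\<^sub>2 \<omega> \<omega>' W' v v' \<phi>
    by (intro weighted_window.intro r \<Psi>1 \<Psi>2 \<omega>0 \<omega>im K0(1) \<omega>' Cv v0 even A(1,2) W' v' \<phi> P1 P2 Pr)
  show ?thesis by (rule analysis_op_continuous[OF \<epsilon>])
qed

end
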